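(* Consider the followers $y_i^{(r_i)}+f_i^T(x_i,t)\theta_i=u_i+d_i$, $i=1,\dots,N$, with $d_i\equiv 0$ for all $i$, the leader $\dot v_0=Sv_0$, $y_0=Fv_0$, and the switching graph $\bar{\mathcal G}_{\sigma(t)}$, as described in the context. Assume: (1) $S$ is marginally stable, i.e. no eigenvalue of $S$ has positive real part and the eigenvalues of $S$ with zero real part are semi-simple; (2) the pair $(F,S)$ is detectable; (3) there exist a subsequence $\{i_k\}$ of $\{i:i=0,1,2,\dots\}$ and a number $\nu>0$ with $t_{i_{k+1}}-t_{i_k}<\nu$ for all $k$ such that the union graph $\bar{\mathcal G}([t_{i_k},t_{i_{k+1}}))$ contains a spanning tree with the node $0$ as the root; (4) $\mathcal G_{\sigma(t)}$ is undirected for every $t\ge 0$; (5) for each $i$, $\|f_i(x_i,t)\|\le \phi_i(x_i)$ for all $x_i\in\mathbb R^{r_i}$ and $t\ge 0$, for some globally defined function $\phi_i$. Then the leader-following output synchronization problem is solvable by the distributed control law $$ \begin{aligned} u_i&=f_i^T(x_i,t)\hat\theta_i-k_is_i+\dot p_{ri},\\ \dot{\tilde\theta}_i&=-\Lambda_i^{-1}f_i(x_i,t)s_i,\\ \dot v_i&=S_iv_i+L_i\sum_{j\in\bar{\mathcal N}_i(t)}F(v_j-v_i),\\ \dot S_i&=\mu_1\sum_{j\in\bar{\mathcal N}_i(t)}(S_j-S_i),\\ \dot L_i&=\mu_2\sum_{j\in\bar{\mathcal N}_i(t)}(L_j-L_i),\qquad i=1,\dots,N, \end{aligned} $$ with the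 design parameters as specified in the context. That is, an admissible choice of the design parameters exists (in particular an admissible $L_0$), and with such parameters, for any initial states $x_i(0),\hat\theta_i(0),v_i(0),S_i(0),L_i(0)$, $i=1,\dots,N$, and $v_0(0)$, the solution of the closed-loop system exists for all $t\ge0$ and satisfies $$\lim_{t\to\infty}\big(y_i^{(k)}(t)-y_0^{(k)}(t)\big)=0,\qquad i=1,\dots,N,\ k=0,\dots,r_i-1.$$
   Context: Switching signal. $\sigma:[0,\infty)\to\mathcal P=\{1,\dots,n_0\}$ is piecewise constant, with switching instants $t_0=0<t_1<t_2<\cdots$ satisfying $t_{i+1}-t_i\ge\tau_0>0$ for a constant $\tau_0$ (dwell time) and all $i$. Followers. For $i=1,\dots,N$: $r_i\ge1$ is an integer; $u_i,y_i\in\mathbb R$ are the input and output; $x_i=\mathrm{col}(y_i,\dot y_i,\dots,y_i^{(r_i-1)})\in\mathbb R^{r_i}$ is the state; $f_i:\mathbb R^{r_i}\times[0,\infty)\to\mathbb R^{m_i}$ is a known function, locally Lipschitz in $x_i$ uniformly in $t$ and continuous in $t$; $\theta_i\in\mathbb R^{m_i}$ is an unknown constant vector; $d_i$ is the external disturbance. Leader. $v_0\in\mathbb R^n$, $y_0\in\mathbb R$, and $S\in\mathbb R^{n\times n}$, $F\in\mathbb R^{1\times n}$ are constant matrices. Graphs. $\bar{\mathcal G}_{\sigma(t)}=(\bar{\mathcal V},\bar{\mathcal E}_{\sigma(t)})$ is a time-varying digraph with node set $\bar{\mathcal V}=\{0,1,\dots,N\}$; node $0$ is the leader and node $i\ge1$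 is follower $i$. For $i=1,\dots,N$, $j=0,\dots,N$, $i\ne j$, $(j,i)\in\bar{\mathcal E}_{\sigma(t)}$ iff $u_i$ can use the information of agent $j$ at time $t$. $\bar{\mathcal N}_i(t)=\{j:(j,i)\in\bar{\mathcal E}_{\sigma(t)}\}$. $\mathcal G_{\sigma(t)}$ is the subgraph on $\{1,\dots,N\}$ obtained by removing all edges between node $0$ and the other nodes. The union graph over a time interval has node set $\bar{\mathcal V}$ and edge set the union of the edge sets $\bar{\mathcal E}_{\sigma(t)}$ over that interval. $\mathcal H_{\sigma(t)}\in\mathbb R^{N\times N}$ is obtained from the (unweighted) Laplacian of $\bar{\mathcal G}_{\sigma(t)}$ by removing the first row and first column (those of node $0$); thus its $(i,i)$ entry is $|\bar{\mathcal N}_i(t)|$ and, for $i\neq j$, its $(i,j)$ entry is $-1$ if $j\in\bar{\mathcal N}_i(t)$ and $0$ otherwise. Control law. $v_i\in\mathbb R^n$, $S_i\in\mathbb R^{n\times n}$, $L_i\in\mathbb R^n$ for $i=1,\dots,N$, and $S_0=S$. $\hat\theta_i$ is the estimate of $\theta_i$ and $\tilde\theta_i=\hat\theta_i-\theta_i$ (so $\dot{\tilde\theta}_i=\dot{\hat\theta}_i$). Further, $$p_{ri}=FS_i^{r_i-1}v_i-\sum_{k=1}^{r_i-1}\beta_{ki}\big(y_i^{(r_i-1-k)}-FS_i^{r_i-1-k}v_i\big),\qquad s_i=y_i^{(r_i-1)}-p_{ri},$$ and $\dot p_{ri}$ is the time derivative of $p_{ri}$ along the closed-loop system (it depends only on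 $x_i$ and on $v_j,S_j,L_j$ for agent $i$ and its neighbors). Design parameters. $\mu_1,\mu_2,k_i>0$ are constants; $\Lambda_i\in\mathbb R^{m_i\times m_i}$ are symmetric positive definite; $\beta_{1i},\dots,\beta_{(r_i-1)i}$ are positive constants such that the polynomial $\lambda^{r_i-1}+\beta_{1i}\lambda^{r_i-2}+\cdots+\beta_{(r_i-2)i}\lambda+\beta_{(r_i-1)i}$ is stable (all roots have negative real part); $L_0\in\mathbb R^n$ is a constant vector such that the linear time-varying system $\dot{\bar v}=\big(I_N\otimes S-\mathcal H_{\sigma(t)}\otimes(L_0F)\big)\bar v$ is exponentially stable. *)

theory Defs
  imports
    "HOL-Analysis.Analysis"
    "Jordan_Normal_Form.Gauss_Jordan_Elimination"
begin

text \<open>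
  Conventions.  The leader's dimension \<open>n\<close> and the number of followers are the
  same throughout and are finite index types \<open>'n\<close> and \<open>'N\<close>.  The dimensions
  \<open>r i\<close> and \<open>m i\<close> depend on the follower, so the corresponding vectors and matrices are
  carrier-based (\<^typ>\<open>real Matrix.vec\<close>, \<^typ>\<open>real Matrix.mat\<close>).  The nodes of the
  communication graph are of type \<open>'N option\<close>: \<open>None\<close> is node 0 (the leader) and
  \<open>Some i\<close> is follower \<open>i\<close>.  The row vector \<open>F\<close> is an element of
  \<open>real ^ 'n\<close>, and \<open>F v\<close> is written \<open>F \<bullet> v\<close>.
\<close>

no_notation Matrix.vec_index (infixl \<open>$\<close> 100)
no_notation Matrix.scalar_prod (infix \<open>\<bullet>\<close> 70)
notation Matrix.vec_index (infixl \<open>$\<^sub>v\<close> 100)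
notation Matrix.scalar_prod (infix \<open>\<bullet>\<^sub>v\<close> 70)


section \<open>Matrices\<close>

definition vec_norm :: "real Matrix.vec \<Rightarrow> real" where
  "vec_norm x = sqrt (x \<bullet>\<^sub>v x)"

definition sym_pos_def :: "nat \<Rightarrow> real Matrix.mat \<Rightarrow> bool" where
  "sym_pos_def m A \<longleftrightarrow>
     A \<in> carrier_mat m m \<and> transpose_mat A = A \<and>
     (\<forall>z\<in>carrier_vec m. z \<noteq> 0\<^sub>v m \<longrightarrow> 0 < z \<bullet>\<^sub>v (A *\<^sub>v z))"

definition kronecker :: "real ^ 'b ^ 'a \<Rightarrow> real ^ 'd ^ 'c \<Rightarrow> real ^ ('b \<times> 'd) ^ ('a \<times> 'c)" where
  "kronecker A B = (\<chi> p q. A $ fst p $ fst q * B $ snd p $ snd q)"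

definition col_times_row :: "real ^ 'a \<Rightarrow> real ^ 'b \<Rightarrow> real ^ 'b ^ 'a" where
  "col_times_row c w = (\<chi> a b. c $ a * w $ b)"

text \<open>Powers of a square matrix applied to a vector; \<open>A ^ k\<close> on type \<open>real ^ 'n ^ 'n\<close>
  would be the entrywise power.\<close>

definition mat_power_vec :: "real ^ 'n ^ 'n \<Rightarrow> nat \<Rightarrow> real ^ 'n \<Rightarrow> real ^ 'n" where
  "mat_power_vec A k v = (((*v) A) ^^ k) v"

definition complexify :: "real ^ 'n ^ 'n \<Rightarrow> complex ^ 'n ^ 'n" where
  "complexify A = map_matrix complex_of_real A"

definition eigenspace :: "complex ^ 'n ^ 'n \<Rightarrow> complex \<Rightarrow> (complex ^ 'n) set" where
  "eigenspace A z = {u. A *v u = z *s u}"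

definition is_eigenvalue :: "complex ^ 'n ^ 'n \<Rightarrow> complex \<Rightarrow> bool" where
  "is_eigenvalue A z \<longleftrightarrow> (\<exists>u\<in>eigenspace A z. u \<noteq> 0)"

definition characteristic_poly :: "complex ^ 'n ^ 'n \<Rightarrow> complex poly" where
  "characteristic_poly A =
     Determinants.det (Finite_Cartesian_Product.mat [:0, 1:] - map_matrix (\<lambda>a. [:a:]) A)"

text \<open>Semi-simple: algebraic and geometric multiplicity coincide.\<close>

definition semisimple_eigenvalue :: "complex ^ 'n ^ 'n \<Rightarrow> complex \<Rightarrow> bool" where
  "semisimple_eigenvalue A z \<longleftrightarrow>
     is_eigenvalue A z \<and>
     Polynomial.order z (characteristic_poly A) = vec.dim (eigenspace A z)"

definition marginally_stable :: "real ^ 'n ^ 'n \<Rightarrow> bool" where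
  "marginally_stable S \<longleftrightarrow>
     (\<forall>z. is_eigenvalue (complexify S) z \<longrightarrow>
        Re z \<le> 0 \<and> (Re z = 0 \<longrightarrow> semisimple_eigenvalue (complexify S) z))"

definition hurwitz :: "real ^ 'n ^ 'n \<Rightarrow> bool" where
  "hurwitz A \<longleftrightarrow> (\<forall>z. is_eigenvalue (complexify A) z \<longrightarrow> Re z < 0)"

definition detectable :: "real ^ 'n \<Rightarrow> real ^ 'n ^ 'n \<Rightarrow> bool" where
  "detectable F S \<longleftrightarrow> (\<exists>G. hurwitz (S + col_times_row G F))"


section \<open>Graphs\<close>

text \<open>A digraph on a node type is its edge relation; \<open>(j, i)\<close> is an edge from \<open>j\<close> to \<open>i\<close>.\<close>

definition neighbors :: "('a \<times> 'a) set \<Rightarrow> 'a \<Rightarrow> 'a set" where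
  "neighbors E i = {j. (j, i) \<in> E}"

definition laplacian :: "('a \<times> 'a) set \<Rightarrow> real ^ 'a ^ 'a" where
  "laplacian E =
     (\<chi> i j. if i = j then real (card (neighbors E i)) else if j \<in> neighbors E i then -1 else 0)"

definition H_matrix :: "('N option \<times> 'N option) set \<Rightarrow> real ^ 'N ^ 'N" where
  "H_matrix E = (\<chi> i j. laplacian E $ Some i $ Some j)"

definition follower_subgraph :: "('N option \<times> 'N option) set \<Rightarrow> ('N \<times> 'N) set" where
  "follower_subgraph E = {(j, i). (Some j, Some i) \<in> E}"

definition directed_tree :: "'a \<Rightarrow> ('a \<times> 'a) set \<Rightarrow> bool" where
  "directed_tree r0 T \<longleftrightarrow>
     neighbors T r0 = {} \<and>
     (\<forall>i. i \<noteq> r0 \<longrightarrow> (\<exists>!j. j \<in> neighbors T i)) \<and>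
     (\<forall>i. (r0, i) \<in> T\<^sup>*)"

definition contains_spanning_tree :: "'a \<Rightarrow> ('a \<times> 'a) set \<Rightarrow> bool" where
  "contains_spanning_tree r0 E \<longleftrightarrow> (\<exists>T\<subseteq>E. directed_tree r0 T)"

definition union_graph :: "(real \<Rightarrow> ('a \<times> 'a) set) \<Rightarrow> real \<Rightarrow> real \<Rightarrow> ('a \<times> 'a) set" where
  "union_graph G a b = (\<Union>t\<in>{a..<b}. G t)"


section \<open>Differential equations with switching\<close>

text \<open>\<open>w\<close> is continuous on \<open>[a, \<infinity>)\<close> and has derivative \<open>w'\<close> at every time except
  possibly those in the set \<open>D\<close> of switching instants.\<close>

definition pw_derivative ::
    "real set \<Rightarrow> real \<Rightarrow> (real \<Rightarrow> 'a::real_normed_vector) \<Rightarrow> (real \<Rightarrow> 'a) \<Rightarrow> bool" where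
  "pw_derivative D a w w' \<longleftrightarrow>
     continuous_on {a..} w \<and> (\<forall>t>a. t \<notin> D \<longrightarrow> (w has_vector_derivative w' t) (at t))"

definition exponentially_stable :: "real set \<Rightarrow> (real \<Rightarrow> real ^ 'a ^ 'a) \<Rightarrow> bool" where
  "exponentially_stable D A \<longleftrightarrow>
     (\<exists>c>0. \<exists>\<alpha>>0. \<forall>t0\<ge>0. \<forall>w. pw_derivative D t0 w (\<lambda>t. A t *v w t) \<longrightarrow>
        (\<forall>t\<ge>t0. norm (w t) \<le> c * exp (- \<alpha> * (t - t0)) * norm (w t0)))"

definition locally_lipschitz_uniform :: "nat \<Rightarrow> (real Matrix.vec \<Rightarrow> real \<Rightarrow> real Matrix.vec) \<Rightarrow> bool"
  where
  "locally_lipschitz_uniform r f \<longleftrightarrow>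
     (\<forall>x\<in>carrier_vec r. \<exists>\<delta>>0. \<exists>K\<ge>0. \<forall>a\<in>carrier_vec r. \<forall>b\<in>carrier_vec r.
        vec_norm (a - x) < \<delta> \<and> vec_norm (b - x) < \<delta> \<longrightarrow>
        (\<forall>t\<ge>0. vec_norm (f a t - f b t) \<le> K * vec_norm (a - b)))"


section \<open>Closed-loop system\<close>

text \<open>The state \<open>x\<close> is \<open>col(y, y', \<dots>, y\<^sup>(\<^sup>r\<^sup>-\<^sup>1\<^sup>))\<close> for the output
  \<open>y = x $\<^sub>v 0\<close>, and \<open>y\<^sup>(\<^sup>r\<^sup>) + f\<^sup>T(x,t) \<theta> = u + d\<close>.\<close>

definition follower_plant ::
    "real set \<Rightarrow> nat \<Rightarrow> (real Matrix.vec \<Rightarrow> real \<Rightarrow> real Matrix.vec) \<Rightarrow> real Matrix.vec \<Rightarrow>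
     (real \<Rightarrow> real) \<Rightarrow> (real \<Rightarrow> real) \<Rightarrow> (real \<Rightarrow> real Matrix.vec) \<Rightarrow> bool" where
  "follower_plant D r f \<theta> d u x \<longleftrightarrow>
     (\<forall>t\<ge>0. x t \<in> carrier_vec r) \<and>
     (\<forall>k. Suc k < r \<longrightarrow>
        (\<forall>t\<ge>0. ((\<lambda>s. x s $\<^sub>v k) has_real_derivative x t $\<^sub>v Suc k) (at t within {0..}))) \<and>
     pw_derivative D 0 (\<lambda>t. x t $\<^sub>v (r - 1)) (\<lambda>t. u t + d t - f (x t) t \<bullet>\<^sub>v \<theta>)"

definition p_ref ::
    "nat \<Rightarrow> (nat \<Rightarrow> real) \<Rightarrow> real ^ 'n \<Rightarrow> real Matrix.vec \<Rightarrow> real ^ 'n ^ 'n \<Rightarrow> real ^ 'n \<Rightarrow> real" where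
  "p_ref r \<beta> F x S v =
     F \<bullet> mat_power_vec S (r - 1) v
     - (\<Sum>k=1..r-1. \<beta> k * (x $\<^sub>v (r - 1 - k) - F \<bullet> mat_power_vec S (r - 1 - k) v))"

definition s_err ::
    "nat \<Rightarrow> (nat \<Rightarrow> real) \<Rightarrow> real ^ 'n \<Rightarrow> real Matrix.vec \<Rightarrow> real ^ 'n ^ 'n \<Rightarrow> real ^ 'n \<Rightarrow> real" where
  "s_err r \<beta> F x S v = x $\<^sub>v (r - 1) - p_ref r \<beta> F x S v"

text \<open>The derivative of \<open>p_ref\<close> along the trajectory.  It exists at every positive time that is
  not a switching instant, since \<open>p_ref\<close> does not involve the last component of the state.\<close>

definition control_input ::
    "nat \<Rightarrow> (real Matrix.vec \<Rightarrow> real \<Rightarrow> real Matrix.vec) \<Rightarrow> real ^ 'n \<Rightarrow> real \<Rightarrow> (nat \<Rightarrow> real) \<Rightarrow>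
     (real \<Rightarrow> real Matrix.vec) \<Rightarrow> (real \<Rightarrow> real Matrix.vec) \<Rightarrow>
     (real \<Rightarrow> real ^ 'n ^ 'n) \<Rightarrow> (real \<Rightarrow> real ^ 'n) \<Rightarrow> real \<Rightarrow> real" where
  "control_input r f F \<kappa> \<beta> x \<theta>h S v t =
     f (x t) t \<bullet>\<^sub>v \<theta>h t
     - \<kappa> * s_err r \<beta> F (x t) (S t) (v t)
     + deriv (\<lambda>\<tau>. p_ref r \<beta> F (x \<tau>) (S \<tau>) (v \<tau>)) t"

definition adaptation_law ::
    "real set \<Rightarrow> nat \<Rightarrow> nat \<Rightarrow> (real Matrix.vec \<Rightarrow> real \<Rightarrow> real Matrix.vec) \<Rightarrow> real ^ 'n \<Rightarrow>
     real Matrix.mat \<Rightarrow> (nat \<Rightarrow> real) \<Rightarrow>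
     (real \<Rightarrow> real Matrix.vec) \<Rightarrow> (real \<Rightarrow> real Matrix.vec) \<Rightarrow>
     (real \<Rightarrow> real ^ 'n ^ 'n) \<Rightarrow> (real \<Rightarrow> real ^ 'n) \<Rightarrow> bool" where
  "adaptation_law D r m f F \<Lambda> \<beta> x \<theta>h S v \<longleftrightarrow>
     (\<forall>t\<ge>0. \<theta>h t \<in> carrier_vec m) \<and>
     (\<forall>l<m. pw_derivative D 0 (\<lambda>t. \<theta>h t $\<^sub>v l)
        (\<lambda>t. - ((the (mat_inverse \<Lambda>) *\<^sub>v f (x t) t) $\<^sub>v l * s_err r \<beta> F (x t) (S t) (v t))))"

definition closed_loop_solution ::
    "real set \<Rightarrow> (real \<Rightarrow> ('N::finite option \<times> 'N option) set) \<Rightarrow>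
     ('N \<Rightarrow> nat) \<Rightarrow> ('N \<Rightarrow> nat) \<Rightarrow> ('N \<Rightarrow> real Matrix.vec \<Rightarrow> real \<Rightarrow> real Matrix.vec) \<Rightarrow>
     ('N \<Rightarrow> real Matrix.vec) \<Rightarrow> ('N \<Rightarrow> real \<Rightarrow> real) \<Rightarrow>
     real ^ 'n ^ 'n \<Rightarrow> real ^ 'n \<Rightarrow>
     real \<Rightarrow> real \<Rightarrow> ('N \<Rightarrow> real) \<Rightarrow> ('N \<Rightarrow> real Matrix.mat) \<Rightarrow> ('N \<Rightarrow> nat \<Rightarrow> real) \<Rightarrow> real ^ 'n \<Rightarrow>
     ('N \<Rightarrow> real \<Rightarrow> real Matrix.vec) \<Rightarrow> ('N \<Rightarrow> real \<Rightarrow> real Matrix.vec) \<Rightarrow>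
     ('N option \<Rightarrow> real \<Rightarrow> real ^ 'n) \<Rightarrow> ('N option \<Rightarrow> real \<Rightarrow> real ^ 'n ^ 'n) \<Rightarrow>
     ('N option \<Rightarrow> real \<Rightarrow> real ^ 'n) \<Rightarrow> bool" where
  "closed_loop_solution D G r m f \<theta> d S F \<mu>1 \<mu>2 \<kappa> \<Lambda> \<beta> L0 x \<theta>h v Sh L \<longleftrightarrow>
     (\<forall>t\<ge>0. (v None has_vector_derivative S *v v None t) (at t within {0..})) \<and>
     (\<forall>t\<ge>0. Sh None t = S) \<and>
     (\<forall>t\<ge>0. L None t = L0) \<and>
     (\<forall>i.
        follower_plant D (r i) (f i) (\<theta> i) (d i)
          (control_input (r i) (f i) F (\<kappa> i) (\<beta> i) (x i) (\<theta>h i) (Sh (Some i)) (v (Some i))) (x i) \<and>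
        adaptation_law D (r i) (m i) (f i) F (\<Lambda> i) (\<beta> i) (x i) (\<theta>h i) (Sh (Some i)) (v (Some i)) \<and>
        pw_derivative D 0 (v (Some i))
          (\<lambda>t. Sh (Some i) t *v v (Some i) t +
               (\<Sum>j\<in>neighbors (G t) (Some i). F \<bullet> (v j t - v (Some i) t)) *\<^sub>R L (Some i) t) \<and>
        pw_derivative D 0 (Sh (Some i))
          (\<lambda>t. \<mu>1 *\<^sub>R (\<Sum>j\<in>neighbors (G t) (Some i). Sh j t - Sh (Some i) t)) \<and>
        pw_derivative D 0 (L (Some i))
          (\<lambda>t. \<mu>2 *\<^sub>R (\<Sum>j\<in>neighbors (G t) (Some i). L j t - L (Some i) t)))"

definition admissible_parameters ::
    "real set \<Rightarrow> (real \<Rightarrow> ('N::finite option \<times> 'N option) set) \<Rightarrow> ('N \<Rightarrow> nat) \<Rightarrow> ('N \<Rightarrow> nat) \<Rightarrow>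
     real ^ 'n ^ 'n \<Rightarrow> real ^ 'n \<Rightarrow>
     real \<Rightarrow> real \<Rightarrow> ('N \<Rightarrow> real) \<Rightarrow> ('N \<Rightarrow> real Matrix.mat) \<Rightarrow> ('N \<Rightarrow> nat \<Rightarrow> real) \<Rightarrow> real ^ 'n \<Rightarrow>
     bool" where
  "admissible_parameters D G r m S F \<mu>1 \<mu>2 \<kappa> \<Lambda> \<beta> L0 \<longleftrightarrow>
     0 < \<mu>1 \<and> 0 < \<mu>2 \<and>
     (\<forall>i. 0 < \<kappa> i) \<and>
     (\<forall>i. sym_pos_def (m i) (\<Lambda> i)) \<and>
     (\<forall>i. \<forall>k\<in>{1..r i - 1}. 0 < \<beta> i k) \<and>
     (\<forall>i. \<forall>z::complex.
        z ^ (r i - 1) + (\<Sum>k=1..r i - 1. complex_of_real (\<beta> i k) * z ^ (r i - 1 - k)) = 0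
        \<longrightarrow> Re z < 0) \<and>
     exponentially_stable D
       (\<lambda>t. kronecker (Finite_Cartesian_Product.mat 1) S - kronecker (H_matrix (G t)) (col_times_row L0 F))"

end

theory Submission
  imports Defs "Jordan_Normal_Form.Jordan_Normal_Form_Existence"
begin

text \<open>Marginal stability of \<open>S\<close> gives a positive definite form \<open>B\<close> with \<open>B x (S x) \<le> 0\<close>, built from
  Jordan coordinates with rapidly growing weights along the blocks.  On the subspace where neither the
  output \<open>F\<close> nor the dissipation of \<open>B\<close> sees the flow of \<open>S\<close>, \<open>S\<close> is skew for \<open>B\<close>; detectability makes it
  dissipative for a second form there, so this subspace is trivial and a Gramian bound holds.  An
  admissible choice is therefore \<open>L\<^sub>0 = P\<inverse> F\<^sup>T\<close> with \<open>P\<close> the matrix of \<open>B\<close>: since the followers' graph is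
  undirected, \<open>\<Sum>\<^sub>i B w\<^sub>i w\<^sub>i\<close> is nonincreasing, and joint connectivity with the Gramian bound forces it to
  drop by a fixed fraction over every window.

  The same argument in dimension one gives \<open>S\<^sub>i \<rightarrow> S\<close> and \<open>L\<^sub>i \<rightarrow> L\<^sub>0\<close>.  Hence \<open>v\<^sub>i - v\<^sub>0\<close> solves the
  exponentially stable system up to a perturbation with vanishing gain, and \<open>v\<^sub>i - v\<^sub>0 \<rightarrow> 0\<close>.

  For each follower \<open>s\<^sub>i\<^sup>2 + \<theta>\<^sup>~\<^sub>i\<^sup>T \<Lambda>\<^sub>i \<theta>\<^sup>~\<^sub>i\<close>, with \<open>\<theta>\<^sup>~\<^sub>i\<close> the parameter error, decreases at the rate
  \<open>2 k\<^sub>i s\<^sub>i\<^sup>2\<close>.  So \<open>s\<^sub>i\<close> is square integrable, \<open>x\<^sub>i\<close> is bounded, the bound on \<open>f\<^sub>i\<close> (made locally uniform by the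
  Lipschitz condition and compactness) bounds \<open>s\<^sub>i'\<close>, and Barbalat's lemma gives \<open>s\<^sub>i \<rightarrow> 0\<close>.  The tracking
  errors are the output of a stable filter driven by \<open>s\<^sub>i\<close> and by the vanishing observer errors.\<close>

subsection \<open>Differential equations with switching\<close>


text \<open>Three obstacles shape the proof. First, a follower could escape to infinity in finite
  time, since \<open>f\<close> is only locally Lipschitz. The closed loop is a cascade: the leader,
  \<open>Sh\<close> and \<open>L\<close> evolve without feedback from the rest, they drive
  \<open>v\<close>, and every follower is then driven separately. All layers except the followers
  are affine in their unknown. For a follower the Lyapunov function that gives convergence also
  bounds \<open>s\<close> and the parameter errors, and the other states then obey a linear
  differential inequality. Second, the input contains the derivative of a reference that itself
  depends on the unknown state; taking \<open>s\<close> as coordinate in place of the last state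
  removes this derivative from the equations. Third, \<open>B\<close> decreases only weakly, and an
  edge may be inactive during most of a window. Thanks to the dwell time an edge that occurs at all
  stays active for a stretch of length \<tau>0, which is what the Gramian bound needs. Existence and
  convergence are separate: convergence is shown for every closed-loop solution, not only for the
  constructed one. Admissible \<beta> are binomial coefficients, which give the stable polynomial
  \<open>(1 + z)^(r - 1)\<close>.\<close>

lemma pw_ftc:
  fixes w :: "real \<Rightarrow> 'a::banach"
  assumes D: "finite (D \<inter> {a..b})" and ab: "a \<le> b"
    and c: "continuous_on {a..b} w"
    and d: "\<And>t. a < t \<Longrightarrow> t < b \<Longrightarrow> t \<notin> D \<Longrightarrow> (w has_vector_derivative w' t) (at t)"
  shows "(w' has_integral (w b - w a)) {a..b}"
  by (rule fundamental_theorem_of_calculus_interior_strong[OF D ab]) (use c d in auto)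

text \<open>The form in which all Lyapunov arguments are carried across switching instants. Integral
  estimates are mostly phrased as antitonicity of the estimated function plus a correction
  term.\<close>

lemma pw_antimono:
  fixes w :: "real \<Rightarrow> real"
  assumes D: "finite (D \<inter> {a..b})" and ab: "a \<le> b"
    and c: "continuous_on {a..b} w"
    and d: "\<And>t. a < t \<Longrightarrow> t < b \<Longrightarrow> t \<notin> D \<Longrightarrow> (w has_vector_derivative w' t) (at t)"
    and le: "\<And>t. a < t \<Longrightarrow> t < b \<Longrightarrow> t \<notin> D \<Longrightarrow> w' t \<le> 0"
  shows "w b \<le> w a"
proof -
  \<comment> \<open>The derivative is unknown at the exceptional points; the value 0 there makes the
    integrand nonpositive everywhere.\<close>
  have "((\<lambda>t. if a < t \<and> t < b \<and> t \<notin> D then w' t else 0) has_integral (w b - w a)) {a..b}"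
    by (rule pw_ftc[OF D ab c]) (use d in auto)
  from has_integral_neg[OF this] have "0 \<le> - (w b - w a)"
    by (rule has_integral_nonneg) (use le in auto)
  then show ?thesis by simp
qed

text \<open>The function \<open>exp (- k * (t - a)) * (\<phi> t + h / k)\<close> is nonincreasing.
  The rate \<open>k\<close> may have either sign: a growth bound needs \<open>k > 0\<close>, a
  stable filter \<open>k < 0\<close>.\<close>

lemma pw_gronwall:
  fixes \<phi> :: "real \<Rightarrow> real"
  assumes D: "finite (D \<inter> {a..b})" and ab: "a \<le> b"
    and c: "continuous_on {a..b} \<phi>" and k: "k \<noteq> 0"
    and d: "\<And>t. a < t \<Longrightarrow> t < b \<Longrightarrow> t \<notin> D \<Longrightarrow> (\<phi> has_vector_derivative \<phi>' t) (at t)"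
    and le: "\<And>t. a < t \<Longrightarrow> t < b \<Longrightarrow> t \<notin> D \<Longrightarrow> \<phi>' t \<le> k * \<phi> t + h"
  shows "\<phi> b + h / k \<le> exp (k * (b - a)) * (\<phi> a + h / k)"
proof -
  have "exp (- k * (b - a)) * (\<phi> b + h / k) \<le> exp (- k * (a - a)) * (\<phi> a + h / k)"
  proof (rule pw_antimono[OF D ab, where w = "\<lambda>t. exp (- k * (t - a)) * (\<phi> t + h / k)"
        and w' = "\<lambda>t. exp (- k * (t - a)) * (\<phi>' t - k * \<phi> t - h)"])
    show "continuous_on {a..b} (\<lambda>t. exp (- k * (t - a)) * (\<phi> t + h / k))"
      by (intro continuous_intros c)
    fix t assume t: "a < t" "t < b" "t \<notin> D"
    from d[OF t] have "(\<phi> has_real_derivative \<phi>' t) (at t)"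
      by (simp add: has_real_derivative_iff_has_vector_derivative)
    then have "((\<lambda>t. exp (- k * (t - a)) * (\<phi> t + h / k)) has_real_derivative
        exp (- k * (t - a)) * (\<phi>' t - k * \<phi> t - h)) (at t)"
      by (auto intro!: derivative_eq_intros simp: algebra_simps k)
    then show "((\<lambda>t. exp (- k * (t - a)) * (\<phi> t + h / k)) has_vector_derivative
        exp (- k * (t - a)) * (\<phi>' t - k * \<phi> t - h)) (at t)"
      by (simp add: has_real_derivative_iff_has_vector_derivative)
    show "exp (- k * (t - a)) * (\<phi>' t - k * \<phi> t - h) \<le> 0"
      using le[OF t] by (simp add: mult_le_0_iff)
  qed
  then have "exp (k * (b - a)) * (exp (- k * (b - a)) * (\<phi> b + h / k))
      \<le> exp (k * (b - a)) * (\<phi> a + h / k)"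
    by simp
  then show ?thesis
    by (simp add: exp_minus mult.assoc[symmetric])
qed

text \<open>If the right-hand side is continuous, the solution is its integral, so the exceptional
  points disappear and the one-sided derivative at the initial time exists.\<close>

lemma pw_derivative_continuous:
  fixes w :: "real \<Rightarrow> 'a::banach"
  assumes D: "\<And>a b. finite (D \<inter> {a..b})" and w: "pw_derivative D a w w'"
    and c: "continuous_on {a..} w'" and t: "a \<le> t"
  shows "(w has_vector_derivative w' t) (at t within {a..})"
proof -
  have eq: "w s = w a + integral {a..s} w'" if "s \<in> {a..t+1}" for s
  proof -
    have "(w' has_integral (w s - w a)) {a..s}"
    proof (rule pw_ftc[OF D])
      show "continuous_on {a..s} w"
        by (rule continuous_on_subset[of "{a..}"]) (use w in \<open>auto simp: pw_derivative_def\<close>)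
    qed (use that w in \<open>auto simp: pw_derivative_def\<close>)
    then show ?thesis by (simp add: has_integral_iff)
  qed
  have "((\<lambda>s. w a + integral {a..s} w') has_vector_derivative w' t) (at t within {a..t+1})"
  proof -
    have "((\<lambda>s. integral {a..s} w') has_vector_derivative w' t) (at t within {a..t+1})"
      by (rule integral_has_vector_derivative)
        (use t in \<open>auto intro: continuous_on_subset[OF c]\<close>)
    from has_vector_derivative_add[OF has_vector_derivative_const this] show ?thesis by simp
  qed
  then have "(w has_vector_derivative w' t) (at t within {a..t+1})"
    by (rule has_vector_derivative_transform[rotated 2]) (use t in simp, rule eq)
  moreover have "at t within {a..t+1} = at t within {a..}"
    by (rule at_within_nhd[where S = "{..<t+1}"]) auto
  ultimately show ?thesis by simp
qed

lemma pw_derivative_subset: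
  assumes "pw_derivative D a w w'" "a \<le> b"
  shows "pw_derivative D b w w'"
proof -
  have "continuous_on {b..} w"
    by (rule continuous_on_subset[of "{a..}"]) (use assms in \<open>auto simp: pw_derivative_def\<close>)
  then show ?thesis using assms unfolding pw_derivative_def by auto
qed

lemma pw_derivative_linear:
  assumes w: "pw_derivative D a w w'" and l: "bounded_linear l"
  shows "pw_derivative D a (\<lambda>t. l (w t)) (\<lambda>t. l (w' t))"
  using w unfolding pw_derivative_def
  by (auto intro: bounded_linear.has_vector_derivative[OF l] bounded_linear.continuous_on[OF l])

section \<open>Existence of solutions, without and with switching\<close>

lemma continuous_on_lipschitz_comp:
  fixes f :: "real \<Rightarrow> 'a::real_normed_vector \<Rightarrow> 'b::real_normed_vector"
  assumes cont: "\<And>z. continuous_on A (\<lambda>t. f t z)"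
    and lip: "\<And>t x y. t \<in> A \<Longrightarrow> norm (f t x - f t y) \<le> K * norm (x - y)"
    and z: "continuous_on A z"
  shows "continuous_on A (\<lambda>t. f t (z t))"
  unfolding continuous_on_def
proof
  fix t assume t: "t \<in> A"
  have 1: "((\<lambda>s. f s (z t) - f t (z t)) \<longlongrightarrow> 0) (at t within A)"
    using cont[of "z t"] t unfolding continuous_on_def by (simp add: LIM_zero)
  have 2: "((\<lambda>s. f s (z s) - f s (z t)) \<longlongrightarrow> 0) (at t within A)"
  proof (rule Lim_null_comparison)
    show "eventually (\<lambda>s. norm (f s (z s) - f s (z t)) \<le> K * norm (z s - z t)) (at t within A)"
      unfolding eventually_at using lip by (auto intro!: exI[of _ 1])
    have "((\<lambda>s. z s - z t) \<longlongrightarrow> 0) (at t within A)"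
      using z t unfolding continuous_on_def by (simp add: LIM_zero)
    then have "((\<lambda>s. K * norm (z s - z t)) \<longlongrightarrow> K * 0) (at t within A)"
      by (intro tendsto_mult tendsto_const tendsto_norm_zero)
    then show "((\<lambda>s. K * norm (z s - z t)) \<longlongrightarrow> 0) (at t within A)" by simp
  qed
  have "((\<lambda>s. f s (z s) - f t (z t)) \<longlongrightarrow> 0) (at t within A)"
    using tendsto_add[OF 1 2] by simp
  then show "((\<lambda>s. f s (z s)) \<longlongrightarrow> f t (z t)) (at t within A)" by (rule LIM_zero_cancel)
qed

text \<open>The weight \<open>exp (2\<kappa>(t - a))\<close> makes the Picard operator a contraction on an interval of any length.\<close>

lemma picard_lindelof:
  fixes f :: "real \<Rightarrow> 'a::banach \<Rightarrow> 'a"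
  assumes ab: "a \<le> b"
    and cont: "\<And>z. continuous_on {a..b} (\<lambda>t. f t z)"
    and lip: "\<And>t x y. t \<in> {a..b} \<Longrightarrow> norm (f t x - f t y) \<le> K * norm (x - y)"
  shows "\<exists>w. w a = w0 \<and> (\<forall>t\<in>{a..b}. (w has_vector_derivative f t (w t)) (at t within {a..b}))"
proof -
  define \<kappa> where "\<kappa> = \<bar>K\<bar> + 1"
  have \<kappa>: "\<kappa> > 0" "K \<le> \<kappa>" unfolding \<kappa>_def by auto
  define e where "e t = exp (2 * \<kappa> * (t - a))" for t
  have e_pos: "e t > 0" for t unfolding e_def by simp
  have e_cont: "continuous_on A e" for A unfolding e_def by (intro continuous_intros)
  \<comment> \<open>The fixed point is sought for the quotient \<open>y\<close> of the solution by
    the weight \<open>e\<close>, so that the plain supremum norm of \<open>y\<close> is the weighted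
    norm of the solution.\<close>
  define g where "g y s = f s (e s *\<^sub>R apply_bcontfun y s)" for y :: "real \<Rightarrow>\<^sub>C 'a" and s
  have g_cont: "continuous_on {a..b} (g y)" for y
    unfolding g_def
    by (rule continuous_on_lipschitz_comp[OF cont lip]) (auto intro!: continuous_intros e_cont)
  have g_int: "g y integrable_on {a..t}" if "t \<in> {a..b}" for y t
    by (rule integrable_continuous_interval) (use that in \<open>auto intro: continuous_on_subset[OF g_cont]\<close>)
  define h where "h y t = inverse (e t) *\<^sub>R (w0 + integral {a..t} (g y))" for y t
  have h_cont: "continuous_on {a..b} (h y)" for y
    unfolding h_def
    by (intro continuous_intros e_cont indefinite_integral_continuous_1 g_int)
      (use ab e_pos in \<open>auto simp: less_imp_neq[symmetric]\<close>)
  \<comment> \<open>Clamping time to \<open>{a..b}\<close> turns functions on the interval into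
    bounded continuous functions on the line, which form a complete space.\<close>
  define c where "c t = max a (min b t)" for t
  have c_in: "c t \<in> {a..b}" for t using ab unfolding c_def by auto
  have c_id: "t \<in> {a..b} \<Longrightarrow> c t = t" for t unfolding c_def by auto
  have c_cont: "continuous_on UNIV c" unfolding c_def by (intro continuous_intros)
  have hc: "(\<lambda>t. h y (c t)) \<in> bcontfun" for y
  proof -
    have "compact (h y ` {a..b})" by (rule compact_continuous_image[OF h_cont]) auto
    then obtain M where M: "\<And>t. t \<in> {a..b} \<Longrightarrow> norm (h y t) \<le> M"
      using compact_imp_bounded bounded_iff by (metis imageI)
    show ?thesis
    proof (rule bcontfun_normI)
      show "continuous_on UNIV (\<lambda>t. h y (c t))"
        by (rule continuous_on_compose2[OF h_cont c_cont]) (use c_in in auto)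
    qed (use M c_in in auto)
  qed
  define T where "T y = Bcontfun (\<lambda>t. h y (c t))" for y
  have T_app: "apply_bcontfun (T y) t = h y (c t)" for y t
    unfolding T_def by (simp add: Bcontfun_inverse[OF hc])
  have e_int: "(e has_integral ((e t - 1) / (2 * \<kappa>))) {a..t}" if "t \<in> {a..b}" for t
  proof -
    have "(e has_integral (e t / (2 * \<kappa>) - e a / (2 * \<kappa>))) {a..t}"
    proof (rule fundamental_theorem_of_calculus)
      show "a \<le> t" using that by auto
      fix x
      have "((\<lambda>t. e t / (2 * \<kappa>)) has_real_derivative e x) (at x within {a..t})"
        unfolding e_def using \<kappa> by (auto intro!: derivative_eq_intros)
      then show "((\<lambda>t. e t / (2 * \<kappa>)) has_vector_derivative e x) (at x within {a..t})"
        by (simp add: has_real_derivative_iff_has_vector_derivative)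
    qed
    then show ?thesis by (simp add: e_def diff_divide_distrib)
  qed
  have contr: "dist (T x) (T y) \<le> 1/2 * dist x y" for x y
  proof (rule dist_bound)
    fix t
    let ?t = "c t"
    have "norm (integral {a..?t} (g x) - integral {a..?t} (g y)) = norm (integral {a..?t} (\<lambda>s. g x s - g y s))"
      by (subst integral_diff[OF g_int[OF c_in] g_int[OF c_in]]) (rule refl)
    also have "\<dots> \<le> integral {a..?t} (\<lambda>s. \<kappa> * dist x y * e s)"
    proof (rule integral_norm_bound_integral)
      show "(\<lambda>s. g x s - g y s) integrable_on {a..?t}" by (intro integrable_diff g_int c_in)
      show "(\<lambda>s. \<kappa> * dist x y * e s) integrable_on {a..?t}"
        using has_integral_mult_right[OF e_int[OF c_in]] by (rule has_integral_integrable)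
      fix s assume s: "s \<in> {a..?t}"
      then have "norm (g x s - g y s) \<le> K * norm (e s *\<^sub>R apply_bcontfun x s - e s *\<^sub>R apply_bcontfun y s)"
        unfolding g_def by (intro lip) (use c_in[of t] in auto)
      also have "\<dots> = K * (e s * dist (apply_bcontfun x s) (apply_bcontfun y s))"
        using e_pos[of s] by (simp add: dist_norm scaleR_diff_right[symmetric])
      also have "\<dots> \<le> \<kappa> * (e s * dist x y)"
        using \<kappa> e_pos[of s] by (intro mult_mono) (auto simp: dist_bounded intro: mult_nonneg_nonneg)
      finally show "norm (g x s - g y s) \<le> \<kappa> * dist x y * e s" by (simp add: mult_ac)
    qed
    also have "\<dots> = \<kappa> * dist x y * ((e ?t - 1) / (2 * \<kappa>))"
      using has_integral_mult_right[OF e_int[OF c_in]] by (rule integral_unique)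
    also have "\<dots> \<le> e ?t * (1/2 * dist x y)"
      using \<kappa> by (simp add: field_simps)
    finally have "norm (integral {a..?t} (g x) - integral {a..?t} (g y)) \<le> e ?t * (1/2 * dist x y)" .
    then have "inverse (e ?t) * norm (integral {a..?t} (g x) - integral {a..?t} (g y))
        \<le> inverse (e ?t) * (e ?t * (1/2 * dist x y))"
      using e_pos[of ?t] by (intro mult_left_mono) auto
    moreover have "dist (h x ?t) (h y ?t)
        = inverse (e ?t) * norm (integral {a..?t} (g x) - integral {a..?t} (g y))"
      using e_pos[of ?t] unfolding h_def dist_norm
      by (simp add: scaleR_diff_right[symmetric] del: scaleR_add_right)
    ultimately show "dist (apply_bcontfun (T x) t) (apply_bcontfun (T y) t) \<le> 1/2 * dist x y"
      using e_pos[of ?t] by (simp add: T_app mult.assoc[symmetric])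
  qed
  from banach_fix_type[of "1/2" T] contr obtain y where y: "T y = y" by auto
  define w where "w t = w0 + integral {a..t} (g y)" for t
  have yw: "e t *\<^sub>R apply_bcontfun y t = w t" if "t \<in> {a..b}" for t
  proof -
    have "apply_bcontfun y t = h y (c t)" by (subst y[symmetric]) (rule T_app)
    then show ?thesis using e_pos[of t] unfolding c_id[OF that] h_def w_def by simp
  qed
  show ?thesis
  proof (intro exI[of _ w] conjI ballI)
    show "w a = w0" unfolding w_def by simp
    fix t assume t: "t \<in> {a..b}"
    have "((\<lambda>u. integral {a..u} (g y)) has_vector_derivative g y t) (at t within {a..b})"
      by (rule integral_has_vector_derivative[OF g_cont t])
    from has_vector_derivative_add[OF has_vector_derivative_const this]
    show "(w has_vector_derivative f t (w t)) (at t within {a..b})"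
      unfolding w_def[abs_def] g_def using yw[OF t] unfolding w_def g_def by simp
  qed
qed

text \<open>The field is multiplied by a cutoff that makes it globally Lipschitz. The a priori bound
  has to cover slowed-down equations, with a factor \<open>l t\<close> in \<open>[0, 1]\<close>,
  because it is applied to the solution of the cut-off equation, for which \<open>l\<close> is the
  cutoff along that solution. The bound then shows that the cutoff is 1 throughout.\<close>

lemma picard_lindelof_apriori:
  fixes f :: "real \<Rightarrow> 'a::banach \<Rightarrow> 'a"
  assumes ab: "a \<le> b"
    and cont: "\<And>z. continuous_on {a..b} (\<lambda>t. f t z)"
    and lip: "\<And>R. \<exists>K. \<forall>t\<in>{a..b}. \<forall>x y. norm x \<le> R \<longrightarrow> norm y \<le> R \<longrightarrow>
                norm (f t x - f t y) \<le> K * norm (x - y)"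
    and apriori: "\<And>z l. z a = z0 \<Longrightarrow> (\<And>t. 0 \<le> l t \<and> l t \<le> (1::real)) \<Longrightarrow>
        (\<And>t. t \<in> {a..b} \<Longrightarrow> (z has_vector_derivative l t *\<^sub>R f t (z t)) (at t within {a..b})) \<Longrightarrow>
        \<forall>t\<in>{a..b}. norm (z t) \<le> R"
  shows "\<exists>w. w a = z0 \<and> (\<forall>t\<in>{a..b}. (w has_vector_derivative f t (w t)) (at t within {a..b}))"
proof -
  \<comment> \<open>The cutoff equals 1 up to norm \<open>R\<close>, vanishes beyond
    \<open>R1\<close>, and is 1-Lipschitz in between.\<close>
  define R1 where "R1 = \<bar>R\<bar> + 1"
  obtain K0 where K0: "\<And>t x y. t \<in> {a..b} \<Longrightarrow> norm x \<le> R1 \<Longrightarrow> norm y \<le> R1 \<Longrightarrow>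
                norm (f t x - f t y) \<le> K0 * norm (x - y)"
    using lip[of R1] by blast
  define K where "K = \<bar>K0\<bar>"
  have K: "norm (f t x - f t y) \<le> K * norm (x - y)"
    if "t \<in> {a..b}" "norm x \<le> R1" "norm y \<le> R1" for t x y
    using K0[OF that] unfolding K_def by (meson abs_ge_self mult_right_mono norm_ge_zero order_trans)
  have "bounded ((\<lambda>t. f t 0) ` {a..b})"
    by (intro compact_imp_bounded compact_continuous_image cont) auto
  then obtain M0 where M0: "\<And>t. t \<in> {a..b} \<Longrightarrow> norm (f t 0) \<le> M0"
    unfolding bounded_iff by blast
  define M where "M = \<bar>M0\<bar> + K * R1"
  have M: "norm (f t x) \<le> M" if "t \<in> {a..b}" "norm x \<le> R1" for t x
  proof -
    have "norm (f t x) \<le> norm (f t x - f t 0) + norm (f t 0)" by (metis norm_triangle_sub add.commute)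
    also have "norm (f t x - f t 0) \<le> K * norm (x - 0)" using that by (intro K) (auto simp: R1_def)
    also have "\<dots> \<le> K * R1" using that unfolding K_def by (intro mult_left_mono) auto
    finally show ?thesis using M0[OF that(1)] unfolding M_def by linarith
  qed
  define cut where "cut z = max 0 (min 1 (R1 - norm z))" for z :: 'a
  have cut: "0 \<le> cut z" "cut z \<le> 1" for z unfolding cut_def by auto
  have cut_out: "cut z = 0" if "norm z > R1" for z using that unfolding cut_def by auto
  have cut_in: "cut z = 1" if "norm z \<le> R" for z using that unfolding cut_def R1_def by auto
  have cut_lip: "\<bar>cut x - cut y\<bar> \<le> norm (x - y)" for x y
    using norm_triangle_ineq3[of x y] unfolding cut_def by linarith
  define g where "g t z = cut z *\<^sub>R f t z" for t z
  \<comment> \<open>\<open>f\<close> is controlled only inside the ball of radius \<open>R1\<close>;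
    one of the two points there suffices, because the cutoff vanishes at the other one if it is
    outside.\<close>
  have half: "norm (g t x - g t y) \<le> (M + K) * norm (x - y)"
    if t: "t \<in> {a..b}" and x: "norm x \<le> R1" for t x y
  proof (cases "norm y \<le> R1")
    case True
    have "g t x - g t y = (cut x - cut y) *\<^sub>R f t x + cut y *\<^sub>R (f t x - f t y)"
      unfolding g_def by (simp add: algebra_simps)
    then have "norm (g t x - g t y) \<le> \<bar>cut x - cut y\<bar> * norm (f t x) + \<bar>cut y\<bar> * norm (f t x - f t y)"
      by (metis norm_scaleR norm_triangle_ineq)
    also have "\<dots> \<le> norm (x - y) * M + 1 * (K * norm (x - y))"
      using cut_lip cut M[OF t x] K[OF t x True] by (intro add_mono mult_mono) (auto simp: K_def)
    finally show ?thesis by (simp add: algebra_simps)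
  next
    case False
    then have y0: "cut y = 0" using cut_out by auto
    then have "norm (g t x - g t y) = \<bar>cut x - cut y\<bar> * norm (f t x)"
      unfolding g_def by simp
    also have "\<dots> \<le> norm (x - y) * M" using cut_lip M[OF t x] by (intro mult_mono) auto
    also have "\<dots> \<le> (M + K) * norm (x - y)" unfolding K_def by (simp add: algebra_simps)
    finally show ?thesis .
  qed
  have M0': "0 \<le> M + K"
    unfolding M_def K_def R1_def by simp
  have g_lip: "norm (g t x - g t y) \<le> (M + K) * norm (x - y)" if t: "t \<in> {a..b}" for t x y
  proof -
    consider "norm x \<le> R1" | "norm y \<le> R1" | "norm x > R1" "norm y > R1" by linarith
    then show ?thesis
    proof cases
      case 2 then show ?thesis using half[OF t 2, of x] by (simp add: norm_minus_commute)
    next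
      case 3 then show ?thesis using M0' cut_out unfolding g_def by simp
    qed (use half[OF t] in auto)
  qed
  have g_cont: "continuous_on {a..b} (\<lambda>t. g t z)" for z
    unfolding g_def by (intro continuous_intros cont)
  from picard_lindelof[of a b g, OF ab g_cont g_lip] obtain w where w: "w a = z0"
    "\<And>t. t \<in> {a..b} \<Longrightarrow> (w has_vector_derivative g t (w t)) (at t within {a..b})"
    by blast
  have "\<forall>t\<in>{a..b}. norm (w t) \<le> R"
    by (rule apriori[where l = "\<lambda>t. cut (w t)"]) (use cut w in \<open>auto simp: g_def\<close>)
  then show ?thesis
    using w cut_in by (intro exI[of _ w]) (auto simp: g_def)
qed

lemma grid_index:
  fixes ts :: "nat \<Rightarrow> real"
  assumes strict: "\<And>k. ts k < ts (Suc k)" and unb: "\<And>t. \<exists>k. t < ts k" and t: "ts 0 \<le> t"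
  obtains k where "ts k \<le> t" "t < ts (Suc k)"
proof -
  define n where "n = (LEAST k. t < ts k)"
  have n: "t < ts n" unfolding n_def using unb by (rule LeastI_ex)
  then have "n \<noteq> 0" using t by (metis not_less)
  then obtain k where k: "n = Suc k" by (cases n) auto
  have "\<not> t < ts k" using not_less_Least[of k "\<lambda>k. t < ts k"] k unfolding n_def by auto
  then show thesis using that[of k] n k by auto
qed

lemma grid_index_unique:
  fixes ts :: "nat \<Rightarrow> real"
  assumes strict: "\<And>k. ts k < ts (Suc k)"
    and "ts k \<le> t" "t < ts (Suc k)" "ts l \<le> t" "t < ts (Suc l)"
  shows "k = l"
proof -
  have mono: "strict_mono ts" using strict by (simp add: strict_mono_Suc_iff)
  then show ?thesis
    using assms(2-) by (meson Suc_leI linorder_neqE_nat not_less order_le_less_trans strict_mono_less_eq)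
qed

text \<open>Every cell of the grid is solved with the final value of the previous cell as initial
  value; \<open>zs\<close> collects these values.\<close>

lemma ode_glue:
  fixes f :: "real \<Rightarrow> 'a::real_normed_vector \<Rightarrow> 'a" and ts :: "nat \<Rightarrow> real"
  assumes strict: "\<And>k. ts k < ts (Suc k)" and unb: "\<And>t. \<exists>k. t < ts k"
    and step: "\<And>k z. \<exists>w. w (ts k) = z \<and> continuous_on {ts k..ts (Suc k)} w \<and>
       (\<forall>t\<in>{ts k<..<ts (Suc k)}. (w has_vector_derivative f t (w t)) (at t))"
  shows "\<exists>w. w (ts 0) = z0 \<and> pw_derivative (range ts) (ts 0) w (\<lambda>t. f t (w t))"
proof -
  obtain W where W: "\<And>k z. W k z (ts k) = z" "\<And>k z. continuous_on {ts k..ts (Suc k)} (W k z)"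
    "\<And>k z t. ts k < t \<Longrightarrow> t < ts (Suc k) \<Longrightarrow> (W k z has_vector_derivative f t (W k z t)) (at t)"
    using step by (metis greaterThanLessThan_iff)
  define zs where "zs = rec_nat z0 (\<lambda>k z. W k z (ts (Suc k)))"
  have zs: "zs 0 = z0" "zs (Suc k) = W k (zs k) (ts (Suc k))" for k unfolding zs_def by auto
  define idx where "idx t = (SOME k. ts k \<le> t \<and> t < ts (Suc k))" for t
  have idx_eq: "idx t = k" if "ts k \<le> t" "t < ts (Suc k)" for t k
  proof -
    have "ts (idx t) \<le> t \<and> t < ts (Suc (idx t))"
      unfolding idx_def by (rule someI[of _ k]) (use that in auto)
    then show ?thesis using that by (intro grid_index_unique[of ts] strict) auto
  qed
  define w where "w t = W (idx t) (zs (idx t)) t" for t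
  \<comment> \<open>At a right endpoint the index already belongs to the next cell; the two pieces
    agree there by the choice of \<open>zs\<close>. This gives continuity across the grid.\<close>
  have w_eq: "w t = W k (zs k) t" if "t \<in> {ts k..ts (Suc k)}" for t k
  proof (cases "t = ts (Suc k)")
    case True
    then have "idx t = Suc k" by (intro idx_eq) (use strict in auto)
    then show ?thesis unfolding w_def by (simp add: True W(1) zs)
  next
    case False then show ?thesis using that idx_eq[of k t] unfolding w_def by auto
  qed
  have cn: "continuous_on {ts 0..ts n} w" for n
  proof (induction n)
    case (Suc n)
    have "continuous_on {ts n..ts (Suc n)} w"
      using W(2)[of n "zs n"] by (subst continuous_on_cong[OF refl w_eq]) auto
    then have "continuous_on ({ts 0..ts n} \<union> {ts n..ts (Suc n)}) w"
      by (intro continuous_on_closed_Un Suc) auto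
    moreover have "ts 0 \<le> ts n" using strict by (simp add: lift_Suc_mono_le order_less_imp_le)
    ultimately show ?case using strict[of n] by (simp add: ivl_disj_un_two_touch)
  qed simp
  have "continuous_on {ts 0..} w"
    unfolding continuous_on_eq_continuous_within
  proof
    fix t assume t: "t \<in> {ts 0..}"
    obtain n where n: "t < ts n" using unb by auto
    have "at t within {ts 0..} = at t within {ts 0..ts n}"
      by (rule at_within_nhd[where S = "{..<ts n}"]) (use n in auto)
    then show "continuous (at t within {ts 0..}) w"
      using cn[of n] t n unfolding continuous_on_eq_continuous_within continuous_within by auto
  qed
  moreover have "(w has_vector_derivative f t (w t)) (at t)" if "ts 0 < t" "t \<notin> range ts" for t
  proof -
    obtain k where k: "ts k \<le> t" "t < ts (Suc k)"
      by (rule grid_index[of ts t, OF strict unb]) (use \<open>ts 0 < t\<close> in auto)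
    then have k': "ts k < t" using that by (metis less_eq_real_def rangeI)
    have wt: "w t = W k (zs k) t" using k by (intro w_eq) auto
    show ?thesis unfolding wt
      by (rule has_vector_derivative_transform_within_open[OF W(3)[OF k' k(2)], of "{ts k<..<ts (Suc k)}"])
        (use k' k w_eq[of _ k] in \<open>auto simp: eq_commute\<close>)
  qed
  moreover have "w (ts 0) = z0"
    using w_eq[of "ts 0" 0] strict[of 0] by (simp add: W(1) zs less_imp_le)
  ultimately show ?thesis unfolding pw_derivative_def by auto
qed

lemma has_vector_derivative_interior_interval:
  assumes "(w has_vector_derivative d) (at t within {a..b})" "a < t" "t < (b::real)"
  shows "(w has_vector_derivative d) (at t)"
  using assms at_within_Icc_at[of a t b] by simp

text \<open>\<open>f\<close> may jump at a grid point. On the closed cell it is replaced by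
  \<open>g k\<close>, which agrees with it on the open cell and has no jump at the ends.\<close>

lemma ode_switched_lipschitz:
  fixes f :: "real \<Rightarrow> 'a::banach \<Rightarrow> 'a" and ts :: "nat \<Rightarrow> real"
  assumes strict: "\<And>k. ts k < ts (Suc k)" and unb: "\<And>t. \<exists>k. t < ts k"
    and g: "\<And>k t z. t \<in> {ts k<..<ts (Suc k)} \<Longrightarrow> f t z = g k t z"
    and cont: "\<And>k z. continuous_on {ts k..ts (Suc k)} (\<lambda>t. g k t z)"
    and lip: "\<And>k. \<exists>K. \<forall>t\<in>{ts k..ts (Suc k)}. \<forall>x y. norm (g k t x - g k t y) \<le> K * norm (x - y)"
  shows "\<exists>w. w (ts 0) = z0 \<and> pw_derivative (range ts) (ts 0) w (\<lambda>t. f t (w t))"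
proof (rule ode_glue[OF strict unb])
  fix k z
  obtain K where K: "\<And>t x y. t \<in> {ts k..ts (Suc k)} \<Longrightarrow> norm (g k t x - g k t y) \<le> K * norm (x - y)"
    using lip[of k] by blast
  obtain w where w: "w (ts k) = z"
    "\<And>t. t \<in> {ts k..ts (Suc k)} \<Longrightarrow> (w has_vector_derivative g k t (w t)) (at t within {ts k..ts (Suc k)})"
    using picard_lindelof[of "ts k" "ts (Suc k)" "g k" K z, OF less_imp_le[OF strict] cont K] by blast
  have "continuous_on {ts k..ts (Suc k)} w"
    using w(2) by (intro continuous_on_vector_derivative) auto
  moreover have "(w has_vector_derivative f t (w t)) (at t)" if "t \<in> {ts k<..<ts (Suc k)}" for t
    using has_vector_derivative_interior_interval[OF w(2)[of t]] that g[OF that, of "w t"] by simp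
  ultimately show "\<exists>w. w (ts k) = z \<and> continuous_on {ts k..ts (Suc k)} w \<and>
       (\<forall>t\<in>{ts k<..<ts (Suc k)}. (w has_vector_derivative f t (w t)) (at t))"
    using w(1) by blast
qed


subsection \<open>Lyapunov forms from the Jordan normal form\<close>


no_notation Matrix.vec_index (infixl \<open>$\<close> 100)
no_notation Matrix.scalar_prod (infix \<open>\<bullet>\<close> 70)
no_notation Group.monoid.mult (infixl \<open>\<otimes>\<index>\<close> 70)

text \<open>Links the determinant over an index type, in which the characteristic polynomial is
  stated, to the carrier-based one of the Jordan normal form: permutations are conjugated by an
  enumeration of the indices.\<close>

lemma det_carrier_mat:
  fixes A :: "'a::comm_ring_1 ^ 'n ^ 'n"
  assumes h: "bij_betw h {0..<n} (UNIV :: 'n set)"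
  shows "Determinants.det A = Determinant.det (Matrix.mat n n (\<lambda>(i, j). A $ h i $ h j))"
proof -
  let ?U = "UNIV :: 'n set"
  define \<phi> where "\<phi> = (\<lambda>p x. if x \<in> ?U then h (p (inv_into {0..<n} h x)) else x)"
  have \<phi>: "bij_betw \<phi> {p. p permutes {0..<n}} {p. p permutes ?U}"
    unfolding \<phi>_def by (rule bij_betw_permutations[OF h])
  have inj: "inj_on h {0..<n}" and im: "h ` {0..<n} = ?U" using h by (auto simp: bij_betw_def)
  have s: "sign (\<phi> p) = sign p" if "p permutes {0..<n}" for p
  proof -
    have "\<phi> p = map_permutation {0..<n} h p"
      unfolding \<phi>_def map_permutation_def restrict_id_def im by (auto simp: fun_eq_iff)
    then show ?thesis using sign_map_permutation[OF inj that] by simp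
  qed
  have pr: "(\<Prod>i\<in>?U. A $ i $ \<phi> p i) = (\<Prod>i = 0..<n. Matrix.mat n n (\<lambda>(i, j). A $ h i $ h j) $$ (i, p i))"
    if "p permutes {0..<n}" for p
  proof -
    have "(\<Prod>i\<in>?U. A $ i $ \<phi> p i) = (\<Prod>i = 0..<n. A $ h i $ \<phi> p (h i))"
      by (rule prod.reindex_bij_betw[OF h, symmetric])
    also have "\<dots> = (\<Prod>i = 0..<n. Matrix.mat n n (\<lambda>(i, j). A $ h i $ h j) $$ (i, p i))"
    proof (rule prod.cong[OF refl])
      fix i assume i: "i \<in> {0..<n}"
      then have "p i \<in> {0..<n}" using permutes_in_image[OF that] by blast
      then show "A $ h i $ \<phi> p (h i) = Matrix.mat n n (\<lambda>(i, j). A $ h i $ h j) $$ (i, p i)"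
        using i unfolding \<phi>_def by (simp add: inv_into_f_f[OF inj])
    qed
    finally show ?thesis .
  qed
  have "Determinants.det A = (\<Sum>p\<in>{p. p permutes ?U}. of_int (sign p) * (\<Prod>i\<in>?U. A $ i $ p i))"
    unfolding Determinants.det_def by simp
  also have "\<dots> = (\<Sum>p\<in>{p. p permutes {0..<n}}. of_int (sign (\<phi> p)) * (\<Prod>i\<in>?U. A $ i $ \<phi> p i))"
    by (rule sum.reindex_bij_betw[OF \<phi>, symmetric])
  also have "\<dots> = (\<Sum>p\<in>{p. p permutes {0..<n}}. of_int (sign p) *
      (\<Prod>i = 0..<n. Matrix.mat n n (\<lambda>(i, j). A $ h i $ h j) $$ (i, p i)))"
    by (rule sum.cong[OF refl]) (simp add: s pr)
  also have "\<dots> = Determinant.det (Matrix.mat n n (\<lambda>(i, j). A $ h i $ h j))"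
    by (subst det_def'[of _ n]) auto
  finally show ?thesis .
qed

text \<open>Forgets the list of blocks. A Jordan matrix is bidiagonal; \<open>a\<close> is its
  diagonal, and \<open>e i\<close> says that position \<open>i\<close> is not the last of its block,
  so a superdiagonal 1 only joins equal diagonal entries.\<close>

lemma jordan_matrix_entries:
  "\<exists>a e. (\<forall>i < sum_list (map fst xs). e i \<longrightarrow> Suc i < sum_list (map fst xs) \<and> a (Suc i) = a i) \<and>
     (\<forall>i < sum_list (map fst xs). \<forall>j < sum_list (map fst xs).
        jordan_matrix xs $$ (i, j) = (if i = j then a i else if j = Suc i \<and> e i then 1 else (0::'a::{zero,one})))"
proof (induction xs)
  case Nil then show ?case by auto
next
  case (Cons x xs)
  obtain m c where x: "x = (m, c)" by force
  let ?n = "sum_list (map fst xs)"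
  obtain a e where ae: "\<And>i. i < ?n \<Longrightarrow> e i \<Longrightarrow> Suc i < ?n \<and> a (Suc i) = a i"
     "\<And>i j. i < ?n \<Longrightarrow> j < ?n \<Longrightarrow>
        jordan_matrix xs $$ (i, j) = (if i = j then a i else if j = Suc i \<and> e i then 1 else (0::'a))"
    using Cons by blast
  define a' where "a' i = (if i < m then c else a (i - m))" for i
  define e' where "e' i \<longleftrightarrow> (if i < m then Suc i < m else e (i - m))" for i
  have J: "jordan_matrix (x # xs) = four_block_mat (jordan_block m c) (0\<^sub>m m ?n) (0\<^sub>m ?n m) (jordan_matrix xs)"
    unfolding x jordan_matrix_def[of "(m, c) # xs"] by (simp add: jordan_matrix_def[symmetric] Let_def)
  have 1: "Suc i < m + ?n \<and> a' (Suc i) = a' i" if "i < m + ?n" "e' i" for i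
  proof (cases "i < m")
    case True then show ?thesis using that unfolding a'_def e'_def by auto
  next
    case False
    then have "Suc (i - m) < ?n \<and> a (Suc (i - m)) = a (i - m)"
      using that by (intro ae(1)) (auto simp: e'_def)
    moreover have "Suc i - m = Suc (i - m)" using False by simp
    ultimately show ?thesis using False that(1) unfolding a'_def by auto
  qed
  have 2: "jordan_matrix (x # xs) $$ (i, j) = (if i = j then a' i else if j = Suc i \<and> e' i then 1 else 0)"
    if i: "i < m + ?n" and j: "j < m + ?n" for i j
  proof -
    consider "i < m" "j < m" | "i < m" "\<not> j < m" | "\<not> i < m" "j < m" | "\<not> i < m" "\<not> j < m" by blast
    then show ?thesis
    proof cases
      case 4
      then show ?thesis using i j ae(2)[of "i - m" "j - m"] unfolding J a'_def e'_def
        by (auto simp: Suc_diff_le)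
    qed (use i j in \<open>auto simp: J a'_def e'_def\<close>)
  qed
  show ?case by (rule exI[of _ a'], rule exI[of _ e']) (use 1 2 in \<open>auto simp: x\<close>)
qed

text \<open>No conjugation: \<open>q\<close> acts as a linear functional, a row of a matrix.\<close>

definition cdot :: "complex ^ 'n \<Rightarrow> complex ^ 'n \<Rightarrow> complex" where
  "cdot q x = (\<Sum>j\<in>UNIV. q $ j * x $ j)"

lemma cdot_add: "cdot q (x + y) = cdot q x + cdot q y"
  by (simp add: cdot_def algebra_simps sum.distrib)

lemma cdot_scale: "cdot q (c *s x) = c * cdot q x"
  by (simp add: cdot_def algebra_simps sum_distrib_left)

text \<open>\<open>p\<close> is a Jordan basis and \<open>q\<close> its dual basis. Positions are
  natural numbers because the relation for coordinate \<open>k\<close> refers to the next position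
  of the block.\<close>

definition jordan_coords ::
  "complex ^ 'n ^ 'n \<Rightarrow> (nat \<Rightarrow> complex ^ 'n) \<Rightarrow> (nat \<Rightarrow> complex ^ 'n) \<Rightarrow> (nat \<Rightarrow> complex) \<Rightarrow> (nat \<Rightarrow> bool) \<Rightarrow> bool" where
  "jordan_coords A q p a e \<longleftrightarrow>
     (\<forall>x. x = (\<Sum>k<CARD('n). cdot (q k) x *s p k)) \<and>
     (\<forall>k<CARD('n). \<forall>l<CARD('n). cdot (q k) (p l) = (if k = l then 1 else 0)) \<and>
     (\<forall>k<CARD('n). \<forall>x. cdot (q k) (A *v x) = a k * cdot (q k) x + (if e k then cdot (q (Suc k)) x else 0)) \<and>
     (\<forall>k<CARD('n). e k \<longrightarrow> Suc k < CARD('n) \<and> a (Suc k) = a k) \<and>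
     characteristic_poly A = (\<Prod>k<CARD('n). [:- a k, 1:])"

lemma jordan_coords_exist: "\<exists>q p a e. jordan_coords (A :: complex ^ 'n ^ 'n) q p a e"
proof -
  let ?N = "CARD('n)"
  obtain h where h: "bij_betw h {0..<?N} (UNIV :: 'n set)"
    using ex_bij_betw_nat_finite[of "UNIV :: 'n set"] by auto
  have inj: "inj_on h {0..<?N}" and im: "h ` {0..<?N} = UNIV" using h by (auto simp: bij_betw_def)
  define g where "g = inv_into {0..<?N} h"
  have g: "g i \<in> {0..<?N}" "h (g i) = i" for i
    unfolding g_def using im by (auto intro: inv_into_into f_inv_into_f simp del: atLeastLessThan_iff)
  have gh: "i < ?N \<Longrightarrow> g (h i) = i" for i unfolding g_def by (simp add: inv_into_f_f[OF inj])
  have gN: "g i < ?N" for i using g(1)[of i] by simp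
  define M where "M = Matrix.mat ?N ?N (\<lambda>(i, j). A $ h i $ h j)"
  have M: "M \<in> carrier_mat ?N ?N" unfolding M_def by simp
  obtain as where as: "char_poly M = (\<Prod> a \<leftarrow> as. [:- a, 1:])" using char_poly_factorized[OF M] by auto
  obtain xs where "jordan_nf M xs" using jordan_nf_exists[OF M as] by auto
  then obtain P Q where w: "similar_mat_wit M (jordan_matrix xs) P Q"
    unfolding jordan_nf_def similar_mat_def by auto
  define J where "J = jordan_matrix xs"
  have car: "J \<in> carrier_mat ?N ?N" "P \<in> carrier_mat ?N ?N" "Q \<in> carrier_mat ?N ?N"
    and PQ: "P * Q = 1\<^sub>m ?N" and QP: "Q * P = 1\<^sub>m ?N" and MPJQ: "M = P * J * Q"
    using w M unfolding similar_mat_wit_def J_def by (auto simp: Let_def)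
  have len: "sum_list (map fst xs) = ?N" using car(1) unfolding J_def by (metis carrier_matD(1) jordan_matrix_dim(1))
  \<comment> \<open>The rows of \<open>Q\<close> are the coordinate functionals; this identity is
    their relation along the matrix.\<close>
  have QM: "Q * M = J * Q"
  proof -
    have "Q * M = Q * (P * (J * Q))" unfolding MPJQ using car by (simp add: assoc_mult_mat[of _ ?N ?N _ ?N _ ?N])
    also have "\<dots> = (Q * P) * (J * Q)" using car by (intro assoc_mult_mat[symmetric, of _ ?N ?N _ ?N _ ?N]) auto
    also have "\<dots> = J * Q" unfolding QP using car by simp
    finally show ?thesis .
  qed
  obtain a e where ae: "\<And>i. i < ?N \<Longrightarrow> e i \<Longrightarrow> Suc i < ?N \<and> a (Suc i) = a i"
     "\<And>i j. i < ?N \<Longrightarrow> j < ?N \<Longrightarrow> J $$ (i, j) = (if i = j then a i else if j = Suc i \<and> e i then 1 else 0)"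
    using jordan_matrix_entries[of xs] unfolding len J_def by blast
  define q where "q k = (\<chi> j. Q $$ (k, g j))" for k
  define p where "p k = (\<chi> j. P $$ (g j, k))" for k
  have sumU: "(\<Sum>j\<in>UNIV. F j) = (\<Sum>i = 0..<?N. F (h i))" for F :: "'n \<Rightarrow> complex"
    by (rule sum.reindex_bij_betw[OF h, symmetric])
  have mult: "(B * C) $$ (i, j) = (\<Sum>k = 0..<?N. B $$ (i, k) * C $$ (k, j))"
    if "B \<in> carrier_mat ?N ?N" "C \<in> carrier_mat ?N ?N" "i < ?N" "j < ?N" for B C :: "complex mat" and i j
    using that by (simp add: scalar_prod_def)
  have cd: "cdot (q k) x = (\<Sum>i = 0..<?N. Q $$ (k, i) * x $ h i)" for k x
    unfolding cdot_def q_def by (simp add: sumU gh)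
  have c1: "x = (\<Sum>k<?N. cdot (q k) x *s p k)" for x
  proof (rule Finite_Cartesian_Product.vec_eq_iff[THEN iffD2], rule allI)
    fix j
    have "(\<Sum>k<?N. cdot (q k) x *s p k) $ j
        = (\<Sum>k<?N. \<Sum>i = 0..<?N. P $$ (g j, k) * Q $$ (k, i) * x $ h i)"
      by (simp add: cd p_def sum_distrib_left sum_distrib_right mult_ac)
    also have "\<dots> = (\<Sum>i = 0..<?N. (\<Sum>k<?N. P $$ (g j, k) * Q $$ (k, i)) * x $ h i)"
      by (subst sum.swap) (simp add: sum_distrib_right)
    also have "\<dots> = (\<Sum>i = 0..<?N. (P * Q) $$ (g j, i) * x $ h i)"
      by (rule sum.cong[OF refl]) (use car gN in \<open>simp add: mult atLeast0LessThan del: index_mult_mat\<close>)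
    also have "\<dots> = (\<Sum>i = 0..<?N. if i = g j then x $ h i else 0)"
      unfolding PQ by (rule sum.cong[OF refl]) (use gN in auto)
    also have "\<dots> = x $ j" using g[of j] by (simp add: sum.delta)
    finally show "x $ j = (\<Sum>k<?N. cdot (q k) x *s p k) $ j" by simp
  qed
  have c2: "cdot (q k) (p l) = (if k = l then 1 else 0)" if "k < ?N" "l < ?N" for k l
  proof -
    have "cdot (q k) (p l) = (Q * P) $$ (k, l)"
      using car that by (simp add: cd mult p_def gh del: index_mult_mat)
    then show ?thesis using that unfolding QP by simp
  qed
  have c3: "cdot (q k) (A *v x) = a k * cdot (q k) x + (if e k then cdot (q (Suc k)) x else 0)"
    if k: "k < ?N" for k x
  proof -
    have "cdot (q k) (A *v x) = (\<Sum>i = 0..<?N. Q $$ (k, i) * (\<Sum>l = 0..<?N. M $$ (i, l) * x $ h l))"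
      unfolding cd matrix_vector_mult_def by (simp add: sumU M_def)
    also have "\<dots> = (\<Sum>l = 0..<?N. (\<Sum>i = 0..<?N. Q $$ (k, i) * M $$ (i, l)) * x $ h l)"
      by (simp add: sum_distrib_left sum_distrib_right mult.assoc) (rule sum.swap)
    also have "\<dots> = (\<Sum>l = 0..<?N. (J * Q) $$ (k, l) * x $ h l)"
      unfolding QM[symmetric] by (rule sum.cong[OF refl]) (use car M k in \<open>simp add: mult del: index_mult_mat\<close>)
    also have "\<dots> = (\<Sum>l = 0..<?N. (a k * Q $$ (k, l) + (if e k then Q $$ (Suc k, l) else 0)) * x $ h l)"
    proof (rule sum.cong[OF refl])
      fix l assume l: "l \<in> {0..<?N}"
      have "(J * Q) $$ (k, l) = (\<Sum>m = 0..<?N. J $$ (k, m) * Q $$ (m, l))"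
        using car l k by (subst mult) auto
      also have "\<dots> = (\<Sum>m = 0..<?N. (if m = k then a k * Q $$ (k, l) else 0) +
          (if m = Suc k then (if e k then Q $$ (Suc k, l) else 0) else 0))"
        by (rule sum.cong[OF refl]) (use k in \<open>auto simp: ae(2)\<close>)
      also have "\<dots> = a k * Q $$ (k, l) + (if e k then Q $$ (Suc k, l) else 0)"
        using k ae(1)[OF k] by (auto simp: sum.distrib sum.delta)
      finally show "(J * Q) $$ (k, l) * x $ h l = (a k * Q $$ (k, l) + (if e k then Q $$ (Suc k, l) else 0)) * x $ h l"
        by simp
    qed
    also have "\<dots> = a k * cdot (q k) x + (if e k then cdot (q (Suc k)) x else 0)"
      unfolding cd by (auto simp: sum_distrib_left algebra_simps sum.distrib)
    finally show ?thesis .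
  qed
  have c5: "characteristic_poly A = (\<Prod>k<?N. [:- a k, 1:])"
  proof -
    have "characteristic_poly A = Determinant.det (Matrix.mat ?N ?N (\<lambda>(i, j).
        (Finite_Cartesian_Product.mat [:0, 1:] - map_matrix (\<lambda>a. [:a:]) A) $ h i $ h j))"
      unfolding characteristic_poly_def by (rule det_carrier_mat[OF h])
    also have "Matrix.mat ?N ?N (\<lambda>(i, j).
        (Finite_Cartesian_Product.mat [:0, 1:] - map_matrix (\<lambda>a. [:a:]) A) $ h i $ h j) = char_poly_matrix M"
      unfolding char_poly_matrix_def
      by (rule eq_matI) (auto simp: M_def Finite_Cartesian_Product.mat_def map_matrix_def inj_on_eq_iff[OF inj])
    also have "Determinant.det (char_poly_matrix M) = char_poly J"
      using w char_poly_similar[of M J] unfolding similar_mat_def J_def char_poly_def by blast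
    also have "\<dots> = (\<Prod> a \<leftarrow> diag_mat J. [:- a, 1:])"
    proof (rule char_poly_upper_triangular[OF car(1)])
      show "upper_triangular J" unfolding upper_triangular_def using car(1) ae(2) by auto
    qed
    also have "\<dots> = (\<Prod>k<?N. [:- a k, 1:])"
    proof -
      have "diag_mat J = map a [0..<?N]"
        unfolding diag_mat_def using car(1) ae(2) by auto
      then show ?thesis by (simp add: prod.list_conv_set_nth atLeast0LessThan)
    qed
    finally show ?thesis .
  qed
  show ?thesis
    unfolding jordan_coords_def using c1 c2 c3 c5 ae(1) by blast
qed

lemma order_prod_linear:
  fixes a :: "nat \<Rightarrow> complex"
  shows "Polynomial.order z (\<Prod>k<n. [:- a k, 1:]) = card {k. k < n \<and> a k = z}"
proof (induction n)
  case (Suc n)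
  have ne: "(\<Prod>k<m. [:- a k, 1:]) \<noteq> 0" for m by auto
  have "Polynomial.order z (\<Prod>k<Suc n. [:- a k, 1:])
      = Polynomial.order z (\<Prod>k<n. [:- a k, 1:]) + Polynomial.order z [:- a n, 1:]"
    unfolding prod.lessThan_Suc by (rule order_mult) (use ne[of "Suc n"] in \<open>simp add: prod.lessThan_Suc\<close>)
  also have "Polynomial.order z [:- a n, 1:] = (if a n = z then 1 else 0)"
    using order_power_n_n[of z 1] by (auto intro!: order_0I)
  also have "Polynomial.order z (\<Prod>k<n. [:- a k, 1:]) + (if a n = z then 1 else 0) = card {k. k < Suc n \<and> a k = z}"
  proof -
    have "{k. k < Suc n \<and> a k = z} = (if a n = z then insert n {k. k < n \<and> a k = z} else {k. k < n \<and> a k = z})"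
      by (auto simp: less_Suc_eq)
    then show ?thesis using Suc by simp
  qed
  finally show ?case .
qed simp

text \<open>The first basis vector of a block is an eigenvector, and the other positions of the
  block carry the same diagonal entry.\<close>

lemma jordan_coords_eigenvalue:
  fixes A :: "complex ^ 'n ^ 'n"
  assumes J: "jordan_coords A q p a e"
  shows "k < CARD('n) \<Longrightarrow> is_eigenvalue A (a k)"
proof -
  have chain: "is_eigenvalue A (a k)" if k: "k < CARD('n)" and start: "\<And>j. j < CARD('n) \<Longrightarrow> Suc j = k \<Longrightarrow> \<not> e j" for k
  proof -
    have "A *v p k = (\<Sum>j<CARD('n). cdot (q j) (A *v p k) *s p j)"
      using J unfolding jordan_coords_def by blast
    also have "\<dots> = (\<Sum>j<CARD('n). if j = k then a k *s p k else 0)"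
    proof (rule sum.cong[OF refl])
      fix j assume j: "j \<in> {..<CARD('n)}"
      have "cdot (q j) (A *v p k) = a j * cdot (q j) (p k) + (if e j then cdot (q (Suc j)) (p k) else 0)"
        using J j unfolding jordan_coords_def by auto
      also have "(if e j then cdot (q (Suc j)) (p k) else 0) = 0"
        using J j k start[of j] unfolding jordan_coords_def by auto
      also have "cdot (q j) (p k) = (if j = k then 1 else 0)"
        using J j k unfolding jordan_coords_def by auto
      finally show "cdot (q j) (A *v p k) *s p j = (if j = k then a k *s p k else 0)" by auto
    qed
    finally have "A *v p k = a k *s p k" using k by simp
    moreover have "p k \<noteq> 0"
    proof
      assume "p k = 0"
      then have "cdot (q k) (p k) = 0" by (simp add: cdot_def)
      then show False using J k unfolding jordan_coords_def by auto
    qed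
    ultimately show ?thesis unfolding is_eigenvalue_def eigenspace_def by auto
  qed
  show "k < CARD('n) \<Longrightarrow> is_eigenvalue A (a k)"
  proof (induction k)
    case 0 then show ?case by (intro chain) auto
  next
    case (Suc k)
    show ?case
    proof (cases "e k")
      case True
      then show ?thesis using Suc J unfolding jordan_coords_def by simp
    qed (use Suc chain in auto)
  qed
qed

text \<open>An eigenvector with eigenvalue \<open>z\<close> is supported on the first positions of the Jordan blocks with
  eigenvalue \<open>z\<close>, so equality of the multiplicities leaves room only for blocks of size 1.\<close>

lemma jordan_coords_semisimple:
  fixes A :: "complex ^ 'n ^ 'n"
  assumes J: "jordan_coords A q p a e" and ss: "semisimple_eigenvalue A z"
    and k: "k < CARD('n)" and ak: "a k = z"
  shows "\<not> e k"
proof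
  assume ek: "e k"
  let ?N = "CARD('n)"
  have J1: "\<And>x. x = (\<Sum>k<?N. cdot (q k) x *s p k)"
    and J3: "\<And>k x. k < ?N \<Longrightarrow> cdot (q k) (A *v x) = a k * cdot (q k) x + (if e k then cdot (q (Suc k)) x else 0)"
    and J4: "\<And>k. k < ?N \<Longrightarrow> e k \<Longrightarrow> Suc k < ?N \<and> a (Suc k) = a k"
    and J5: "characteristic_poly A = (\<Prod>k<?N. [:- a k, 1:])"
    using J unfolding jordan_coords_def by blast+
  \<comment> \<open>The positions with diagonal entry \<open>z\<close> at which a block
    starts.\<close>
  define I where "I = {i. i < ?N \<and> a i = z \<and> (\<forall>j. Suc j = i \<longrightarrow> \<not> e j)}"
  have supp: "cdot (q i) x = 0" if x: "A *v x = z *s x" and i: "i < ?N" "i \<notin> I" for x i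
  proof -
    have rel: "z * cdot (q j) x = a j * cdot (q j) x + (if e j then cdot (q (Suc j)) x else 0)" if "j < ?N" for j
      using J3[OF that, of x] by (simp add: x cdot_scale)
    \<comment> \<open>Backwards along a block: once the next coordinate is known to vanish, the
      eigenvector equation reads \<open>(z - a j) * cdot (q j) x = 0\<close>.\<close>
    have off: "a j \<noteq> z \<longrightarrow> cdot (q j) x = 0" if "j < ?N" for j
      using that
    proof (induction "?N - j" arbitrary: j rule: less_induct)
      case less
      show ?case
      proof
        assume ne: "a j \<noteq> z"
        have "(if e j then cdot (q (Suc j)) x else 0) = 0"
          using J4[OF less.prems] less.hyps[of "Suc j"] ne less.prems by auto
        then have "(z - a j) * cdot (q j) x = 0" using rel[OF less.prems] by (simp add: algebra_simps)
        then show "cdot (q j) x = 0" using ne by simp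
      qed
    qed
    show ?thesis
    proof (cases "a i = z")
      case True
      then obtain j where j: "Suc j = i" "e j" using i unfolding I_def by auto
      then have "a j = z" using J4[of j] i True by auto
      then show ?thesis using rel[of j] j i by auto
    qed (use off i in auto)
  qed
  have "eigenspace A z \<subseteq> vec.span (p ` I)"
  proof
    fix x assume "x \<in> eigenspace A z"
    then have x: "A *v x = z *s x" unfolding eigenspace_def by simp
    have "x = (\<Sum>k<?N. cdot (q k) x *s p k)" by (rule J1)
    also have "\<dots> = (\<Sum>k\<in>I. cdot (q k) x *s p k)"
      by (rule sum.mono_neutral_right) (use supp[OF x] in \<open>auto simp: I_def\<close>)
    also have "\<dots> \<in> vec.span (p ` I)"
      by (intro vec.span_sum vec.span_scale vec.span_base) auto
    finally show "x \<in> vec.span (p ` I)" .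
  qed
  moreover have finI: "finite I" unfolding I_def by simp
  ultimately have "vec.dim (eigenspace A z) \<le> card (p ` I)" by (intro vec.dim_le_card) auto
  also have "\<dots> \<le> card I" by (rule card_image_le[OF finI])
  also have "card I < card {k. k < ?N \<and> a k = z}"
  proof (rule psubset_card_mono)
    \<comment> \<open>A link at \<open>k\<close> makes \<open>Suc k\<close> count for the algebraic
      multiplicity but not for the geometric one.\<close>
    have "Suc k \<notin> I" unfolding I_def using ek by auto
    moreover have "Suc k \<in> {k. k < ?N \<and> a k = z}" using J4[OF k ek] ak by auto
    ultimately show "I \<subset> {k. k < ?N \<and> a k = z}" unfolding I_def by blast
  qed simp
  also have "\<dots> = Polynomial.order z (characteristic_poly A)"
    unfolding J5 by (rule order_prod_linear[symmetric])
  finally show False using ss unfolding semisimple_eigenvalue_def by simp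
qed



section \<open>Positive definite forms along which a stable matrix dissipates\<close>

definition cvec :: "real ^ 'n \<Rightarrow> complex ^ 'n" where
  "cvec x = (\<chi> i. complex_of_real (x $ i))"

lemma cvec_simps: "cvec (x + y) = cvec x + cvec y" "cvec (c *\<^sub>R x) = complex_of_real c *s cvec x"
  "complexify S *v cvec x = cvec (S *v x)" "cvec x = 0 \<longleftrightarrow> x = 0"
  by (simp_all add: cvec_def complexify_def map_matrix_def matrix_vector_mult_def
      Finite_Cartesian_Product.vec_eq_iff)

text \<open>The cross terms of a Jordan block with eigenvalue \<open>-b\<close>, \<open>b > 0\<close>, are absorbed by weights growing
  along the block by a factor of at least \<open>4/b\<^sup>2\<close>.\<close>

lemma jordan_weights:
  fixes a :: "nat \<Rightarrow> complex"
  assumes e: "\<And>k. k < N \<Longrightarrow> e k \<Longrightarrow> Suc k < N \<and> a (Suc k) = a k"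
    and a: "\<And>k. k < N \<Longrightarrow> Re (a k) \<le> 0"
    and ss: "\<And>k. k < N \<Longrightarrow> Re (a k) = 0 \<Longrightarrow> \<not> e k"
  shows "\<exists>d. (\<forall>k. 0 < d k) \<and> (\<forall>y.
    (\<Sum>k<N. d k * (2 * Re (cnj (y k) * (a k * y k + (if e k then y (Suc k) else 0)))))
      \<le> (\<Sum>k<N. d k * (Re (a k) * (cmod (y k))\<^sup>2)))"
proof -
  \<comment> \<open>The sum provides a single growth factor for all positions. A position on the
    imaginary axis contributes \<open>4 / 0 = 0\<close>, and it has no link to absorb.\<close>
  define \<rho> where "\<rho> = 1 + (\<Sum>k<N. 4 / (Re (a k))\<^sup>2)"
  have \<rho>1: "\<rho> \<ge> 1" unfolding \<rho>_def by (simp add: sum_nonneg)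
  have \<rho>: "4 / (Re (a k))\<^sup>2 \<le> \<rho>" if "k < N" for k
    using member_le_sum[of k "{..<N}" "\<lambda>k. 4 / (Re (a k))\<^sup>2"] that unfolding \<rho>_def by auto
  define d where "d k = \<rho> ^ k" for k
  have d: "d k > 0" for k unfolding d_def using \<rho>1 by simp
  have main: "(\<Sum>k<N. d k * (2 * Re (cnj (y k) * (a k * y k + (if e k then y (Suc k) else 0)))))
      \<le> (\<Sum>k<N. d k * (Re (a k) * (cmod (y k))\<^sup>2))" for y
  proof -
    \<comment> \<open>A quarter of the dissipation available at \<open>k\<close>. A link costs at
      most \<open>g k + g (Suc k)\<close>, so every position pays at most twice, once for its own
      link and once for the incoming one, and half of the dissipation is left.\<close>
    define g where "g k = d k * (- Re (a k) / 2 * (cmod (y k))\<^sup>2)" for k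
    have g0: "g k \<ge> 0" if "k < N" for k
      unfolding g_def using d[of k] a[OF that] by (simp add: mult_le_0_iff)
    have summand: "d k * (2 * Re (cnj (y k) * (a k * y k + (if e k then y (Suc k) else 0))))
        \<le> d k * (2 * Re (a k) * (cmod (y k))\<^sup>2) + g k + (if e k then g (Suc k) else 0)" if k: "k < N" for k
    proof -
      have r: "Re (cnj (y k) * (a k * y k)) = Re (a k) * (cmod (y k))\<^sup>2"
        unfolding cmod_power2 by (simp add: algebra_simps power2_eq_square)
      show ?thesis
      proof (cases "e k")
        case False
        then show ?thesis using g0[OF k] d[of k] by (simp only: r if_False add_0_right)
      next
        case True
        define b where "b = - Re (a k)"
        have b: "b > 0" using a[OF k] ss[OF k] True unfolding b_def by fastforce
        have d4: "4 / b\<^sup>2 * d k \<le> d (Suc k)"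
          using mult_right_mono[OF \<rho>[OF k] less_imp_le[OF d[of k]]] unfolding b_def d_def by simp
        have "2 * Re (cnj (y k) * y (Suc k)) \<le> 2 * (cmod (y k) * cmod (y (Suc k)))"
          using complex_Re_le_cmod[of "cnj (y k) * y (Suc k)"] by (simp add: norm_mult)
        also have "\<dots> \<le> b / 2 * (cmod (y k))\<^sup>2 + 2 / b * (cmod (y (Suc k)))\<^sup>2"
        proof -
          have "0 \<le> (b * cmod (y k) - 2 * cmod (y (Suc k)))\<^sup>2 / (2 * b)" using b by simp
          then show ?thesis using b by (simp add: power2_eq_square field_simps)
        qed
        finally have "d k * (2 * Re (cnj (y k) * y (Suc k)))
            \<le> d k * (b / 2 * (cmod (y k))\<^sup>2 + 2 / b * (cmod (y (Suc k)))\<^sup>2)"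
          using d[of k] by simp
        also have "\<dots> = g k + (4 / b\<^sup>2 * d k) * (b / 2 * (cmod (y (Suc k)))\<^sup>2)"
          using b unfolding g_def b_def[symmetric] by (simp add: field_simps power2_eq_square)
        also have "\<dots> \<le> g k + d (Suc k) * (b / 2 * (cmod (y (Suc k)))\<^sup>2)"
          using d4 b by (intro add_left_mono mult_right_mono) auto
        also have "\<dots> = g k + g (Suc k)"
          unfolding g_def b_def using e[OF k True] by (simp only: algebra_simps)
        finally show ?thesis using True by (simp only: if_True distrib_left r plus_complex.simps mult.assoc)
      qed
    qed
    \<comment> \<open>Distinct links have distinct targets, so no position is charged twice as a
      target.\<close>
    have shift: "(\<Sum>k<N. if e k then g (Suc k) else 0) \<le> (\<Sum>k<N. g k)"
    proof -
      have "(\<Sum>k<N. if e k then g (Suc k) else 0) = (\<Sum>k\<in>{k\<in>{..<N}. e k}. g (Suc k))"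
        by (rule sum.inter_filter[symmetric]) simp
      also have "\<dots> = (\<Sum>k\<in>Suc ` {k\<in>{..<N}. e k}. g k)" by (subst sum.reindex) auto
      also have "\<dots> \<le> (\<Sum>k<N. g k)" by (rule sum_mono2) (use e g0 in auto)
      finally show ?thesis .
    qed
    have "(\<Sum>k<N. d k * (2 * Re (cnj (y k) * (a k * y k + (if e k then y (Suc k) else 0)))))
        \<le> (\<Sum>k<N. d k * (2 * Re (a k) * (cmod (y k))\<^sup>2) + g k + (if e k then g (Suc k) else 0))"
      by (rule sum_mono) (use summand in auto)
    also have "\<dots> \<le> (\<Sum>k<N. d k * (2 * Re (a k) * (cmod (y k))\<^sup>2)) + (\<Sum>k<N. g k) + (\<Sum>k<N. g k)"
      unfolding sum.distrib using shift by simp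
    also have "\<dots> = (\<Sum>k<N. d k * (Re (a k) * (cmod (y k))\<^sup>2))"
      unfolding sum.distrib[symmetric] by (rule sum.cong[OF refl]) (simp add: g_def algebra_simps)
    finally show ?thesis .
  qed
  show ?thesis using d main by blast
qed

text \<open>\<open>B\<close> is the real part of a weighted Hermitian product of Jordan coordinates,
  hence symmetric on real vectors. One construction serves the marginally stable and the Hurwitz
  case.\<close>

lemma jordan_dissipative_form:
  fixes S :: "real ^ 'n ^ 'n"
  assumes J: "jordan_coords (complexify S) q p a e"
    and a: "\<And>k. k < CARD('n) \<Longrightarrow> Re (a k) \<le> 0"
    and ss: "\<And>k. k < CARD('n) \<Longrightarrow> Re (a k) = 0 \<Longrightarrow> \<not> e k"
  shows "\<exists>B. bounded_bilinear B \<and> (\<forall>x y. B x y = B y x) \<and> (\<forall>x. x \<noteq> 0 \<longrightarrow> 0 < B x x) \<and>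
    (\<forall>x. B x (S *v x) \<le> 0) \<and>
    ((\<forall>k<CARD('n). Re (a k) < 0) \<longrightarrow> (\<forall>x. x \<noteq> 0 \<longrightarrow> B x (S *v x) < (0::real)))"
proof -
  let ?N = "CARD('n)"
  have J1: "\<And>x. x = (\<Sum>k<?N. cdot (q k) x *s p k)"
    and J3: "\<And>k x. k < ?N \<Longrightarrow> cdot (q k) (complexify S *v x) = a k * cdot (q k) x + (if e k then cdot (q (Suc k)) x else 0)"
    and J4: "\<And>k. k < ?N \<Longrightarrow> e k \<Longrightarrow> Suc k < ?N \<and> a (Suc k) = a k"
    using J unfolding jordan_coords_def by blast+
  obtain d where d: "\<And>k. 0 < d k" and le: "\<And>y.
    (\<Sum>k<?N. d k * (2 * Re (cnj (y k) * (a k * y k + (if e k then y (Suc k) else 0)))))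
      \<le> (\<Sum>k<?N. d k * (Re (a k) * (cmod (y k))\<^sup>2))"
    using jordan_weights[of ?N e a, OF J4 a ss] by blast
  define Y where "Y k x = cdot (q k) (cvec x)" for k x
  have Y: "Y k (x + y) = Y k x + Y k y" "Y k (c *\<^sub>R x) = complex_of_real c * Y k x" for k x y c
    unfolding Y_def by (simp_all add: cvec_simps cdot_add cdot_scale)
  define B where "B x y = (\<Sum>k<?N. d k * Re (cnj (Y k x) * Y k y))" for x y
  have "linear (B x)" for x
    by (rule linearI) (simp_all add: B_def Y algebra_simps sum.distrib sum_distrib_left)
  moreover have "linear (\<lambda>x. B x y)" for y
    by (rule linearI) (simp_all add: B_def Y algebra_simps sum.distrib sum_distrib_left)
  ultimately have bil: "bounded_bilinear B" using bilinear_conv_bounded_bilinear unfolding bilinear_def by blast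
  have Bxx: "B x x = (\<Sum>k<?N. d k * (cmod (Y k x))\<^sup>2)" for x
    unfolding B_def cmod_power2 by (simp add: power2_eq_square)
  have nz: "\<exists>k<?N. Y k x \<noteq> 0" if "x \<noteq> 0" for x
  proof (rule ccontr)
    assume "\<not> (\<exists>k<?N. Y k x \<noteq> 0)"
    then have "(\<Sum>k<?N. cdot (q k) (cvec x) *s p k) = 0" unfolding Y_def by simp
    then have "cvec x = 0" using J1[of "cvec x"] by simp
    then show False using that by (simp add: cvec_simps)
  qed
  have pos: "0 < B x x" if x: "x \<noteq> 0" for x
  proof -
    obtain k where k: "k < ?N" "Y k x \<noteq> 0" using nz[OF x] by auto
    show ?thesis unfolding Bxx by (rule sum_pos2[of _ k]) (use k d in \<open>auto simp: less_imp_le\<close>)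
  qed
  have ineq: "2 * B x (S *v x) \<le> (\<Sum>k<?N. d k * (Re (a k) * (cmod (Y k x))\<^sup>2))" for x
  proof -
    have "2 * B x (S *v x) = (\<Sum>k<?N. d k * (2 * Re (cnj (Y k x) * (a k * Y k x + (if e k then Y (Suc k) x else 0)))))"
      unfolding B_def sum_distrib_left
      by (rule sum.cong[OF refl]) (simp add: Y_def cvec_simps(3)[symmetric] J3)
    also have "\<dots> \<le> (\<Sum>k<?N. d k * (Re (a k) * (cmod (Y k x))\<^sup>2))" by (rule le)
    finally show ?thesis .
  qed
  have diss: "B x (S *v x) \<le> 0" for x
  proof -
    have "(\<Sum>k<?N. d k * (Re (a k) * (cmod (Y k x))\<^sup>2)) \<le> 0"
      by (intro sum_nonpos mult_nonneg_nonpos mult_nonpos_nonneg) (use a d in \<open>auto simp: less_imp_le\<close>)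
    then show ?thesis using ineq[of x] by linarith
  qed
  have strict: "B x (S *v x) < 0" if neg: "\<forall>k<?N. Re (a k) < 0" and x: "x \<noteq> 0" for x
  proof -
    obtain k where k: "k < ?N" "Y k x \<noteq> 0" using nz[OF x] by auto
    have "0 < (\<Sum>k<?N. - (d k * (Re (a k) * (cmod (Y k x))\<^sup>2)))"
    proof (rule sum_pos2[of _ k])
      show "0 < - (d k * (Re (a k) * (cmod (Y k x))\<^sup>2))"
        using k d[of k] neg by (simp add: mult_less_0_iff zero_less_mult_iff)
      show "0 \<le> - (d i * (Re (a i) * (cmod (Y i x))\<^sup>2))" if "i \<in> {..<?N}" for i
        using d[of i] a[of i] that by (simp add: mult_le_0_iff)
    qed (use k in auto)
    then show ?thesis using ineq[of x] by (simp add: sum_negf)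
  qed
  show ?thesis
    by (intro exI[of _ B] conjI allI impI bil pos diss strict) (auto simp: B_def algebra_simps intro!: sum.cong)
qed

lemma marginally_stable_form:
  fixes S :: "real ^ 'n ^ 'n"
  assumes "marginally_stable S"
  shows "\<exists>B. bounded_bilinear B \<and> (\<forall>x y. B x y = B y x) \<and> (\<forall>x. x \<noteq> 0 \<longrightarrow> 0 < B x x) \<and>
    (\<forall>x. B x (S *v x) \<le> (0::real))"
proof -
  obtain q p a e where J: "jordan_coords (complexify S) q p a e" using jordan_coords_exist by blast
  have ev: "is_eigenvalue (complexify S) (a k)" if "k < CARD('n)" for k
    by (rule jordan_coords_eigenvalue[OF J that])
  have ss: "\<not> e k" if "k < CARD('n)" "Re (a k) = 0" for k
    using jordan_coords_semisimple[OF J _ that(1) refl] assms ev[OF that(1)] that(2)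
    unfolding marginally_stable_def by blast
  have "Re (a k) \<le> 0" if "k < CARD('n)" for k
    using assms ev[OF that] unfolding marginally_stable_def by blast
  from jordan_dissipative_form[OF J this ss] show ?thesis by blast
qed

lemma hurwitz_form:
  fixes A :: "real ^ 'n ^ 'n"
  assumes "hurwitz A"
  shows "\<exists>B. bounded_bilinear B \<and> (\<forall>x y. B x y = B y x) \<and> (\<forall>x. x \<noteq> 0 \<longrightarrow> 0 < B x x) \<and>
    (\<forall>x. x \<noteq> 0 \<longrightarrow> B x (A *v x) < (0::real))"
proof -
  obtain q p a e where J: "jordan_coords (complexify A) q p a e" using jordan_coords_exist by blast
  have neg: "Re (a k) < 0" if "k < CARD('n)" for k
    using jordan_coords_eigenvalue[OF J that] assms unfolding hurwitz_def by blast
  then show ?thesis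
    using jordan_dissipative_form[OF J] by (metis less_imp_le less_irrefl)
qed


subsection \<open>Dissipative pairs and observability\<close>


lemma bounded_bilinear_quadratic_derivative:
  assumes B: "bounded_bilinear (B :: 'a::real_normed_vector \<Rightarrow> 'a \<Rightarrow> real)" and sym: "\<And>x y. B x y = B y x"
    and w: "(w has_vector_derivative w') (at t within T)"
  shows "((\<lambda>t. B (w t) (w t)) has_vector_derivative 2 * B (w t) w') (at t within T)"
  using bounded_bilinear.has_vector_derivative[OF B w w] sym[of w' "w t"] by simp

lemma continuous_on_Pair_const: "continuous_on T (Pair x)"
  using continuous_on_Pair[of T "\<lambda>_. x" "\<lambda>t. t"] by simp

lemma positive_form_lower_bound:
  fixes B :: "'a::euclidean_space \<Rightarrow> 'a \<Rightarrow> real"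
  assumes B: "bounded_bilinear B" and pos: "\<And>x. x \<noteq> 0 \<Longrightarrow> 0 < B x x"
  shows "\<exists>c>0. \<forall>x. c * (norm x)\<^sup>2 \<le> B x x"
proof -
  interpret bounded_bilinear B by (rule B)
  have cont: "continuous_on (sphere 0 1) (\<lambda>x. B x x)"
    by (intro continuous_on continuous_intros)
  have "sphere (0::'a) 1 \<noteq> {}" by simp
  from continuous_attains_inf[OF compact_sphere this cont] obtain x0 where
    x0: "norm x0 = 1" and min: "\<And>y. norm y = 1 \<Longrightarrow> B x0 x0 \<le> B y y" by auto
  have "B x0 x0 * (norm x)\<^sup>2 \<le> B x x" for x
  proof (cases "x = 0")
    case False
    have "B x0 x0 \<le> B (x /\<^sub>R norm x) (x /\<^sub>R norm x)" by (rule min) (use False in simp)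
    also have "\<dots> = B x x / (norm x)\<^sup>2" by (simp add: scaleR_left scaleR_right power2_eq_square field_simps)
    finally show ?thesis using False by (simp add: field_simps)
  qed (simp add: zero_left)
  moreover have "0 < B x0 x0" by (rule pos) (use x0 in auto)
  ultimately show ?thesis by blast
qed

lemma positive_form_dominates:
  fixes B Q :: "'a::euclidean_space \<Rightarrow> 'a \<Rightarrow> real"
  assumes B: "bounded_bilinear B" and pos: "\<And>x. x \<noteq> 0 \<Longrightarrow> 0 < B x x" and Q: "bounded_bilinear Q"
  shows "\<exists>K\<ge>0. \<forall>x. \<bar>Q x x\<bar> \<le> K * B x x"
proof -
  obtain c where c: "c > 0" "\<And>x. c * (norm x)\<^sup>2 \<le> B x x" using positive_form_lower_bound[OF B pos] by blast
  obtain K where K: "K \<ge> 0" "\<And>x y. norm (Q x y) \<le> norm x * norm y * K"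
    using bounded_bilinear.nonneg_bounded[OF Q] by auto
  have "\<bar>Q x x\<bar> \<le> (K / c) * B x x" for x
  proof -
    have "\<bar>Q x x\<bar> \<le> K * (norm x)\<^sup>2" using K(2)[of x x] by (simp add: power2_eq_square mult_ac)
    also have "\<dots> = (K / c) * (c * (norm x)\<^sup>2)" using c by simp
    also have "\<dots> \<le> (K / c) * B x x" using c K by (intro mult_left_mono) auto
    finally show ?thesis .
  qed
  then show ?thesis using c K by (intro exI[of _ "K / c"]) auto
qed

text \<open>If \<open>A\<close> is skew for \<open>B\<close> on an invariant subspace and dissipative for another form \<open>Q\<close>, then a
  minimiser of \<open>Q\<close> on the \<open>B\<close>-sphere of the subspace would satisfy \<open>Q x (A x) = 0\<close>.\<close>

lemma skew_dissipative_subspace_trivial: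
  fixes B Q :: "'a::euclidean_space \<Rightarrow> 'a \<Rightarrow> real" and A :: "'a \<Rightarrow> 'a"
  assumes B: "bounded_bilinear B" "\<And>x y. B x y = B y x" "\<And>x. x \<noteq> 0 \<Longrightarrow> 0 < B x x"
    and Q: "bounded_bilinear Q" "\<And>x y. Q x y = Q y x"
    and U: "Real_Vector_Spaces.subspace U" and inv: "\<And>x. x \<in> U \<Longrightarrow> A x \<in> U"
    and skew: "\<And>x. x \<in> U \<Longrightarrow> B x (A x) = 0" and diss: "\<And>x. x \<in> U \<Longrightarrow> x \<noteq> 0 \<Longrightarrow> Q x (A x) < 0"
  shows "U \<subseteq> {0}"
proof (rule ccontr)
  assume "\<not> U \<subseteq> {0}"
  then obtain y where y: "y \<in> U" "y \<noteq> 0" by auto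
  interpret B: bounded_bilinear B by (rule B)
  interpret Q: bounded_bilinear Q by (rule Q)
  define K where "K = U \<inter> {x. B x x = 1}"
  have norm1: "x /\<^sub>R sqrt (B x x) \<in> K" if "x \<in> U" "x \<noteq> 0" for x
  proof -
    have "0 < B x x" using B(3) that by auto
    then show ?thesis using that U unfolding K_def
      by (auto simp: subspace_scale B.scaleR_left B.scaleR_right field_simps simp flip: power2_eq_square)
  qed
  obtain c where c: "c > 0" "\<And>x. c * (norm x)\<^sup>2 \<le> B x x" using positive_form_lower_bound[OF B(1,3)] by blast
  have "bounded K"
    unfolding bounded_iff
  proof (intro exI ballI)
    fix x assume "x \<in> K"
    then have "(norm x)\<^sup>2 \<le> 1 / c" using c(1) c(2)[of x] unfolding K_def by (simp add: field_simps)
    then show "norm x \<le> sqrt (1 / c)" by (rule real_le_rsqrt)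
  qed
  moreover have "closed K"
  proof -
    have "continuous_on UNIV (\<lambda>x. B x x)" by (intro B.continuous_on continuous_intros)
    then have "closed {x. B x x = 1}" by (intro closed_Collect_eq) auto
    then show ?thesis unfolding K_def using closed_subspace[OF U] by (rule closed_Int[rotated])
  qed
  ultimately have "compact K" by (simp add: compact_eq_bounded_closed)
  moreover have "K \<noteq> {}" using norm1[OF y] by auto
  moreover have "continuous_on K (\<lambda>x. Q x x)" by (intro Q.continuous_on continuous_intros)
  ultimately obtain x where x: "x \<in> K" and min: "\<And>z. z \<in> K \<Longrightarrow> Q x x \<le> Q z z"
    using continuous_attains_inf[of K "\<lambda>x. Q x x"] by blast
  define l where "l = Q x x"
  have xU: "x \<in> U" "B x x = 1" using x unfolding K_def by auto
  have x0: "x \<noteq> 0" using xU by (auto simp: B.zero_left)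
  have lower: "l * B z z \<le> Q z z" if z: "z \<in> U" for z
  proof (cases "z = 0")
    case False
    then have p: "0 < B z z" using B(3) by auto
    have "l \<le> Q (z /\<^sub>R sqrt (B z z)) (z /\<^sub>R sqrt (B z z))" unfolding l_def by (rule min[OF norm1[OF z False]])
    also have "\<dots> = Q z z / B z z" using p by (simp add: Q.scaleR_left Q.scaleR_right field_simps)
    finally show ?thesis using p by (simp add: field_simps)
  qed (simp add: B.zero_left Q.zero_left)
  define q where "q = Q x (A x)"
  define k where "k = Q (A x) (A x) - l * B (A x) (A x)"
  have q: "q < 0" unfolding q_def by (rule diss[OF xU(1) x0])
  \<comment> \<open>\<open>Q - l B\<close> is nonnegative on the subspace and vanishes at
    \<open>x\<close>. Moving from \<open>x\<close> in the direction \<open>A x\<close> gives a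
    quadratic in \<open>h\<close> whose linear coefficient is \<open>2 q\<close>, since skewness
    removes the contribution of \<open>B\<close>.\<close>
  have "0 \<le> 2 * h * q + h\<^sup>2 * k" for h
  proof -
    have "x + h *\<^sub>R A x \<in> U" using xU(1) inv U by (simp add: subspace_add subspace_scale)
    from lower[OF this] show ?thesis
      using skew[OF xU(1)] xU(2) B(2)[of "A x" x] Q(2)[of "A x" x] unfolding q_def k_def l_def
      by (simp add: B.add_left B.add_right B.scaleR_left B.scaleR_right Q.add_left Q.add_right
          Q.scaleR_left Q.scaleR_right algebra_simps power2_eq_square)
  qed
  \<comment> \<open>This positive step is small enough for the negative linear term to beat the
    quadratic one.\<close>
  from this[of "- q / (\<bar>k\<bar> + 1)"] have "0 \<le> (- q / (\<bar>k\<bar> + 1)) * (2 * q + (- q / (\<bar>k\<bar> + 1)) * k)"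
    by (simp add: power2_eq_square algebra_simps)
  moreover have "0 < - q / (\<bar>k\<bar> + 1)" using q by (simp add: field_simps)
  ultimately have "0 \<le> 2 * q + (- q / (\<bar>k\<bar> + 1)) * k" using zero_le_mult_iff not_less by (smt (verit))
  moreover have "(- q / (\<bar>k\<bar> + 1)) * k \<le> - q"
  proof -
    have "(- q) * k \<le> (- q) * (\<bar>k\<bar> + 1)" using q by (intro mult_left_mono) auto
    then show ?thesis by (simp add: field_simps)
  qed
  ultimately show False using q by linarith
qed

section \<open>The flow of a dissipative pair and its Gramian\<close>

text \<open>\<open>L\<close> is the Riesz representer of \<open>F\<close> for the form
  \<open>B\<close>, and observability counts the dissipation of \<open>B\<close> as a second output
  besides \<open>F\<close>. There are two instances: the leader dynamics with its output, and the
  scalar integrator that governs every entry of the errors of \<open>Sh\<close> and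
  \<open>L\<close>.\<close>

locale dissipative_pair =
  fixes A :: "'a::euclidean_space \<Rightarrow> 'a" and F :: "'a \<Rightarrow> real" and B :: "'a \<Rightarrow> 'a \<Rightarrow> real" and L :: 'a
  assumes linA: "linear A" and linF: "linear F"
    and B: "bounded_bilinear B" and B_sym: "B x y = B y x" and B_pos: "x \<noteq> 0 \<Longrightarrow> 0 < B x x"
    and diss: "B x (A x) \<le> 0" and gain: "B L x = F x"
    and observable: "(\<And>k. F ((A ^^ k) x) = 0 \<and> B ((A ^^ k) x) (A ((A ^^ k) x)) = 0) \<Longrightarrow> x = 0"
begin

lemmas B_simps = bounded_bilinear.add_left[OF B] bounded_bilinear.add_right[OF B]
  bounded_bilinear.diff_left[OF B] bounded_bilinear.diff_right[OF B]
  bounded_bilinear.scaleR_left[OF B] bounded_bilinear.scaleR_right[OF B]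
  bounded_bilinear.minus_left[OF B] bounded_bilinear.minus_right[OF B]

lemma B_nonneg: "0 \<le> B x x"
  using B_pos[of x] bounded_bilinear.zero_left[OF B] by (cases "x = 0") (auto simp: less_imp_le)

text \<open>The rate at which \<open>B u u\<close> decreases along \<open>u' = A u\<close>.\<close>

definition diss_rate :: "'a \<Rightarrow> real" where
  "diss_rate x = - 2 * B x (A x)"

lemma diss_rate_nonneg: "0 \<le> diss_rate x"
  unfolding diss_rate_def using diss[of x] by simp

lemma diss_rate_diff: "diss_rate (x - y) \<le> 2 * diss_rate x + 2 * diss_rate y"
proof -
  have "diss_rate (x + y) + diss_rate (x - y) = 2 * diss_rate x + 2 * diss_rate y"
    unfolding diss_rate_def by (simp add: B_simps linear_add[OF linA] linear_diff[OF linA])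
  then show ?thesis using diss_rate_nonneg[of "x + y"] by linarith
qed

lemma B_add: "B (x + y) (x + y) \<le> 2 * B x x + 2 * B y y"
proof -
  have "B (x + y) (x + y) + B (x - y) (x - y) = 2 * B x x + 2 * B y y" by (simp add: B_simps)
  then show ?thesis using B_nonneg[of "x - y"] by linarith
qed

lemma bounded_linear_A: "bounded_linear A" using linA by (rule linear_conv_bounded_linear[THEN iffD1])
lemma bounded_linear_F: "bounded_linear F" using linF by (rule linear_conv_bounded_linear[THEN iffD1])

lemma diss_rate_bound: "\<exists>K\<ge>0. \<forall>x. diss_rate x \<le> K * B x x"
proof -
  have "bounded_bilinear (\<lambda>x y. B x (A y))"
    by (rule bounded_bilinear.comp[OF B bounded_linear_ident bounded_linear_A])
  from positive_form_dominates[OF B B_pos this] obtain K where K: "K \<ge> 0" "\<And>x. \<bar>B x (A x)\<bar> \<le> K * B x x" by blast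
  have "diss_rate x \<le> (2 * K) * B x x" for x
    using K(2)[of x] unfolding diss_rate_def by linarith
  then show ?thesis using K(1) by (intro exI[of _ "2 * K"]) auto
qed

lemma F_bound: "\<exists>K\<ge>0. \<forall>x. (F x)\<^sup>2 \<le> K * B x x"
proof -
  have "bounded_bilinear (\<lambda>x y. F x * F y)"
    by (rule bounded_bilinear.comp[OF bounded_bilinear_mult bounded_linear_F bounded_linear_F])
  from positive_form_dominates[OF B B_pos this] show ?thesis by (simp add: power2_eq_square)
qed

text \<open>Solutions of \<open>u' = A u\<close> with values at \<open>0\<close> running through a basis give a flow that is linear in
  the initial value by construction.\<close>

lemma flow_exists:
  "\<exists>\<Phi>. (\<forall>x. \<Phi> 0 x = x) \<and> (\<forall>t. linear (\<Phi> t)) \<and>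
     (\<forall>x. \<forall>t\<ge>0. ((\<lambda>t. \<Phi> t x) has_vector_derivative A (\<Phi> t x)) (at t within {0..})) \<and>
     continuous_on (UNIV \<times> {0..}) (\<lambda>(x, t). \<Phi> t x)"
proof -
  \<comment> \<open>No switching takes place here; the integers only provide a grid for the
    existence theorem.\<close>
  define ts where "ts k = real k" for k
  have ts: "ts k < ts (Suc k)" "\<exists>k. t < ts k" for k t
    unfolding ts_def using reals_Archimedean2 by auto
  have D: "finite (range ts \<inter> {a..b})" for a b
  proof (rule finite_subset)
    show "range ts \<inter> {a..b} \<subseteq> ts ` {..nat \<lfloor>b\<rfloor>}" unfolding ts_def by (auto simp: le_nat_iff le_floor_iff)
  qed simp
  obtain K where K: "\<And>x. norm (A x) \<le> norm x * K" using bounded_linear.bounded[OF bounded_linear_A] by auto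
  have ex: "\<exists>w. w (ts 0) = b \<and> pw_derivative (range ts) (ts 0) w (\<lambda>t. A (w t))" for b
    by (rule ode_switched_lipschitz[where g = "\<lambda>k t. A", OF ts])
      (use K in \<open>auto intro!: exI[of _ K] simp: linear_diff[OF linA, symmetric] mult.commute\<close>)
  obtain \<phi> where \<phi>: "\<And>b. \<phi> b 0 = b" "\<And>b. pw_derivative (range ts) 0 (\<phi> b) (\<lambda>t. A (\<phi> b t))"
    using ex unfolding ts_def by (metis of_nat_0)
  have \<phi>_cont: "continuous_on {0..} (\<phi> b)" for b using \<phi>(2)[of b] unfolding pw_derivative_def by auto
  have \<phi>_der: "(\<phi> b has_vector_derivative A (\<phi> b t)) (at t within {0..})" if "t \<ge> 0" for b t
    by (rule pw_derivative_continuous[OF D \<phi>(2)])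
      (use that in \<open>auto intro: bounded_linear.continuous_on[OF bounded_linear_A] \<phi>_cont\<close>)
  define \<Phi> where "\<Phi> t x = (\<Sum>b\<in>Basis. (x \<bullet> b) *\<^sub>R \<phi> b t)" for t x
  show ?thesis
  proof (intro exI[of _ \<Phi>] conjI allI impI)
    show "\<Phi> 0 x = x" for x unfolding \<Phi>_def by (simp add: \<phi> euclidean_representation)
    show "linear (\<Phi> t)" for t
      unfolding \<Phi>_def by (rule linearI) (simp_all add: inner_add_left scaleR_add_left sum.distrib scaleR_sum_right)
    fix x :: 'a and t :: real assume t: "0 \<le> t"
    have "A (\<Phi> t x) = (\<Sum>b\<in>Basis. (x \<bullet> b) *\<^sub>R A (\<phi> b t))"
      unfolding \<Phi>_def by (simp add: linear_sum[OF linA] linear_scale[OF linA])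
    then show "((\<lambda>t. \<Phi> t x) has_vector_derivative A (\<Phi> t x)) (at t within {0..})"
      unfolding \<Phi>_def
      by (auto intro!: has_vector_derivative_sum bounded_linear.has_vector_derivative[OF bounded_linear_scaleR_right] \<phi>_der t)
  next
    show "continuous_on (UNIV \<times> {0..}) (\<lambda>(x, t). \<Phi> t x)"
      unfolding \<Phi>_def case_prod_beta
      by (intro continuous_intros continuous_on_compose2[OF \<phi>_cont]) auto
  qed
qed

lemma solution_energy:
  assumes u: "\<And>t. t \<in> {p..q} \<Longrightarrow> (u has_vector_derivative A (u t)) (at t within {p..q})" and t: "t \<in> {p..q}"
  shows "B (u t) (u t) \<le> B (u p) (u p)"
proof (rule pw_antimono[where D = "{}" and w = "\<lambda>t. B (u t) (u t)" and w' = "\<lambda>t. - diss_rate (u t)"])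
  have "continuous_on {p..q} u" using u by (intro continuous_on_vector_derivative) auto
  then have "continuous_on {p..t} u" by (rule continuous_on_subset) (use t in auto)
  then show "continuous_on {p..t} (\<lambda>t. B (u t) (u t))" by (intro bounded_bilinear.continuous_on[OF B])
  fix s assume s: "p < s" "s < t"
  have "(u has_vector_derivative A (u s)) (at s)"
    by (rule has_vector_derivative_interior_interval[OF u]) (use s t in auto)
  from bounded_bilinear_quadratic_derivative[OF B B_sym this]
  show "((\<lambda>t. B (u t) (u t)) has_vector_derivative - diss_rate (u s)) (at s)" unfolding diss_rate_def by simp
qed (use t diss_rate_nonneg in auto)

text \<open>The difference of two solutions is a solution, and its energy cannot grow from
  0.\<close>

lemma solution_unique:
  assumes u: "\<And>t. t \<in> {p..q} \<Longrightarrow> (u has_vector_derivative A (u t)) (at t within {p..q})"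
    and v: "\<And>t. t \<in> {p..q} \<Longrightarrow> (v has_vector_derivative A (v t)) (at t within {p..q})"
    and eq: "u p = v p" and t: "t \<in> {p..q}"
  shows "u t = v t"
proof -
  have "B (u t - v t) (u t - v t) \<le> B (u p - v p) (u p - v p)"
    by (rule solution_energy[where u = "\<lambda>t. u t - v t", OF _ t])
      (auto simp: linear_diff[OF linA] intro!: has_vector_derivative_diff u v)
  then have "B (u t - v t) (u t - v t) \<le> 0" using eq by (simp add: bounded_bilinear.zero_left[OF B])
  then show ?thesis using B_pos[of "u t - v t"] by force
qed

text \<open>The integral along the flow is a continuous quadratic function of the initial state and
  positive on the unit sphere by observability, so compactness bounds it below. Since
  \<open>A\<close> is autonomous, the constant does not depend on the starting time
  \<open>p\<close>.\<close>

lemma gramian_bound: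
  assumes \<tau>: "0 < \<tau>"
  shows "\<exists>C>0. \<forall>p u. (\<forall>t\<in>{p..p+\<tau>}. (u has_vector_derivative A (u t)) (at t within {p..p+\<tau>})) \<longrightarrow>
     B (u p) (u p) \<le> C * integral {p..p+\<tau>} (\<lambda>t. diss_rate (u t) + (F (u t))\<^sup>2)"
proof -
  obtain \<Phi> where \<Phi>0: "\<And>x. \<Phi> 0 x = x" and \<Phi>lin: "\<And>t. linear (\<Phi> t)"
    and \<Phi>der: "\<And>x t. t \<ge> 0 \<Longrightarrow> ((\<lambda>t. \<Phi> t x) has_vector_derivative A (\<Phi> t x)) (at t within {0..})"
    and \<Phi>cont: "continuous_on (UNIV \<times> {0..}) (\<lambda>(x, t). \<Phi> t x)"
    using flow_exists by blast
  define g where "g x = diss_rate x + (F x)\<^sup>2" for x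
  have g0: "0 \<le> g x" for x unfolding g_def using diss_rate_nonneg[of x] by simp
  have g_cont: "continuous_on UNIV g" unfolding g_def diss_rate_def
    by (intro continuous_intros bounded_bilinear.continuous_on[OF B] bounded_linear.continuous_on[OF bounded_linear_A]
        bounded_linear.continuous_on[OF bounded_linear_F])
  have g_scale: "g (c *\<^sub>R x) = c\<^sup>2 * g x" for c x
    unfolding g_def diss_rate_def
    by (simp add: B_simps linear_scale[OF linA] linear_scale[OF linF] algebra_simps power2_eq_square)
  have gx_cont: "continuous_on {0..\<tau>} (\<lambda>t. g (\<Phi> t x))" for x
  proof -
    have "continuous_on {0..\<tau>} (\<lambda>t. \<Phi> t x)"
      using continuous_on_compose2[OF \<Phi>cont, of "{0..\<tau>}" "\<lambda>t. (x, t)"] by (fastforce simp: continuous_on_Pair_const)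
    then show ?thesis by (rule continuous_on_compose2[OF g_cont]) auto
  qed
  define W where "W x = integral {0..\<tau>} (\<lambda>t. g (\<Phi> t x))" for x
  have W_cont: "continuous_on UNIV W"
    unfolding W_def cbox_interval[symmetric]
  proof (rule integral_continuous_on_param)
    have "continuous_on (UNIV \<times> cbox 0 \<tau>) (\<lambda>z. g (case z of (x, t) \<Rightarrow> \<Phi> t x))"
      by (rule continuous_on_compose2[OF g_cont continuous_on_subset[OF \<Phi>cont]]) auto
    then show "continuous_on (UNIV \<times> cbox 0 \<tau>) (\<lambda>(x, t). g (\<Phi> t x))" by (simp add: case_prod_beta)
  qed
  have \<Phi>der': "((\<lambda>t. \<Phi> t x) has_vector_derivative A (\<Phi> t x)) (at t within {0..\<tau>})" if "t \<in> {0..\<tau>}" for x t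
    by (rule has_vector_derivative_within_subset[OF \<Phi>der]) (use that in auto)
  have W_pos: "0 < W x" if x: "x \<noteq> 0" for x
  proof (rule ccontr)
    assume "\<not> 0 < W x"
    moreover have "0 \<le> W x" unfolding W_def by (intro integral_nonneg integrable_continuous_interval gx_cont g0)
    ultimately have W0: "W x = 0" by simp
    have gz: "g (\<Phi> t x) = 0" if "t \<in> {0..\<tau>}" for t
      using integral_eq_0_iff[OF gx_cont[of x]] g0 \<tau> W0 that unfolding W_def by auto
    have rz: "diss_rate (\<Phi> t x) = 0" "F (\<Phi> t x) = 0" if "t \<in> {0..\<tau>}" for t
      using gz[OF that] diss_rate_nonneg[of "\<Phi> t x"] unfolding g_def
      by (smt (verit) zero_le_power2 zero_eq_power2)+
    obtain Kd where Kd: "\<And>x. diss_rate x \<le> Kd * B x x" using diss_rate_bound by blast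
    define R where "R z = {y. diss_rate y = 0 \<and> F y = 0}" for z :: 'a
    \<comment> \<open>The two outputs vanish along the flow and are differentiated repeatedly. The
      interval is open so that derivatives are two-sided.\<close>
    have "\<forall>t\<in>{0<..<\<tau>}. diss_rate ((A ^^ k) (\<Phi> t x)) = 0 \<and> F ((A ^^ k) (\<Phi> t x)) = 0" for k
    proof (induction k)
      case 0 then show ?case using rz by auto
    next
      case (Suc k)
      show ?case
      proof
        fix t assume t: "t \<in> {0<..<\<tau>}"
        define y where "y s = (A ^^ k) (\<Phi> s x)" for s
        have linAk: "linear (A ^^ k)"
        proof (induction k)
          case 0 show ?case using linear_id by (simp add: id_def)
        next
          case (Suc k) show ?case unfolding funpow.simps by (rule linear_compose[OF Suc linA])
        qed
        have "((\<lambda>s. \<Phi> s x) has_vector_derivative A (\<Phi> t x)) (at t)"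
          by (rule has_vector_derivative_interior_interval[OF \<Phi>der']) (use t in auto)
        from bounded_linear.has_vector_derivative[OF linear_conv_bounded_linear[THEN iffD1, OF linAk] this]
        have y': "(y has_vector_derivative A (y t)) (at t)"
          unfolding y_def by (simp add: funpow_swap1)
        have zero_deriv: "l (A (y t)) = 0" if l: "bounded_linear l" and lz: "\<And>s. s \<in> {0<..<\<tau>} \<Longrightarrow> l (y s) = 0"
          for l :: "'a \<Rightarrow> real"
        proof -
          have "((\<lambda>s. l (y s)) has_vector_derivative l (A (y t))) (at t)"
            by (rule bounded_linear.has_vector_derivative[OF l y'])
          moreover have "((\<lambda>s. l (y s)) has_vector_derivative 0) (at t)"
            by (rule has_vector_derivative_transform_within_open[of "\<lambda>_. 0" _ _ "{0<..<\<tau>}"]) (use t lz in auto)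
          ultimately show ?thesis by (rule vector_derivative_unique_at)
        qed
        have F0: "F (A (y t)) = 0" by (rule zero_deriv[OF bounded_linear_F]) (use Suc in \<open>auto simp: y_def\<close>)
        text \<open>A semidefinite form that vanishes at \<open>y\<close> has \<open>y\<close> in its radical.\<close>
        have rad: "B z (A y') + B y' (A z) = 0" if "diss_rate y' = 0" for y' z
        proof -
          define b where "b = B z (A y') + B y' (A z)"
          have "0 \<le> diss_rate (z + h *\<^sub>R y')" for h by (rule diss_rate_nonneg)
          then have "0 \<le> diss_rate z - 2 * h * b" for h
            using that unfolding b_def diss_rate_def
            by (simp add: B_simps linear_add[OF linA] linear_scale[OF linA] algebra_simps)
          \<comment> \<open>This value of \<open>h\<close> makes the right-hand side equal to -1
            unless \<open>b = 0\<close>.\<close>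
          from this[of "(diss_rate z + 1) / (2 * b)"] have "b = 0" by (cases "b = 0") simp_all
          then show ?thesis unfolding b_def .
        qed
        \<comment> \<open>For fixed \<open>z\<close> the functional
          \<open>B z (A y) + B y (A z)\<close> is linear in \<open>y\<close> and vanishes along the
          trajectory, hence also on its derivative \<open>A (y t)\<close>. Taking
          \<open>z = A (y t)\<close> gives the next dissipation rate.\<close>
        have "B z (A (A (y t))) + B (A (y t)) (A z) = 0" for z
          by (rule zero_deriv[of "\<lambda>y. B z (A y) + B y (A z)"])
            (use Suc rad in \<open>auto simp: y_def intro!: bounded_linear_add bounded_linear_compose[OF bounded_bilinear.bounded_linear_right[OF B] bounded_linear_A]
               bounded_bilinear.bounded_linear_left[OF B]\<close>)
        from this[of "A (y t)"] have "diss_rate (A (y t)) = 0" unfolding diss_rate_def by simp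
        with F0 show "diss_rate ((A ^^ Suc k) (\<Phi> t x)) = 0 \<and> F ((A ^^ Suc k) (\<Phi> t x)) = 0"
          unfolding y_def by simp
      qed
    qed
    \<comment> \<open>Any interior time would do. The energy does not decrease on the way there
      because the dissipation rate is 0, so the initial state vanishes as well.\<close>
    then have "\<Phi> (\<tau>/2) x = 0"
      using \<tau> by (intro observable) (auto simp: diss_rate_def)
    moreover have "B (\<Phi> 0 x) (\<Phi> 0 x) \<le> B (\<Phi> (\<tau>/2) x) (\<Phi> (\<tau>/2) x)"
    proof -
      have "- B (\<Phi> (\<tau>/2) x) (\<Phi> (\<tau>/2) x) \<le> - B (\<Phi> 0 x) (\<Phi> 0 x)"
      proof (rule pw_antimono[where D = "{}" and w = "\<lambda>t. - B (\<Phi> t x) (\<Phi> t x)" and w' = "\<lambda>t. diss_rate (\<Phi> t x)"])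
        have "continuous_on {0..\<tau>/2} (\<lambda>t. \<Phi> t x)"
          using continuous_on_compose2[OF \<Phi>cont, of "{0..\<tau>/2}" "\<lambda>t. (x, t)"] by (fastforce simp: continuous_on_Pair_const)
        then show "continuous_on {0..\<tau>/2} (\<lambda>t. - B (\<Phi> t x) (\<Phi> t x))"
          by (intro continuous_intros bounded_bilinear.continuous_on[OF B])
        fix s assume s: "0 < s" "s < \<tau>/2"
        then have sT: "s \<in> {0..\<tau>}" by auto
        have "((\<lambda>t. \<Phi> t x) has_vector_derivative A (\<Phi> s x)) (at s)"
          by (rule has_vector_derivative_interior_interval[OF \<Phi>der'[OF sT]]) (use s in auto)
        from has_vector_derivative_minus[OF bounded_bilinear_quadratic_derivative[OF B B_sym this]]
        show "((\<lambda>t. - B (\<Phi> t x) (\<Phi> t x)) has_vector_derivative diss_rate (\<Phi> s x)) (at s)"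
          unfolding diss_rate_def by simp
        show "diss_rate (\<Phi> s x) \<le> 0" using rz(1)[OF sT] by simp
      qed (use \<tau> in auto)
      then show ?thesis by simp
    qed
    ultimately have "B x x \<le> 0" by (simp add: \<Phi>0 bounded_bilinear.zero_left[OF B])
    then show False using B_pos[OF x] by simp
  qed
  have W_scale: "W (c *\<^sub>R x) = c\<^sup>2 * W x" for c x
    unfolding W_def by (simp add: linear_scale[OF \<Phi>lin] g_scale)
  have "sphere (0::'a) 1 \<noteq> {}" by simp
  from continuous_attains_inf[OF compact_sphere this continuous_on_subset[OF W_cont]] obtain x0 where
    x0: "norm x0 = 1" and min: "\<And>y. norm y = 1 \<Longrightarrow> W x0 \<le> W y" by auto
  have w0: "0 < W x0" by (rule W_pos) (use x0 in auto)
  have W_low: "W x0 * (norm x)\<^sup>2 \<le> W x" for x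
  proof (cases "x = 0")
    case True
    have "W 0 = 0" using W_scale[of 0 0] by simp
    then show ?thesis using True by simp
  next
    case False
    have "W x0 \<le> W (x /\<^sub>R norm x)" by (rule min) (use False in simp)
    then show ?thesis using False by (simp add: W_scale field_simps)
  qed
  obtain K where K: "K \<ge> 0" "\<And>x y. norm (B x y) \<le> norm x * norm y * K"
    using bounded_bilinear.nonneg_bounded[OF B] by auto
  define C where "C = (K + 1) / W x0"
  have C: "C > 0" unfolding C_def using K w0 by simp
  have BW: "B x x \<le> C * W x" for x
  proof -
    have "B x x \<le> K * (norm x)\<^sup>2" using K(2)[of x x] by (simp add: power2_eq_square mult_ac)
    also have "\<dots> \<le> (K + 1) * (norm x)\<^sup>2" by (intro mult_right_mono) auto
    also have "\<dots> = C * (W x0 * (norm x)\<^sup>2)" unfolding C_def using w0 by simp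
    also have "\<dots> \<le> C * W x" using C W_low by (intro mult_left_mono) auto
    finally show ?thesis .
  qed
  show ?thesis
  proof (intro exI[of _ C] conjI C allI impI)
    fix p u assume u: "\<forall>t\<in>{p..p+\<tau>}. (u has_vector_derivative A (u t)) (at t within {p..p+\<tau>})"
    have shifted: "u (t + p) = \<Phi> t (u p)" if t: "t \<in> {0..\<tau>}" for t
    proof (rule solution_unique[of 0 \<tau> "\<lambda>t. u (t + p)" "\<lambda>t. \<Phi> t (u p)", OF _ \<Phi>der' _ t])
      fix s assume s: "s \<in> {0..\<tau>}"
      have im: "(\<lambda>t. t + p) ` {0..\<tau>} = {p..p+\<tau>}"
        by (simp add: image_add_atLeastAtMost' add.commute)
      have "(u has_vector_derivative A (u (s + p))) (at (s + p) within (\<lambda>t. t + p) ` {0..\<tau>})"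
        using u s unfolding im by auto
      moreover have "((\<lambda>t. t + p) has_vector_derivative 1) (at s within {0..\<tau>})"
        by (auto intro!: derivative_eq_intros)
      ultimately show "((\<lambda>t. u (t + p)) has_vector_derivative A (u (s + p))) (at s within {0..\<tau>})"
        using vector_diff_chain_within[of "\<lambda>t. t + p" 1 s "{0..\<tau>}" u] by (simp add: o_def)
    qed (simp_all add: \<Phi>0)
    have "integral {p..p+\<tau>} (\<lambda>t. g (u t)) = integral {0..\<tau>} (\<lambda>t. g (u (t + p)))"
      using integral_shift_Icc_real[of 0 \<tau> "\<lambda>t. g (u t)" p] by (simp add: o_def add.commute)
    also have "\<dots> = W (u p)" unfolding W_def by (rule integral_cong) (simp add: shifted)
    finally show "B (u p) (u p) \<le> C * integral {p..p+\<tau>} (\<lambda>t. diss_rate (u t) + (F (u t))\<^sup>2)"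
      using BW[of "u p"] unfolding g_def by simp
  qed
qed

end


subsection \<open>Consensus over jointly connected graphs\<close>


lemma sum_option_neighbors:
  fixes f :: "'N::finite option \<Rightarrow> real"
  shows "(\<Sum>j\<in>neighbors E i. f j) = (if (None, i) \<in> E then f None else 0) +
    (\<Sum>j\<in>UNIV. if (Some j, i) \<in> E then f (Some j) else 0)"
proof -
  have "(\<Sum>j\<in>neighbors E i. f j) = (\<Sum>j\<in>UNIV. if (j, i) \<in> E then f j else 0)"
    unfolding neighbors_def by (simp add: sum.inter_filter[symmetric])
  also have "\<dots> = (\<Sum>j\<in>insert None (range Some). if (j, i) \<in> E then f j else 0)"
    by (simp add: UNIV_option_conv)
  also have "\<dots> = (if (None, i) \<in> E then f None else 0) + (\<Sum>j\<in>range Some. if (j, i) \<in> E then f j else 0)"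
    by (subst sum.insert) auto
  also have "(\<Sum>j\<in>range Some. if (j, i) \<in> E then f j else 0) = (\<Sum>j\<in>UNIV. if (Some j, i) \<in> E then f (Some j) else 0)"
    by (subst sum.reindex) auto
  finally show ?thesis .
qed

text \<open>\<open>2 (a - b) b = - (a - b)^2 + a^2 - b^2\<close>. The differences of squares are
  antisymmetric in the two ends and cancel over the undirected follower edges; an edge from the
  leader leaves minus a square because \<xi> is 0 there.\<close>

lemma symmetric_coupling:
  fixes \<xi> :: "'N::finite option \<Rightarrow> real"
  assumes sym: "sym (follower_subgraph E)" and \<xi>0: "\<xi> None = 0"
  shows "(\<Sum>i\<in>UNIV. \<Sum>j\<in>neighbors E (Some i). 2 * (\<xi> j - \<xi> (Some i)) * \<xi> (Some i))
    \<le> - (\<Sum>i\<in>UNIV. \<Sum>j\<in>neighbors E (Some i). (\<xi> j - \<xi> (Some i))\<^sup>2)"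
proof -
  define h where "h i j = (if (Some j, Some i) \<in> E then (\<xi> (Some j))\<^sup>2 - (\<xi> (Some i))\<^sup>2 else 0)" for i j
  have anti: "h j i = - h i j" for i j
    using sym unfolding h_def follower_subgraph_def sym_def by auto
  have "(\<Sum>i\<in>UNIV. \<Sum>j\<in>UNIV. h i j) = (\<Sum>i\<in>UNIV. \<Sum>j\<in>UNIV. h j i)" by (rule sum.swap)
  also have "\<dots> = - (\<Sum>i\<in>UNIV. \<Sum>j\<in>UNIV. h i j)" unfolding sum_negf[symmetric] by (intro sum.cong refl anti)
  finally have h0: "(\<Sum>i\<in>UNIV. \<Sum>j\<in>UNIV. h i j) = 0" by simp
  have "(\<Sum>i\<in>UNIV. \<Sum>j\<in>neighbors E (Some i). 2 * (\<xi> j - \<xi> (Some i)) * \<xi> (Some i))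
     + (\<Sum>i\<in>UNIV. \<Sum>j\<in>neighbors E (Some i). (\<xi> j - \<xi> (Some i))\<^sup>2)
     = (\<Sum>i\<in>UNIV. \<Sum>j\<in>neighbors E (Some i). (\<xi> j)\<^sup>2 - (\<xi> (Some i))\<^sup>2)"
    unfolding sum.distrib[symmetric] by (intro sum.cong refl) (simp add: algebra_simps power2_eq_square)
  also have "\<dots> = (\<Sum>i\<in>UNIV. (if (None, Some i) \<in> E then - (\<xi> (Some i))\<^sup>2 else 0) + (\<Sum>j\<in>UNIV. h i j))"
    by (rule sum.cong[OF refl]) (simp add: sum_option_neighbors \<xi>0 h_def if_distrib cong: if_cong)
  also have "\<dots> = (\<Sum>i\<in>UNIV. if (None, Some i) \<in> E then - (\<xi> (Some i))\<^sup>2 else 0)"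
    by (simp add: sum.distrib h0)
  also have "\<dots> \<le> 0" by (rule sum_nonpos) auto
  finally show ?thesis by simp
qed

lemma sum_power2_le_card:
  fixes f :: "'b \<Rightarrow> real"
  shows "(\<Sum>i\<in>I. f i)\<^sup>2 \<le> real (card I) * (\<Sum>i\<in>I. (f i)\<^sup>2)"
  using Cauchy_Schwarz_ineq_sum[of "\<lambda>_. 1" f I] by simp

section \<open>Energy of the consensus error\<close>

context dissipative_pair
begin

text \<open>The dynamics of the errors relative to the leader, which is why node \<open>None\<close>
  is held at 0. The initial time is arbitrary because exponential stability has to be uniform in
  it.\<close>

definition consensus ::
    "real set \<Rightarrow> (real \<Rightarrow> ('N option \<times> 'N option) set) \<Rightarrow> real \<Rightarrow> ('N::finite option \<Rightarrow> real \<Rightarrow> 'a) \<Rightarrow> bool" where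
  "consensus D G t0 W \<longleftrightarrow> (\<forall>t. W None t = 0) \<and>
     (\<forall>i. pw_derivative D t0 (W (Some i))
        (\<lambda>t. A (W (Some i) t) + (\<Sum>j\<in>neighbors (G t) (Some i). F (W j t) - F (W (Some i) t)) *\<^sub>R L))"

definition energy :: "('N::finite option \<Rightarrow> real \<Rightarrow> 'a) \<Rightarrow> real \<Rightarrow> real" where
  "energy W t = (\<Sum>i\<in>UNIV. B (W (Some i) t) (W (Some i) t))"

text \<open>A lower bound for the rate at which \<open>energy\<close> decreases.\<close>

definition decay :: "('N::finite option \<times> 'N option) set \<Rightarrow> ('N option \<Rightarrow> real \<Rightarrow> 'a) \<Rightarrow> real \<Rightarrow> real" where
  "decay E W t = (\<Sum>i\<in>UNIV. diss_rate (W (Some i) t)) +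
     (\<Sum>i\<in>UNIV. \<Sum>j\<in>neighbors E (Some i). (F (W j t) - F (W (Some i) t))\<^sup>2)"

lemma energy_nonneg: "0 \<le> energy W t"
  unfolding energy_def by (intro sum_nonneg B_nonneg)

lemma decay_nonneg: "0 \<le> decay E W t"
  unfolding decay_def by (intro add_nonneg_nonneg sum_nonneg diss_rate_nonneg) auto

lemma decay_ge:
  shows "diss_rate (W (Some i) t) \<le> decay E W t"
    and "(j, Some i) \<in> E \<Longrightarrow> (F (W j t) - F (W (Some i) t))\<^sup>2 \<le> decay E W t"
    and "(\<Sum>i\<in>UNIV. \<Sum>j\<in>neighbors E (Some i). (F (W j t) - F (W (Some i) t))\<^sup>2) \<le> decay E W t"
proof -
  let ?s1 = "\<Sum>i\<in>UNIV. diss_rate (W (Some i) t)"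
  let ?g = "\<lambda>i. \<Sum>j\<in>neighbors E (Some i). (F (W j t) - F (W (Some i) t))\<^sup>2"
  have 1: "0 \<le> ?s1" by (intro sum_nonneg diss_rate_nonneg)
  have g0: "0 \<le> ?g i" for i by (intro sum_nonneg) auto
  have 2: "0 \<le> (\<Sum>i\<in>UNIV. ?g i)" by (intro sum_nonneg g0)
  have "diss_rate (W (Some i) t) \<le> ?s1"
    by (rule member_le_sum) (auto simp: diss_rate_nonneg)
  then show "diss_rate (W (Some i) t) \<le> decay E W t" unfolding decay_def using 2 by linarith
  show 3: "(\<Sum>i\<in>UNIV. ?g i) \<le> decay E W t" unfolding decay_def using 1 by linarith
  assume "(j, Some i) \<in> E"
  then have "(F (W j t) - F (W (Some i) t))\<^sup>2 \<le> ?g i"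
    by (intro member_le_sum[of j _ "\<lambda>j. (F (W j t) - F (W (Some i) t))\<^sup>2"]) (auto simp: neighbors_def)
  also have "?g i \<le> (\<Sum>i\<in>UNIV. ?g i)" by (rule member_le_sum) (auto simp: g0)
  finally show "(F (W j t) - F (W (Some i) t))\<^sup>2 \<le> decay E W t" using 3 by linarith
qed

lemma consensus_continuous: "consensus D G t0 W \<Longrightarrow> continuous_on {t0..} (W j)"
  unfolding consensus_def pw_derivative_def by (cases j) (auto simp: fun_eq_iff[of "W None"] cong: continuous_on_cong)

lemma energy_continuous: "consensus D G t0 W \<Longrightarrow> continuous_on {t0..} (energy W)"
  unfolding energy_def[abs_def]
  by (intro continuous_intros bounded_bilinear.continuous_on[OF B] consensus_continuous)

text \<open>The gain identity \<open>B L x = F x\<close> turns the injected coupling into a product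
  of scalar outputs, so the coupling acts like the scalar consensus of
  \<open>symmetric_coupling\<close>.\<close>

lemma energy_derivative:
  assumes W: "consensus D G t0 W" and t: "t0 < t" "t \<notin> D" and sym: "sym (follower_subgraph (G t))"
  obtains e where "(energy W has_vector_derivative e) (at t)" "e \<le> - decay (G t) W t"
proof
  define c where "c i = (\<Sum>j\<in>neighbors (G t) (Some i). F (W j t) - F (W (Some i) t))" for i
  let ?e = "\<Sum>i\<in>UNIV. 2 * B (W (Some i) t) (A (W (Some i) t) + c i *\<^sub>R L)"
  show "(energy W has_vector_derivative ?e) (at t)"
    unfolding energy_def[abs_def] c_def
    by (intro has_vector_derivative_sum bounded_bilinear_quadratic_derivative[OF B B_sym])
      (use W t in \<open>auto simp: consensus_def pw_derivative_def\<close>)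
  have "?e = (\<Sum>i\<in>UNIV. - diss_rate (W (Some i) t)) + (\<Sum>i\<in>UNIV. 2 * (c i * F (W (Some i) t)))"
    unfolding sum.distrib[symmetric]
  proof (rule sum.cong[OF refl])
    fix i
    have "B (W (Some i) t) L = F (W (Some i) t)" using gain[of "W (Some i) t"] B_sym[of "W (Some i) t" L] by linarith
    then show "2 * B (W (Some i) t) (A (W (Some i) t) + c i *\<^sub>R L)
        = - diss_rate (W (Some i) t) + 2 * (c i * F (W (Some i) t))"
      unfolding diss_rate_def by (simp add: B_simps)
  qed
  also have "(\<Sum>i\<in>UNIV. 2 * (c i * F (W (Some i) t))) =
      (\<Sum>i\<in>UNIV. \<Sum>j\<in>neighbors (G t) (Some i). 2 * (F (W j t) - F (W (Some i) t)) * F (W (Some i) t))"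
    unfolding c_def sum_distrib_left sum_distrib_right
    by (intro sum.cong refl) (simp add: algebra_simps)
  also have "\<dots> \<le> - (\<Sum>i\<in>UNIV. \<Sum>j\<in>neighbors (G t) (Some i). (F (W j t) - F (W (Some i) t))\<^sup>2)"
    using symmetric_coupling[OF sym, of "\<lambda>j. F (W j t)"] W linear_0[OF linF] unfolding consensus_def by simp
  finally show "?e \<le> - decay (G t) W t" unfolding decay_def by (simp add: sum_negf)
qed

lemma energy_antimono:
  assumes W: "consensus D G t0 W" and D: "\<And>a b. finite (D \<inter> {a..b})"
    and sym: "\<And>t. t0 \<le> t \<Longrightarrow> sym (follower_subgraph (G t))" and ab: "t0 \<le> a" "a \<le> b"
  shows "energy W b \<le> energy W a"
proof -
  have "\<exists>e. t0 < t \<and> t \<notin> D \<longrightarrow> (energy W has_vector_derivative e) (at t) \<and> e \<le> - decay (G t) W t" for t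
    using energy_derivative[OF W, of t] sym[of t] by (metis less_imp_le)
  then obtain e where e: "\<And>t. t0 < t \<Longrightarrow> t \<notin> D \<Longrightarrow> (energy W has_vector_derivative e t) (at t)"
    "\<And>t. t0 < t \<Longrightarrow> t \<notin> D \<Longrightarrow> e t \<le> - decay (G t) W t" by metis
  show ?thesis
  proof (rule pw_antimono[OF D ab(2), where w = "energy W" and w' = e])
    show "continuous_on {a..b} (energy W)"
      by (rule continuous_on_subset[OF energy_continuous[OF W]]) (use ab in auto)
    fix t assume t: "a < t" "t < b" "t \<notin> D"
    show "(energy W has_vector_derivative e t) (at t)" by (rule e) (use t ab in auto)
    have "e t \<le> - decay (G t) W t" by (rule e) (use t ab in auto)
    then show "e t \<le> 0" using decay_nonneg[of "G t" W t] by linarith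
  qed
qed

text \<open>Over a window in which every edge of a graph rooted at the leader is active for a time \<open>\<tau>\<close>, the
  energy drops by a fixed fraction.  The solution is compared with the uncoupled flow started at the
  beginning of the window: the two differ by at most the energy drop \<open>\<delta>\<close>, so along each edge the output
  of the difference of two uncoupled solutions is of order \<open>\<delta>\<close>, and the Gramian bound turns this
  into a bound on the difference of the states.\<close>

lemma window_decay_exists:
  assumes \<tau>: "0 < \<tau>" and \<nu>: "0 < \<nu>"
  shows "\<exists>C>1. \<forall>D G t0 a b E (W :: 'N::finite option \<Rightarrow> real \<Rightarrow> 'a).
     consensus D G t0 W \<longrightarrow> (\<forall>a b. finite (D \<inter> {a..b})) \<longrightarrow> (\<forall>t\<ge>t0. sym (follower_subgraph (G t))) \<longrightarrow>
     t0 \<le> a \<longrightarrow> a \<le> b \<longrightarrow> b - a \<le> \<nu> \<longrightarrow> (\<forall>i. (None, i) \<in> E\<^sup>*) \<longrightarrow>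
     (\<forall>(j, i)\<in>E. i \<noteq> None \<and> (\<exists>p. a \<le> p \<and> p + \<tau> \<le> b \<and> (\<forall>t\<in>{p<..<p+\<tau>}. (j, i) \<in> G t))) \<longrightarrow>
     energy W a \<le> C * (energy W a - energy W b)"
proof -
  obtain \<Phi> where \<Phi>0: "\<And>x. \<Phi> 0 x = x" and \<Phi>lin: "\<And>t. linear (\<Phi> t)"
    and \<Phi>der: "\<And>x t. t \<ge> 0 \<Longrightarrow> ((\<lambda>t. \<Phi> t x) has_vector_derivative A (\<Phi> t x)) (at t within {0..})"
    using flow_exists by blast
  obtain Cg where Cg: "Cg > 0" "\<And>p u. (\<forall>t\<in>{p..p+\<tau>}. (u has_vector_derivative A (u t)) (at t within {p..p+\<tau>})) \<Longrightarrow>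
     B (u p) (u p) \<le> Cg * integral {p..p+\<tau>} (\<lambda>t. diss_rate (u t) + (F (u t))\<^sup>2)"
    using gramian_bound[OF \<tau>] by blast
  obtain Kr where Kr: "Kr \<ge> 0" "\<And>x. diss_rate x \<le> Kr * B x x" using diss_rate_bound by blast
  obtain KF where KF: "KF \<ge> 0" "\<And>x. (F x)\<^sup>2 \<le> KF * B x x" using F_bound by blast
  define n where "n = CARD('N option)"
  \<comment> \<open>\<open>K1\<close> bounds the coupling input by \<open>decay\<close>,
    \<open>K2\<close> the distance to the uncoupled flow after the exponential growth over a window,
    \<open>K3\<close> the effect of this distance on the Gramian integrand, and \<open>K4\<close>
    the energy difference across one edge, each in multiples of the energy drop. \<open>C\<close>
    adds up a bound for paths of at most \<open>n * n\<close> edges over all followers.\<close>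
  define K1 where "K1 = real n * B L L"
  define K2 where "K2 = exp \<nu> * K1"
  define K3 where "K3 = 8 * (Kr + KF) * K2"
  define K4 where "K4 = Cg * (10 + K3 * \<tau>) + 8 + 8 * Kr * K2 * \<nu>"
  define C where "C = 2 + real CARD('N) * (4 ^ (n * n) * K4)"
  have K1: "K1 \<ge> 0" unfolding K1_def using B_nonneg by simp
  have K2: "K2 \<ge> 0" unfolding K2_def using K1 by simp
  have K3: "K3 \<ge> 0" unfolding K3_def using K2 Kr KF by simp
  have K4: "K4 \<ge> 0" unfolding K4_def using Cg K2 K3 Kr \<tau> \<nu> by (intro add_nonneg_nonneg mult_nonneg_nonneg) auto
  have C: "C > 1" unfolding C_def using K4 by (simp add: add_pos_nonneg)
  have main: "energy W a \<le> C * (energy W a - energy W b)"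
    if W: "consensus D G t0 W" and D: "\<And>a b. finite (D \<inter> {a..b})"
      and sym: "\<And>t. t0 \<le> t \<Longrightarrow> sym (follower_subgraph (G t))"
      and ab: "t0 \<le> a" "a \<le> b" "b - a \<le> \<nu>" and root: "\<And>i. (None, i) \<in> E\<^sup>*"
      and E: "\<And>j i. (j, i) \<in> E \<Longrightarrow> i \<noteq> None \<and> (\<exists>p. a \<le> p \<and> p + \<tau> \<le> b \<and> (\<forall>t\<in>{p<..<p+\<tau>}. (j, i) \<in> G t))"
    for D G t0 a b E and W :: "'N option \<Rightarrow> real \<Rightarrow> 'a"
  proof -
    define V where "V = energy W"
    define \<delta> where "\<delta> = V a - V b"
    have Vmono: "V t \<le> V s" if "a \<le> s" "s \<le> t" for s t
      unfolding V_def by (rule energy_antimono[OF W D sym]) (use that ab in auto)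
    have \<delta>0: "\<delta> \<ge> 0" unfolding \<delta>_def using Vmono[of a b] ab by simp
    have "\<exists>e. t0 < t \<and> t \<notin> D \<longrightarrow> (V has_vector_derivative e) (at t) \<and> e \<le> - decay (G t) W t" for t
      unfolding V_def using energy_derivative[OF W, of t] sym[of t] by (metis less_imp_le)
    then obtain V' where V': "\<And>t. t0 < t \<Longrightarrow> t \<notin> D \<Longrightarrow> (V has_vector_derivative V' t) (at t)"
      "\<And>t. t0 < t \<Longrightarrow> t \<notin> D \<Longrightarrow> V' t \<le> - decay (G t) W t" by metis
    have Vcont: "continuous_on {p..q} V" if "a \<le> p" for p q
      unfolding V_def by (rule continuous_on_subset[OF energy_continuous[OF W]]) (use that ab in auto)
    have Wcont: "continuous_on {p..q} (W j)" if "a \<le> p" for j p q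
      by (rule continuous_on_subset[OF consensus_continuous[OF W]]) (use that ab in auto)
    have W0: "W None t = 0" for t using W unfolding consensus_def by auto
    define z where "z j t = \<Phi> (t - a) (W j a)" for j t
    have z0: "z None t = 0" for t unfolding z_def W0 by (rule linear_0[OF \<Phi>lin])
    have z_der: "(z j has_vector_derivative A (z j t)) (at t within {a..})" if "t \<ge> a" for j t
    proof -
      have "((\<lambda>t. \<Phi> t (W j a)) has_vector_derivative A (z j t)) (at (t - a) within (\<lambda>t. t - a) ` {a..})"
        unfolding z_def by (rule has_vector_derivative_within_subset[OF \<Phi>der]) (use that in auto)
      moreover have "((\<lambda>t. t - a) has_vector_derivative 1) (at t within {a..})"
        by (auto intro!: derivative_eq_intros)
      ultimately show ?thesis
        using vector_diff_chain_within[of "\<lambda>t. t - a" 1 t "{a..}" "\<lambda>t. \<Phi> t (W j a)"]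
        unfolding z_def[abs_def] by (simp add: o_def)
    qed
    have z_at: "(z j has_vector_derivative A (z j t)) (at t)" if "t > a" for j t
    proof -
      have "at t within {a..} = at t" by (rule at_within_nhd[of t "{a<..}", THEN trans]) (use that in auto)
      then show ?thesis using z_der[of t j] that by simp
    qed
    have z_cont: "continuous_on {p..q} (z j)" if "a \<le> p" for j p q
    proof -
      have "continuous_on {a..} (z j)" by (rule continuous_on_vector_derivative) (use z_der in auto)
      then show ?thesis by (rule continuous_on_subset) (use that in auto)
    qed
    define e where "e j t = W j t - z j t" for j t
    have e0: "e None t = 0" for t unfolding e_def by (simp add: W0 z0)
    have ea: "e j a = 0" for j unfolding e_def z_def by (simp add: \<Phi>0)
    have e_cont: "continuous_on {p..q} (e j)" if "a \<le> p" for j p q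
      unfolding e_def[abs_def] by (intro continuous_intros Wcont z_cont that)
    define \<epsilon> where "\<epsilon> t = energy e t" for t
    have \<epsilon>_ge: "B (e j t) (e j t) \<le> \<epsilon> t" for j t
    proof (cases j)
      case None then show ?thesis using energy_nonneg[of e t]
        by (simp add: \<epsilon>_def e0 bounded_bilinear.zero_left[OF B])
    next
      case (Some i) then show ?thesis unfolding \<epsilon>_def energy_def
        by (simp add: member_le_sum[of i UNIV "\<lambda>i. B (e (Some i) t) (e (Some i) t)"] B_nonneg)
    qed
    have \<epsilon>_bound: "\<epsilon> t \<le> K2 * \<delta>" if t: "t \<in> {a..b}" for t
    proof -
      define c where "c i t = (\<Sum>j\<in>neighbors (G t) (Some i). F (W j t) - F (W (Some i) t))" for i t
      define \<epsilon>' where "\<epsilon>' t = (\<Sum>i\<in>UNIV. 2 * B (e (Some i) t) (A (e (Some i) t) + c i t *\<^sub>R L))" for t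
      \<comment> \<open>Instead of integrating \<open>decay\<close>, a multiple of the energy is
        added: its decrease pays for the coupling input that drives the error
        \<open>e\<close>.\<close>
      have "exp (- (t - a)) * \<epsilon> t + K1 * V t \<le> exp (- (a - a)) * \<epsilon> a + K1 * V a"
      proof (rule pw_antimono[OF D, where w = "\<lambda>t. exp (- (t - a)) * \<epsilon> t + K1 * V t"
          and w' = "\<lambda>t. exp (- (t - a)) * (\<epsilon>' t - \<epsilon> t) + K1 * V' t"])
        show "a \<le> t" using t by simp
        show "continuous_on {a..t} (\<lambda>t. exp (- (t - a)) * \<epsilon> t + K1 * V t)"
          unfolding \<epsilon>_def energy_def
          by (intro continuous_intros bounded_bilinear.continuous_on[OF B] e_cont Vcont) auto
        fix s assume s: "a < s" "s < t" "s \<notin> D"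
        have t0s: "t0 < s" using s ab by simp
        have e_der: "(e (Some i) has_vector_derivative A (e (Some i) s) + c i s *\<^sub>R L) (at s)" for i
        proof -
          have "(W (Some i) has_vector_derivative A (W (Some i) s) + c i s *\<^sub>R L) (at s)"
            using W t0s s(3) unfolding consensus_def pw_derivative_def c_def by auto
          from has_vector_derivative_diff[OF this z_at[OF s(1), of "Some i"]]
          show ?thesis unfolding e_def[abs_def] by (simp add: linear_diff[OF linA] algebra_simps)
        qed
        have \<epsilon>der: "(\<epsilon> has_vector_derivative \<epsilon>' s) (at s)"
          unfolding \<epsilon>_def[abs_def] \<epsilon>'_def energy_def
          by (intro has_vector_derivative_sum bounded_bilinear_quadratic_derivative[OF B B_sym] e_der)
        then have "(\<epsilon> has_real_derivative \<epsilon>' s) (at s)" "(V has_real_derivative V' s) (at s)"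
          using V'(1)[OF t0s s(3)] by (simp_all add: has_real_derivative_iff_has_vector_derivative)
        then have "((\<lambda>t. exp (- (t - a)) * \<epsilon> t + K1 * V t) has_real_derivative
            exp (- (s - a)) * (\<epsilon>' s - \<epsilon> s) + K1 * V' s) (at s)"
          by (auto intro!: derivative_eq_intros simp: algebra_simps)
        then show "((\<lambda>t. exp (- (t - a)) * \<epsilon> t + K1 * V t) has_vector_derivative
            exp (- (s - a)) * (\<epsilon>' s - \<epsilon> s) + K1 * V' s) (at s)"
          by (simp add: has_real_derivative_iff_has_vector_derivative)
        have "\<epsilon>' s - \<epsilon> s \<le> K1 * decay (G s) W s"
        proof -
          \<comment> \<open>From \<open>0 \<le> B (x - k L) (x - k L)\<close> and the dissipativity
            of \<open>A\<close>.\<close>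
          have "2 * B x (A x + k *\<^sub>R L) \<le> B x x + k\<^sup>2 * B L L" for x k
            using diss[of x] B_nonneg[of "x - k *\<^sub>R L"] B_sym[of L x]
            by (simp add: B_simps power2_eq_square algebra_simps)
          then have "\<epsilon>' s \<le> (\<Sum>i\<in>UNIV. B (e (Some i) s) (e (Some i) s) + (c i s)\<^sup>2 * B L L)"
            unfolding \<epsilon>'_def by (intro sum_mono)
          then have "\<epsilon>' s - \<epsilon> s \<le> (\<Sum>i\<in>UNIV. (c i s)\<^sup>2) * B L L"
            unfolding \<epsilon>_def energy_def by (simp add: sum.distrib sum_distrib_right)
          also have "(\<Sum>i\<in>UNIV. (c i s)\<^sup>2) \<le> (\<Sum>i\<in>UNIV. real n *
              (\<Sum>j\<in>neighbors (G s) (Some i). (F (W j s) - F (W (Some i) s))\<^sup>2))"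
          proof (rule sum_mono)
            fix i
            have "(c i s)\<^sup>2 \<le> real (card (neighbors (G s) (Some i))) *
                (\<Sum>j\<in>neighbors (G s) (Some i). (F (W j s) - F (W (Some i) s))\<^sup>2)"
              unfolding c_def by (rule sum_power2_le_card)
            also have "\<dots> \<le> real n * (\<Sum>j\<in>neighbors (G s) (Some i). (F (W j s) - F (W (Some i) s))\<^sup>2)"
            proof (intro mult_right_mono sum_nonneg)
              have "card (neighbors (G s) (Some i)) \<le> n" unfolding n_def by (rule card_mono) auto
              then show "real (card (neighbors (G s) (Some i))) \<le> real n" by simp
            qed auto
            finally show "(c i s)\<^sup>2 \<le> real n * (\<Sum>j\<in>neighbors (G s) (Some i). (F (W j s) - F (W (Some i) s))\<^sup>2)" .
          qed
          also have "\<dots> \<le> real n * decay (G s) W s"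
            unfolding sum_distrib_left[symmetric] using decay_ge(3) by (intro mult_left_mono) auto
          finally show ?thesis unfolding K1_def using B_nonneg[of L] by (simp add: mult_right_mono mult_ac)
        qed
        then have "exp (- (s - a)) * (\<epsilon>' s - \<epsilon> s) \<le> exp (- (s - a)) * (K1 * decay (G s) W s)"
          by (intro mult_left_mono) auto
        also have "\<dots> \<le> 1 * (K1 * decay (G s) W s)"
          using s K1 decay_nonneg[of "G s" W s] by (intro mult_right_mono) auto
        also have "\<dots> \<le> - (K1 * V' s)"
          using mult_left_mono[OF V'(2)[OF t0s s(3)] K1] by simp
        finally show "exp (- (s - a)) * (\<epsilon>' s - \<epsilon> s) + K1 * V' s \<le> 0" by simp
      qed
      moreover have "\<epsilon> a = 0" unfolding \<epsilon>_def energy_def by (simp add: ea bounded_bilinear.zero_left[OF B])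
      ultimately have "exp (- (t - a)) * \<epsilon> t \<le> K1 * (V a - V t)" by (simp add: algebra_simps)
      also have "\<dots> \<le> K1 * \<delta>" unfolding \<delta>_def using K1 Vmono[of t b] t by (intro mult_left_mono) auto
      finally have "exp (t - a) * (exp (- (t - a)) * \<epsilon> t) \<le> exp (t - a) * (K1 * \<delta>)" by (intro mult_left_mono) auto
      moreover have "exp (t - a) * exp (- (t - a)) = 1" by (simp flip: exp_add)
      ultimately have "\<epsilon> t \<le> exp (t - a) * (K1 * \<delta>)" by (metis mult.assoc mult_1)
      also have "\<dots> \<le> exp \<nu> * (K1 * \<delta>)" using t ab K1 \<delta>0 by (intro mult_right_mono) auto
      finally show ?thesis unfolding K2_def by simp
    qed
    have edge: "B (W i a - W j a) (W i a - W j a) \<le> K4 * \<delta>" if ji: "(j, i) \<in> E" for i j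
    proof -
      obtain k where k: "i = Some k" using E[OF ji] by auto
      obtain p where p: "a \<le> p" "p + \<tau> \<le> b" "\<And>t. p < t \<Longrightarrow> t < p + \<tau> \<Longrightarrow> (j, i) \<in> G t" using E[OF ji] by auto
      define u where "u t = z i t - z j t" for t
      have u_at: "(u has_vector_derivative A (u t)) (at t)" if "t > a" for t
        unfolding u_def[abs_def] linear_diff[OF linA] by (intro has_vector_derivative_diff z_at that)
      have u_within: "(u has_vector_derivative A (u t)) (at t within {a..})" if "t \<ge> a" for t
        unfolding u_def[abs_def] linear_diff[OF linA] by (intro has_vector_derivative_diff z_der that)
      have u_cont: "continuous_on {s..q} u" if "a \<le> s" for s q
        unfolding u_def[abs_def] by (intro continuous_intros z_cont that)
      have u_eq: "u t = (W i t - W j t) - (e i t - e j t)" for t unfolding u_def e_def by simp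
      have rW: "diss_rate (W l t) \<le> decay (G t) W t" for l t
        using decay_ge(1) decay_nonneg[of "G t" W t]
        by (cases l) (auto simp: W0 diss_rate_def bounded_bilinear.zero_left[OF B])
      have re: "diss_rate (e l t) \<le> Kr * \<epsilon> t" for l t
        using Kr(2)[of "e l t"] mult_left_mono[OF \<epsilon>_ge Kr(1), of l t] by linarith
      have fe: "(F (e l t))\<^sup>2 \<le> KF * \<epsilon> t" for l t
        using KF(2)[of "e l t"] mult_left_mono[OF \<epsilon>_ge KF(1), of l t] by linarith
      \<comment> \<open>Two applications of \<open>diss_rate_diff\<close> produce the factor 8. The
        output below gets only a factor 2 for \<open>decay\<close>, because the edge is active and
        \<open>decay\<close> contains the output difference itself; the sum is the 10 in
        \<open>int_bound\<close>.\<close>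
      have ru: "diss_rate (u t) \<le> 8 * decay (G t) W t + 8 * Kr * K2 * \<delta>" if t: "t \<in> {a..b}" for t
      proof -
        have "diss_rate (u t) \<le> 2 * diss_rate (W i t - W j t) + 2 * diss_rate (e i t - e j t)"
          unfolding u_eq by (rule diss_rate_diff)
        also have "\<dots> \<le> 8 * decay (G t) W t + 8 * (Kr * \<epsilon> t)"
          using diss_rate_diff[of "W i t" "W j t"] diss_rate_diff[of "e i t" "e j t"]
            rW[of i t] rW[of j t] re[of i t] re[of j t] by linarith
        also have "Kr * \<epsilon> t \<le> Kr * (K2 * \<delta>)" by (intro mult_left_mono \<epsilon>_bound t Kr)
        finally show ?thesis by (simp add: mult.assoc)
      qed
      have sq: "(x - y)\<^sup>2 \<le> 2 * x\<^sup>2 + 2 * y\<^sup>2" for x y :: real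
        using zero_le_power2[of "x + y"] by (simp add: power2_eq_square algebra_simps)
      have fu: "(F (u t))\<^sup>2 \<le> 2 * decay (G t) W t + 8 * KF * K2 * \<delta>" if t: "t \<in> {a..b}" "(j, i) \<in> G t" for t
      proof -
        have "F (u t) = (F (W i t) - F (W j t)) - (F (e i t) - F (e j t))"
          unfolding u_eq by (simp add: linear_diff[OF linF])
        then have "(F (u t))\<^sup>2 \<le> 2 * (F (W i t) - F (W j t))\<^sup>2 + 2 * (F (e i t) - F (e j t))\<^sup>2"
          by (simp only: sq)
        also have "(F (W i t) - F (W j t))\<^sup>2 \<le> decay (G t) W t"
          using decay_ge(2)[of j k "G t" W t] t(2) k by (simp add: power2_commute)
        also have "(F (e i t) - F (e j t))\<^sup>2 \<le> 4 * (KF * \<epsilon> t)"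
          using sq[of "F (e i t)" "F (e j t)"] fe[of i t] fe[of j t] by linarith
        also have "KF * \<epsilon> t \<le> KF * (K2 * \<delta>)" by (intro mult_left_mono \<epsilon>_bound t KF)
        finally show ?thesis by (simp add: mult.assoc)
      qed
      define g where "g t = diss_rate (u t) + (F (u t))\<^sup>2" for t
      have g_cont: "continuous_on {p..p+\<tau>} g" unfolding g_def[abs_def] diss_rate_def
        by (intro continuous_intros bounded_bilinear.continuous_on[OF B] bounded_linear.continuous_on[OF bounded_linear_A]
            bounded_linear.continuous_on[OF bounded_linear_F] u_cont p)
      have int_bound: "integral {p..p+\<tau>} g \<le> (10 + K3 * \<tau>) * \<delta>"
      proof -
        have "integral {p..p+\<tau>} g + 10 * V (p+\<tau>) - K3 * \<delta> * (p+\<tau>)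
            \<le> integral {p..p} g + 10 * V p - K3 * \<delta> * p"
        proof (rule pw_antimono[OF D, where w = "\<lambda>t. integral {p..t} g + 10 * V t - K3 * \<delta> * t"
            and w' = "\<lambda>t. g t + 10 * V' t - K3 * \<delta>"])
          show "p \<le> p + \<tau>" using \<tau> by simp
          show "continuous_on {p..p+\<tau>} (\<lambda>t. integral {p..t} g + 10 * V t - K3 * \<delta> * t)"
            by (intro continuous_intros indefinite_integral_continuous_1 integrable_continuous_interval g_cont Vcont p)
          fix t assume t: "p < t" "t < p + \<tau>" "t \<notin> D"
          have tt: "t0 < t" "t \<in> {a..b}" using t p ab by auto
          have "((\<lambda>t. integral {p..t} g) has_vector_derivative g t) (at t)"
            by (rule has_vector_derivative_interior_interval[OF integral_has_vector_derivative[OF g_cont]]) (use t in auto)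
          then have "((\<lambda>t. integral {p..t} g) has_real_derivative g t) (at t)" "(V has_real_derivative V' t) (at t)"
            using V'(1)[OF tt(1) t(3)] by (simp_all add: has_real_derivative_iff_has_vector_derivative)
          then have "((\<lambda>t. integral {p..t} g + 10 * V t - K3 * \<delta> * t) has_real_derivative (g t + 10 * V' t - K3 * \<delta>)) (at t)"
            by (auto intro!: derivative_eq_intros)
          then show "((\<lambda>t. integral {p..t} g + 10 * V t - K3 * \<delta> * t) has_vector_derivative (g t + 10 * V' t - K3 * \<delta>)) (at t)"
            by (simp add: has_real_derivative_iff_has_vector_derivative)
          have "g t \<le> 10 * decay (G t) W t + K3 * \<delta>"
            using ru[OF tt(2)] fu[OF tt(2) p(3)[OF t(1,2)]] unfolding g_def K3_def by (simp add: algebra_simps)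
          then show "g t + 10 * V' t - K3 * \<delta> \<le> 0" using V'(2)[OF tt(1) t(3)] by linarith
        qed
        moreover have "V p - V (p+\<tau>) \<le> \<delta>" unfolding \<delta>_def using Vmono[of a p] Vmono[of "p+\<tau>" b] p \<tau> by simp
        ultimately show ?thesis by (simp add: algebra_simps)
      qed
      have up: "B (u p) (u p) \<le> Cg * ((10 + K3 * \<tau>) * \<delta>)"
      proof -
        have "B (u p) (u p) \<le> Cg * integral {p..p+\<tau>} g"
          unfolding g_def
          by (rule Cg(2)) (use p in \<open>auto intro!: has_vector_derivative_within_subset[OF u_within]\<close>)
        also have "\<dots> \<le> Cg * ((10 + K3 * \<tau>) * \<delta>)" using Cg(1) int_bound by (intro mult_left_mono) auto
        finally show ?thesis .
      qed
      \<comment> \<open>The Gramian bounds \<open>u\<close> at the time \<open>p\<close> at which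
        the edge becomes active. Going back to the start of the window costs the dissipation between
        \<open>a\<close> and \<open>p\<close>, which is again of the order of the energy
        drop.\<close>
      have "- B (u p) (u p) + 8 * V p - 8 * Kr * K2 * \<delta> * p \<le> - B (u a) (u a) + 8 * V a - 8 * Kr * K2 * \<delta> * a"
      proof (rule pw_antimono[OF D p(1), where w = "\<lambda>t. - B (u t) (u t) + 8 * V t - 8 * Kr * K2 * \<delta> * t"
          and w' = "\<lambda>t. diss_rate (u t) + 8 * V' t - 8 * Kr * K2 * \<delta>"])
        show "continuous_on {a..p} (\<lambda>t. - B (u t) (u t) + 8 * V t - 8 * Kr * K2 * \<delta> * t)"
          by (intro continuous_intros bounded_bilinear.continuous_on[OF B] u_cont Vcont) auto
        fix t assume t: "a < t" "t < p" "t \<notin> D"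
        have tt: "t0 < t" "t \<in> {a..b}" using t p ab \<tau> by auto
        have "((\<lambda>t. B (u t) (u t)) has_real_derivative - diss_rate (u t)) (at t)" "(V has_real_derivative V' t) (at t)"
          using V'(1)[OF tt(1) t(3)] bounded_bilinear_quadratic_derivative[OF B B_sym u_at[OF t(1)]]
          by (simp_all add: has_real_derivative_iff_has_vector_derivative diss_rate_def)
        then have "((\<lambda>t. - B (u t) (u t) + 8 * V t - 8 * Kr * K2 * \<delta> * t) has_real_derivative
            diss_rate (u t) + 8 * V' t - 8 * Kr * K2 * \<delta>) (at t)"
          by (auto intro!: derivative_eq_intros)
        then show "((\<lambda>t. - B (u t) (u t) + 8 * V t - 8 * Kr * K2 * \<delta> * t) has_vector_derivative
            diss_rate (u t) + 8 * V' t - 8 * Kr * K2 * \<delta>) (at t)"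
          by (simp add: has_real_derivative_iff_has_vector_derivative)
        show "diss_rate (u t) + 8 * V' t - 8 * Kr * K2 * \<delta> \<le> 0"
          using ru[OF tt(2)] V'(2)[OF tt(1) t(3)] by linarith
      qed
      moreover have "V a - V p \<le> \<delta>" unfolding \<delta>_def using Vmono[of p b] p \<tau> by simp
      moreover have "8 * Kr * K2 * \<delta> * (p - a) \<le> 8 * Kr * K2 * \<delta> * \<nu>"
        using Kr K2 \<delta>0 p ab \<tau> by (intro mult_left_mono) auto
      ultimately have "B (u a) (u a) \<le> B (u p) (u p) + 8 * \<delta> + 8 * Kr * K2 * \<delta> * \<nu>"
        by (simp add: algebra_simps)
      then have "B (u a) (u a) \<le> K4 * \<delta>" using up unfolding K4_def by (simp add: algebra_simps)
      then show ?thesis unfolding u_def z_def by (simp add: \<Phi>0)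
    qed
    \<comment> \<open>The bound is propagated from the leader, where the error is 0. Every edge
      doubles the previous bound and adds twice \<open>K4 * \<delta>\<close>, which the base 4
      covers.\<close>
    have path: "B (W i a) (W i a) \<le> 4 ^ k * (K4 * \<delta>)" if "(None, i) \<in> E ^^ k" for k i
      using that
    proof (induction k arbitrary: i)
      case 0 then show ?case using K4 \<delta>0 by (simp add: W0 bounded_bilinear.zero_left[OF B])
    next
      case (Suc k)
      then obtain j where j: "(None, j) \<in> E ^^ k" "(j, i) \<in> E" by auto
      have "B (W i a) (W i a) \<le> 2 * B (W i a - W j a) (W i a - W j a) + 2 * B (W j a) (W j a)"
        using B_add[of "W i a - W j a" "W j a"] by simp
      also have "\<dots> \<le> 2 * (K4 * \<delta>) + 2 * (4 ^ k * (K4 * \<delta>))"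
        using edge[OF j(2)] Suc.IH[OF j(1)] by simp
      also have "\<dots> \<le> 2 * (4 ^ k * (K4 * \<delta>)) + 2 * (4 ^ k * (K4 * \<delta>))"
      proof -
        have "1 * (K4 * \<delta>) \<le> 4 ^ k * (K4 * \<delta>)" using K4 \<delta>0 by (intro mult_right_mono) auto
        then show ?thesis by linarith
      qed
      finally show ?case by (simp add: algebra_simps)
    qed
    have state: "B (W i a) (W i a) \<le> 4 ^ (n * n) * (K4 * \<delta>)" for i
    proof -
      have fin: "finite E" by simp
      obtain k where k: "(None, i) \<in> E ^^ k" "k \<le> card E"
        using root[of i] rtrancl_finite_eq_relpow[OF fin] by auto
      have "card E \<le> card (UNIV :: ('N option \<times> 'N option) set)" by (rule card_mono) auto
      then have "k \<le> n * n" using k(2) by (simp add: n_def card_cartesian_product flip: UNIV_Times_UNIV)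
      then have "(4::real) ^ k * (K4 * \<delta>) \<le> 4 ^ (n * n) * (K4 * \<delta>)"
        using K4 \<delta>0 by (intro mult_right_mono power_increasing) auto
      then show ?thesis using path[OF k(1)] by linarith
    qed
    have "energy W a \<le> (\<Sum>i\<in>(UNIV::'N set). 4 ^ (n * n) * (K4 * \<delta>))"
      unfolding energy_def by (rule sum_mono) (rule state)
    also have "\<dots> \<le> C * \<delta>" unfolding C_def using \<delta>0 by (simp add: algebra_simps)
    finally show ?thesis unfolding \<delta>_def V_def .
  qed
  show ?thesis
  proof (intro exI[of _ C] conjI C allI impI)
    fix D G t0 a b E and W :: "'N option \<Rightarrow> real \<Rightarrow> 'a"
    assume W: "consensus D G t0 W" and D: "\<forall>a b. finite (D \<inter> {a..b})"
      and sym: "\<forall>t\<ge>t0. sym (follower_subgraph (G t))" and ab: "t0 \<le> a" "a \<le> b" "b - a \<le> \<nu>"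
      and root: "\<forall>i. (None, i) \<in> E\<^sup>*"
      and E: "\<forall>(j, i)\<in>E. i \<noteq> None \<and> (\<exists>p. a \<le> p \<and> p + \<tau> \<le> b \<and> (\<forall>t\<in>{p<..<p+\<tau>}. (j, i) \<in> G t))"
    show "energy W a \<le> C * (energy W a - energy W b)"
    proof (rule main[OF W _ _ ab, of E])
      show "finite (D \<inter> {a..b})" for a b using D by simp
      show "sym (follower_subgraph (G t))" if "t0 \<le> t" for t using sym that by simp
      show "(None, i) \<in> E\<^sup>*" for i using root by simp
      fix j i assume "(j, i) \<in> E"
      from bspec[OF E this] show "i \<noteq> None \<and> (\<exists>p. a \<le> p \<and> p + \<tau> \<le> b \<and> (\<forall>t\<in>{p<..<p+\<tau>}. (j, i) \<in> G t))" by simp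
    qed
  qed
qed

end



section \<open>The observer gain\<close>

text \<open>The matrix of a positive definite form is injective, hence onto.\<close>

lemma riesz_form:
  fixes B :: "'a::euclidean_space \<Rightarrow> 'a \<Rightarrow> real"
  assumes B: "bounded_bilinear B" and pos: "\<And>x. x \<noteq> 0 \<Longrightarrow> 0 < B x x"
  shows "\<exists>l. \<forall>x. B l x = F \<bullet> x"
proof -
  interpret bounded_bilinear B by (rule B)
  define P where "P x = (\<Sum>b\<in>Basis. B x b *\<^sub>R b)" for x
  have P: "P x \<bullet> y = B x y" for x y
  proof -
    have "B x y = B x (\<Sum>b\<in>Basis. (y \<bullet> b) *\<^sub>R b)" by (simp add: euclidean_representation)
    also have "\<dots> = (\<Sum>b\<in>Basis. (y \<bullet> b) * B x b)" by (simp add: sum_right scaleR_right)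
    also have "\<dots> = P x \<bullet> y" unfolding P_def inner_sum_left inner_scaleR_left
      by (intro sum.cong refl) (simp add: inner_commute mult.commute)
    finally show ?thesis by simp
  qed
  have lin: "linear P"
    unfolding P_def by (rule linearI) (simp_all add: add_left scaleR_left scaleR_add_left sum.distrib scaleR_sum_right)
  have "inj P"
    unfolding linear_injective_0[OF lin] using P pos by (metis inner_zero_left less_irrefl)
  then have "surj P" by (rule linear_inj_imp_surj[OF lin])
  then obtain l where "F = P l" by auto
  then have "\<forall>x. B l x = F \<bullet> x" by (simp add: P)
  then show ?thesis by blast
qed

lemma col_times_row_vec: "col_times_row l F *v x = (F \<bullet> x) *\<^sub>R l"
  by (simp add: Finite_Cartesian_Product.vec_eq_iff col_times_row_def matrix_vector_mult_def inner_vec_def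
      sum_distrib_left mult_ac)

lemma dissipative_pair_exists:
  fixes S :: "real ^ 'n ^ 'n"
  assumes S: "marginally_stable S" and det: "detectable F S"
  shows "\<exists>B L. dissipative_pair ((*v) S) ((\<bullet>) F) B L"
proof -
  obtain B where B: "bounded_bilinear B" "\<And>x y. B x y = B y x" "\<And>x. x \<noteq> 0 \<Longrightarrow> 0 < B x x"
    "\<And>x. B x (S *v x) \<le> (0::real)"
    using marginally_stable_form[OF S] by blast
  interpret B: bounded_bilinear B by (rule B)
  obtain G where "hurwitz (S + col_times_row G F)" using det unfolding detectable_def by blast
  from hurwitz_form[OF this] obtain Q where Q: "bounded_bilinear Q" "\<And>x y. Q x y = Q y x"
    "\<And>x. x \<noteq> 0 \<Longrightarrow> Q x ((S + col_times_row G F) *v x) < (0::real)" by blast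
  obtain L where L: "\<And>x. B L x = F \<bullet> x" using riesz_form[OF B(1,3)] by blast
  define A where "A = (*v) S"
  have linA: "linear A" unfolding A_def by simp
  \<comment> \<open>The subspace that neither the output nor the dissipation of \<open>B\<close> can
    see.\<close>
  define U where "U = {x. \<forall>k. F \<bullet> (A ^^ k) x = 0 \<and> B ((A ^^ k) x) (A ((A ^^ k) x)) = 0}"
  have linAk: "linear (A ^^ k)" for k
  proof (induction k)
    case 0 show ?case using linear_id by (simp add: id_def)
  next
    case (Suc k) show ?case unfolding funpow.simps by (rule linear_compose[OF Suc linA])
  qed
  \<comment> \<open>Zeros of a semidefinite quadratic form are closed under addition: by the
    parallelogram identity two nonpositive values add up to 0.\<close>
  have null: "B (x + y) (A (x + y)) = 0" if x: "B x (A x) = 0" and y: "B y (A y) = 0" for x y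
  proof -
    have "B (x + y) (A (x + y)) + B (x - y) (A (x - y)) = 0"
      using x y by (simp add: B.add_left B.add_right B.diff_left B.diff_right linear_add[OF linA] linear_diff[OF linA])
    moreover have "B (x + y) (A (x + y)) \<le> 0" "B (x - y) (A (x - y)) \<le> 0" using B(4) unfolding A_def by auto
    ultimately show ?thesis by linarith
  qed
  have "Real_Vector_Spaces.subspace U"
    unfolding Real_Vector_Spaces.subspace_def U_def
    using null by (auto simp: linear_0[OF linAk] linear_add[OF linAk] linear_scale[OF linAk] linear_0[OF linA]
        linear_scale[OF linA] B.zero_left B.scaleR_left B.scaleR_right inner_add_right)
  moreover have "A x \<in> U" if "x \<in> U" for x
  proof -
    have "(A ^^ k) (A x) = (A ^^ Suc k) x" for k by (simp add: funpow_swap1)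
    moreover have "F \<bullet> (A ^^ Suc k) x = 0 \<and> B ((A ^^ Suc k) x) (A ((A ^^ Suc k) x)) = 0" for k
      using that unfolding U_def by blast
    ultimately show ?thesis unfolding U_def by simp
  qed
  moreover have U0: "F \<bullet> x = 0" "B x (A x) = 0" if "x \<in> U" for x
  proof -
    have "F \<bullet> (A ^^ 0) x = 0 \<and> B ((A ^^ 0) x) (A ((A ^^ 0) x)) = 0" using that unfolding U_def by blast
    then show "F \<bullet> x = 0" "B x (A x) = 0" by auto
  qed
  \<comment> \<open>On \<open>U\<close> the output is 0, so \<open>S\<close> coincides there with
    the Hurwitz matrix \<open>S + G F\<close> supplied by detectability.\<close>
  moreover have "Q x (A x) < 0" if "x \<in> U" "x \<noteq> 0" for x
    using Q(3)[OF that(2)] U0(1)[OF that(1)]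
    by (simp add: A_def matrix_vector_mult_add_rdistrib col_times_row_vec)
  ultimately have "U \<subseteq> {0}"
    by (intro skew_dissipative_subspace_trivial[where A = A, OF B(1-3) Q(1,2)]) auto
  then have "x = 0" if "\<And>k. F \<bullet> (A ^^ k) x = 0 \<and> B ((A ^^ k) x) (A ((A ^^ k) x)) = 0" for x
    using that unfolding U_def by blast
  then have "dissipative_pair A ((\<bullet>) F) B L"
    using B L linA by (intro dissipative_pair.intro) (auto simp: A_def bounded_linear_inner_right bounded_linear.linear)
  then show ?thesis unfolding A_def by blast
qed

text \<open>Models \<open>y' = \<mu>\<close> times the sum of neighbour differences: no own
  dynamics, the full state as output, and \<mu> as gain. The gain identity forces the form
  \<open>x * y / \<mu>\<close>.\<close>

lemma dissipative_pair_scalar: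
  assumes "0 < \<mu>"
  shows "dissipative_pair (\<lambda>_::real. 0) (\<lambda>x. x) (\<lambda>x y. x * y / \<mu>) \<mu>"
proof (rule dissipative_pair.intro)
  show "linear (\<lambda>_::real. 0::real)" by (rule linear_zero)
  show "linear (\<lambda>x::real. x)" by (rule linear_ident)
  have "bounded_bilinear (\<lambda>x y. x * (inverse \<mu> * y))"
    by (rule bounded_bilinear.comp[OF bounded_bilinear_mult bounded_linear_ident bounded_linear_mult_right])
  then show "bounded_bilinear (\<lambda>x y. x * y / \<mu>)" by (simp add: divide_inverse mult_ac)
  show "x = 0" if "\<And>k. ((\<lambda>_::real. 0::real) ^^ k) x = 0 \<and> ((\<lambda>_. 0) ^^ k) x * 0 / \<mu> = 0" for x :: real
    using that[of 0] by simp
qed (use assms in \<open>auto simp: zero_less_mult_iff linorder_neq_iff\<close>)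

section \<open>Exponential decay over the switching network\<close>

text \<open>The windows start at prescribed instants while \<open>t0\<close> is arbitrary, so the
  constants have to absorb the wait for the first complete window; this keeps them uniform in
  \<open>t0\<close>.\<close>

lemma geometric_window_decay:
  fixes a :: "nat \<Rightarrow> real"
  assumes gap: "\<And>k. a (Suc k) - a k < \<nu>" and \<nu>: "0 < \<nu>" and unb: "\<And>t. \<exists>k. t < a k" and q: "0 < q" "q < 1"
  shows "\<exists>C>0. \<exists>\<alpha>>0. \<forall>t0\<ge>0. \<forall>V. (\<forall>t. 0 \<le> V t) \<longrightarrow> (\<forall>s t. t0 \<le> s \<longrightarrow> s \<le> t \<longrightarrow> V t \<le> V s) \<longrightarrow>
    (\<forall>k. t0 \<le> a k \<longrightarrow> V (a (Suc k)) \<le> q * V (a k)) \<longrightarrow> (\<forall>k. a k \<le> a (Suc k)) \<longrightarrow>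
    (\<forall>t\<ge>t0. V t \<le> C * exp (- \<alpha> * (t - t0)) * (V t0 :: real))"
proof -
  define \<alpha> where "\<alpha> = - ln q / \<nu>"
  \<comment> \<open>The longest wait from \<open>t0\<close> to the start of a window: less than one
    gap, or up to \<open>a 0\<close> if \<open>t0\<close> precedes all windows.\<close>
  define c0 where "c0 = \<nu> + \<bar>a 0\<bar>"
  define C where "C = exp (\<alpha> * (c0 + \<nu>))"
  have \<alpha>: "\<alpha> > 0" unfolding \<alpha>_def using q \<nu> by (simp add: divide_neg_pos)
  have main: "V t \<le> C * exp (- \<alpha> * (t - t0)) * V t0"
    if t0: "t0 \<ge> 0" and V0: "\<And>t. 0 \<le> V t" and mono: "\<And>s t. t0 \<le> s \<Longrightarrow> s \<le> t \<Longrightarrow> V t \<le> V s"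
      and dec: "\<And>k. t0 \<le> a k \<Longrightarrow> V (a (Suc k)) \<le> q * V (a k)" and inc: "\<And>k. a k \<le> a (Suc k)" and t: "t0 \<le> t"
    for t0 V t
  proof -
    define k0 where "k0 = (LEAST k. t0 \<le> a k)"
    have ex: "\<exists>k. t0 \<le> a k" using unb[of t0] less_imp_le by blast
    have k0: "t0 \<le> a k0" unfolding k0_def by (rule LeastI_ex[OF ex])
    have k0': "a k0 \<le> t0 + c0"
    proof (cases k0)
      case 0 then show ?thesis using t0 \<nu> unfolding c0_def by simp
    next
      case (Suc k)
      have "\<not> t0 \<le> a k" by (rule not_less_Least) (use Suc in \<open>simp add: k0_def[symmetric]\<close>)
      then show ?thesis using gap[of k] Suc unfolding c0_def by simp
    qed
    have step: "t0 \<le> a (k0 + j) \<and> a (k0 + j) \<le> t0 + c0 + real j * \<nu> \<and> V (a (k0 + j)) \<le> q ^ j * V t0" for j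
    proof (induction j)
      case 0 then show ?case using k0 k0' mono[of t0 "a k0"] by simp
    next
      case (Suc j)
      have "V (a (Suc (k0 + j))) \<le> q * V (a (k0 + j))" by (rule dec) (use Suc in auto)
      also have "\<dots> \<le> q * (q ^ j * V t0)" using Suc q by (intro mult_left_mono) auto
      finally show ?case using Suc gap[of "k0 + j"] inc[of "k0 + j"] by (simp add: algebra_simps)
    qed
    show ?thesis
    proof (cases "t < t0 + c0")
      case True
      have "V t \<le> 1 * V t0" using mono[of t0 t] t by simp
      also have "\<dots> \<le> exp (\<alpha> * (c0 + \<nu>) - \<alpha> * (t - t0)) * V t0"
      proof (rule mult_right_mono[OF _ V0])
        have "\<alpha> * (t - t0) \<le> \<alpha> * (c0 + \<nu>)" using True \<alpha> \<nu> by (intro mult_left_mono) auto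
        then show "1 \<le> exp (\<alpha> * (c0 + \<nu>) - \<alpha> * (t - t0))" by simp
      qed
      finally show ?thesis unfolding C_def by (simp add: exp_add[symmetric])
    next
      case False
      \<comment> \<open>As every window is shorter than \<nu>, at least this many complete windows
        fit between the first one and \<open>t\<close>.\<close>
      define j where "j = nat \<lfloor>(t - t0 - c0) / \<nu>\<rfloor>"
      have "real j \<le> (t - t0 - c0) / \<nu>" "(t - t0 - c0) / \<nu> - 1 \<le> real j"
        unfolding j_def using False \<nu> by (auto simp: of_nat_nat)
      then have j: "real j * \<nu> \<le> t - t0 - c0" "t - t0 - c0 - \<nu> \<le> real j * \<nu>" using \<nu> by (simp_all add: field_simps)
      have "V t \<le> V (a (k0 + j))" using step[of j] j(1) by (intro mono) auto
      also have "\<dots> \<le> q ^ j * V t0" using step[of j] by simp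
      also have "\<dots> \<le> exp (- \<alpha> * (t - t0 - c0 - \<nu>)) * V t0"
      proof (rule mult_right_mono[OF _ V0])
        have "q ^ j = exp (real j * ln q)" using q by (simp add: exp_of_nat_mult)
        also have "real j * ln q = - \<alpha> * (real j * \<nu>)" unfolding \<alpha>_def using \<nu> by simp
        also have "exp (- \<alpha> * (real j * \<nu>)) \<le> exp (- \<alpha> * (t - t0 - c0 - \<nu>))" using j(2) \<alpha> by simp
        finally show "q ^ j \<le> exp (- \<alpha> * (t - t0 - c0 - \<nu>))" .
      qed
      also have "exp (- \<alpha> * (t - t0 - c0 - \<nu>)) = C * exp (- \<alpha> * (t - t0))"
        unfolding C_def by (simp add: exp_add[symmetric] algebra_simps)
      finally show ?thesis .
    qed
  qed
  have "C > 0" unfolding C_def by simp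
  show ?thesis
  proof (rule exI[of _ C], rule conjI[OF \<open>C > 0\<close>], rule exI[of _ \<alpha>], rule conjI[OF \<alpha>], intro allI impI)
    fix t0 V t
    assume "0 \<le> t0" "\<forall>t. 0 \<le> V t" "\<forall>s t. t0 \<le> s \<longrightarrow> s \<le> t \<longrightarrow> V t \<le> V s"
      "\<forall>k. t0 \<le> a k \<longrightarrow> V (a (Suc k)) \<le> q * V (a k)" "\<forall>k. a k \<le> a (Suc k)" "t0 \<le> t"
    then show "V t \<le> C * exp (- \<alpha> * (t - t0)) * V t0" by (intro main) simp_all
  qed
qed

lemma exp_decay_tendsto:
  fixes \<alpha> :: real
  assumes "0 < \<alpha>"
  shows "((\<lambda>t. exp (- \<alpha> * t)) \<longlongrightarrow> 0) at_top"
  by (rule filterlim_compose[OF exp_at_bot])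
    (rule filterlim_tendsto_neg_mult_at_bot[OF tendsto_const _ filterlim_ident], use assms in simp)

locale switching_network =
  fixes G :: "real \<Rightarrow> ('N::finite option \<times> 'N option) set" and ts :: "nat \<Rightarrow> real" and \<tau>0 :: real
  assumes ts_0: "ts 0 = 0" and dwell_pos: "0 < \<tau>0" and dwell_time: "\<tau>0 \<le> ts (Suc k) - ts k"
    and G_const: "t \<in> {ts k..<ts (Suc k)} \<Longrightarrow> G t = G (ts k)"
    and G_edges: "0 \<le> t \<Longrightarrow> (j, i) \<in> G t \<Longrightarrow> i \<noteq> None \<and> i \<noteq> j"
    and connected: "\<exists>(\<iota> :: nat \<Rightarrow> nat) \<nu>. strict_mono \<iota> \<and> 0 < \<nu> \<and>
         (\<forall>k. ts (\<iota> (Suc k)) - ts (\<iota> k) < \<nu> \<and>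
              contains_spanning_tree None (union_graph G (ts (\<iota> k)) (ts (\<iota> (Suc k)))))"
    and undirected: "0 \<le> t \<Longrightarrow> sym (follower_subgraph (G t))"
begin

lemma ts_strict: "ts k < ts (Suc k)"
  using dwell_time[of k] dwell_pos by simp

lemma ts_mono: "k \<le> l \<Longrightarrow> ts k \<le> ts l"
  by (rule lift_Suc_mono_le[of ts]) (auto simp: less_imp_le[OF ts_strict])

lemma ts_nonneg: "0 \<le> ts k"
  using ts_mono[of 0 k] ts_0 by simp

text \<open>The dwell time keeps the switching instants from accumulating.\<close>

lemma ts_ge: "real k * \<tau>0 \<le> ts k"
proof (induction k)
  case (Suc k) then show ?case using dwell_time[of k] by (simp add: algebra_simps)
qed (simp add: ts_0)

lemma ts_unbounded: "\<exists>k. t < ts k"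
proof -
  obtain k where "t / \<tau>0 < real k" using reals_Archimedean2 by auto
  then have "t < real k * \<tau>0" using dwell_pos by (simp add: field_simps)
  then show ?thesis using ts_ge[of k] by (intro exI[of _ k]) linarith
qed

lemma finite_switching: "finite (range ts \<inter> {a..b})"
proof -
  obtain n where n: "b < ts n" using ts_unbounded by auto
  have "range ts \<inter> {a..b} \<subseteq> ts ` {..n}"
  proof
    fix x assume "x \<in> range ts \<inter> {a..b}"
    then obtain k where k: "x = ts k" "ts k \<le> b" by auto
    then have "k \<le> n" using n ts_mono[of n k] by (metis le_cases not_less order_trans)
    then show "x \<in> ts ` {..n}" using k by auto
  qed
  then show ?thesis by (rule finite_subset) simp
qed

text \<open>An edge of the union graph is present at some instant, hence during the whole interval
  between two switching instants around it. This interval has length at least \<tau>0, as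
  \<open>window_decay_exists\<close> requires.\<close>

lemma consensus_energy_decay:
  assumes "dissipative_pair A F B L"
  shows "\<exists>C>0. \<exists>\<alpha>>0. \<forall>t0\<ge>0. \<forall>W. dissipative_pair.consensus A F L (range ts) G t0 W \<longrightarrow>
    (\<forall>t\<ge>t0. dissipative_pair.energy B W t \<le> C * exp (- \<alpha> * (t - t0)) * dissipative_pair.energy B W t0)"
proof -
  interpret dissipative_pair A F B L by (rule assms)
  obtain \<iota> :: "nat \<Rightarrow> nat" and \<nu> where \<iota>: "strict_mono \<iota>" and \<nu>: "0 < \<nu>"
    and gap: "\<And>k. ts (\<iota> (Suc k)) - ts (\<iota> k) < \<nu>"
    and tree: "\<And>k. contains_spanning_tree None (union_graph G (ts (\<iota> k)) (ts (\<iota> (Suc k))))"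
    using connected by blast
  define a where "a k = ts (\<iota> k)" for k
  have a_mono: "a k \<le> a (Suc k)" for k
    unfolding a_def by (rule ts_mono) (use \<iota> in \<open>simp add: strict_mono_less_eq\<close>)
  obtain C where C: "C > 1" and win: "\<forall>D H t0 a b E (W :: 'N option \<Rightarrow> real \<Rightarrow> 'a).
     consensus D H t0 W \<longrightarrow> (\<forall>a b. finite (D \<inter> {a..b})) \<longrightarrow> (\<forall>t\<ge>t0. sym (follower_subgraph (H t))) \<longrightarrow>
     t0 \<le> a \<longrightarrow> a \<le> b \<longrightarrow> b - a \<le> \<nu> \<longrightarrow> (\<forall>i. (None, i) \<in> E\<^sup>*) \<longrightarrow>
     (\<forall>(j, i)\<in>E. i \<noteq> None \<and> (\<exists>p. a \<le> p \<and> p + \<tau>0 \<le> b \<and> (\<forall>t\<in>{p<..<p+\<tau>0}. (j, i) \<in> H t))) \<longrightarrow>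
     energy W a \<le> C * (energy W a - energy W b)"
    using window_decay_exists[OF dwell_pos \<nu>] by - (elim exE conjE, rule that)
  \<comment> \<open>\<open>V a \<le> C * (V a - V b)\<close> rearranged is
    \<open>V b \<le> (1 - 1 / C) * V a\<close>.\<close>
  define q where "q = 1 - 1 / C"
  have q: "0 < q" "q < 1" unfolding q_def using C by auto
  have step: "energy W (a (Suc k)) \<le> q * energy W (a k)"
    if t0: "0 \<le> t0" "t0 \<le> a k" and W: "consensus (range ts) G t0 W" for t0 k and W :: "'N option \<Rightarrow> real \<Rightarrow> 'a"
  proof -
    let ?E = "union_graph G (a k) (a (Suc k))"
    obtain T where "T \<subseteq> ?E" "directed_tree None T" using tree[of k] unfolding contains_spanning_tree_def a_def by blast
    then have root: "\<forall>i. (None, i) \<in> ?E\<^sup>*" unfolding directed_tree_def using rtrancl_mono by blast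
    have act: "i \<noteq> None \<and> (\<exists>p. a k \<le> p \<and> p + \<tau>0 \<le> a (Suc k) \<and> (\<forall>t\<in>{p<..<p+\<tau>0}. (j, i) \<in> G t))"
      if ji: "(j, i) \<in> ?E" for j i
    proof -
      obtain t where t: "a k \<le> t" "t < a (Suc k)" "(j, i) \<in> G t" using ji unfolding union_graph_def by auto
      have "ts 0 \<le> t" using t(1) ts_nonneg[of "\<iota> k"] unfolding a_def ts_0 by simp
      then obtain l where l: "ts l \<le> t" "t < ts (Suc l)"
        using grid_index[of ts t, OF ts_strict ts_unbounded] by blast
      \<comment> \<open>The ends of the window are switching instants, so an interval between
        consecutive instants that meets the window lies inside it.\<close>
      have "\<iota> k \<le> l"
      proof (rule ccontr)
        assume "\<not> \<iota> k \<le> l"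
        then have "ts (Suc l) \<le> ts (\<iota> k)" by (intro ts_mono) simp
        then show False using l t unfolding a_def by simp
      qed
      then have 1: "a k \<le> ts l" unfolding a_def by (rule ts_mono)
      have "Suc l \<le> \<iota> (Suc k)"
      proof (rule ccontr)
        assume "\<not> Suc l \<le> \<iota> (Suc k)"
        then have "ts (\<iota> (Suc k)) \<le> ts l" by (intro ts_mono) simp
        then show False using l t unfolding a_def by simp
      qed
      then have "ts (Suc l) \<le> a (Suc k)" unfolding a_def by (rule ts_mono)
      then have 2: "ts l + \<tau>0 \<le> a (Suc k)" using dwell_time[of l] by linarith
      have 3: "(j, i) \<in> G s" if "s \<in> {ts l<..<ts l + \<tau>0}" for s
        using G_const[of s l] G_const[of t l] that l t(3) dwell_time[of l] by auto
      have "i \<noteq> None" using G_edges[of t j i] t(3) \<open>ts 0 \<le> t\<close> ts_0 by simp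
      then show ?thesis using 1 2 3 by blast
    qed
    have "energy W (a k) \<le> C * (energy W (a k) - energy W (a (Suc k)))"
    proof (rule win[rule_format, OF W _ _ t0(2) a_mono, of ?E])
      show "a (Suc k) - a k \<le> \<nu>" using gap[of k] unfolding a_def by simp
      show "sym (follower_subgraph (G t))" if "t0 \<le> t" for t by (rule undirected) (use that t0(1) in simp)
      show "finite (range ts \<inter> {a..b})" for a b by (rule finite_switching)
      show "(None, i) \<in> ?E\<^sup>*" for i using root by blast
      show "case x of (j, i) \<Rightarrow> i \<noteq> None \<and> (\<exists>p. a k \<le> p \<and> p + \<tau>0 \<le> a (Suc k) \<and> (\<forall>t\<in>{p<..<p+\<tau>0}. (j, i) \<in> G t))"
        if "x \<in> ?E" for x
        using that act by (cases x) simp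
    qed
    then show ?thesis unfolding q_def using C by (simp add: field_simps)
  qed
  have unb: "\<exists>k. t < a k" for t
  proof -
    obtain k where "t < ts k" using ts_unbounded by auto
    also have "ts k \<le> ts (\<iota> k)" by (rule ts_mono) (rule strict_mono_imp_increasing[OF \<iota>])
    finally show ?thesis unfolding a_def by blast
  qed
  have gap': "a (Suc k) - a k < \<nu>" for k using gap unfolding a_def by simp
  obtain C' \<alpha> where C': "C' > 0" "\<alpha> > 0" and dec: "\<forall>t0\<ge>0. \<forall>V. (\<forall>t. 0 \<le> V t) \<longrightarrow>
     (\<forall>s t. t0 \<le> s \<longrightarrow> s \<le> t \<longrightarrow> V t \<le> V s) \<longrightarrow>
     (\<forall>k. t0 \<le> a k \<longrightarrow> V (a (Suc k)) \<le> q * V (a k)) \<longrightarrow> (\<forall>k. a k \<le> a (Suc k)) \<longrightarrow>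
     (\<forall>t\<ge>t0. V t \<le> C' * exp (- \<alpha> * (t - t0)) * (V t0 :: real))"
    using geometric_window_decay[of a \<nu> q, OF gap' \<nu> unb q] by - (elim exE conjE, rule that)
  show ?thesis
  proof (rule exI[of _ C'], rule conjI[OF C'(1)], rule exI[of _ \<alpha>], rule conjI[OF C'(2)], intro allI impI)
    fix t0 t and W :: "'N option \<Rightarrow> real \<Rightarrow> 'a"
    assume t0: "0 \<le> t0" and W: "consensus (range ts) G t0 W" and t: "t0 \<le> t"
    have "\<forall>t\<ge>t0. energy W t \<le> C' * exp (- \<alpha> * (t - t0)) * energy W t0"
    proof (rule dec[THEN spec, THEN mp, OF t0, THEN spec, THEN mp, THEN mp, THEN mp, THEN mp])
      show "\<forall>t. 0 \<le> energy W t" using energy_nonneg by blast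
      show "\<forall>s t. t0 \<le> s \<longrightarrow> s \<le> t \<longrightarrow> energy W t \<le> energy W s"
        using energy_antimono[OF W finite_switching] undirected t0 by simp
      show "\<forall>k. t0 \<le> a k \<longrightarrow> energy W (a (Suc k)) \<le> q * energy W (a k)" using step[OF t0 _ W] by blast
      show "\<forall>k. a k \<le> a (Suc k)" using a_mono by blast
    qed
    then show "energy W t \<le> C' * exp (- \<alpha> * (t - t0)) * energy W t0" using t by blast
  qed
qed

lemma scalar_consensus_tendsto:
  fixes y :: "'N option \<Rightarrow> real \<Rightarrow> real"
  assumes \<mu>: "0 < \<mu>" and y0: "\<And>t. y None t = 0"
    and y: "\<And>i. pw_derivative (range ts) 0 (y (Some i)) (\<lambda>t. \<mu> * (\<Sum>j\<in>neighbors (G t) (Some i). y j t - y (Some i) t))"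
  shows "(y (Some i) \<longlongrightarrow> 0) at_top"
proof -
  interpret dissipative_pair "\<lambda>_::real. 0" "\<lambda>x. x" "\<lambda>x y. x * y / \<mu>" \<mu> by (rule dissipative_pair_scalar[OF \<mu>])
  have W: "consensus (range ts) G 0 y" unfolding consensus_def using y y0 by (simp add: mult.commute)
  obtain C \<alpha> where C: "C > 0" "\<alpha> > 0" "\<And>t. t \<ge> 0 \<Longrightarrow> energy y t \<le> C * exp (- \<alpha> * (t - 0)) * energy y 0"
    using consensus_energy_decay[OF dissipative_pair_axioms] W order_refl[of "0::real"] by blast
  have lim: "((\<lambda>t. \<mu> * (C * exp (- \<alpha> * (t - 0)) * energy y 0)) \<longlongrightarrow> 0) at_top"
    using tendsto_mult_right_zero[OF tendsto_mult_left_zero[OF exp_decay_tendsto[OF C(2)], of "energy y 0"], of "\<mu> * C"]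
    by (simp add: mult.assoc)
  have "((\<lambda>t. (y (Some i) t)\<^sup>2) \<longlongrightarrow> 0) at_top"
  proof (rule tendsto_sandwich[OF _ _ tendsto_const lim])
    show "\<forall>\<^sub>F t in at_top. (y (Some i) t)\<^sup>2 \<le> \<mu> * (C * exp (- \<alpha> * (t - 0)) * energy y 0)"
      unfolding eventually_at_top_linorder
    proof (intro exI[of _ 0] allI impI)
      fix t :: real assume t: "0 \<le> t"
      have "y (Some i) t * y (Some i) t / \<mu> \<le> energy y t"
        unfolding energy_def by (rule member_le_sum) (use \<mu> in auto)
      then have "(y (Some i) t)\<^sup>2 \<le> \<mu> * energy y t" using \<mu> by (simp add: field_simps power2_eq_square)
      also have "\<dots> \<le> \<mu> * (C * exp (- \<alpha> * (t - 0)) * energy y 0)" using C(3)[OF t] \<mu> by (intro mult_left_mono) auto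
      finally show "(y (Some i) t)\<^sup>2 \<le> \<mu> * (C * exp (- \<alpha> * (t - 0)) * energy y 0)" .
    qed
  qed auto
  then show ?thesis using tendsto_real_sqrt[of "\<lambda>t. (y (Some i) t)\<^sup>2" 0 at_top] tendsto_rabs_zero_cancel by simp
qed

end



section \<open>The stacked error system and its perturbations\<close>

lemma sum_UNIV_prod: "(\<Sum>p\<in>(UNIV :: ('a::finite \<times> 'b::finite) set). f p) = (\<Sum>i\<in>UNIV. \<Sum>j\<in>UNIV. f (i, j))"
  unfolding UNIV_Times_UNIV[symmetric] sum.cartesian_product by (simp add: case_prod_beta)

definition agent :: "real ^ ('N::finite \<times> 'n::finite) \<Rightarrow> 'N \<Rightarrow> real ^ 'n" where
  "agent w i = (\<chi> a. w $ (i, a))"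

lemma bounded_linear_agent: "bounded_linear (\<lambda>w :: real ^ ('N::finite \<times> 'n::finite). agent w i)"
  by (rule linear_conv_bounded_linear[THEN iffD1], rule linearI)
    (simp_all add: agent_def Finite_Cartesian_Product.vec_eq_iff)

lemma norm_agent: "(norm (w :: real ^ ('N::finite \<times> 'n::finite)))\<^sup>2 = (\<Sum>i\<in>UNIV. (norm (agent w i))\<^sup>2)"
  by (simp add: power2_norm_eq_inner inner_vec_def sum_UNIV_prod agent_def)

lemma norm_agent_le: "norm (agent w i) \<le> norm (w :: real ^ ('N::finite \<times> 'n::finite))"
proof -
  have "(norm (agent w i))\<^sup>2 \<le> (norm w)\<^sup>2"
    unfolding norm_agent by (rule member_le_sum) auto
  then show ?thesis by (simp add: abs_le_square_iff[symmetric])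
qed

lemma agent_kronecker:
  fixes w :: "real ^ ('N::finite \<times> 'n::finite)"
  shows "agent (kronecker P Q *v w) i = (\<Sum>j\<in>UNIV. P $ i $ j *\<^sub>R (Q *v agent w j))"
  by (simp add: Finite_Cartesian_Product.vec_eq_iff agent_def kronecker_def matrix_vector_mult_def
      sum_UNIV_prod sum_distrib_left mult_ac)

text \<open>An edge from the leader enters only through the degree on the diagonal; with \<xi> equal
  to 0 at the leader this is the missing difference.\<close>

lemma H_matrix_coupling:
  fixes \<xi> :: "'N::finite option \<Rightarrow> real"
  assumes "\<xi> None = 0" "(Some i, Some i) \<notin> E"
  shows "(\<Sum>j\<in>UNIV. H_matrix E $ i $ j * \<xi> (Some j)) = - (\<Sum>j\<in>neighbors E (Some i). \<xi> j - \<xi> (Some i))"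
proof -
  have "(\<Sum>j\<in>UNIV. H_matrix E $ i $ j * \<xi> (Some j)) = (\<Sum>j\<in>UNIV.
      (if j = i then real (card (neighbors E (Some i))) * \<xi> (Some i) else 0) -
      (if (Some j, Some i) \<in> E then \<xi> (Some j) else 0))"
    by (rule sum.cong[OF refl]) (use assms(2) in \<open>auto simp: H_matrix_def laplacian_def neighbors_def\<close>)
  also have "\<dots> = real (card (neighbors E (Some i))) * \<xi> (Some i) -
      (\<Sum>j\<in>UNIV. if (Some j, Some i) \<in> E then \<xi> (Some j) else 0)"
    by (simp add: sum_subtractf)
  also have "(\<Sum>j\<in>UNIV. if (Some j, Some i) \<in> E then \<xi> (Some j) else 0) = (\<Sum>j\<in>neighbors E (Some i). \<xi> j)"
    by (simp add: sum_option_neighbors assms(1))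
  finally show ?thesis by (simp add: sum_subtractf)
qed

definition network_matrix :: "real ^ 'n ^ 'n \<Rightarrow> real ^ 'n \<Rightarrow> real ^ 'n \<Rightarrow> ('N::finite option \<times> 'N option) set \<Rightarrow>
    real ^ ('N \<times> 'n::finite) ^ ('N \<times> 'n)" where
  "network_matrix S L F E =
     kronecker (Finite_Cartesian_Product.mat 1) S - kronecker (H_matrix E) (col_times_row L F)"

lemma agent_network_matrix:
  fixes w :: "real ^ ('N::finite \<times> 'n::finite)"
  assumes W: "\<And>j. W j = (case j of None \<Rightarrow> 0 | Some i \<Rightarrow> agent w i)" and "(Some i, Some i) \<notin> E"
  shows "agent (network_matrix S L F E *v w) i =
    S *v agent w i + (\<Sum>j\<in>neighbors E (Some i). F \<bullet> W j - F \<bullet> W (Some i)) *\<^sub>R L"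
proof -
  have "agent (network_matrix S L F E *v w) i =
      agent (kronecker (Finite_Cartesian_Product.mat 1) S *v w) i
      - agent (kronecker (H_matrix E) (col_times_row L F) *v w) i"
    unfolding network_matrix_def matrix_vector_mult_diff_rdistrib
    by (rule linear_diff[OF bounded_linear.linear[OF bounded_linear_agent[of i]]])
  also have "agent (kronecker (Finite_Cartesian_Product.mat 1) S *v w) i =
      (\<Sum>j\<in>UNIV. if i = j then S *v agent w j else 0)"
    unfolding agent_kronecker by (rule sum.cong[OF refl]) (simp add: Finite_Cartesian_Product.mat_def)
  also have "\<dots> = S *v agent w i" by simp
  also have "agent (kronecker (H_matrix E) (col_times_row L F) *v w) i
      = (\<Sum>j\<in>UNIV. H_matrix E $ i $ j * (F \<bullet> W (Some j))) *\<^sub>R L"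
    unfolding agent_kronecker by (simp add: col_times_row_vec W scaleR_sum_left)
  also have "\<dots> = - ((\<Sum>j\<in>neighbors E (Some i). F \<bullet> W j - F \<bullet> W (Some i)) *\<^sub>R L)"
    by (subst H_matrix_coupling[where \<xi> = "\<lambda>j. F \<bullet> W j"]) (use assms in auto)
  finally show ?thesis by simp
qed

context switching_network
begin

lemma G_no_loop: "0 \<le> t \<Longrightarrow> (Some i, Some i) \<notin> G t"
  using G_edges[of t "Some i" "Some i"] by auto

text \<open>The energy is equivalent to the squared norm of the stacked vector, which halves the
  rate and puts a root into the constant.\<close>

lemma network_exponentially_stable:
  assumes "dissipative_pair ((*v) S) ((\<bullet>) F) B L"
  shows "exponentially_stable (range ts) (\<lambda>t. network_matrix S L F (G t))"
proof -
  interpret dissipative_pair "(*v) S" "(\<bullet>) F" B L by (rule assms)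
  obtain C \<alpha> where C: "C > 0" "\<alpha> > 0" and dec: "\<And>t0 W t. t0 \<ge> 0 \<Longrightarrow> consensus (range ts) G t0 W \<Longrightarrow> t \<ge> t0 \<Longrightarrow>
    energy W t \<le> C * exp (- \<alpha> * (t - t0)) * energy W t0"
    using consensus_energy_decay[OF assms] by blast
  obtain c1 where c1: "c1 > 0" "\<And>x. c1 * (norm x)\<^sup>2 \<le> B x x" using positive_form_lower_bound[OF B B_pos] by blast
  obtain c2 where c2: "c2 > 0" "\<And>x y. norm (B x y) \<le> norm x * norm y * c2"
    using bounded_bilinear.pos_bounded[OF B] by auto
  define c where "c = sqrt (C * c2 / c1)"
  have c: "c > 0" unfolding c_def using C c1 c2 by simp
  have main: "norm (w t) \<le> c * exp (- (\<alpha> / 2) * (t - t0)) * norm (w t0)"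
    if t0: "t0 \<ge> 0" and w: "pw_derivative (range ts) t0 w (\<lambda>t. network_matrix S L F (G t) *v w t)" and t: "t \<ge> t0"
    for t0 w t
  proof -
    define W where "W j t = (case j of None \<Rightarrow> 0 | Some i \<Rightarrow> agent (w t) i)" for j t
    have "consensus (range ts) G t0 W"
      unfolding consensus_def
    proof (intro conjI allI)
      show "W None t = 0" for t by (simp add: W_def)
      fix i
      have "pw_derivative (range ts) t0 (\<lambda>t. agent (w t) i) (\<lambda>t. agent (network_matrix S L F (G t) *v w t) i)"
        by (rule pw_derivative_linear[OF w bounded_linear_agent])
      moreover have "agent (network_matrix S L F (G t) *v w t) i = S *v W (Some i) t +
          (\<Sum>j\<in>neighbors (G t) (Some i). F \<bullet> W j t - F \<bullet> W (Some i) t) *\<^sub>R L" if "t0 < t" for t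
        using agent_network_matrix[of "\<lambda>j. W j t" "w t" i "G t" S L F] G_no_loop[of t i] that t0
        by (simp add: W_def)
      ultimately show "pw_derivative (range ts) t0 (W (Some i)) (\<lambda>t. S *v W (Some i) t +
          (\<Sum>j\<in>neighbors (G t) (Some i). F \<bullet> W j t - F \<bullet> W (Some i) t) *\<^sub>R L)"
        unfolding pw_derivative_def by (simp add: W_def[of "Some i", abs_def])
    qed
    from dec[OF t0 this t] have e: "energy W t \<le> C * exp (- \<alpha> * (t - t0)) * energy W t0" .
    have lo: "c1 * (norm (w s))\<^sup>2 \<le> energy W s" for s
      unfolding norm_agent energy_def sum_distrib_left by (rule sum_mono) (simp add: W_def c1)
    have hi: "energy W s \<le> c2 * (norm (w s))\<^sup>2" for s
      unfolding norm_agent energy_def sum_distrib_left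
    proof (rule sum_mono)
      fix i show "B (W (Some i) s) (W (Some i) s) \<le> c2 * (norm (agent (w s) i))\<^sup>2"
        using c2(2)[of "agent (w s) i" "agent (w s) i"] by (simp add: W_def power2_eq_square mult_ac)
    qed
    have "c1 * (norm (w t))\<^sup>2 \<le> C * exp (- \<alpha> * (t - t0)) * (c2 * (norm (w t0))\<^sup>2)"
    proof -
      have "energy W t \<le> C * exp (- \<alpha> * (t - t0)) * (c2 * (norm (w t0))\<^sup>2)"
        by (rule order_trans[OF e mult_left_mono[OF hi]]) (use C in simp)
      then show ?thesis using lo[of t] by linarith
    qed
    then have "(norm (w t))\<^sup>2 \<le> (C * c2 / c1) * exp (- \<alpha> * (t - t0)) * (norm (w t0))\<^sup>2"
      using c1(1) by (simp add: field_simps)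
    also have "\<dots> = (c * exp (- (\<alpha> / 2) * (t - t0)) * norm (w t0))\<^sup>2"
    proof -
      have "(exp (- (\<alpha> / 2) * (t - t0)))\<^sup>2 = exp (2 * (- (\<alpha> / 2) * (t - t0)))" by (rule exp_double[symmetric])
      also have "\<dots> = exp (- \<alpha> * (t - t0))" by simp
      finally show ?thesis unfolding c_def power_mult_distrib using C c1 c2 by simp
    qed
    finally show ?thesis by (rule power2_le_imp_le) (use c in simp)
  qed
  show ?thesis unfolding exponentially_stable_def
    by (rule exI[of _ c], rule conjI[OF c], rule exI[of _ "\<alpha> / 2"], rule conjI)
      (use C(2) in simp, intro allI impI main)
qed

text \<open>The initial time need not be a switching instant: the grid \<open>s\<close> consists of
  \<open>t0\<close> followed by the later switching instants.\<close>

lemma linear_solution_exists: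
  fixes f :: "('N option \<times> 'N option) set \<Rightarrow> real ^ 'm ^ ('m::finite)"
  assumes t0: "0 \<le> t0"
  shows "\<exists>w. w t0 = w0 \<and> pw_derivative (range ts) t0 w (\<lambda>t. f (G t) *v w t)"
proof -
  obtain k0 where k0: "ts k0 \<le> t0" "t0 < ts (Suc k0)"
    using grid_index[of ts t0, OF ts_strict ts_unbounded] t0 ts_0 by auto
  define s where "s k = (case k of 0 \<Rightarrow> t0 | Suc k \<Rightarrow> ts (Suc (k0 + k)))" for k
  have s: "s 0 = t0" "s (Suc k) = ts (Suc (k0 + k))" for k unfolding s_def by auto
  have strict: "s k < s (Suc k)" for k
    using k0 ts_strict by (cases k) (auto simp: s)
  have unb: "\<exists>k. t < s k" for t
  proof -
    obtain k where "t < ts k" using ts_unbounded by auto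
    also have "\<dots> \<le> s (Suc k)" unfolding s by (rule ts_mono) simp
    finally show ?thesis by blast
  qed
  have const: "G t = G (ts (k0 + k))" if "t \<in> {s k<..<s (Suc k)}" for t k
    using that k0 by (cases k) (auto simp: s intro!: G_const)
  have "\<exists>w. w (s 0) = w0 \<and> pw_derivative (range s) (s 0) w (\<lambda>t. f (G t) *v w t)"
  proof (rule ode_switched_lipschitz[where g = "\<lambda>k t z. f (G (ts (k0 + k))) *v z", OF strict unb])
    fix k t z assume "t \<in> {s k<..<s (Suc k)}"
    then show "f (G t) *v z = f (G (ts (k0 + k))) *v z" using const by simp
  next
    fix k
    obtain K where "\<And>x. norm (f (G (ts (k0 + k))) *v x) \<le> norm x * K"
      using bounded_linear.bounded[OF matrix_vector_mul_bounded_linear] by blast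
    then show "\<exists>K. \<forall>t\<in>{s k..s (Suc k)}. \<forall>x y. norm (f (G (ts (k0 + k))) *v x - f (G (ts (k0 + k))) *v y) \<le> K * norm (x - y)"
      by (intro exI[of _ K]) (simp add: matrix_vector_mult_diff_distrib[symmetric] mult.commute)
  qed simp
  then obtain w where w: "w t0 = w0" "pw_derivative (range s) t0 w (\<lambda>t. f (G t) *v w t)" unfolding s by blast
  have "t \<notin> range s" if "t0 < t" "t \<notin> range ts" for t
  proof
    assume "t \<in> range s"
    then obtain k where "t = s k" by auto
    then show False using that by (cases k) (auto simp: s)
  qed
  then have "pw_derivative (range ts) t0 w (\<lambda>t. f (G t) *v w t)" using w(2) unfolding pw_derivative_def by blast
  then show ?thesis using w(1) by blast
qed

text \<open>On windows of a fixed length \<open>T\<close> the perturbed solution stays close to the unperturbed one, which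
  contracts by \<open>1/4\<close>.\<close>

lemma perturbed_linear_tendsto:
  fixes f :: "('N option \<times> 'N option) set \<Rightarrow> real ^ 'm ^ ('m::finite)"
  assumes stable: "exponentially_stable (range ts) (\<lambda>t. f (G t))"
    and w: "pw_derivative (range ts) 0 w (\<lambda>t. f (G t) *v w t + g t)"
    and g: "\<And>t. 0 \<le> t \<Longrightarrow> norm (g t) \<le> \<epsilon> t * (norm (w t) + c)" and c: "0 \<le> c" and \<epsilon>0: "\<And>t. 0 \<le> t \<Longrightarrow> 0 \<le> \<epsilon> t"
    and \<epsilon>: "(\<epsilon> \<longlongrightarrow> 0) at_top"
  shows "(w \<longlongrightarrow> 0) at_top"
proof -
  obtain c0 \<alpha> where c0: "c0 > 0" "\<alpha> > 0" and st: "\<And>t0 w t. t0 \<ge> 0 \<Longrightarrow> pw_derivative (range ts) t0 w (\<lambda>t. f (G t) *v w t) \<Longrightarrow> t \<ge> t0 \<Longrightarrow>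
    norm (w t) \<le> c0 * exp (- \<alpha> * (t - t0)) * norm (w t0)"
    using stable unfolding exponentially_stable_def by blast
  have "\<exists>K. \<forall>x. norm (f E *v x) \<le> norm x * K" for E
    using bounded_linear.bounded[OF matrix_vector_mul_bounded_linear[of "f E"]] by blast
  then obtain KE where KE: "\<And>E x. norm (f E *v x) \<le> norm x * KE E" by metis
  define K where "K = (\<Sum>E\<in>UNIV. \<bar>KE E\<bar>)"
  have K0: "K \<ge> 0" unfolding K_def by (simp add: sum_nonneg)
  have K: "norm (f E *v x) \<le> K * norm x" for E x
  proof -
    have "KE E \<le> K" unfolding K_def using member_le_sum[of E UNIV "\<lambda>E. \<bar>KE E\<bar>"] by simp
    then have "norm x * KE E \<le> norm x * K" by (intro mult_left_mono) auto
    then show ?thesis using KE[of E x] by (simp add: mult.commute)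
  qed
  obtain T where T: "T > 0" "c0 * exp (- \<alpha> * T) \<le> 1/4"
  proof -
    have "\<forall>\<^sub>F t in at_top. exp (- \<alpha> * t) < 1 / (4 * c0)"
      by (rule order_tendstoD[OF exp_decay_tendsto[OF c0(2)]]) (use c0 in simp)
    then have "\<forall>\<^sub>F t in at_top. exp (- \<alpha> * t) < 1 / (4 * c0) \<and> 0 < t"
      using eventually_gt_at_top[of "0::real"] by (rule eventually_conj)
    then obtain t where "exp (- \<alpha> * t) < 1 / (4 * c0)" "0 < t" using eventually_happens by fastforce
    then show ?thesis using that[of t] c0 by (simp add: field_simps)
  qed
  \<comment> \<open>The growth rate of the squared distance to the unperturbed solution:
    \<open>2 K\<close> from the matrix and 3 from the perturbation with gain at most 1.\<close>
  define k where "k = 2 * K + 3"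
  have k: "k \<ge> 1" unfolding k_def using K0 by simp
  \<comment> \<open>The growth over one window. Being at least 1 it may be replaced by its square,
    which lets a root be taken in the final estimate.\<close>
  define \<Lambda> where "\<Lambda> = exp (k * T)"
  have \<Lambda>: "\<Lambda> \<ge> 1" unfolding \<Lambda>_def using k T by simp
  have window: "norm (w t) \<le> c0 * exp (- \<alpha> * (t - t0)) * norm (w t0) + \<Lambda> * e * (c0 * norm (w t0) + c)"
    if t0: "0 \<le> t0" and e: "0 \<le> e" "e \<le> 1" "\<And>t. t \<ge> t0 \<Longrightarrow> \<epsilon> t \<le> e" and t: "t \<in> {t0..t0+T}" for t0 e t
  proof -
    obtain h where h: "h t0 = w t0" "pw_derivative (range ts) t0 h (\<lambda>t. f (G t) *v h t)"
      using linear_solution_exists[OF t0] by blast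
    define m where "m = c0 * norm (w t0) + c"
    have m0: "m \<ge> 0" unfolding m_def using c c0 by simp
    have h_bound: "norm (h s) \<le> c0 * exp (- \<alpha> * (s - t0)) * norm (w t0)" if "s \<ge> t0" for s
      using st[OF t0 h(2) that] h(1) by simp
    have h_bound': "norm (h s) \<le> c0 * norm (w t0)" if "s \<ge> t0" for s
    proof -
      have "c0 * exp (- \<alpha> * (s - t0)) * norm (w t0) \<le> c0 * 1 * norm (w t0)"
        using c0 that by (intro mult_right_mono mult_left_mono) auto
      then show ?thesis using h_bound[OF that] by simp
    qed
    have w': "pw_derivative (range ts) t0 w (\<lambda>t. f (G t) *v w t + g t)"
      by (rule pw_derivative_subset[OF w t0])
    define d where "d s = w s - h s" for s
    have d_cont: "continuous_on {t0..t} d"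
    proof -
      have "continuous_on {t0..} d" unfolding d_def[abs_def]
        using w' h(2) by (intro continuous_on_diff) (auto simp: pw_derivative_def)
      then show ?thesis by (rule continuous_on_subset) auto
    qed
    have "d t \<bullet> d t + (e * m)\<^sup>2 / k \<le> exp (k * (t - t0)) * (d t0 \<bullet> d t0 + (e * m)\<^sup>2 / k)"
    proof (rule pw_gronwall[OF finite_switching, where \<phi> = "\<lambda>s. d s \<bullet> d s"
        and \<phi>' = "\<lambda>s. 2 * (d s \<bullet> (f (G s) *v d s + g s))"])
      show "t0 \<le> t" "k \<noteq> 0" using t k by auto
      show "continuous_on {t0..t} (\<lambda>s. d s \<bullet> d s)" by (intro continuous_intros d_cont)
      fix s assume s: "t0 < s" "s < t" "s \<notin> range ts"
      have "(d has_vector_derivative (f (G s) *v d s + g s)) (at s)"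
      proof -
        have "(w has_vector_derivative (f (G s) *v w s + g s)) (at s)" "(h has_vector_derivative (f (G s) *v h s)) (at s)"
          using w' h(2) s unfolding pw_derivative_def by auto
        from has_vector_derivative_diff[OF this] show ?thesis
          unfolding d_def[abs_def] by (simp add: matrix_vector_mult_diff_distrib algebra_simps)
      qed
      from bounded_bilinear_quadratic_derivative[OF bounded_bilinear_inner inner_commute this]
      show "((\<lambda>s. d s \<bullet> d s) has_vector_derivative 2 * (d s \<bullet> (f (G s) *v d s + g s))) (at s)" .
      have gs: "norm (g s) \<le> e * norm (d s) + e * m"
      proof -
        have "norm (w s) \<le> norm (d s) + norm (h s)" unfolding d_def by (metis diff_add_cancel norm_triangle_ineq)
        then have "norm (w s) + c \<le> norm (d s) + m" using h_bound'[of s] s unfolding m_def by simp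
        moreover have "norm (g s) \<le> \<epsilon> s * (norm (w s) + c)" using g[of s] s t0 by simp
        moreover have "\<epsilon> s * (norm (w s) + c) \<le> e * (norm (d s) + m)"
          using e(3)[of s] s \<epsilon>0[of s] t0 calculation(1) c e(1) by (intro mult_mono) auto
        ultimately show ?thesis by (simp add: algebra_simps)
      qed
      have "d s \<bullet> (f (G s) *v d s) \<le> K * (d s \<bullet> d s)"
      proof -
        have "d s \<bullet> (f (G s) *v d s) \<le> norm (d s) * norm (f (G s) *v d s)" by (rule norm_cauchy_schwarz)
        also have "\<dots> \<le> norm (d s) * (K * norm (d s))" by (intro mult_left_mono K) auto
        finally show ?thesis by (simp add: power2_norm_eq_inner[symmetric] power2_eq_square mult_ac)
      qed
      moreover have "2 * (d s \<bullet> g s) \<le> 3 * (d s \<bullet> d s) + (e * m)\<^sup>2"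
      proof -
        have "d s \<bullet> g s \<le> norm (d s) * norm (g s)" by (rule norm_cauchy_schwarz)
        also have "\<dots> \<le> norm (d s) * (e * norm (d s) + e * m)" by (intro mult_left_mono gs) auto
        finally have "2 * (d s \<bullet> g s) \<le> 2 * (e * (norm (d s))\<^sup>2) + 2 * (norm (d s) * (e * m))"
          by (simp add: algebra_simps power2_eq_square)
        also have "e * (norm (d s))\<^sup>2 \<le> 1 * (norm (d s))\<^sup>2" using e by (intro mult_right_mono) auto
        also have "2 * (norm (d s) * (e * m)) \<le> (norm (d s))\<^sup>2 + (e * m)\<^sup>2"
          using sum_squares_bound[of "norm (d s)" "e * m"] by (simp add: mult_ac)
        finally show ?thesis by (simp add: power2_norm_eq_inner)
      qed
      ultimately show "2 * (d s \<bullet> (f (G s) *v d s + g s)) \<le> k * (d s \<bullet> d s) + (e * m)\<^sup>2"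
        unfolding k_def by (simp add: inner_add_right algebra_simps)
    qed
    then have gr: "d t \<bullet> d t + (e * m)\<^sup>2 / k \<le> exp (k * (t - t0)) * (d t0 \<bullet> d t0 + (e * m)\<^sup>2 / k)" .
    have "(norm (d t))\<^sup>2 \<le> exp (k * (t - t0)) * ((e * m)\<^sup>2 / k)"
    proof -
      have "0 \<le> (e * m)\<^sup>2 / k" using k by simp
      moreover have "d t0 \<bullet> d t0 = 0" by (simp add: d_def h(1))
      ultimately show ?thesis using gr unfolding power2_norm_eq_inner by (simp only: add_0)
    qed
    also have "\<dots> \<le> \<Lambda> * (e * m)\<^sup>2"
      unfolding \<Lambda>_def
    proof (rule mult_mono)
      show "(e * m)\<^sup>2 / k \<le> (e * m)\<^sup>2" using k mult_left_mono[OF k, of "(e * m)\<^sup>2"] by (simp add: divide_le_eq)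
    qed (use t k in auto)
    also have "\<dots> \<le> \<Lambda>\<^sup>2 * (e * m)\<^sup>2"
      using \<Lambda> self_le_power[of \<Lambda> 2] by (intro mult_right_mono) auto
    also have "\<dots> = (\<Lambda> * e * m)\<^sup>2" by (simp add: power_mult_distrib)
    finally have "norm (d t) \<le> \<Lambda> * e * m" by (rule power2_le_imp_le) (use \<Lambda> e m0 in simp)
    moreover have "norm (w t) \<le> norm (h t) + norm (d t)" unfolding d_def by (metis add.commute diff_add_cancel norm_triangle_ineq)
    ultimately show ?thesis using h_bound[of t] t unfolding m_def by simp
  qed
  show ?thesis
  proof (rule tendstoI)
    fix \<eta> :: real assume \<eta>: "0 < \<eta>"
    \<comment> \<open>Chosen such that the bound \<open>3 * \<eta>'\<close> at the window starts,
      carried through a window, stays below \<eta>.\<close>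
    define \<eta>' where "\<eta>' = \<eta> / (3 * (c0 + 1) + 2)"
    have \<eta>': "\<eta>' > 0" "(c0 + 1) * (3 * \<eta>') + \<eta>' < \<eta>"
    proof -
      have p: "0 < 3 * (c0 + 1) + 2" using c0 by simp
      then show "\<eta>' > 0" unfolding \<eta>'_def using \<eta> by simp
      have "\<eta>' * (3 * (c0 + 1) + 2) = \<eta>" unfolding \<eta>'_def using p by simp
      then show "(c0 + 1) * (3 * \<eta>') + \<eta>' < \<eta>" using \<open>\<eta>' > 0\<close> by (simp add: algebra_simps)
    qed
    define e where "e = min 1 (min (1 / (4 * \<Lambda> * c0)) (\<eta>' / (\<Lambda> * (c + 1))))"
    have e: "0 < e" "e \<le> 1" "\<Lambda> * e * c0 \<le> 1/4" "\<Lambda> * e * c \<le> \<eta>'"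
    proof -
      show e0: "0 < e" "e \<le> 1" unfolding e_def using \<Lambda> c0 \<eta>' c by auto
      have "e \<le> 1 / (4 * \<Lambda> * c0)" unfolding e_def by simp
      then show "\<Lambda> * e * c0 \<le> 1/4" using \<Lambda> c0 by (simp add: field_simps)
      have "e \<le> \<eta>' / (\<Lambda> * (c + 1))" unfolding e_def by simp
      then have "\<Lambda> * e * (c + 1) \<le> \<eta>'" using \<Lambda> c by (simp add: pos_le_divide_eq mult_ac)
      moreover have "\<Lambda> * e * c \<le> \<Lambda> * e * (c + 1)" using \<Lambda> e0 by (intro mult_left_mono) auto
      ultimately show "\<Lambda> * e * c \<le> \<eta>'" by linarith
    qed
    have "\<forall>\<^sub>F t in at_top. \<epsilon> t < e" by (rule order_tendstoD[OF \<epsilon>]) (rule e)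
    then obtain t1' where t1': "\<And>t. t \<ge> t1' \<Longrightarrow> \<epsilon> t < e" unfolding eventually_at_top_linorder by blast
    define t1 where "t1 = max 0 t1'"
    have t1: "t1 \<ge> 0" "\<And>t. t \<ge> t1 \<Longrightarrow> \<epsilon> t \<le> e" unfolding t1_def using t1' by (auto simp: less_imp_le)
    have win: "norm (w t) \<le> c0 * exp (- \<alpha> * (t - s)) * norm (w s) + 1/4 * norm (w s) + \<eta>'"
      if "s \<ge> t1" "t \<in> {s..s+T}" for s t
    proof -
      have "norm (w t) \<le> c0 * exp (- \<alpha> * (t - s)) * norm (w s) + \<Lambda> * e * (c0 * norm (w s) + c)"
        by (rule window) (use that t1 e in auto)
      moreover have "\<Lambda> * e * (c0 * norm (w s) + c) = (\<Lambda> * e * c0) * norm (w s) + \<Lambda> * e * c" by (simp add: algebra_simps)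
      moreover have "(\<Lambda> * e * c0) * norm (w s) \<le> 1/4 * norm (w s)" by (intro mult_right_mono e) auto
      ultimately show ?thesis using e(4) by linarith
    qed
    \<comment> \<open>Over a window the norm shrinks by 1/4 from stability plus 1/4 from the
      perturbation, up to \<open>\<eta>'\<close>; the fixed point of \<open>x / 2 + \<eta>'\<close>
      is \<open>2 * \<eta>'\<close>.\<close>
    have b: "norm (w (t1 + real j * T)) \<le> (1/2) ^ j * norm (w t1) + 2 * \<eta>'" for j
    proof (induction j)
      case 0 then show ?case using \<eta>' by simp
    next
      case (Suc j)
      let ?s = "t1 + real j * T"
      have "norm (w (?s + T)) \<le> c0 * exp (- \<alpha> * T) * norm (w ?s) + 1/4 * norm (w ?s) + \<eta>'"
        using win[of ?s "?s + T"] T by simp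
      moreover have "c0 * exp (- \<alpha> * T) * norm (w ?s) \<le> 1/4 * norm (w ?s)" by (intro mult_right_mono T) auto
      ultimately have "norm (w (?s + T)) \<le> 1/2 * norm (w ?s) + \<eta>'" by linarith
      then show ?case using Suc by (simp add: algebra_simps)
    qed
    have "((\<lambda>j. (1/2::real) ^ j * norm (w t1)) \<longlongrightarrow> 0) sequentially"
      by (intro tendsto_mult_left_zero LIMSEQ_power_zero) simp
    then have "\<forall>\<^sub>F j in sequentially. (1/2::real) ^ j * norm (w t1) < \<eta>'" by (rule order_tendstoD) (rule \<eta>')
    then obtain J where J: "\<And>j. j \<ge> J \<Longrightarrow> (1/2::real) ^ j * norm (w t1) < \<eta>'" unfolding eventually_sequentially by blast
    have "dist (w t) 0 < \<eta>" if t: "t \<ge> t1 + real J * T" for t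
    proof -
      define j where "j = nat \<lfloor>(t - t1) / T\<rfloor>"
      have q: "real J \<le> (t - t1) / T" using t T by (simp add: field_simps)
      then have q0: "0 \<le> (t - t1) / T" by (rule order_trans[rotated]) simp
      have "real j \<le> (t - t1) / T" "(t - t1) / T \<le> real j + 1" unfolding j_def using q0 by (auto simp: of_nat_nat)
      then have tt: "t \<in> {t1 + real j * T..t1 + real j * T + T}" using T by (auto simp: field_simps)
      have "J \<le> j" unfolding j_def using q by (simp add: le_nat_iff le_floor_iff)
      then have bj: "norm (w (t1 + real j * T)) \<le> 3 * \<eta>'" using b[of j] J[of j] by simp
      have "norm (w t) \<le> c0 * exp (- \<alpha> * (t - (t1 + real j * T))) * norm (w (t1 + real j * T)) + 1/4 * norm (w (t1 + real j * T)) + \<eta>'"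
        by (rule win) (use tt T in auto)
      also have "c0 * exp (- \<alpha> * (t - (t1 + real j * T))) * norm (w (t1 + real j * T)) \<le> c0 * 1 * norm (w (t1 + real j * T))"
        using c0 tt by (intro mult_right_mono mult_left_mono) auto
      also have "c0 * 1 * norm (w (t1 + real j * T)) + 1/4 * norm (w (t1 + real j * T)) \<le> (c0 + 1) * norm (w (t1 + real j * T))"
        by (simp add: algebra_simps)
      also have "\<dots> \<le> (c0 + 1) * (3 * \<eta>')" using bj c0 by (intro mult_left_mono) auto
      finally have "norm (w t) \<le> (c0 + 1) * (3 * \<eta>') + \<eta>'" by simp
      then show ?thesis using \<eta>' by simp
    qed
    then show "\<forall>\<^sub>F t in at_top. dist (w t) 0 < \<eta>" unfolding eventually_at_top_linorder by blast
  qed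
qed

end

section \<open>An admissible choice of the parameters\<close>

text \<open>The polynomial is \<open>(1 + z)^n\<close>, whose only possible root is -1.\<close>

lemma binomial_stable:
  fixes z :: complex
  assumes "z ^ n + (\<Sum>k=1..n. complex_of_real (real (n choose k)) * z ^ (n - k)) = 0"
  shows "Re z < 0"
proof -
  have "(1 + z) ^ n = (\<Sum>k\<le>n. of_nat (n choose k) * 1 ^ k * z ^ (n - k))" by (rule binomial_ring)
  also have "\<dots> = z ^ n + (\<Sum>k=1..n. complex_of_real (real (n choose k)) * z ^ (n - k))"
    by (simp add: atMost_atLeast0 sum.atLeast_Suc_atMost)
  finally have "(1 + z) ^ n = 0" using assms by simp
  then have "z = -1" using add_eq_0_iff by (metis power_not_zero)
  then show ?thesis by simp
qed

lemma sym_pos_def_one: "sym_pos_def m (1\<^sub>m m)"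
proof -
  have "0 < z \<bullet>\<^sub>v z" if z: "z \<in> carrier_vec m" "z \<noteq> 0\<^sub>v m" for z :: "real Matrix.vec"
  proof -
    obtain i where i: "i < m" "z $\<^sub>v i \<noteq> 0"
    proof (rule ccontr)
      assume "\<not> thesis"
      then have "z = 0\<^sub>v m" using that z(1) by (intro eq_vecI) auto
      then show False using z(2) by simp
    qed
    have "0 < (\<Sum>i = 0..<m. z $\<^sub>v i * z $\<^sub>v i)"
      by (rule sum_pos2[of _ i]) (use i in \<open>auto simp: zero_less_mult_iff linorder_neq_iff\<close>)
    then show ?thesis using z by (simp add: scalar_prod_def)
  qed
  then show ?thesis unfolding sym_pos_def_def by auto
qed

context switching_network
begin

lemma admissible_parameters_exist:
  assumes S: "marginally_stable S" and det: "detectable F S"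
  shows "\<exists>\<mu>1 \<mu>2 \<kappa> \<Lambda> \<beta> L0. admissible_parameters (range ts) G r m S F \<mu>1 \<mu>2 \<kappa> \<Lambda> \<beta> L0"
proof -
  obtain B L where L: "dissipative_pair ((*v) S) ((\<bullet>) F) B L" using dissipative_pair_exists[OF S det] by blast
  have st: "Re z < 0" if "z ^ (r i - 1) + (\<Sum>k=1..r i - 1. complex_of_real (real ((r i - 1) choose k)) * z ^ (r i - 1 - k)) = 0" for i z
    by (rule binomial_stable[OF that])
  have "admissible_parameters (range ts) G r m S F 1 1 (\<lambda>_. 1) (\<lambda>i. 1\<^sub>m (m i)) (\<lambda>i k. real ((r i - 1) choose k)) L"
    unfolding admissible_parameters_def
  proof (intro conjI allI ballI impI)
    show "exponentially_stable (range ts) (\<lambda>t. kronecker (Finite_Cartesian_Product.mat 1) S - kronecker (H_matrix (G t)) (col_times_row L F))"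
      using network_exponentially_stable[OF L] unfolding network_matrix_def .
    fix i z
    assume "z ^ (r i - 1) + (\<Sum>k=1..r i - 1. complex_of_real (real ((r i - 1) choose k)) * z ^ (r i - 1 - k)) = 0"
    then show "Re z < 0" by (rule st)
  qed (simp_all add: sym_pos_def_one)
  then show ?thesis by blast
qed

end


subsection \<open>Stable filters and adaptive tracking\<close>


lemma exp_decay_tendsto_shift:
  fixes \<alpha> :: real
  assumes "0 < \<alpha>"
  shows "((\<lambda>t. exp (- \<alpha> * (t - t0)) * c) \<longlongrightarrow> 0) at_top"
proof -
  have "exp (- \<alpha> * (t - t0)) * c = exp (- \<alpha> * t) * (exp (\<alpha> * t0) * c)" for t
    unfolding mult.assoc[symmetric] exp_add[symmetric] by (simp add: algebra_simps)
  then show ?thesis using tendsto_mult_left_zero[OF exp_decay_tendsto[OF assms], of "exp (\<alpha> * t0) * c"] by (simp only:)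
qed

text \<open>With \<open>a = - Re z\<close>, half of the decay of the squared norm absorbs the input,
  leaving the limit bound \<open>h^2 / a^2\<close>. The factor 2 in the conclusion makes room for
  the transient.\<close>

lemma stable_filter_bound:
  fixes \<eta> g :: "real \<Rightarrow> complex"
  assumes D: "\<And>a b. finite (D \<inter> {a..b})" and z: "Re z < 0" and c: "continuous_on {T..} \<eta>"
    and d: "\<And>t. T < t \<Longrightarrow> t \<notin> D \<Longrightarrow> (\<eta> has_vector_derivative z * \<eta> t + g t) (at t)"
    and h: "0 < h" and g: "\<forall>\<^sub>F t in at_top. norm (g t) \<le> h"
  shows "\<forall>\<^sub>F t in at_top. norm (\<eta> t) \<le> 2 / (- Re z) * h"
proof -
  define a where "a = - Re z"
  have a: "a > 0" unfolding a_def using z by simp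
  obtain T0 where T0: "\<And>t. t \<ge> T0 \<Longrightarrow> norm (g t) \<le> h" using g unfolding eventually_at_top_linorder by blast
  define T1 where "T1 = max T T0"
  have T1: "T \<le> T1" "\<And>t. t \<ge> T1 \<Longrightarrow> norm (g t) \<le> h" unfolding T1_def using T0 by auto
  have gr: "\<eta> t \<bullet> \<eta> t + (h\<^sup>2 / a) / (- a) \<le> exp (- a * (t - T1)) * (\<eta> T1 \<bullet> \<eta> T1 + (h\<^sup>2 / a) / (- a))" if t: "T1 \<le> t" for t
  proof (rule pw_gronwall[OF D t, where \<phi> = "\<lambda>s. \<eta> s \<bullet> \<eta> s" and \<phi>' = "\<lambda>s. 2 * (\<eta> s \<bullet> (z * \<eta> s + g s))"])
    have "continuous_on {T1..t} \<eta>" by (rule continuous_on_subset[OF c]) (use T1 in auto)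
    then show "continuous_on {T1..t} (\<lambda>s. \<eta> s \<bullet> \<eta> s)" by (intro continuous_intros)
    show "- a \<noteq> 0" using a by simp
    fix s assume s: "T1 < s" "s < t" "s \<notin> D"
    have "(\<eta> has_vector_derivative z * \<eta> s + g s) (at s)" by (rule d) (use s T1 in auto)
    from bounded_bilinear_quadratic_derivative[OF bounded_bilinear_inner inner_commute this]
    show "((\<lambda>s. \<eta> s \<bullet> \<eta> s) has_vector_derivative 2 * (\<eta> s \<bullet> (z * \<eta> s + g s))) (at s)" .
    have 1: "\<eta> s \<bullet> (z * \<eta> s) = - a * (\<eta> s \<bullet> \<eta> s)"
      unfolding a_def inner_complex_def by (simp add: algebra_simps)
    have "\<eta> s \<bullet> g s \<le> norm (\<eta> s) * norm (g s)" by (rule norm_cauchy_schwarz)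
    also have "\<dots> \<le> norm (\<eta> s) * h" using T1(2)[of s] s by (intro mult_left_mono) auto
    finally have 2: "2 * (\<eta> s \<bullet> g s) \<le> 2 * (norm (\<eta> s) * h)" by simp
    have "0 \<le> (a * norm (\<eta> s) - h)\<^sup>2 / a" using a by simp
    then have "2 * (norm (\<eta> s) * h) \<le> a * (norm (\<eta> s))\<^sup>2 + h\<^sup>2 / a"
      using a by (simp add: power2_eq_square field_simps)
    then have "2 * (\<eta> s \<bullet> g s) \<le> a * (\<eta> s \<bullet> \<eta> s) + h\<^sup>2 / a" using 2 by (simp add: power2_norm_eq_inner)
    then show "2 * (\<eta> s \<bullet> (z * \<eta> s + g s)) \<le> - a * (\<eta> s \<bullet> \<eta> s) + h\<^sup>2 / a"
      by (simp add: inner_add_right 1 algebra_simps)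
  qed
  have "((\<lambda>t. exp (- a * (t - T1)) * (\<eta> T1 \<bullet> \<eta> T1 + (h\<^sup>2 / a) / (- a))) \<longlongrightarrow> 0) at_top"
    by (rule exp_decay_tendsto_shift[OF a])
  then have "\<forall>\<^sub>F t in at_top. exp (- a * (t - T1)) * (\<eta> T1 \<bullet> \<eta> T1 + (h\<^sup>2 / a) / (- a)) < h\<^sup>2 / a\<^sup>2"
    by (rule order_tendstoD) (use a h in simp)
  then have "\<forall>\<^sub>F t in at_top. exp (- a * (t - T1)) * (\<eta> T1 \<bullet> \<eta> T1 + (h\<^sup>2 / a) / (- a)) < h\<^sup>2 / a\<^sup>2 \<and> T1 \<le> t"
    using eventually_ge_at_top by (rule eventually_conj)
  then show ?thesis
  proof (rule eventually_mono)
    fix t assume t: "exp (- a * (t - T1)) * (\<eta> T1 \<bullet> \<eta> T1 + (h\<^sup>2 / a) / (- a)) < h\<^sup>2 / a\<^sup>2 \<and> T1 \<le> t"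
    have "(h\<^sup>2 / a) / (- a) = - (h\<^sup>2 / a\<^sup>2)" by (simp add: power2_eq_square)
    then have "(norm (\<eta> t))\<^sup>2 \<le> 2 * (h\<^sup>2 / a\<^sup>2)" using gr[of t] t unfolding power2_norm_eq_inner by linarith
    also have "\<dots> \<le> (2 / a * h)\<^sup>2"
    proof -
      have "(2 / a * h)\<^sup>2 = 4 * (h\<^sup>2 / a\<^sup>2)" by (simp add: power_mult_distrib power_divide)
      moreover have "0 \<le> h\<^sup>2 / a\<^sup>2" by simp
      ultimately show ?thesis by linarith
    qed
    finally show "norm (\<eta> t) \<le> 2 / (- Re z) * h"
      unfolding a_def[symmetric] by (rule power2_le_imp_le) (use a h in simp)
  qed
qed

lemma has_vector_derivative_cmult:
  fixes c :: complex
  assumes "(f has_vector_derivative f') F"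
  shows "((\<lambda>t. c * f t) has_vector_derivative c * f') F"
  by (rule bounded_linear.has_vector_derivative[OF bounded_linear_mult_right assms])

text \<open>The bound is linear in \<open>b\<close> with one constant \<open>C\<close>. So the same
  statement yields boundedness for a fixed \<open>b\<close> and convergence when \<open>b\<close> is
  made small.\<close>

definition cascade_bound :: "real set \<Rightarrow> complex poly \<Rightarrow> nat \<Rightarrow> real \<Rightarrow> bool" where
  "cascade_bound D p n C \<longleftrightarrow> (\<forall>T b (e :: nat \<Rightarrow> real \<Rightarrow> complex) \<delta>. 0 < b \<longrightarrow> (\<forall>k<n. continuous_on {T..} (e k)) \<longrightarrow>
    (\<forall>k<n. \<forall>t>T. t \<notin> D \<longrightarrow> (e k has_vector_derivative e (Suc k) t + \<delta> k t) (at t)) \<longrightarrow>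
    (\<forall>k<n. \<forall>\<^sub>F t in at_top. norm (\<delta> k t) \<le> b) \<longrightarrow>
    (\<forall>\<^sub>F t in at_top. norm (\<Sum>k\<le>n. coeff p k * e k t) \<le> b) \<longrightarrow>
    (\<forall>k\<le>n. \<forall>\<^sub>F t in at_top. norm (e k t) \<le> C * b))"

text \<open>Each root of the polynomial is split off as a first-order stable filter.\<close>

lemma stable_cascade_bound:
  fixes p :: "complex poly"
  assumes D: "\<And>a b. finite (D \<inter> {a..b})"
    and "degree p = n" "lead_coeff p = 1" "\<And>z. poly p z = 0 \<Longrightarrow> Re z < 0"
  shows "\<exists>C>0. cascade_bound D p n C"
  using assms(2-)
proof (induction n arbitrary: p)
  case 0
  then have "coeff p 0 = 1" by simp
  then show ?case unfolding cascade_bound_def by (intro exI[of _ 1]) auto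
next
  case (Suc n)
  have "\<not> constant (poly p)" using Suc.prems(1) by (simp add: constant_degree)
  then obtain z where z: "poly p z = 0" using fundamental_theorem_of_algebra by blast
  \<comment> \<open>Reading \<open>e (Suc k)\<close> as the shift of \<open>e k\<close>, the
    combination \<eta> below is \<open>q\<close> applied to the shift. Its derivative is
    \<open>z * \<eta>\<close> plus the combination for \<open>p\<close>, up to the defects
    \<delta>.\<close>
  then obtain q where q: "p = [:- z, 1:] * q" by (metis poly_eq_0_iff_dvd dvdE)
  have q0: "q \<noteq> 0" using q Suc.prems(1) by auto
  have "degree p = degree [:- z, 1:] + degree q" unfolding q by (rule degree_mult_eq) (use q0 in auto)
  then have degq: "degree q = n" using Suc.prems(1) by simp
  have leadq: "lead_coeff q = 1" using Suc.prems(2) unfolding q lead_coeff_mult by simp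
  have rootq: "Re y < 0" if "poly q y = 0" for y using Suc.prems(3)[of y] that unfolding q by simp
  have rz: "Re z < 0" by (rule Suc.prems(3)[OF z])
  have coeffp: "coeff p k = (if k = 0 then 0 else coeff q (k - 1)) - z * coeff q k" for k
    unfolding q by (cases k) (simp_all add: coeff_pCons)
  have "\<exists>C>0. cascade_bound D q n C" by (rule Suc.IH[OF degq leadq]) (rule rootq)
  then obtain Cq where Cq: "Cq > 0" and IH: "cascade_bound D q n Cq" by blast
  define Q where "Q = (\<Sum>k\<le>n. norm (coeff q k))"
  define P where "P = (\<Sum>k\<le>n. norm (coeff p k))"
  \<comment> \<open>The filter bound for \<eta>, enlarged by 1 so that \<open>M * b\<close>
    dominates \<open>b\<close> too; the induction hypothesis takes one bound for both inputs.
    \<open>C\<close> then covers the lower signals and the top one, which is recovered because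
    \<open>p\<close> is monic.\<close>
  define M where "M = 1 + 2 / (- Re z) * (1 + Q)"
  define C where "C = Cq * M + (1 + P * (Cq * M))"
  have Q0: "Q \<ge> 0" and P0: "P \<ge> 0" unfolding Q_def P_def by (simp_all add: sum_nonneg)
  have M: "M \<ge> 1" unfolding M_def using rz Q0 by (simp add: divide_nonneg_neg)
  have C: "C > 0" unfolding C_def using Cq M P0 by (intro add_pos_pos add_pos_nonneg mult_pos_pos mult_nonneg_nonneg) auto
  show ?case
    unfolding cascade_bound_def
  proof (rule exI[of _ C], rule conjI[OF C], intro allI impI)
    fix T b k and e \<delta> :: "nat \<Rightarrow> real \<Rightarrow> complex"
    assume b: "0 < b" and cont: "\<forall>k<Suc n. continuous_on {T..} (e k)"
      and der: "\<forall>k<Suc n. \<forall>t>T. t \<notin> D \<longrightarrow> (e k has_vector_derivative e (Suc k) t + \<delta> k t) (at t)"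
      and \<delta>: "\<forall>k<Suc n. \<forall>\<^sub>F t in at_top. norm (\<delta> k t) \<le> b"
      and s: "\<forall>\<^sub>F t in at_top. norm (\<Sum>k\<le>Suc n. coeff p k * e k t) \<le> b" and k: "k \<le> Suc n"
    define \<eta> where "\<eta> t = (\<Sum>k\<le>n. coeff q k * e k t)" for t
    define g where "g t = (\<Sum>k\<le>Suc n. coeff p k * e k t) + (\<Sum>k\<le>n. coeff q k * \<delta> k t)" for t
    have shift: "(\<Sum>k\<le>Suc n. coeff p k * e k t) = (\<Sum>k\<le>n. coeff q k * e (Suc k) t) - z * \<eta> t" for t
    proof -
      have "(\<Sum>k\<le>Suc n. coeff p k * e k t) =
          (\<Sum>k\<le>Suc n. (if k = 0 then 0 else coeff q (k - 1)) * e k t) - z * (\<Sum>k\<le>Suc n. coeff q k * e k t)"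
        unfolding sum_distrib_left sum_subtractf[symmetric]
        by (rule sum.cong[OF refl]) (simp add: coeffp algebra_simps)
      also have "(\<Sum>k\<le>Suc n. (if k = 0 then 0 else coeff q (k - 1)) * e k t) = (\<Sum>k\<le>n. coeff q k * e (Suc k) t)"
        by (subst sum.atMost_Suc_shift) simp
      also have "(\<Sum>k\<le>Suc n. coeff q k * e k t) = \<eta> t"
        unfolding \<eta>_def using degq by (simp add: coeff_eq_0)
      finally show ?thesis .
    qed
    have \<eta>_cont: "continuous_on {T..} \<eta>"
      unfolding \<eta>_def using cont by (intro continuous_intros) auto
    have \<eta>_der: "(\<eta> has_vector_derivative z * \<eta> t + g t) (at t)" if t: "T < t" "t \<notin> D" for t
    proof -
      have "(\<eta> has_vector_derivative (\<Sum>k\<le>n. coeff q k * (e (Suc k) t + \<delta> k t))) (at t)"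
        unfolding \<eta>_def[abs_def]
        by (intro has_vector_derivative_sum has_vector_derivative_cmult) (use der t in auto)
      moreover have "(\<Sum>k\<le>n. coeff q k * (e (Suc k) t + \<delta> k t)) = z * \<eta> t + g t"
        unfolding g_def shift by (simp add: algebra_simps sum.distrib)
      ultimately show ?thesis by simp
    qed
    have "\<forall>\<^sub>F t in at_top. \<forall>k\<in>{..n}. norm (\<delta> k t) \<le> b"
      by (rule eventually_ball_finite) (use \<delta> in auto)
    with s have "\<forall>\<^sub>F t in at_top. norm (g t) \<le> (1 + Q) * b"
    proof eventually_elim
      case (elim t)
      have "norm (\<Sum>k\<le>n. coeff q k * \<delta> k t) \<le> (\<Sum>k\<le>n. norm (coeff q k) * b)"
        by (rule sum_norm_le) (use elim in \<open>auto simp: norm_mult intro: mult_left_mono\<close>)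
      also have "\<dots> = Q * b" unfolding Q_def by (simp add: sum_distrib_right)
      finally show ?case unfolding g_def
        using norm_triangle_ineq[of "\<Sum>k\<le>Suc n. coeff p k * e k t" "\<Sum>k\<le>n. coeff q k * \<delta> k t"] elim
        by (simp add: algebra_simps)
    qed
    from stable_filter_bound[OF D rz \<eta>_cont \<eta>_der _ this]
    have \<eta>b: "\<forall>\<^sub>F t in at_top. norm (\<eta> t) \<le> 2 / (- Re z) * ((1 + Q) * b)" using b Q0 by simp
    have Mb: "b \<le> M * b" "2 / (- Re z) * ((1 + Q) * b) \<le> M * b" "0 < M * b"
      using M b mult_right_mono[OF M, of b] unfolding M_def by (auto simp: algebra_simps)
    have "\<forall>k\<le>n. \<forall>\<^sub>F t in at_top. norm (e k t) \<le> Cq * (M * b)"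
    proof (rule IH[unfolded cascade_bound_def, THEN spec, THEN spec, THEN spec, THEN spec, THEN mp, THEN mp, THEN mp, THEN mp, THEN mp])
      show "0 < M * b" by (rule Mb)
      show "\<forall>k<n. continuous_on {T..} (e k)" using cont by simp
      show "\<forall>k<n. \<forall>t>T. t \<notin> D \<longrightarrow> (e k has_vector_derivative e (Suc k) t + \<delta> k t) (at t)" using der by simp
      show "\<forall>k<n. \<forall>\<^sub>F t in at_top. norm (\<delta> k t) \<le> M * b"
      proof (intro allI impI)
        fix k assume "k < n"
        then have "\<forall>\<^sub>F t in at_top. norm (\<delta> k t) \<le> b" using \<delta> by simp
        then show "\<forall>\<^sub>F t in at_top. norm (\<delta> k t) \<le> M * b" by (rule eventually_mono) (use Mb in linarith)
      qed
      show "\<forall>\<^sub>F t in at_top. norm (\<Sum>k\<le>n. coeff q k * e k t) \<le> M * b"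
        using \<eta>b unfolding \<eta>_def by (rule eventually_mono) (use Mb in linarith)
    qed
    then have low: "\<forall>\<^sub>F t in at_top. \<forall>k\<in>{..n}. norm (e k t) \<le> Cq * (M * b)"
      by (intro eventually_ball_finite) auto
    have CC: "Cq * (M * b) \<le> C * b" "b + P * (Cq * (M * b)) \<le> C * b"
      unfolding C_def using Cq M b P0 by (simp_all add: algebra_simps)
    show "\<forall>\<^sub>F t in at_top. norm (e k t) \<le> C * b"
    proof (cases "k \<le> n")
      case True
      from low show ?thesis
      proof eventually_elim
        case (elim t)
        then have "norm (e k t) \<le> Cq * (M * b)" using True by simp
        then show ?case using CC(1) by linarith
      qed
    next
      case False
      then have kn: "k = Suc n" using k by simp
      from low s show ?thesis
      proof eventually_elim
        case (elim t)
        have "coeff p (Suc n) = 1" using Suc.prems by simp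
        then have "e k t = (\<Sum>k\<le>Suc n. coeff p k * e k t) - (\<Sum>k\<le>n. coeff p k * e k t)" unfolding kn by simp
        then have "norm (e k t) \<le> norm (\<Sum>k\<le>Suc n. coeff p k * e k t) + norm (\<Sum>k\<le>n. coeff p k * e k t)"
          by (metis norm_triangle_ineq4)
        also have "norm (\<Sum>k\<le>n. coeff p k * e k t) \<le> (\<Sum>k\<le>n. norm (coeff p k) * (Cq * (M * b)))"
          by (rule sum_norm_le) (use elim in \<open>auto simp: norm_mult intro: mult_left_mono\<close>)
        also have "\<dots> = P * (Cq * (M * b))" unfolding P_def by (simp add: sum_distrib_right)
        finally show ?case using elim(2) CC(2) by linarith
      qed
    qed
  qed
qed

text \<open>Square integrability of \<open>s\<close> appears as a nonnegative \<open>V\<close> with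
  derivative \<open>- \<kappa> * s^2\<close>. If \<bar>s t\<bar> is at least \<eta>, the Lipschitz
  bound keeps \<bar>s\<bar> above \<open>\<eta> / 2\<close> for a fixed time, so \<open>V\<close>
  drops by a fixed amount. This cannot happen once \<open>V\<close> is closer to its infimum than
  that amount.\<close>

lemma barbalat:
  fixes V s :: "real \<Rightarrow> real"
  assumes D: "\<And>a b. finite (D \<inter> {a..b})" and \<kappa>: "0 < \<kappa>" and V0: "\<And>t. T \<le> t \<Longrightarrow> 0 \<le> V t"
    and Vc: "continuous_on {T..} V" and sc: "continuous_on {T..} s"
    and Vd: "\<And>t. T < t \<Longrightarrow> t \<notin> D \<Longrightarrow> (V has_vector_derivative - \<kappa> * (s t)\<^sup>2) (at t)"
    and sd: "\<And>t. T < t \<Longrightarrow> t \<notin> D \<Longrightarrow> (s has_vector_derivative s' t) (at t)"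
    and M: "\<And>t. T < t \<Longrightarrow> t \<notin> D \<Longrightarrow> \<bar>s' t\<bar> \<le> M"
  shows "(s \<longlongrightarrow> 0) at_top"
proof -
  define M' where "M' = \<bar>M\<bar> + 1"
  have M': "M' > 0" "\<And>t. T < t \<Longrightarrow> t \<notin> D \<Longrightarrow> \<bar>s' t\<bar> \<le> M'" unfolding M'_def using M by force+
  have mono: "V q \<le> V p" if "T \<le> p" "p \<le> q" for p q
  proof (rule pw_antimono[OF D that(2), where w = V and w' = "\<lambda>t. - \<kappa> * (s t)\<^sup>2"])
    show "continuous_on {p..q} V" by (rule continuous_on_subset[OF Vc]) (use that in auto)
    show "(V has_vector_derivative - \<kappa> * (s t)\<^sup>2) (at t)" if "p < t" "t < q" "t \<notin> D" for t
      by (rule Vd) (use that \<open>T \<le> p\<close> in auto)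
  qed (use \<kappa> in simp)
  have lip: "\<bar>s q - s p\<bar> \<le> M' * (q - p)" if pq: "T \<le> p" "p \<le> q" for p q
  proof -
    have "s q - M' * q \<le> s p - M' * p"
    proof (rule pw_antimono[OF D pq(2), where w = "\<lambda>t. s t - M' * t" and w' = "\<lambda>t. s' t - M'"])
      show "continuous_on {p..q} (\<lambda>t. s t - M' * t)"
        by (intro continuous_intros continuous_on_subset[OF sc]) (use pq in auto)
      fix t assume t: "p < t" "t < q" "t \<notin> D"
      have "(s has_real_derivative s' t) (at t)" using sd[of t] t pq by (simp add: has_real_derivative_iff_has_vector_derivative)
      then have "((\<lambda>t. s t - M' * t) has_real_derivative s' t - M') (at t)" by (auto intro!: derivative_eq_intros)
      then show "((\<lambda>t. s t - M' * t) has_vector_derivative s' t - M') (at t)"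
        by (simp add: has_real_derivative_iff_has_vector_derivative)
      show "s' t - M' \<le> 0" using M'(2)[of t] t pq by simp
    qed
    moreover have "- s q - M' * q \<le> - s p - M' * p"
    proof (rule pw_antimono[OF D pq(2), where w = "\<lambda>t. - s t - M' * t" and w' = "\<lambda>t. - s' t - M'"])
      show "continuous_on {p..q} (\<lambda>t. - s t - M' * t)"
        by (intro continuous_intros continuous_on_subset[OF sc]) (use pq in auto)
      fix t assume t: "p < t" "t < q" "t \<notin> D"
      have "(s has_real_derivative s' t) (at t)" using sd[of t] t pq by (simp add: has_real_derivative_iff_has_vector_derivative)
      then have "((\<lambda>t. - s t - M' * t) has_real_derivative - s' t - M') (at t)" by (auto intro!: derivative_eq_intros)
      then show "((\<lambda>t. - s t - M' * t) has_vector_derivative - s' t - M') (at t)"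
        by (simp add: has_real_derivative_iff_has_vector_derivative)
      show "- s' t - M' \<le> 0" using M'(2)[of t] t pq by simp
    qed
    ultimately show ?thesis by (simp add: algebra_simps abs_le_iff)
  qed
  show ?thesis
  proof (rule tendstoI)
    fix \<eta> :: real assume \<eta>: "0 < \<eta>"
    define h where "h = \<eta> / (2 * M')"
    define drop where "drop = \<kappa> * (\<eta> / 2)\<^sup>2 * h"
    have h: "h > 0" "M' * h = \<eta> / 2" unfolding h_def using \<eta> M' by auto
    have drop: "drop > 0" unfolding drop_def using h \<kappa> \<eta> by simp
    define l where "l = (INF t\<in>{T..}. V t)"
    have bdd: "bdd_below (V ` {T..})" using V0 by (intro bdd_belowI[of _ 0]) auto
    obtain t1 where t1: "T \<le> t1" "V t1 < l + drop"
      using cINF_less_iff[of "{T..}" V "l + drop"] bdd drop unfolding l_def by auto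
    have "\<bar>s t\<bar> < \<eta>" if t: "t1 \<le> t" for t
    proof (rule ccontr)
      assume ns: "\<not> \<bar>s t\<bar> < \<eta>"
      have tT: "T \<le> t" using t t1 by simp
      have big: "\<eta> / 2 \<le> \<bar>s q\<bar>" if "t \<le> q" "q \<le> t + h" for q
      proof -
        have "\<bar>s q - s t\<bar> \<le> M' * (q - t)" by (rule lip[OF tT]) (use that in simp)
        also have "\<dots> \<le> M' * h" using that M' by (intro mult_left_mono) auto
        finally show ?thesis using ns h by linarith
      qed
      have "V (t + h) + \<kappa> * (\<eta> / 2)\<^sup>2 * (t + h) \<le> V t + \<kappa> * (\<eta> / 2)\<^sup>2 * t"
      proof (rule pw_antimono[OF D, where w = "\<lambda>q. V q + \<kappa> * (\<eta> / 2)\<^sup>2 * q" and w' = "\<lambda>q. - \<kappa> * (s q)\<^sup>2 + \<kappa> * (\<eta> / 2)\<^sup>2"])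
        show "t \<le> t + h" using h by simp
        show "continuous_on {t..t + h} (\<lambda>q. V q + \<kappa> * (\<eta> / 2)\<^sup>2 * q)"
          by (intro continuous_intros continuous_on_subset[OF Vc]) (use tT in auto)
        fix q assume q: "t < q" "q < t + h" "q \<notin> D"
        have "(V has_real_derivative - \<kappa> * (s q)\<^sup>2) (at q)"
          using Vd[of q] q tT by (simp add: has_real_derivative_iff_has_vector_derivative)
        then have "((\<lambda>q. V q + \<kappa> * (\<eta> / 2)\<^sup>2 * q) has_real_derivative - \<kappa> * (s q)\<^sup>2 + \<kappa> * (\<eta> / 2)\<^sup>2) (at q)"
          by (auto intro!: derivative_eq_intros)
        then show "((\<lambda>q. V q + \<kappa> * (\<eta> / 2)\<^sup>2 * q) has_vector_derivative - \<kappa> * (s q)\<^sup>2 + \<kappa> * (\<eta> / 2)\<^sup>2) (at q)"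
          by (simp add: has_real_derivative_iff_has_vector_derivative)
        have "(\<eta> / 2)\<^sup>2 \<le> \<bar>s q\<bar>\<^sup>2" using big[of q] q \<eta> by (intro power_mono) auto
        then show "- \<kappa> * (s q)\<^sup>2 + \<kappa> * (\<eta> / 2)\<^sup>2 \<le> 0" using \<kappa> by simp
      qed
      then have "V (t + h) + drop \<le> V t" unfolding drop_def by (simp add: algebra_simps)
      moreover have "V t \<le> V t1" by (rule mono[OF t1(1) t])
      moreover have "l \<le> V (t + h)" unfolding l_def by (rule cINF_lower[OF bdd]) (use tT h in simp)
      ultimately show False using t1 by linarith
    qed
    then show "\<forall>\<^sub>F t in at_top. dist (s t) 0 < \<eta>" unfolding eventually_at_top_linorder by (auto simp: dist_norm)
  qed
qed

lemma bounded_coordinates_subsequence: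
  fixes X :: "nat \<Rightarrow> nat \<Rightarrow> real"
  assumes "\<And>n k. k < r \<Longrightarrow> \<bar>X n k\<bar> \<le> R"
  shows "\<exists>l \<rho>. strict_mono \<rho> \<and> (\<forall>e>0. \<forall>\<^sub>F n in sequentially. \<forall>k<r. \<bar>X (\<rho> n) k - l k\<bar> < e)"
proof -
  have "bounded ((\<lambda>x. x k) ` range X)" if "k \<in> {..<r}" for k
    unfolding bounded_iff using assms that by (intro exI[of _ R]) auto
  then have "\<forall>d\<subseteq>{..<r}. \<exists>l. \<exists>\<rho>. strict_mono \<rho> \<and>
      (\<forall>e>0. eventually (\<lambda>n. \<forall>i\<in>d. dist (X (\<rho> n) i) (l i) < e) sequentially)"
    by (intro compact_lemma_general[of "{..<r}" "\<lambda>x k. x k" X "\<lambda>f. f"]) auto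
  from this[rule_format, of "{..<r}"] show ?thesis by (auto simp: dist_real_def Ball_def)
qed



section \<open>Uniform bounds and Lipschitz constants on boxes\<close>

lemma vec_norm_L2: "x \<in> carrier_vec n \<Longrightarrow> vec_norm x = L2_set (\<lambda>k. x $\<^sub>v k) {..<n}"
  unfolding vec_norm_def L2_set_def by (auto simp: scalar_prod_def power2_eq_square atLeast0LessThan)

lemma vec_norm_nonneg: "x \<in> carrier_vec n \<Longrightarrow> 0 \<le> vec_norm x"
  by (simp add: vec_norm_L2 L2_set_nonneg)

lemma component_le_vec_norm: "x \<in> carrier_vec n \<Longrightarrow> k < n \<Longrightarrow> \<bar>x $\<^sub>v k\<bar> \<le> vec_norm x"
  unfolding vec_norm_L2 using member_le_L2_set[of "{..<n}" k "\<lambda>k. \<bar>x $\<^sub>v k\<bar>"] by (simp add: L2_set_def)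

lemma vec_norm_le_sum: "x \<in> carrier_vec n \<Longrightarrow> vec_norm x \<le> (\<Sum>k<n. \<bar>x $\<^sub>v k\<bar>)"
  unfolding vec_norm_L2 by (rule L2_set_le_sum_abs)

lemma vec_norm_le_diff:
  assumes "x \<in> carrier_vec n" "y \<in> carrier_vec n"
  shows "vec_norm x \<le> vec_norm (x - y) + vec_norm y"
proof -
  have "L2_set (\<lambda>k. (x - y) $\<^sub>v k + y $\<^sub>v k) {..<n} \<le> L2_set (\<lambda>k. (x - y) $\<^sub>v k) {..<n} + L2_set (\<lambda>k. y $\<^sub>v k) {..<n}"
    by (rule L2_set_triangle_ineq)
  moreover have "L2_set (\<lambda>k. (x - y) $\<^sub>v k + y $\<^sub>v k) {..<n} = L2_set (\<lambda>k. x $\<^sub>v k) {..<n}"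
    by (rule L2_set_cong) (use assms in auto)
  ultimately show ?thesis
    using vec_norm_L2[of x n] vec_norm_L2[of y n] vec_norm_L2[of "x - y" n] assms by simp
qed

lemma vec_norm_diff_le:
  assumes "x \<in> carrier_vec n" "y \<in> carrier_vec n"
  shows "vec_norm (x - y) \<le> vec_norm x + vec_norm y"
proof -
  have "L2_set (\<lambda>k. x $\<^sub>v k + - (y $\<^sub>v k)) {..<n} \<le> L2_set (\<lambda>k. x $\<^sub>v k) {..<n} + L2_set (\<lambda>k. - (y $\<^sub>v k)) {..<n}"
    by (rule L2_set_triangle_ineq)
  moreover have "L2_set (\<lambda>k. x $\<^sub>v k + - (y $\<^sub>v k)) {..<n} = L2_set (\<lambda>k. (x - y) $\<^sub>v k) {..<n}"
    by (rule L2_set_cong) (use assms in auto)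
  moreover have "L2_set (\<lambda>k. - (y $\<^sub>v k)) {..<n} = L2_set (\<lambda>k. y $\<^sub>v k) {..<n}"
    by (simp add: L2_set_def)
  ultimately show ?thesis
    using vec_norm_L2[of x n] vec_norm_L2[of y n] vec_norm_L2[of "x - y" n] assms by simp
qed

definition in_box :: "nat \<Rightarrow> real \<Rightarrow> real Matrix.vec \<Rightarrow> bool" where
  "in_box r R x \<longleftrightarrow> x \<in> carrier_vec r \<and> (\<forall>k<r. \<bar>x $\<^sub>v k\<bar> \<le> R)"

lemma box_subsequence:
  fixes X :: "nat \<Rightarrow> real Matrix.vec"
  assumes X: "\<And>n. in_box r R (X n)"
  shows "\<exists>l \<rho>. l \<in> carrier_vec r \<and> strict_mono \<rho> \<and> (\<forall>e>0. \<forall>\<^sub>F n in sequentially. vec_norm (X (\<rho> n) - l) < e)"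
proof -
  obtain l \<rho> where \<rho>: "strict_mono \<rho>" and
    lim: "\<And>e. e > 0 \<Longrightarrow> \<forall>\<^sub>F n in sequentially. \<forall>k<r. \<bar>X (\<rho> n) $\<^sub>v k - l k\<bar> < e"
    using bounded_coordinates_subsequence[of r "\<lambda>n k. X n $\<^sub>v k" R] X unfolding in_box_def by blast
  define l' where "l' = Matrix.vec r l"
  have "\<forall>\<^sub>F n in sequentially. vec_norm (X (\<rho> n) - l') < e" if e: "e > 0" for e
  proof -
    have "\<forall>\<^sub>F n in sequentially. \<forall>k<r. \<bar>X (\<rho> n) $\<^sub>v k - l k\<bar> < e / (real r + 1)" by (rule lim) (use e in simp)
    then show ?thesis
    proof (rule eventually_mono)
      fix n assume n: "\<forall>k<r. \<bar>X (\<rho> n) $\<^sub>v k - l k\<bar> < e / (real r + 1)"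
      have c: "X (\<rho> n) \<in> carrier_vec r" "l' \<in> carrier_vec r" using X unfolding in_box_def l'_def by auto
      have "vec_norm (X (\<rho> n) - l') \<le> (\<Sum>k<r. \<bar>(X (\<rho> n) - l') $\<^sub>v k\<bar>)" using c by (intro vec_norm_le_sum) auto
      also have "\<dots> \<le> (\<Sum>k<r. e / (real r + 1))"
        by (rule sum_mono) (use n c in \<open>auto simp: l'_def less_imp_le\<close>)
      also have "\<dots> < e" using e by (simp add: field_simps)
      finally show "vec_norm (X (\<rho> n) - l') < e" .
    qed
  qed
  then show ?thesis using \<rho> unfolding l'_def by (intro exI[of _ "Matrix.vec r l"] exI[of _ \<rho>]) auto
qed

text \<open>The bound \<phi> is an arbitrary function, possibly unbounded on the box. Near an
  accumulation point \<open>l\<close> of a hypothetical unbounded sequence, the local Lipschitz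
  condition bounds \<open>f\<close> by its bound at \<open>l\<close> plus
  \<open>K * \<delta>\<close>.\<close>

lemma uniform_bound_on_box:
  assumes car: "\<forall>x\<in>carrier_vec r. \<forall>t\<ge>0. f x t \<in> carrier_vec m"
    and lip: "locally_lipschitz_uniform r f"
    and bnd: "\<exists>\<phi>. \<forall>x\<in>carrier_vec r. \<forall>t\<ge>0. vec_norm (f x t) \<le> \<phi> x"
  shows "\<exists>M. \<forall>x. in_box r R x \<longrightarrow> (\<forall>t\<ge>0. vec_norm (f x t) \<le> M)"
proof (rule ccontr)
  assume "\<not> ?thesis"
  then have "\<forall>n. \<exists>x t. in_box r R x \<and> t \<ge> 0 \<and> real n < vec_norm (f x t)" by (meson not_le)
  then obtain X t where X: "\<And>n. in_box r R (X n)" "\<And>n. t n \<ge> 0" "\<And>n. real n < vec_norm (f (X n) (t n))" by metis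
  obtain l \<rho> where l: "l \<in> carrier_vec r" "strict_mono \<rho>"
    and lim: "\<And>e. e > 0 \<Longrightarrow> \<forall>\<^sub>F n in sequentially. vec_norm (X (\<rho> n) - l) < e"
    using box_subsequence[of r R X, OF X(1)] by blast
  obtain \<delta> K where \<delta>: "\<delta> > 0" "K \<ge> 0" and K: "\<And>a b t. a \<in> carrier_vec r \<Longrightarrow> b \<in> carrier_vec r \<Longrightarrow>
      vec_norm (a - l) < \<delta> \<Longrightarrow> vec_norm (b - l) < \<delta> \<Longrightarrow> t \<ge> 0 \<Longrightarrow> vec_norm (f a t - f b t) \<le> K * vec_norm (a - b)"
    using lip l(1) unfolding locally_lipschitz_uniform_def by meson
  obtain \<phi> where \<phi>: "\<And>x t. x \<in> carrier_vec r \<Longrightarrow> t \<ge> 0 \<Longrightarrow> vec_norm (f x t) \<le> \<phi> x" using bnd by blast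
  have ll: "vec_norm (l - l) < \<delta>"
  proof -
    have "vec_norm (l - l) \<le> (\<Sum>k<r. \<bar>(l - l) $\<^sub>v k\<bar>)" using l by (intro vec_norm_le_sum) auto
    also have "\<dots> = 0" using l by simp
    finally show ?thesis using \<delta> by linarith
  qed
  have "\<forall>\<^sub>F n in sequentially. vec_norm (X (\<rho> n) - l) < \<delta> \<and> nat \<lceil>K * \<delta> + \<phi> l\<rceil> \<le> n"
    using lim[OF \<delta>(1)] eventually_ge_at_top by (rule eventually_conj)
  then obtain n where n: "vec_norm (X (\<rho> n) - l) < \<delta>" "nat \<lceil>K * \<delta> + \<phi> l\<rceil> \<le> n"
    using eventually_happens[of _ sequentially] by auto
  let ?x = "X (\<rho> n)" and ?t = "t (\<rho> n)"
  have c: "?x \<in> carrier_vec r" using X unfolding in_box_def by auto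
  have "vec_norm (f ?x ?t) \<le> vec_norm (f ?x ?t - f l ?t) + vec_norm (f l ?t)"
    by (rule vec_norm_le_diff[of _ m]) (use car c l X(2) in auto)
  also have "\<dots> \<le> K * \<delta> + \<phi> l"
  proof (rule add_mono)
    have "vec_norm (f ?x ?t - f l ?t) \<le> K * vec_norm (?x - l)" by (rule K[OF c l(1) n(1) ll X(2)])
    also have "\<dots> \<le> K * \<delta>" using n \<delta> by (intro mult_left_mono) auto
    finally show "vec_norm (f ?x ?t - f l ?t) \<le> K * \<delta>" .
    show "vec_norm (f l ?t) \<le> \<phi> l" by (rule \<phi>[OF l(1) X(2)])
  qed
  also have "\<dots> \<le> real n" using n(2) by linarith
  also have "real n \<le> real (\<rho> n)" using strict_mono_imp_increasing[OF l(2)] by simp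
  finally show False using X(3)[of "\<rho> n"] by simp
qed

text \<open>Take pairs whose difference quotients exceed every \<open>n\<close>. As \<open>f\<close>
  is bounded on the box, the two points of a pair approach each other; near an accumulation point
  both lie in one neighbourhood with a local Lipschitz constant, a contradiction.\<close>

lemma uniform_lipschitz_on_box:
  assumes car: "\<forall>x\<in>carrier_vec r. \<forall>t\<ge>0. f x t \<in> carrier_vec m"
    and lip: "locally_lipschitz_uniform r f"
    and bnd: "\<exists>\<phi>. \<forall>x\<in>carrier_vec r. \<forall>t\<ge>0. vec_norm (f x t) \<le> \<phi> x"
  shows "\<exists>K\<ge>0. \<forall>x y. in_box r R x \<longrightarrow> in_box r R y \<longrightarrow>
    (\<forall>t\<ge>0. vec_norm (f x t - f y t) \<le> K * vec_norm (x - y))"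
proof (rule ccontr)
  assume no: "\<not> ?thesis"
  have "\<exists>x y t. in_box r R x \<and> in_box r R y \<and> t \<ge> 0 \<and> real n * vec_norm (x - y) < vec_norm (f x t - f y t)" for n
  proof (rule ccontr)
    assume "\<not> ?thesis"
    then have "\<forall>x y. in_box r R x \<longrightarrow> in_box r R y \<longrightarrow> (\<forall>t\<ge>0. vec_norm (f x t - f y t) \<le> real n * vec_norm (x - y))"
      by (meson not_le)
    then have "\<exists>K\<ge>0. \<forall>x y. in_box r R x \<longrightarrow> in_box r R y \<longrightarrow> (\<forall>t\<ge>0. vec_norm (f x t - f y t) \<le> K * vec_norm (x - y))"
      by (intro exI[of _ "real n"] conjI of_nat_0_le_iff)
    with no show False by (rule notE)
  qed
  then obtain X Y t where X: "\<And>n. in_box r R (X n)" "\<And>n. in_box r R (Y n)" "\<And>n. t n \<ge> 0"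
    "\<And>n. real n * vec_norm (X n - Y n) < vec_norm (f (X n) (t n) - f (Y n) (t n))" by metis
  have Xc: "X n \<in> carrier_vec r" "Y n \<in> carrier_vec r" for n using X unfolding in_box_def by auto
  obtain M where M: "\<And>x t. in_box r R x \<Longrightarrow> t \<ge> 0 \<Longrightarrow> vec_norm (f x t) \<le> M"
    using uniform_bound_on_box[OF car lip bnd] by blast
  obtain l \<rho> where l: "l \<in> carrier_vec r" "strict_mono \<rho>"
    and lim: "\<And>e. e > 0 \<Longrightarrow> \<forall>\<^sub>F n in sequentially. vec_norm (X (\<rho> n) - l) < e"
    using box_subsequence[of r R X, OF X(1)] by blast
  obtain \<delta> K where \<delta>: "\<delta> > 0" "K \<ge> 0" and K: "\<And>a b t. a \<in> carrier_vec r \<Longrightarrow> b \<in> carrier_vec r \<Longrightarrow>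
      vec_norm (a - l) < \<delta> \<Longrightarrow> vec_norm (b - l) < \<delta> \<Longrightarrow> t \<ge> 0 \<Longrightarrow> vec_norm (f a t - f b t) \<le> K * vec_norm (a - b)"
    using lip l(1) unfolding locally_lipschitz_uniform_def by meson
  have "\<forall>\<^sub>F n in sequentially. vec_norm (X (\<rho> n) - l) < \<delta> / 2 \<and> nat \<lceil>K\<rceil> + nat \<lceil>4 * M / \<delta>\<rceil> + 1 \<le> n"
    using lim[of "\<delta> / 2"] \<delta> eventually_ge_at_top by (intro eventually_conj) auto
  then obtain n where n: "vec_norm (X (\<rho> n) - l) < \<delta> / 2" "nat \<lceil>K\<rceil> + nat \<lceil>4 * M / \<delta>\<rceil> + 1 \<le> n"
    using eventually_happens[of _ sequentially] by auto
  let ?x = "X (\<rho> n)" and ?y = "Y (\<rho> n)" and ?t = "t (\<rho> n)"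
  have \<rho>n: "n \<le> \<rho> n" by (rule strict_mono_imp_increasing[OF l(2)])
  have big: "K \<le> real (\<rho> n)" "4 * M / \<delta> \<le> real (\<rho> n)" "0 < real (\<rho> n)" using n(2) \<rho>n by linarith+
  have fx: "vec_norm (f ?x ?t - f ?y ?t) \<le> 2 * M"
  proof -
    have "f ?x ?t \<in> carrier_vec m" "f ?y ?t \<in> carrier_vec m"
      using bspec[OF car Xc(1)[of "\<rho> n"]] bspec[OF car Xc(2)[of "\<rho> n"]] X(3)[of "\<rho> n"] by simp_all
    from vec_norm_diff_le[OF this] show ?thesis
      using M[OF X(1) X(3), of "\<rho> n" "\<rho> n"] M[OF X(2) X(3), of "\<rho> n" "\<rho> n"] by linarith
  qed
  have "real (\<rho> n) * vec_norm (?x - ?y) < 2 * M" using X(4)[of "\<rho> n"] fx by linarith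
  moreover have "2 * M \<le> real (\<rho> n) * (\<delta> / 2)" using big(2) \<delta> by (simp add: field_simps)
  ultimately have "real (\<rho> n) * vec_norm (?x - ?y) < real (\<rho> n) * (\<delta> / 2)" by linarith
  then have xy: "vec_norm (?x - ?y) < \<delta> / 2" using big(3) by simp
  have "vec_norm (?y - l) \<le> vec_norm ((?y - l) - (?x - l)) + vec_norm (?x - l)"
    by (rule vec_norm_le_diff[of _ r]) (use Xc l in auto)
  also have "(?y - l) - (?x - l) = ?y - ?x" using Xc[of "\<rho> n"] l by (intro eq_vecI) auto
  also have "vec_norm (?y - ?x) = vec_norm (?x - ?y)"
    using Xc[of "\<rho> n"] by (simp add: vec_norm_L2[of _ r] L2_set_def power2_commute)
  finally have yl: "vec_norm (?y - l) < \<delta>" using xy n by linarith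
  have "vec_norm (f ?x ?t - f ?y ?t) \<le> K * vec_norm (?x - ?y)"
    by (rule K) (use Xc X n yl \<delta> in auto)
  also have "\<dots> \<le> real (\<rho> n) * vec_norm (?x - ?y)"
    using big(1) vec_norm_nonneg[of "?x - ?y" r] Xc by (intro mult_right_mono) auto
  finally show False using X(4)[of "\<rho> n"] by simp
qed

section \<open>The quadratic form of the adaptation gain\<close>

text \<open>The arguments are coordinate functions, so that parameter errors can be read directly
  off the state of a differential equation.\<close>

definition quad :: "nat \<Rightarrow> real Matrix.mat \<Rightarrow> (nat \<Rightarrow> real) \<Rightarrow> (nat \<Rightarrow> real) \<Rightarrow> real" where
  "quad m \<Lambda> y z = (\<Sum>l<m. \<Sum>j<m. y l * \<Lambda> $$ (l, j) * z j)"

lemma quad_diff_scale: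
  "quad m \<Lambda> (\<lambda>l. y l - c * z l) (\<lambda>l. y l - c * z l)
    = quad m \<Lambda> y y - c * quad m \<Lambda> y z - c * quad m \<Lambda> z y + c\<^sup>2 * quad m \<Lambda> z z"
  unfolding quad_def by (simp add: algebra_simps sum.distrib sum_subtractf sum_distrib_left power2_eq_square)

lemma quad_sym:
  assumes "sym_pos_def m \<Lambda>"
  shows "quad m \<Lambda> y z = quad m \<Lambda> z y"
proof -
  have eq: "\<Lambda> $$ (l, j) = \<Lambda> $$ (j, l)" if "l < m" "j < m" for l j
  proof -
    have "\<Lambda> \<in> carrier_mat m m" and "transpose_mat \<Lambda> = \<Lambda>" using assms unfolding sym_pos_def_def by auto
    then show ?thesis using index_transpose_mat(1)[of l \<Lambda> j] that by simp
  qed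
  have "quad m \<Lambda> y z = (\<Sum>j<m. \<Sum>l<m. y l * \<Lambda> $$ (l, j) * z j)"
    unfolding quad_def by (rule sum.swap)
  also have "\<dots> = quad m \<Lambda> z y"
    unfolding quad_def
  proof (intro sum.cong refl)
    fix j l assume "j \<in> {..<m}" "l \<in> {..<m}"
    then show "y l * \<Lambda> $$ (l, j) * z j = z j * \<Lambda> $$ (j, l) * y l" using eq[of l j] by simp
  qed
  finally show ?thesis .
qed

lemma quad_pos:
  assumes "sym_pos_def m \<Lambda>" "l < m" "y l \<noteq> 0"
  shows "0 < quad m \<Lambda> y y"
proof -
  have L: "\<Lambda> \<in> carrier_mat m m" using assms unfolding sym_pos_def_def by auto
  let ?z = "Matrix.vec m y"
  have "?z \<noteq> 0\<^sub>v m"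
  proof
    assume "?z = 0\<^sub>v m"
    then have "?z $\<^sub>v l = 0\<^sub>v m $\<^sub>v l" by simp
    then show False using assms by simp
  qed
  then have "0 < ?z \<bullet>\<^sub>v (\<Lambda> *\<^sub>v ?z)" using assms(1) unfolding sym_pos_def_def by auto
  also have "?z \<bullet>\<^sub>v (\<Lambda> *\<^sub>v ?z) = quad m \<Lambda> y y"
    using L unfolding quad_def by (auto simp: scalar_prod_def sum_distrib_left mult.assoc atLeast0LessThan intro!: sum.cong)
  finally show ?thesis .
qed

lemma quad_nonneg:
  assumes "sym_pos_def m \<Lambda>"
  shows "0 \<le> quad m \<Lambda> y y"
proof (cases "\<exists>l<m. y l \<noteq> 0")
  case True then show ?thesis using quad_pos[OF assms] by (auto simp: less_imp_le)
qed (auto simp: quad_def)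

lemma sym_pos_def_inverse:
  assumes "sym_pos_def m \<Lambda>"
  shows "the (mat_inverse \<Lambda>) \<in> carrier_mat m m" "\<Lambda> * the (mat_inverse \<Lambda>) = 1\<^sub>m m"
proof -
  have L: "\<Lambda> \<in> carrier_mat m m" using assms unfolding sym_pos_def_def by auto
  have "Determinant.det \<Lambda> \<noteq> 0"
  proof
    assume "Determinant.det \<Lambda> = 0"
    then obtain v where v: "v \<in> carrier_vec m" "v \<noteq> 0\<^sub>v m" "\<Lambda> *\<^sub>v v = 0\<^sub>v m"
      using det_0_iff_vec_prod_zero_field[OF L] by auto
    then have "0 < v \<bullet>\<^sub>v (\<Lambda> *\<^sub>v v)" using assms unfolding sym_pos_def_def by blast
    then show False using v by simp
  qed
  then have "\<Lambda> \<in> Units (ring_mat TYPE(real) m ())" by (rule det_non_zero_imp_unit[OF L])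
  then obtain X where X: "mat_inverse \<Lambda> = Some X" using mat_inverse(1)[OF L, where b = "()"] by (cases "mat_inverse \<Lambda>") auto
  from mat_inverse(2)[OF L X] show "the (mat_inverse \<Lambda>) \<in> carrier_mat m m" "\<Lambda> * the (mat_inverse \<Lambda>) = 1\<^sub>m m"
    using X by auto
qed

text \<open>The cancellation behind the adaptation law: the gain in the Lyapunov function undoes the
  inverse gain in the update.\<close>

lemma quad_inverse:
  assumes spd: "sym_pos_def m \<Lambda>" and v: "v \<in> carrier_vec m"
  shows "quad m \<Lambda> y (\<lambda>l. (the (mat_inverse \<Lambda>) *\<^sub>v v) $\<^sub>v l) = (\<Sum>l<m. y l * v $\<^sub>v l)"
proof -
  let ?X = "the (mat_inverse \<Lambda>)"
  have L: "\<Lambda> \<in> carrier_mat m m" using spd unfolding sym_pos_def_def by auto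
  note X = sym_pos_def_inverse[OF spd]
  have "\<Lambda> *\<^sub>v (?X *\<^sub>v v) = v" using assoc_mult_mat_vec[OF L X(1) v] X(2) v by simp
  then have e: "v $\<^sub>v l = (\<Sum>j<m. \<Lambda> $$ (l, j) * (?X *\<^sub>v v) $\<^sub>v j)" if "l < m" for l
  proof -
    have "v $\<^sub>v l = (\<Lambda> *\<^sub>v (?X *\<^sub>v v)) $\<^sub>v l" using \<open>\<Lambda> *\<^sub>v (?X *\<^sub>v v) = v\<close> by simp
    also have "\<dots> = (\<Sum>j<m. \<Lambda> $$ (l, j) * (?X *\<^sub>v v) $\<^sub>v j)"
      using L X(1) that by (subst index_mult_mat_vec) (auto simp: scalar_prod_def atLeast0LessThan simp del: index_mult_mat_vec)
    finally show ?thesis .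
  qed
  show ?thesis unfolding quad_def
    by (rule sum.cong[OF refl]) (simp add: e sum_distrib_left mult.assoc del: index_mult_mat_vec)
qed

text \<open>Each coordinate is the pairing with a column of the inverse, so Cauchy-Schwarz for the form bounds it.\<close>

lemma quad_component_bound:
  assumes spd: "sym_pos_def m \<Lambda>"
  shows "\<exists>K\<ge>0. \<forall>y. \<forall>l<m. (y l)\<^sup>2 \<le> K * quad m \<Lambda> y y"
proof -
  define z where "z l j = (the (mat_inverse \<Lambda>) *\<^sub>v unit_vec m l) $\<^sub>v j" for l j
  have pair: "quad m \<Lambda> y (z l) = y l" if "l < m" for y l
  proof -
    have "quad m \<Lambda> y (z l) = (\<Sum>j<m. y j * unit_vec m l $\<^sub>v j)"
      unfolding z_def by (rule quad_inverse[OF spd]) simp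
    also have "\<dots> = (\<Sum>j<m. if j = l then y l else 0)" by (rule sum.cong[OF refl]) (use that in auto)
    finally show ?thesis using that by simp
  qed
  define K where "K = (\<Sum>l<m. quad m \<Lambda> (z l) (z l))"
  have K: "quad m \<Lambda> (z l) (z l) \<le> K" if "l < m" for l
    unfolding K_def by (rule member_le_sum) (use that quad_nonneg[OF spd] in auto)
  have "(y l)\<^sup>2 \<le> K * quad m \<Lambda> y y" if l: "l < m" for y l
  proof -
    have zp: "0 < quad m \<Lambda> (z l) (z l)"
    proof (rule ccontr)
      assume "\<not> 0 < quad m \<Lambda> (z l) (z l)"
      then have "\<forall>j<m. z l j = 0" using quad_pos[OF spd] by blast
      then have "quad m \<Lambda> (\<lambda>_. 1) (z l) = 0" unfolding quad_def by simp
      then show False using pair[OF l, of "\<lambda>_. 1"] by simp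
    qed
    \<comment> \<open>The minimiser over \<open>c\<close> of the quadratic in the next line.\<close>
    define c where "c = y l / quad m \<Lambda> (z l) (z l)"
    have "0 \<le> quad m \<Lambda> y y - c * y l - c * y l + c\<^sup>2 * quad m \<Lambda> (z l) (z l)"
      using quad_nonneg[OF spd, of "\<lambda>j. y j - c * z l j"] quad_sym[OF spd, of "z l" y] pair[OF l, of y]
      unfolding quad_diff_scale by simp
    also have "\<dots> = quad m \<Lambda> y y - (y l)\<^sup>2 / quad m \<Lambda> (z l) (z l)"
      unfolding c_def using zp by (simp add: field_simps power2_eq_square)
    finally have "(y l)\<^sup>2 \<le> quad m \<Lambda> (z l) (z l) * quad m \<Lambda> y y" using zp by (simp add: field_simps)
    also have "\<dots> \<le> K * quad m \<Lambda> y y" by (intro mult_right_mono K l quad_nonneg[OF spd])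
    finally show ?thesis .
  qed
  moreover have "K \<ge> 0" unfolding K_def by (intro sum_nonneg quad_nonneg[OF spd])
  ultimately show ?thesis by blast
qed

lemma quad_derivative:
  assumes spd: "sym_pos_def m \<Lambda>" and y: "\<And>l. l < m \<Longrightarrow> ((\<lambda>t. y t l) has_vector_derivative y' l) (at t within T)"
  shows "((\<lambda>t. quad m \<Lambda> (y t) (y t)) has_vector_derivative 2 * quad m \<Lambda> (y t) y') (at t within T)"
proof -
  have "((\<lambda>t. quad m \<Lambda> (y t) (y t)) has_vector_derivative
      (\<Sum>l<m. \<Sum>j<m. y t l * \<Lambda> $$ (l, j) * y' j + y' l * \<Lambda> $$ (l, j) * y t j)) (at t within T)"
    unfolding quad_def
  proof (intro has_vector_derivative_sum)
    fix l j assume "l \<in> {..<m}" "j \<in> {..<m}"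
    then have "((\<lambda>t. y t l) has_real_derivative y' l) (at t within T)" "((\<lambda>t. y t j) has_real_derivative y' j) (at t within T)"
      using y by (auto simp: has_real_derivative_iff_has_vector_derivative)
    then have "((\<lambda>t. y t l * \<Lambda> $$ (l, j) * y t j) has_real_derivative
        y t l * \<Lambda> $$ (l, j) * y' j + y' l * \<Lambda> $$ (l, j) * y t j) (at t within T)"
      by (auto intro!: derivative_eq_intros)
    then show "((\<lambda>t. y t l * \<Lambda> $$ (l, j) * y t j) has_vector_derivative
        y t l * \<Lambda> $$ (l, j) * y' j + y' l * \<Lambda> $$ (l, j) * y t j) (at t within T)"
      by (simp add: has_real_derivative_iff_has_vector_derivative)
  qed
  moreover have "(\<Sum>l<m. \<Sum>j<m. y t l * \<Lambda> $$ (l, j) * y' j + y' l * \<Lambda> $$ (l, j) * y t j)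
      = quad m \<Lambda> (y t) y' + quad m \<Lambda> y' (y t)"
    unfolding quad_def by (simp add: sum.distrib)
  ultimately show ?thesis using quad_sym[OF spd, of y' "y t"] by simp
qed



section \<open>Adaptive tracking by a single follower\<close>

text \<open>The coefficients of the stable polynomial by ascending power, whereas \<beta> counts
  down from the leading term.\<close>

definition stab_coeff :: "nat \<Rightarrow> (nat \<Rightarrow> real) \<Rightarrow> nat \<Rightarrow> real" where
  "stab_coeff r \<beta> k = (if k = r - 1 then 1 else \<beta> (r - 1 - k))"

lemma sum_stab_coeff:
  fixes g :: "nat \<Rightarrow> 'a::real_algebra_1"
  shows "(\<Sum>k\<le>r - 1. of_real (stab_coeff r \<beta> k) * g k) = g (r - 1) + (\<Sum>k=1..r-1. of_real (\<beta> k) * g (r - 1 - k))"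
proof -
  define n where "n = r - 1"
  have "(\<Sum>k\<le>n. of_real (stab_coeff r \<beta> k) * g k) = (\<Sum>k<n. of_real (\<beta> (n - k)) * g k) + g n"
    unfolding lessThan_Suc_atMost[symmetric] sum.lessThan_Suc by (simp add: stab_coeff_def n_def)
  also have "(\<Sum>k<n. of_real (\<beta> (n - k)) * g k) = (\<Sum>k<n. of_real (\<beta> (n - (n - Suc k))) * g (n - Suc k))"
    by (rule sum.nat_diff_reindex[symmetric])
  also have "\<dots> = (\<Sum>k<n. of_real (\<beta> (Suc k)) * g (n - Suc k))"
    by (rule sum.cong[OF refl]) (simp add: Suc_diff_Suc)
  also have "\<dots> = (\<Sum>k=1..n. of_real (\<beta> k) * g (n - k))"
    by (rule sum.reindex_bij_witness[of _ "\<lambda>k. k - 1" Suc]) auto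
  finally show ?thesis unfolding n_def by simp
qed

text \<open>Exhibits \<open>s\<close> as the stable polynomial applied to the tracking errors, in
  the form required by \<open>cascade_bound\<close>.\<close>

lemma s_err_sum:
  "s_err r \<beta> F x S v = (\<Sum>k\<le>r - 1. stab_coeff r \<beta> k * (x $\<^sub>v k - F \<bullet> mat_power_vec S k v))"
  using sum_stab_coeff[of r \<beta> "\<lambda>k. x $\<^sub>v k - F \<bullet> mat_power_vec S k v"]
  unfolding s_err_def p_ref_def by simp

definition stab_poly :: "nat \<Rightarrow> (nat \<Rightarrow> real) \<Rightarrow> complex poly" where
  "stab_poly r \<beta> = (\<Sum>k\<le>r - 1. Polynomial.monom (complex_of_real (stab_coeff r \<beta> k)) k)"

lemma coeff_stab_poly: "coeff (stab_poly r \<beta>) k = (if k \<le> r - 1 then complex_of_real (stab_coeff r \<beta> k) else 0)"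
  unfolding stab_poly_def coeff_sum coeff_monom by (simp add: sum.delta)

lemma stab_poly_monic: "degree (stab_poly r \<beta>) = r - 1" "lead_coeff (stab_poly r \<beta>) = 1"
proof -
  have 1: "coeff (stab_poly r \<beta>) (r - 1) = 1" by (simp add: coeff_stab_poly stab_coeff_def)
  have "degree (stab_poly r \<beta>) \<le> r - 1" by (rule degree_le) (simp add: coeff_stab_poly)
  moreover have "r - 1 \<le> degree (stab_poly r \<beta>)" by (rule le_degree) (unfold 1, simp)
  ultimately show d: "degree (stab_poly r \<beta>) = r - 1" by simp
  show "lead_coeff (stab_poly r \<beta>) = 1" unfolding d by (rule 1)
qed

lemma poly_stab_poly:
  "poly (stab_poly r \<beta>) z = z ^ (r - 1) + (\<Sum>k=1..r - 1. complex_of_real (\<beta> k) * z ^ (r - 1 - k))"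
  using sum_stab_coeff[of r \<beta> "\<lambda>k. z ^ k"] by (simp add: stab_poly_def poly_sum poly_monom)

lemma quad_scale_right: "quad m \<Lambda> y (\<lambda>l. c * z l) = c * quad m \<Lambda> y z"
  unfolding quad_def by (simp add: sum_distrib_left mult_ac)

text \<open>\<psi> is the estimated reference and its would-be derivatives: each one is the
  derivative of the previous one up to a vanishing defect \<delta>, because the estimates are still
  changing.\<close>

lemma follower_tracking:
  fixes \<psi> \<delta> :: "nat \<Rightarrow> real \<Rightarrow> real"
  assumes D: "\<And>a b. finite (D \<inter> {a..b})" and r: "1 \<le> r"
    and car: "\<forall>x\<in>carrier_vec r. \<forall>t\<ge>0. f x t \<in> carrier_vec m"
    and lip: "locally_lipschitz_uniform r f"
    and bnd: "\<exists>\<phi>. \<forall>x\<in>carrier_vec r. \<forall>t\<ge>0. vec_norm (f x t) \<le> \<phi> x"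
    and \<theta>: "\<theta> \<in> carrier_vec m" and \<kappa>: "0 < \<kappa>" and spd: "sym_pos_def m \<Lambda>"
    and roots: "\<And>z::complex. z ^ (r - 1) + (\<Sum>k=1..r - 1. complex_of_real (\<beta> k) * z ^ (r - 1 - k)) = 0 \<Longrightarrow> Re z < 0"
    and d: "\<And>t. 0 \<le> t \<Longrightarrow> d t = 0"
    and plant: "follower_plant D r f \<theta> d (control_input r f F \<kappa> \<beta> x \<theta>h Sh v) x"
    and adapt: "adaptation_law D r m f F \<Lambda> \<beta> x \<theta>h Sh v"
    and \<psi>: "\<And>k t. \<psi> k t = F \<bullet> mat_power_vec (Sh t) k (v t)"
    and \<psi>c: "\<And>k. k < r \<Longrightarrow> continuous_on {0..} (\<psi> k)"
    and \<psi>d: "\<And>k t. k < r \<Longrightarrow> 0 < t \<Longrightarrow> t \<notin> D \<Longrightarrow> (\<psi> k has_vector_derivative \<psi> (Suc k) t + \<delta> k t) (at t)"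
    and \<delta>0: "\<And>k. k < r \<Longrightarrow> (\<delta> k \<longlongrightarrow> 0) at_top"
    and \<psi>b: "\<And>k. k < r \<Longrightarrow> \<exists>K. \<forall>\<^sub>F t in at_top. \<bar>\<psi> k t\<bar> \<le> K"
    and k: "k < r"
  shows "((\<lambda>t. x t $\<^sub>v k - \<psi> k t) \<longlongrightarrow> 0) at_top"
proof -
  define n where "n = r - 1"
  have rn: "r = Suc n" unfolding n_def using r by simp
  define e where "e k t = x t $\<^sub>v k - \<psi> k t" for k t
  define s where "s t = s_err r \<beta> F (x t) (Sh t) (v t)" for t
  have s_sum: "s t = (\<Sum>k\<le>n. stab_coeff r \<beta> k * e k t)" for t
    unfolding s_def s_err_sum e_def \<psi> n_def ..
  have xcar: "x t \<in> carrier_vec r" if "t \<ge> 0" for t using plant that unfolding follower_plant_def by auto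
  have x_within: "((\<lambda>s. x s $\<^sub>v k) has_vector_derivative x t $\<^sub>v Suc k) (at t within {0..})" if "k < n" "t \<ge> 0" for k t
    using plant that unfolding follower_plant_def rn by (simp add: has_real_derivative_iff_has_vector_derivative)
  have x_at: "((\<lambda>s. x s $\<^sub>v k) has_vector_derivative x t $\<^sub>v Suc k) (at t)" if "k < n" "t > 0" for k t
  proof -
    have "at t within {0..} = at t" by (rule at_within_nhd[of t "{0<..}", THEN trans]) (use that in auto)
    then show ?thesis using x_within[of k t] that by simp
  qed
  have x_cont: "continuous_on {0..} (\<lambda>t. x t $\<^sub>v k)" if "k < r" for k
  proof (cases "k < n")
    case True then show ?thesis by (intro continuous_on_vector_derivative) (use x_within in auto)
  next
    case False
    then have "k = r - 1" using that rn by simp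
    then show ?thesis using plant unfolding follower_plant_def pw_derivative_def by simp
  qed
  have e_cont: "continuous_on {0..} (e k)" if "k < r" for k
    unfolding e_def[abs_def] by (intro continuous_intros x_cont \<psi>c that)
  have s_cont: "continuous_on {0..} s"
    unfolding s_sum[abs_def] by (intro continuous_intros e_cont) (simp add: rn)
  define y where "y t l = \<theta>h t $\<^sub>v l - \<theta> $\<^sub>v l" for t l
  have y_cont: "continuous_on {0..} (\<lambda>t. y t l)" if "l < m" for l
    unfolding y_def using adapt that unfolding adaptation_law_def pw_derivative_def by (intro continuous_intros) auto
  define \<phi> where "\<phi> t = f (x t) t" for t
  have \<phi>car: "\<phi> t \<in> carrier_vec m" if "t \<ge> 0" for t unfolding \<phi>_def using car xcar[OF that] that by blast
  have y_der: "((\<lambda>t. y t l) has_vector_derivative (- s t) * (the (mat_inverse \<Lambda>) *\<^sub>v \<phi> t) $\<^sub>v l) (at t)"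
    if "l < m" "t > 0" "t \<notin> D" for l t
  proof -
    have "((\<lambda>t. \<theta>h t $\<^sub>v l) has_vector_derivative - ((the (mat_inverse \<Lambda>) *\<^sub>v \<phi> t) $\<^sub>v l * s t)) (at t)"
      using adapt that unfolding adaptation_law_def pw_derivative_def \<phi>_def s_def by blast
    from has_vector_derivative_diff[OF this has_vector_derivative_const[of "\<theta> $\<^sub>v l"]]
    show ?thesis unfolding y_def by (simp add: mult.commute)
  qed
  \<comment> \<open>What is left once the input has cancelled the derivative of the reference:
    parameter mismatch and damping.\<close>
  define s' where "s' t = (\<Sum>l<m. y t l * \<phi> t $\<^sub>v l) - \<kappa> * s t" for t
  have s_der: "(s has_vector_derivative s' t) (at t)" if t: "t > 0" "t \<notin> D" for t
  proof -
    define p where "p t = p_ref r \<beta> F (x t) (Sh t) (v t)" for t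
    have p_eq: "p t = \<psi> n t - (\<Sum>k=1..n. \<beta> k * (x t $\<^sub>v (n - k) - \<psi> (n - k) t))" for t
      unfolding p_def p_ref_def \<psi> n_def ..
    define p' where "p' = \<psi> (Suc n) t + \<delta> n t - (\<Sum>k=1..n. \<beta> k * (x t $\<^sub>v Suc (n - k) - (\<psi> (Suc (n - k)) t + \<delta> (n - k) t)))"
    have p_der: "(p has_vector_derivative p') (at t)"
      unfolding p_eq[abs_def] p'_def
    proof (intro has_vector_derivative_diff has_vector_derivative_sum
        bounded_linear.has_vector_derivative[OF bounded_linear_mult_right])
      show "(\<psi> n has_vector_derivative \<psi> (Suc n) t + \<delta> n t) (at t)" by (rule \<psi>d) (use t rn in auto)
      fix k assume k: "k \<in> {1..n}"
      show "((\<lambda>s. x s $\<^sub>v (n - k)) has_vector_derivative x t $\<^sub>v Suc (n - k)) (at t)"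
        by (rule x_at) (use k t in auto)
      show "(\<psi> (n - k) has_vector_derivative \<psi> (Suc (n - k)) t + \<delta> (n - k) t) (at t)"
        by (rule \<psi>d) (use t rn in auto)
    qed
    then have dp: "deriv p t = p'"
      by (intro DERIV_imp_deriv) (simp add: has_real_derivative_iff_has_vector_derivative)
    have xn: "((\<lambda>t. x t $\<^sub>v n) has_vector_derivative
        (control_input r f F \<kappa> \<beta> x \<theta>h Sh v t + d t - f (x t) t \<bullet>\<^sub>v \<theta>)) (at t)"
      using plant t unfolding follower_plant_def pw_derivative_def n_def by blast
    have s_p: "s = (\<lambda>t. x t $\<^sub>v n - p t)" unfolding s_def s_err_def p_def n_def by simp
    have "(s has_vector_derivative (control_input r f F \<kappa> \<beta> x \<theta>h Sh v t + d t - f (x t) t \<bullet>\<^sub>v \<theta>) - p') (at t)"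
      unfolding s_p by (rule has_vector_derivative_diff[OF xn p_der])
    moreover have "control_input r f F \<kappa> \<beta> x \<theta>h Sh v t = \<phi> t \<bullet>\<^sub>v \<theta>h t - \<kappa> * s t + p'"
      unfolding control_input_def \<phi>_def s_def dp[symmetric] p_def[abs_def] by simp
    moreover have "\<phi> t \<bullet>\<^sub>v \<theta>h t - \<phi> t \<bullet>\<^sub>v \<theta> = (\<Sum>l<m. y t l * \<phi> t $\<^sub>v l)"
    proof -
      have "\<theta>h t \<in> carrier_vec m" using adapt t unfolding adaptation_law_def by auto
      then show ?thesis using \<theta> unfolding y_def
        by (simp add: scalar_prod_def atLeast0LessThan sum_subtractf[symmetric] algebra_simps)
    qed
    ultimately show ?thesis using d[of t] t unfolding s'_def \<phi>_def by (simp add: algebra_simps)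
  qed
  define V where "V t = ((s t)\<^sup>2 + quad m \<Lambda> (y t) (y t)) / 2" for t
  have V0: "0 \<le> V t" for t unfolding V_def using quad_nonneg[OF spd, of "y t"] by simp
  have V_cont: "continuous_on {0..} V"
    unfolding V_def quad_def by (intro continuous_intros s_cont y_cont) auto
  \<comment> \<open>The parameter mismatch in \<open>s * s'\<close> cancels against the adaptation
    term by \<open>quad_inverse\<close>.\<close>
  have V_der: "(V has_vector_derivative - \<kappa> * (s t)\<^sup>2) (at t)" if t: "t > 0" "t \<notin> D" for t
  proof -
    have q: "((\<lambda>t. quad m \<Lambda> (y t) (y t)) has_real_derivative
        2 * ((- s t) * quad m \<Lambda> (y t) (\<lambda>l. (the (mat_inverse \<Lambda>) *\<^sub>v \<phi> t) $\<^sub>v l))) (at t)"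
      using quad_derivative[OF spd, of y "\<lambda>l. (- s t) * (the (mat_inverse \<Lambda>) *\<^sub>v \<phi> t) $\<^sub>v l" t UNIV, OF y_der[OF _ t]]
      unfolding quad_scale_right has_real_derivative_iff_has_vector_derivative .
    have sd: "(s has_real_derivative s' t) (at t)"
      using s_der[OF t] by (simp add: has_real_derivative_iff_has_vector_derivative)
    have "(V has_real_derivative (2 * s t * s' t + 2 * ((- s t) * (\<Sum>l<m. y t l * \<phi> t $\<^sub>v l))) / 2) (at t)"
      unfolding V_def[abs_def] using sd q quad_inverse[OF spd \<phi>car, of t "y t"] t
      by (auto intro!: derivative_eq_intros)
    moreover have "(2 * s t * s' t + 2 * ((- s t) * (\<Sum>l<m. y t l * \<phi> t $\<^sub>v l))) / 2 = - \<kappa> * (s t)\<^sup>2"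
      unfolding s'_def by (simp add: algebra_simps power2_eq_square)
    ultimately show ?thesis by (simp add: has_real_derivative_iff_has_vector_derivative)
  qed
  have V_le: "V t \<le> V 0" if t: "t \<ge> 0" for t
    by (rule pw_antimono[OF D t, where w = V and w' = "\<lambda>t. - \<kappa> * (s t)\<^sup>2"])
      (use V_der \<kappa> continuous_on_subset[OF V_cont] in auto)
  have V2: "(s t)\<^sup>2 + quad m \<Lambda> (y t) (y t) = 2 * V t" for t unfolding V_def by simp
  define b where "b = sqrt (2 * V 0) + 1"
  have b: "b > 0" unfolding b_def using V0[of 0] by (simp add: add_nonneg_pos)
  have s_bound: "\<bar>s t\<bar> \<le> b" if "t \<ge> 0" for t
  proof -
    have "(s t)\<^sup>2 \<le> 2 * V 0" using V_le[OF that] quad_nonneg[OF spd, of "y t"] V2[of t] by linarith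
    then have "\<bar>s t\<bar> \<le> sqrt (2 * V 0)" by (simp add: real_le_rsqrt)
    then show ?thesis unfolding b_def by simp
  qed
  obtain Ky where Ky: "Ky \<ge> 0" "\<And>y l. l < m \<Longrightarrow> (y l)\<^sup>2 \<le> Ky * quad m \<Lambda> y y"
    using quad_component_bound[OF spd] by blast
  define Y where "Y = sqrt (Ky * (2 * V 0))"
  have y_bound: "\<bar>y t l\<bar> \<le> Y" if "l < m" "t \<ge> 0" for l t
  proof -
    have "quad m \<Lambda> (y t) (y t) \<le> 2 * V 0" using V_le[OF that(2)] V2[of t] zero_le_power2[of "s t"] by linarith
    then have "Ky * quad m \<Lambda> (y t) (y t) \<le> Ky * (2 * V 0)" using Ky(1) by (rule mult_left_mono)
    then have "(y t l)\<^sup>2 \<le> Ky * (2 * V 0)" using Ky(2)[OF that(1), of "y t"] by linarith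
    then show ?thesis unfolding Y_def by (simp add: real_le_rsqrt)
  qed
  have "\<exists>C>0. cascade_bound D (stab_poly r \<beta>) n C"
    by (rule stable_cascade_bound[OF D]) (use stab_poly_monic[of r \<beta>] roots in \<open>auto simp: n_def poly_stab_poly\<close>)
  then obtain C where C: "C > 0" and casc: "cascade_bound D (stab_poly r \<beta>) n C" by blast
  have e_der: "((\<lambda>t. complex_of_real (e k t)) has_vector_derivative
      complex_of_real (e (Suc k) t) + complex_of_real (- \<delta> k t)) (at t)" if "k < n" "t > 0" "t \<notin> D" for k t
  proof -
    have "(e k has_vector_derivative x t $\<^sub>v Suc k - (\<psi> (Suc k) t + \<delta> k t)) (at t)"
      unfolding e_def[abs_def] by (rule has_vector_derivative_diff[OF x_at \<psi>d]) (use that rn in auto)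
    then have "(e k has_vector_derivative e (Suc k) t + - \<delta> k t) (at t)" unfolding e_def by (simp add: algebra_simps)
    from bounded_linear.has_vector_derivative[OF bounded_linear_of_real this] show ?thesis by simp
  qed
  \<comment> \<open>Used twice: with the constant bound on \<open>s\<close> to bound the state, and
    after Barbalat's lemma with arbitrarily small \<open>h\<close>.\<close>
  have e_bound: "\<forall>\<^sub>F t in at_top. \<bar>e k t\<bar> \<le> C * h" if h: "h > 0" "\<forall>\<^sub>F t in at_top. \<bar>s t\<bar> \<le> h" and k: "k \<le> n" for h k
  proof -
    have "\<forall>k\<le>n. \<forall>\<^sub>F t in at_top. norm (complex_of_real (e k t)) \<le> C * h"
    proof (rule casc[unfolded cascade_bound_def, THEN spec, THEN spec, THEN spec, THEN spec, THEN mp, THEN mp, THEN mp, THEN mp, THEN mp])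
      show "0 < h" by (rule h)
      show "\<forall>k<n. continuous_on {0..} (\<lambda>t. complex_of_real (e k t))"
        using e_cont rn by (auto intro!: continuous_intros)
      show "\<forall>k<n. \<forall>t>0. t \<notin> D \<longrightarrow> ((\<lambda>t. complex_of_real (e k t)) has_vector_derivative
          complex_of_real (e (Suc k) t) + complex_of_real (- \<delta> k t)) (at t)" using e_der by blast
      show "\<forall>k<n. \<forall>\<^sub>F t in at_top. norm (complex_of_real (- \<delta> k t)) \<le> h"
      proof (intro allI impI)
        fix k assume "k < n"
        then have "(\<delta> k \<longlongrightarrow> 0) at_top" using \<delta>0 rn by simp
        from tendstoD[OF this h(1)] show "\<forall>\<^sub>F t in at_top. norm (complex_of_real (- \<delta> k t)) \<le> h"
          by (rule eventually_mono) (simp add: dist_norm less_imp_le)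
      qed
      have "(\<Sum>k\<le>n. coeff (stab_poly r \<beta>) k * complex_of_real (e k t)) = complex_of_real (s t)" for t
        unfolding s_sum of_real_sum of_real_mult by (rule sum.cong[OF refl]) (simp add: coeff_stab_poly n_def)
      then show "\<forall>\<^sub>F t in at_top. norm (\<Sum>k\<le>n. coeff (stab_poly r \<beta>) k * complex_of_real (e k t)) \<le> h"
        using h(2) by simp
    qed
    then show ?thesis using k by simp
  qed
  have "\<forall>k<r. \<exists>K. \<forall>\<^sub>F t in at_top. \<bar>\<psi> k t\<bar> \<le> K" using \<psi>b by blast
  then obtain K where K: "\<And>k. k < r \<Longrightarrow> \<forall>\<^sub>F t in at_top. \<bar>\<psi> k t\<bar> \<le> K k" by metis
  define R where "R = C * b + (\<Sum>k<r. \<bar>K k\<bar>)"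
  have sb: "\<forall>\<^sub>F t in at_top. \<bar>s t\<bar> \<le> b"
    unfolding eventually_at_top_linorder using s_bound by blast
  have "\<forall>\<^sub>F t in at_top. \<bar>x t $\<^sub>v k\<bar> \<le> R" if k: "k < r" for k
  proof -
    have "\<forall>\<^sub>F t in at_top. \<bar>e k t\<bar> \<le> C * b" by (rule e_bound[OF b sb]) (use k rn in simp)
    with K[OF k] show ?thesis
    proof eventually_elim
      case (elim t)
      have "\<bar>K k\<bar> \<le> (\<Sum>k<r. \<bar>K k\<bar>)" by (rule member_le_sum) (use k in auto)
      then show ?case using elim unfolding R_def e_def by linarith
    qed
  qed
  then have "\<forall>\<^sub>F t in at_top. \<forall>k\<in>{..<r}. \<bar>x t $\<^sub>v k\<bar> \<le> R" by (intro eventually_ball_finite) auto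
  then obtain T0 where T0: "\<And>t. t \<ge> T0 \<Longrightarrow> \<forall>k\<in>{..<r}. \<bar>x t $\<^sub>v k\<bar> \<le> R"
    unfolding eventually_at_top_linorder by blast
  obtain M where M: "\<And>x t. in_box r R x \<Longrightarrow> t \<ge> 0 \<Longrightarrow> vec_norm (f x t) \<le> M"
    using uniform_bound_on_box[OF car lip bnd] by blast
  \<comment> \<open>The state is known to lie in the box only eventually, so Barbalat's lemma is
    applied from \<open>T\<close> on.\<close>
  define T where "T = max 0 T0"
  have s'_bound: "\<bar>s' t\<bar> \<le> real m * (Y * M) + \<kappa> * b" if t: "T < t" for t
  proof -
    have t0: "t \<ge> 0" "t \<ge> T0" using t unfolding T_def by auto
    have "in_box r R (x t)" unfolding in_box_def using T0[OF t0(2)] xcar[OF t0(1)] by simp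
    then have fM: "vec_norm (\<phi> t) \<le> M" unfolding \<phi>_def by (rule M[OF _ t0(1)])
    have "\<bar>\<Sum>l<m. y t l * \<phi> t $\<^sub>v l\<bar> \<le> (\<Sum>l<m. \<bar>y t l * \<phi> t $\<^sub>v l\<bar>)" by (rule sum_abs)
    also have "\<dots> \<le> (\<Sum>l<m. Y * M)"
    proof (rule sum_mono)
      fix l assume l: "l \<in> {..<m}"
      have "\<bar>\<phi> t $\<^sub>v l\<bar> \<le> M" using component_le_vec_norm[OF \<phi>car[OF t0(1)], of l] l fM by simp
      then show "\<bar>y t l * \<phi> t $\<^sub>v l\<bar> \<le> Y * M"
        unfolding abs_mult using y_bound[of l t] l t0 by (intro mult_mono) auto
    qed
    finally have "\<bar>\<Sum>l<m. y t l * \<phi> t $\<^sub>v l\<bar> \<le> real m * (Y * M)" by simp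
    moreover have "\<bar>\<kappa> * s t\<bar> \<le> \<kappa> * b" unfolding abs_mult using s_bound[OF t0(1)] \<kappa> by (simp add: mult_left_mono)
    ultimately show ?thesis unfolding s'_def by linarith
  qed
  have "T \<ge> 0" unfolding T_def by simp
  have s_lim: "(s \<longlongrightarrow> 0) at_top"
  proof (rule barbalat[OF D \<kappa>, where V = V and T = T and s' = s' and M = "real m * (Y * M) + \<kappa> * b"])
    show "continuous_on {T..} V" "continuous_on {T..} s"
      using continuous_on_subset[OF V_cont] continuous_on_subset[OF s_cont] \<open>T \<ge> 0\<close> by auto
  qed (use V0 V_der s_der s'_bound \<open>T \<ge> 0\<close> in auto)
  have "((\<lambda>t. e k t) \<longlongrightarrow> 0) at_top"
  proof (rule tendstoI)
    fix \<eta> :: real assume \<eta>: "0 < \<eta>"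
    define h where "h = \<eta> / (2 * C)"
    have h: "h > 0" "C * h < \<eta>" unfolding h_def using C \<eta> by auto
    have "\<forall>\<^sub>F t in at_top. \<bar>s t\<bar> \<le> h"
      using tendstoD[OF s_lim h(1)] by (rule eventually_mono) (simp add: dist_norm less_imp_le)
    from e_bound[OF h(1) this, of k] k rn have "\<forall>\<^sub>F t in at_top. \<bar>e k t\<bar> \<le> C * h" by simp
    then show "\<forall>\<^sub>F t in at_top. dist (e k t) 0 < \<eta>"
      by (rule eventually_mono) (use h in \<open>simp add: dist_norm\<close>)
  qed
  then show ?thesis unfolding e_def .
qed


subsection \<open>Convergence of the distributed observer\<close>


lemma bounded_bilinear_matvec: "bounded_bilinear ((*v) :: real ^ 'n ^ 'm \<Rightarrow> real ^ 'n \<Rightarrow> real ^ 'm)"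
  unfolding bilinear_conv_bounded_bilinear[symmetric] bilinear_def
  by (auto intro!: linearI simp: matrix_vector_mult_add_rdistrib matrix_vector_right_distrib scaleR_matrix_vector_assoc
      matrix_vector_mult_scaleR)

lemma tendsto_zero_bilinear:
  assumes B: "bounded_bilinear B"
  shows "(f \<longlongrightarrow> 0) F \<Longrightarrow> Bfun g F \<Longrightarrow> ((\<lambda>x. B (f x) (g x)) \<longlongrightarrow> 0) F"
    and "Bfun f F \<Longrightarrow> (g \<longlongrightarrow> 0) F \<Longrightarrow> ((\<lambda>x. B (f x) (g x)) \<longlongrightarrow> 0) F"
  using bounded_bilinear.Zfun_prod_Bfun[OF B, of f F g] bounded_bilinear.Bfun_prod_Zfun[OF B, of f F g]
  by (simp_all add: tendsto_Zfun_iff)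

lemma neighbor_sum_tendsto:
  fixes h :: "'N::finite option \<Rightarrow> real \<Rightarrow> 'a::real_normed_vector"
  assumes "\<And>j. (h j \<longlongrightarrow> 0) at_top"
  shows "((\<lambda>t. \<Sum>j\<in>neighbors (G t) i. h j t) \<longlongrightarrow> 0) at_top"
proof (rule Lim_null_comparison)
  show "\<forall>\<^sub>F t in at_top. norm (\<Sum>j\<in>neighbors (G t) i. h j t) \<le> (\<Sum>j\<in>UNIV. norm (h j t))"
    by (rule always_eventually, rule allI, rule order_trans[OF norm_sum]) (rule sum_mono2, auto)
  have "((\<lambda>t. \<Sum>j\<in>UNIV. norm (h j t)) \<longlongrightarrow> (\<Sum>j\<in>(UNIV :: 'N option set). 0)) at_top"
    by (intro tendsto_sum tendsto_norm_zero assms)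
  then show "((\<lambda>t. \<Sum>j\<in>UNIV. norm (h j t)) \<longlongrightarrow> 0) at_top" by simp
qed

lemma mat_power_vec_Suc: "mat_power_vec A (Suc k) v = A *v mat_power_vec A k v"
  by (simp add: mat_power_vec_def)

lemma mat_power_vec_0: "mat_power_vec A 0 v = v"
  by (simp add: mat_power_vec_def)

lemma mat_power_vec_swap: "mat_power_vec A k (A *v v) = mat_power_vec A (Suc k) v"
  by (simp add: mat_power_vec_def funpow_swap1)

lemma mat_power_vec_linear: "linear (mat_power_vec A k)"
  by (induction k) (simp_all add: mat_power_vec_0[abs_def] mat_power_vec_Suc[abs_def] linear_ident
      linear_compose[unfolded o_def, OF _ matrix_vector_mul_linear])

definition embed :: "'N::finite \<Rightarrow> real ^ 'n::finite \<Rightarrow> real ^ ('N \<times> 'n)" where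
  "embed i x = (\<chi> p. if fst p = i then x $ snd p else 0)"

lemma bounded_linear_embed: "bounded_linear (embed i)"
  by (rule linear_conv_bounded_linear[THEN iffD1], rule linearI)
    (simp_all add: embed_def Finite_Cartesian_Product.vec_eq_iff)

lemma agent_embed: "agent (embed i x) j = (if j = i then x else 0)"
  by (simp add: agent_def embed_def Finite_Cartesian_Product.vec_eq_iff)

lemma agent_sum_embed: "agent (\<Sum>i\<in>UNIV. embed i (x i)) j = x j"
proof -
  have "agent (\<Sum>i\<in>UNIV. embed i (x i)) j = (\<Sum>i\<in>UNIV. agent (embed i (x i)) j)"
    by (rule linear_sum[OF bounded_linear.linear[OF bounded_linear_agent]])
  also have "\<dots> = x j" by (simp add: agent_embed)
  finally show ?thesis .
qed

lemma agent_eqI: "(\<And>i. agent a i = agent b i) \<Longrightarrow> a = b"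
  by (auto simp: agent_def Finite_Cartesian_Product.vec_eq_iff)

lemma norm_embed: "norm (embed i x) = norm x"
proof -
  have "(norm (embed i x))\<^sup>2 = (\<Sum>j\<in>UNIV. if j = i then (norm x)\<^sup>2 else 0)"
    unfolding norm_agent by (rule sum.cong[OF refl]) (simp add: agent_embed)
  then show ?thesis by simp
qed

text \<open>The induction step needs the identity in a neighbourhood of \<open>t\<close>, hence
  positive times only.\<close>

lemma iterated_deriv:
  fixes h :: "nat \<Rightarrow> real \<Rightarrow> real"
  assumes "\<And>k t. Suc k < r \<Longrightarrow> 0 < t \<Longrightarrow> (h k has_real_derivative h (Suc k) t) (at t)"
  shows "k < r \<Longrightarrow> 0 < t \<Longrightarrow> (deriv ^^ k) (h 0) t = h k t"
proof (induction k arbitrary: t)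
  case (Suc k)
  have "\<forall>\<^sub>F s in nhds t. s \<in> {0<..}" using Suc.prems by (intro eventually_nhds_in_open) auto
  then have "\<forall>\<^sub>F s in nhds t. (deriv ^^ k) (h 0) s = h k s"
    by (rule eventually_mono) (use Suc in auto)
  then have "deriv ((deriv ^^ k) (h 0)) t = deriv (h k) t" by (rule deriv_cong_ev) simp
  also have "\<dots> = h (Suc k) t" by (rule DERIV_imp_deriv[OF assms]) (use Suc.prems in auto)
  finally show ?case by simp
qed simp

context switching_network
begin

lemma vector_consensus_tendsto:
  fixes X :: "'N option \<Rightarrow> real \<Rightarrow> 'a::euclidean_space"
  assumes \<mu>: "0 < \<mu>" and X0: "\<And>t. 0 \<le> t \<Longrightarrow> X None t = X0"
    and X: "\<And>i. pw_derivative (range ts) 0 (X (Some i)) (\<lambda>t. \<mu> *\<^sub>R (\<Sum>j\<in>neighbors (G t) (Some i). X j t - X (Some i) t))"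
  shows "(X (Some i) \<longlongrightarrow> X0) at_top"
proof -
  have "((\<lambda>t. (X (Some i) t - X0) \<bullet> b) \<longlongrightarrow> 0) at_top" for b
  proof -
    \<comment> \<open>The leader is known to be constant only for nonnegative time, while
      \<open>consensus\<close> asks for the value 0 at all times.\<close>
    define y where "y j t = (case j of None \<Rightarrow> 0 | Some i \<Rightarrow> (X (Some i) t - X0) \<bullet> b)" for j t
    have yj: "y j t = (X j t - X0) \<bullet> b" if "0 \<le> t" for j t
      using X0[OF that] by (cases j) (simp_all add: y_def)
    have "(y (Some i) \<longlongrightarrow> 0) at_top"
    proof (rule scalar_consensus_tendsto[OF \<mu>])
      show "y None t = 0" for t by (simp add: y_def)
      fix i
      have "pw_derivative (range ts) 0 (\<lambda>t. X (Some i) t \<bullet> b)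
          (\<lambda>t. (\<mu> *\<^sub>R (\<Sum>j\<in>neighbors (G t) (Some i). X j t - X (Some i) t)) \<bullet> b)"
        by (rule pw_derivative_linear[OF X bounded_linear_inner_left])
      then have c: "continuous_on {0..} (\<lambda>t. X (Some i) t \<bullet> b)"
        and d: "\<And>t. 0 < t \<Longrightarrow> t \<notin> range ts \<Longrightarrow> ((\<lambda>t. X (Some i) t \<bullet> b) has_vector_derivative
          (\<mu> *\<^sub>R (\<Sum>j\<in>neighbors (G t) (Some i). X j t - X (Some i) t)) \<bullet> b) (at t)"
        unfolding pw_derivative_def by auto
      have yS: "y (Some i) = (\<lambda>t. X (Some i) t \<bullet> b - X0 \<bullet> b)" by (simp add: y_def fun_eq_iff inner_diff_left)
      show "pw_derivative (range ts) 0 (y (Some i)) (\<lambda>t. \<mu> * (\<Sum>j\<in>neighbors (G t) (Some i). y j t - y (Some i) t))"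
        unfolding pw_derivative_def
      proof (intro conjI allI impI)
        show "continuous_on {0..} (y (Some i))" unfolding yS by (intro continuous_intros c)
        fix t :: real assume t: "0 < t" "t \<notin> range ts"
        have "(\<mu> *\<^sub>R (\<Sum>j\<in>neighbors (G t) (Some i). X j t - X (Some i) t)) \<bullet> b
            = \<mu> * (\<Sum>j\<in>neighbors (G t) (Some i). y j t - y (Some i) t)"
          using t by (simp add: inner_sum_left yj inner_diff_left)
        then show "(y (Some i) has_vector_derivative \<mu> * (\<Sum>j\<in>neighbors (G t) (Some i). y j t - y (Some i) t)) (at t)"
          unfolding yS[symmetric]
          using has_vector_derivative_diff[OF d[OF t] has_vector_derivative_const[of "X0 \<bullet> b"]]
          by (simp only: diff_0_right yS[symmetric])
      qed
    qed
    moreover have "y (Some i) = (\<lambda>t. (X (Some i) t - X0) \<bullet> b)" by (simp add: y_def fun_eq_iff)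
    ultimately show ?thesis by (simp only:)
  qed
  then have "((\<lambda>t. X (Some i) t - X0) \<longlongrightarrow> 0) at_top"
    by (subst tendsto_componentwise_iff) simp
  then show ?thesis by (rule LIM_zero_cancel)
qed

lemma leader_bounded:
  fixes S :: "real ^ 'n ^ 'n"
  assumes S: "marginally_stable S"
    and v: "\<And>t. 0 \<le> t \<Longrightarrow> (v has_vector_derivative S *v v t) (at t within {0..})"
  shows "\<exists>K\<ge>0. \<forall>t\<ge>0. norm (v t) \<le> K"
proof -
  obtain B where B: "bounded_bilinear B" "\<And>x y. B x y = B y x" "\<And>x. x \<noteq> 0 \<Longrightarrow> 0 < B x x"
    "\<And>x. B x (S *v x) \<le> (0::real)"
    using marginally_stable_form[OF S] by blast
  obtain c where c: "c > 0" "\<And>x. c * (norm x)\<^sup>2 \<le> B x x" using positive_form_lower_bound[OF B(1,3)] by blast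
  have "norm (v t) \<le> sqrt (B (v 0) (v 0) / c)" if t: "0 \<le> t" for t
  proof -
    have "B (v t) (v t) \<le> B (v 0) (v 0)"
    proof (rule pw_antimono[where D = "{}" and w = "\<lambda>t. B (v t) (v t)" and w' = "\<lambda>t. 2 * B (v t) (S *v v t)"])
      have "continuous_on {0..} v" by (rule continuous_on_vector_derivative) (use v in auto)
      then have "continuous_on {0..t} v" by (rule continuous_on_subset) auto
      then show "continuous_on {0..t} (\<lambda>t. B (v t) (v t))" by (intro bounded_bilinear.continuous_on[OF B(1)])
      fix s assume s: "0 < s" "s < t"
      have "(v has_vector_derivative S *v v s) (at s within {0..})" using v s by simp
      moreover have "at s within {0..} = at s" by (rule at_within_nhd[of s "{0<..}", THEN trans]) (use s in auto)
      ultimately have "(v has_vector_derivative S *v v s) (at s)" by simp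
      from bounded_bilinear_quadratic_derivative[OF B(1,2) this]
      show "((\<lambda>t. B (v t) (v t)) has_vector_derivative 2 * B (v s) (S *v v s)) (at s)" .
      show "2 * B (v s) (S *v v s) \<le> 0" using B(4)[of "v s"] by simp
    qed (use t in auto)
    then have "(norm (v t))\<^sup>2 \<le> B (v 0) (v 0) / c" using c(2)[of "v t"] c(1) by (simp add: field_simps)
    then show ?thesis by (rule real_le_rsqrt)
  qed
  then have "\<forall>t\<ge>0. norm (v t) \<le> \<bar>sqrt (B (v 0) (v 0) / c)\<bar>" by (meson abs_ge_self order_trans)
  then show ?thesis by (intro exI[of _ "\<bar>sqrt (B (v 0) (v 0) / c)\<bar>"] conjI abs_ge_zero)
qed

text \<open>The estimates are not known to be bounded beforehand. The perturbation is therefore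
  bounded by a vanishing gain times the norm of the stacked error plus a bound of the leader, which
  is the form \<open>perturbed_linear_tendsto\<close> accepts.\<close>

lemma observer_tendsto:
  fixes S :: "real ^ 'n ^ 'n"
  assumes S: "marginally_stable S"
    and stable: "exponentially_stable (range ts) (\<lambda>t. network_matrix S L0 F (G t))"
    and v0: "\<And>t. 0 \<le> t \<Longrightarrow> (v None has_vector_derivative S *v v None t) (at t within {0..})"
    and v: "\<And>i. pw_derivative (range ts) 0 (v (Some i)) (\<lambda>t. Sh (Some i) t *v v (Some i) t +
               (\<Sum>j\<in>neighbors (G t) (Some i). F \<bullet> (v j t - v (Some i) t)) *\<^sub>R L (Some i) t)"
    and Sh: "\<And>i. (Sh (Some i) \<longlongrightarrow> S) at_top" and L: "\<And>i. (L (Some i) \<longlongrightarrow> L0) at_top"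
  shows "((\<lambda>t. v (Some i) t - v None t) \<longlongrightarrow> 0) at_top"
proof -
  obtain K0 where K0: "K0 \<ge> 0" "\<And>t. 0 \<le> t \<Longrightarrow> norm (v None t) \<le> K0" using leader_bounded[OF S v0] by blast
  obtain Km where Km: "Km \<ge> 0" "\<And>(M :: real ^ 'n ^ 'n) x. norm (M *v x) \<le> norm M * norm x * Km"
    using bounded_bilinear.nonneg_bounded[OF bounded_bilinear_matvec] by blast
  define n where "n = real CARD('N option)"
  define W where "W j t = v j t - v None t" for j t
  define w where "w t = (\<Sum>i\<in>UNIV. embed i (W (Some i) t))" for t
  define c where "c i t = (\<Sum>j\<in>neighbors (G t) (Some i). F \<bullet> (v j t - v (Some i) t))" for i t
  \<comment> \<open>What replacing \<open>Sh\<close> and \<open>L\<close> by their limits leaves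
    over in the equation of agent \<open>i\<close>.\<close>
  define \<gamma> where "\<gamma> i t = (Sh (Some i) t - S) *v v (Some i) t + c i t *\<^sub>R (L (Some i) t - L0)" for i t
  define g where "g t = (\<Sum>i\<in>UNIV. embed i (\<gamma> i t))" for t
  have aw: "agent (w t) i = W (Some i) t" for t i unfolding w_def by (rule agent_sum_embed)
  have v0_at: "(v None has_vector_derivative S *v v None t) (at t)" if "0 < t" for t
  proof -
    have "at t within {0..} = at t" by (rule at_within_nhd[of t "{0<..}", THEN trans]) (use that in auto)
    then show ?thesis using v0[of t] that by simp
  qed
  have v0_cont: "continuous_on {0..} (v None)" by (rule continuous_on_vector_derivative) (use v0 in auto)
  have w_pw: "pw_derivative (range ts) 0 w (\<lambda>t. network_matrix S L0 F (G t) *v w t + g t)"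
    unfolding pw_derivative_def
  proof (intro conjI allI impI)
    show "continuous_on {0..} w"
      unfolding w_def[abs_def] W_def
      by (intro continuous_on_sum bounded_linear.continuous_on[OF bounded_linear_embed] continuous_on_diff v0_cont)
        (use v in \<open>auto simp: pw_derivative_def\<close>)
    fix t :: real assume t: "0 < t" "t \<notin> range ts"
    have vd: "(v (Some i) has_vector_derivative Sh (Some i) t *v v (Some i) t + c i t *\<^sub>R L (Some i) t) (at t)" for i
      using v[of i] t unfolding pw_derivative_def c_def by blast
    have "(w has_vector_derivative (\<Sum>i\<in>UNIV. embed i (Sh (Some i) t *v v (Some i) t + c i t *\<^sub>R L (Some i) t - S *v v None t))) (at t)"
      unfolding w_def[abs_def] W_def
      by (intro has_vector_derivative_sum bounded_linear.has_vector_derivative[OF bounded_linear_embed]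
          has_vector_derivative_diff vd v0_at t)
    moreover have "(\<Sum>i\<in>UNIV. embed i (Sh (Some i) t *v v (Some i) t + c i t *\<^sub>R L (Some i) t - S *v v None t))
        = network_matrix S L0 F (G t) *v w t + g t"
    proof (rule agent_eqI)
      fix i
      have cW: "c i t = (\<Sum>j\<in>neighbors (G t) (Some i). F \<bullet> W j t - F \<bullet> W (Some i) t)"
        unfolding c_def W_def by (simp add: inner_diff_right)
      have "agent (network_matrix S L0 F (G t) *v w t + g t) i
          = agent (network_matrix S L0 F (G t) *v w t) i + agent (g t) i"
        by (rule linear_add[OF bounded_linear.linear[OF bounded_linear_agent]])
      also have "agent (g t) i = \<gamma> i t" unfolding g_def by (rule agent_sum_embed)
      also have "agent (network_matrix S L0 F (G t) *v w t) i = S *v W (Some i) t + c i t *\<^sub>R L0"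
      proof -
        have "W j t = (case j of None \<Rightarrow> 0 | Some i \<Rightarrow> agent (w t) i)" for j
          by (cases j) (simp add: W_def, simp add: aw)
        from agent_network_matrix[of "\<lambda>j. W j t" "w t" i "G t" S L0 F, OF this G_no_loop] t
        show ?thesis unfolding cW aw by (simp only: less_imp_le)
      qed
      also have "S *v W (Some i) t + c i t *\<^sub>R L0 + \<gamma> i t
          = Sh (Some i) t *v v (Some i) t + c i t *\<^sub>R L (Some i) t - S *v v None t"
        unfolding \<gamma>_def W_def by (simp add: matrix_vector_mult_diff_distrib matrix_vector_mult_diff_rdistrib scaleR_diff_right)
      finally show "agent (\<Sum>i\<in>UNIV. embed i (Sh (Some i) t *v v (Some i) t + c i t *\<^sub>R L (Some i) t - S *v v None t)) i
          = agent (network_matrix S L0 F (G t) *v w t + g t) i"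
        unfolding agent_sum_embed by simp
    qed
    ultimately show "(w has_vector_derivative network_matrix S L0 F (G t) *v w t + g t) (at t)" by simp
  qed
  define \<epsilon> where "\<epsilon> t = (\<Sum>i\<in>UNIV. Km * norm (Sh (Some i) t - S) + 2 * n * norm F * norm (L (Some i) t - L0))" for t
  have n0: "n \<ge> 0" unfolding n_def by simp
  have \<epsilon>0: "0 \<le> \<epsilon> t" for t unfolding \<epsilon>_def using Km n0 by (intro sum_nonneg add_nonneg_nonneg mult_nonneg_nonneg) auto
  have "(w \<longlongrightarrow> 0) at_top"
  proof (rule perturbed_linear_tendsto[OF stable w_pw _ K0(1) \<epsilon>0])
    have "(\<epsilon> \<longlongrightarrow> (\<Sum>i\<in>(UNIV::'N set). Km * norm (S - S) + 2 * n * norm F * norm (L0 - L0))) at_top"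
      unfolding \<epsilon>_def by (intro tendsto_intros Sh L)
    then show "(\<epsilon> \<longlongrightarrow> 0) at_top" by simp
    fix t :: real assume t: "0 \<le> t"
    have Wb: "norm (W j t) \<le> norm (w t)" for j
    proof (cases j)
      case (Some i) then show ?thesis using norm_agent_le[of "w t" i] aw by simp
    qed (simp add: W_def)
    have vb: "norm (v (Some i) t) \<le> norm (w t) + K0" for i
    proof -
      have "v (Some i) t = W (Some i) t + v None t" unfolding W_def by simp
      then have "norm (v (Some i) t) \<le> norm (W (Some i) t) + norm (v None t)" by (metis norm_triangle_ineq)
      then show ?thesis using Wb[of "Some i"] K0(2)[OF t] by linarith
    qed
    have cb: "\<bar>c i t\<bar> \<le> 2 * n * norm F * (norm (w t) + K0)" for i
    proof -
      have "\<bar>c i t\<bar> \<le> (\<Sum>j\<in>neighbors (G t) (Some i). \<bar>F \<bullet> (v j t - v (Some i) t)\<bar>)" unfolding c_def by (rule sum_abs)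
      also have "\<dots> \<le> (\<Sum>j\<in>neighbors (G t) (Some i). norm F * (2 * norm (w t)))"
      proof (rule sum_mono)
        fix j
        have "\<bar>F \<bullet> (v j t - v (Some i) t)\<bar> \<le> norm F * norm (v j t - v (Some i) t)" by (rule Cauchy_Schwarz_ineq2)
        also have "norm (v j t - v (Some i) t) \<le> 2 * norm (w t)"
        proof -
          have "v j t - v (Some i) t = W j t - W (Some i) t" unfolding W_def by simp
          then show ?thesis using norm_triangle_ineq4[of "W j t" "W (Some i) t"] Wb[of j] Wb[of "Some i"] by simp
        qed
        finally show "\<bar>F \<bullet> (v j t - v (Some i) t)\<bar> \<le> norm F * (2 * norm (w t))" by (simp add: mult_left_mono)
      qed
      also have "\<dots> = real (card (neighbors (G t) (Some i))) * (norm F * (2 * norm (w t)))" by simp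
      also have "\<dots> \<le> n * (norm F * (2 * (norm (w t) + K0)))"
      proof (rule mult_mono)
        have "card (neighbors (G t) (Some i)) \<le> CARD('N option)" by (rule card_mono) auto
        then show "real (card (neighbors (G t) (Some i))) \<le> n" unfolding n_def by simp
        show "norm F * (2 * norm (w t)) \<le> norm F * (2 * (norm (w t) + K0))" using K0 by (intro mult_left_mono) auto
      qed (use n0 in auto)
      finally show ?thesis by (simp add: mult_ac)
    qed
    have gb: "norm (\<gamma> i t) \<le> (Km * norm (Sh (Some i) t - S) + 2 * n * norm F * norm (L (Some i) t - L0)) * (norm (w t) + K0)" for i
    proof -
      have "norm (\<gamma> i t) \<le> norm ((Sh (Some i) t - S) *v v (Some i) t) + \<bar>c i t\<bar> * norm (L (Some i) t - L0)"
        unfolding \<gamma>_def by (rule order_trans[OF norm_triangle_ineq]) simp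
      also have "norm ((Sh (Some i) t - S) *v v (Some i) t) \<le> norm (Sh (Some i) t - S) * (norm (w t) + K0) * Km"
        by (rule order_trans[OF Km(2)]) (intro mult_right_mono mult_left_mono vb Km, auto)
      also have "\<bar>c i t\<bar> * norm (L (Some i) t - L0) \<le> 2 * n * norm F * (norm (w t) + K0) * norm (L (Some i) t - L0)"
        by (intro mult_right_mono cb) auto
      finally show ?thesis by (simp add: algebra_simps)
    qed
    have "norm (g t) \<le> (\<Sum>i\<in>UNIV. norm (\<gamma> i t))"
      unfolding g_def by (rule order_trans[OF norm_sum]) (simp add: norm_embed)
    also have "\<dots> \<le> \<epsilon> t * (norm (w t) + K0)" unfolding \<epsilon>_def sum_distrib_right by (rule sum_mono) (rule gb)
    finally show "norm (g t) \<le> \<epsilon> t * (norm (w t) + K0)" .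
  qed
  then have "((\<lambda>t. agent (w t) i) \<longlongrightarrow> agent 0 i) at_top"
    by (rule bounded_linear.tendsto[OF bounded_linear_agent])
  then show ?thesis unfolding aw W_def by (simp add: linear_0[OF bounded_linear.linear[OF bounded_linear_agent]])
qed

end



section \<open>The estimated reference, its derivatives, and the tracking result\<close>

lemma Bfun_linear:
  assumes l: "bounded_linear l" and u: "Bfun u F"
  shows "Bfun (\<lambda>t. l (u t)) F"
proof -
  obtain K where K: "0 < K" "\<forall>\<^sub>F t in F. norm (u t) \<le> K" using u unfolding Bfun_def by blast
  obtain C where C: "0 < C" "\<And>x. norm (l x) \<le> norm x * C" using bounded_linear.pos_bounded[OF l] by blast
  have "\<forall>\<^sub>F t in F. norm (l (u t)) \<le> K * C"
    using K(2) by (rule eventually_mono) (meson C less_imp_le mult_right_mono order_trans)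
  then show ?thesis unfolding Bfun_def using K(1) C(1) by (intro exI[of _ "K * C"]) simp
qed

lemma Bfun_close:
  fixes u w :: "'a \<Rightarrow> 'b::real_normed_vector"
  assumes u: "Bfun u F" and d: "((\<lambda>t. w t - u t) \<longlongrightarrow> 0) F"
  shows "Bfun w F"
proof -
  obtain K where K: "0 < K" "\<forall>\<^sub>F t in F. norm (u t) \<le> K" using u unfolding Bfun_def by blast
  have "\<forall>\<^sub>F t in F. dist (w t - u t) 0 < 1" by (rule tendstoD[OF d]) simp
  with K(2) have "\<forall>\<^sub>F t in F. norm (w t) \<le> K + 1"
  proof eventually_elim
    case (elim t)
    have "norm (w t) \<le> norm (u t) + norm (w t - u t)" by (rule norm_triangle_sub)
    then show ?case using elim by (simp add: dist_norm)
  qed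
  then show ?thesis unfolding Bfun_def using K(1) by (intro exI[of _ "K + 1"]) simp
qed

text \<open>The product-rule remainder: for \<open>v' = A v + \<eta>\<close>, the amount by which
  the derivative of \<open>A^k v\<close> differs from \<open>A^(k+1) v\<close>. Every summand
  contains \<open>A'\<close> or \<eta>.\<close>

primrec power_defect ::
    "real ^ 'n ^ 'n \<Rightarrow> real ^ 'n ^ 'n \<Rightarrow> real ^ 'n \<Rightarrow> real ^ 'n \<Rightarrow> nat \<Rightarrow> real ^ 'n" where
  "power_defect A' A v \<eta> 0 = \<eta>"
| "power_defect A' A v \<eta> (Suc k) = A' *v mat_power_vec A k v + A *v power_defect A' A v \<eta> k"

lemma mat_power_derivative:
  fixes A :: "real \<Rightarrow> real ^ 'n ^ 'n"
  assumes A: "(A has_vector_derivative A') (at t)" and v: "(v has_vector_derivative A t *v v t + \<eta>) (at t)"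
  shows "((\<lambda>t. mat_power_vec (A t) k (v t)) has_vector_derivative
    mat_power_vec (A t) (Suc k) (v t) + power_defect A' (A t) (v t) \<eta> k) (at t)"
proof (induction k)
  case 0 then show ?case using v by (simp add: mat_power_vec_0 mat_power_vec_Suc)
next
  case (Suc k)
  have "A t *v (mat_power_vec (A t) (Suc k) (v t) + power_defect A' (A t) (v t) \<eta> k) + A' *v mat_power_vec (A t) k (v t)
      = mat_power_vec (A t) (Suc (Suc k)) (v t) + power_defect A' (A t) (v t) \<eta> (Suc k)"
    by (simp add: matrix_vector_right_distrib mat_power_vec_Suc)
  with bounded_bilinear.has_vector_derivative[OF bounded_bilinear_matvec A Suc]
  show ?case by (simp only: mat_power_vec_Suc[of "A _" k])
qed

lemma mat_power_continuous:
  assumes "continuous_on T A" "continuous_on T v"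
  shows "continuous_on T (\<lambda>t. mat_power_vec (A t) k (v t))"
proof (induction k)
  case 0 then show ?case using assms by (simp add: mat_power_vec_0)
next
  case (Suc k) show ?case
    unfolding mat_power_vec_Suc by (rule bounded_bilinear.continuous_on[OF bounded_bilinear_matvec assms(1) Suc])
qed

lemma Bfun_mat_power:
  assumes "Bfun u F"
  shows "Bfun (\<lambda>t. mat_power_vec S k (u t)) F"
  by (rule Bfun_linear[OF _ assms]) (rule linear_conv_bounded_linear[THEN iffD1, OF mat_power_vec_linear])

text \<open>Telescoping: the next difference is
  \<open>(A - S) A^k v + S (A^k v - S^k u)\<close>.\<close>

lemma mat_power_tendsto:
  assumes A: "(A \<longlongrightarrow> S) F" and u: "Bfun u F" and v: "((\<lambda>t. v t - u t) \<longlongrightarrow> 0) F"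
  shows "((\<lambda>t. mat_power_vec (A t) k (v t) - mat_power_vec S k (u t)) \<longlongrightarrow> 0) F"
proof (induction k)
  case 0 then show ?case using v by (simp add: mat_power_vec_0)
next
  case (Suc k)
  have b: "Bfun (\<lambda>t. mat_power_vec (A t) k (v t)) F" by (rule Bfun_close[OF Bfun_mat_power[OF u] Suc])
  have 1: "((\<lambda>t. (A t - S) *v mat_power_vec (A t) k (v t)) \<longlongrightarrow> 0) F"
    by (rule tendsto_zero_bilinear(1)[OF bounded_bilinear_matvec LIM_zero[OF A] b])
  have 2: "((\<lambda>t. S *v (mat_power_vec (A t) k (v t) - mat_power_vec S k (u t))) \<longlongrightarrow> 0) F"
    by (rule tendsto_zero_bilinear(2)[OF bounded_bilinear_matvec Bfun_const Suc])
  show ?case using tendsto_add[OF 1 2]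
    by (simp add: mat_power_vec_Suc matrix_vector_mult_diff_distrib matrix_vector_mult_diff_rdistrib)
qed

lemma power_defect_tendsto:
  assumes A: "(A \<longlongrightarrow> S) F" and A': "(A' \<longlongrightarrow> 0) F" and \<eta>: "(\<eta> \<longlongrightarrow> 0) F"
    and b: "\<And>k. Bfun (\<lambda>t. mat_power_vec (A t) k (v t)) F"
  shows "((\<lambda>t. power_defect (A' t) (A t) (v t) (\<eta> t) k) \<longlongrightarrow> 0) F"
proof (induction k)
  case (Suc k)
  have 1: "((\<lambda>t. A' t *v mat_power_vec (A t) k (v t)) \<longlongrightarrow> 0) F"
    by (rule tendsto_zero_bilinear(1)[OF bounded_bilinear_matvec A' b])
  have 2: "((\<lambda>t. A t *v power_defect (A' t) (A t) (v t) (\<eta> t) k) \<longlongrightarrow> 0) F"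
    by (rule tendsto_zero_bilinear(2)[OF bounded_bilinear_matvec Bfun_close[OF Bfun_const[of S] LIM_zero[OF A]] Suc])
  show ?case using tendsto_add[OF 1 2] by simp
qed (use \<eta> in simp)

context switching_network
begin

lemma closed_loop_tracking:
  fixes S :: "real ^ 'n ^ 'n"
  assumes S: "marginally_stable S"
    and par: "admissible_parameters (range ts) G r m S F \<mu>1 \<mu>2 \<kappa> \<Lambda> \<beta> L0"
    and r_pos: "\<And>i. 1 \<le> r i"
    and f_carrier: "\<And>i. \<forall>x\<in>carrier_vec (r i). \<forall>t\<ge>0. f i x t \<in> carrier_vec (m i)"
    and f_lipschitz: "\<And>i. locally_lipschitz_uniform (r i) (f i)"
    and f_bound: "\<And>i. \<exists>\<phi>. \<forall>x\<in>carrier_vec (r i). \<forall>t\<ge>0. vec_norm (f i x t) \<le> \<phi> x"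
    and \<theta>: "\<And>i. \<theta> i \<in> carrier_vec (m i)" and d: "\<And>i t. 0 \<le> t \<Longrightarrow> d i t = 0"
    and sol: "closed_loop_solution (range ts) G r m f \<theta> d S F \<mu>1 \<mu>2 \<kappa> \<Lambda> \<beta> L0 x \<theta>h v Sh L"
    and k: "k < r i"
  shows "((\<lambda>t. x i t $\<^sub>v k - F \<bullet> mat_power_vec S k (v None t)) \<longlongrightarrow> 0) at_top"
proof -
  have v0: "\<And>t. 0 \<le> t \<Longrightarrow> (v None has_vector_derivative S *v v None t) (at t within {0..})"
    and Sh0: "\<And>t. 0 \<le> t \<Longrightarrow> Sh None t = S" and L0: "\<And>t. 0 \<le> t \<Longrightarrow> L None t = L0"
    and plant: "follower_plant (range ts) (r i) (f i) (\<theta> i) (d i)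
          (control_input (r i) (f i) F (\<kappa> i) (\<beta> i) (x i) (\<theta>h i) (Sh (Some i)) (v (Some i))) (x i)"
    and adapt: "adaptation_law (range ts) (r i) (m i) (f i) F (\<Lambda> i) (\<beta> i) (x i) (\<theta>h i) (Sh (Some i)) (v (Some i))"
    and vi: "\<And>i. pw_derivative (range ts) 0 (v (Some i)) (\<lambda>t. Sh (Some i) t *v v (Some i) t +
               (\<Sum>j\<in>neighbors (G t) (Some i). F \<bullet> (v j t - v (Some i) t)) *\<^sub>R L (Some i) t)"
    and Shi: "\<And>i. pw_derivative (range ts) 0 (Sh (Some i))
          (\<lambda>t. \<mu>1 *\<^sub>R (\<Sum>j\<in>neighbors (G t) (Some i). Sh j t - Sh (Some i) t))"
    and Li: "\<And>i. pw_derivative (range ts) 0 (L (Some i))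
          (\<lambda>t. \<mu>2 *\<^sub>R (\<Sum>j\<in>neighbors (G t) (Some i). L j t - L (Some i) t))"
    using sol unfolding closed_loop_solution_def by blast+
  have \<mu>: "0 < \<mu>1" "0 < \<mu>2" and \<kappa>: "0 < \<kappa> i" and spd: "sym_pos_def (m i) (\<Lambda> i)"
    and roots: "\<And>z::complex. z ^ (r i - 1) + (\<Sum>k=1..r i - 1. complex_of_real (\<beta> i k) * z ^ (r i - 1 - k)) = 0 \<Longrightarrow> Re z < 0"
    and stable: "exponentially_stable (range ts) (\<lambda>t. network_matrix S L0 F (G t))"
    using par unfolding admissible_parameters_def network_matrix_def by blast+
  have Sh_lim: "(Sh (Some i) \<longlongrightarrow> S) at_top" for i by (rule vector_consensus_tendsto[OF \<mu>(1) Sh0 Shi])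
  have L_lim: "(L (Some i) \<longlongrightarrow> L0) at_top" for i by (rule vector_consensus_tendsto[OF \<mu>(2) L0 Li])
  have v_lim: "((\<lambda>t. v (Some i) t - v None t) \<longlongrightarrow> 0) at_top" for i
    by (rule observer_tendsto[OF S stable v0 vi Sh_lim L_lim])
  have v0_B: "Bfun (v None) at_top"
  proof -
    obtain K where K: "K \<ge> 0" "\<And>t. 0 \<le> t \<Longrightarrow> norm (v None t) \<le> K" using leader_bounded[OF S v0] by blast
    have "\<forall>\<^sub>F t in at_top. norm (v None t) \<le> K + 1"
      using eventually_ge_at_top[of 0] by (rule eventually_mono) (use K in fastforce)
    then show ?thesis unfolding Bfun_def using K(1) by (intro exI[of _ "K + 1"]) simp
  qed
  have Sh_all: "((\<lambda>t. Sh j t - S) \<longlongrightarrow> 0) at_top" for j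
  proof (cases j)
    case None
    have "\<forall>\<^sub>F t in at_top. Sh j t - S = 0" using eventually_ge_at_top[of "0::real"]
      by (rule eventually_mono) (simp add: None Sh0)
    then show ?thesis by (rule tendsto_eventually)
  qed (use LIM_zero[OF Sh_lim] in auto)
  have v_all: "((\<lambda>t. v j t - v None t) \<longlongrightarrow> 0) at_top" for j
    by (cases j) (use v_lim in auto)
  \<comment> \<open>The follower tracks its own estimate \<open>P\<close>, with defects
    \<open>D\<close>; the distance from \<open>P\<close> to the true leader signals vanishes
    separately.\<close>
  define P where "P k t = mat_power_vec (Sh (Some i) t) k (v (Some i) t)" for k t
  define A' where "A' t = \<mu>1 *\<^sub>R (\<Sum>j\<in>neighbors (G t) (Some i). Sh j t - Sh (Some i) t)" for t
  define \<eta> where "\<eta> t = (\<Sum>j\<in>neighbors (G t) (Some i). F \<bullet> (v j t - v (Some i) t)) *\<^sub>R L (Some i) t" for t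
  define D where "D k t = power_defect (A' t) (Sh (Some i) t) (v (Some i) t) (\<eta> t) k" for k t
  have P_lim: "((\<lambda>t. P k t - mat_power_vec S k (v None t)) \<longlongrightarrow> 0) at_top" for k
    unfolding P_def by (rule mat_power_tendsto[OF Sh_lim v0_B v_lim])
  have P_B: "Bfun (P k) at_top" for k
    by (rule Bfun_close[OF Bfun_mat_power[OF v0_B] P_lim])
  have A'_lim: "(A' \<longlongrightarrow> 0) at_top"
  proof -
    have "((\<lambda>t. Sh j t - Sh (Some i) t) \<longlongrightarrow> 0) at_top" for j
      using tendsto_diff[OF Sh_all[of j] Sh_all[of "Some i"]] by simp
    from tendsto_scaleR[OF tendsto_const[of \<mu>1] neighbor_sum_tendsto[where h = "\<lambda>j t. Sh j t - Sh (Some i) t" and G = G, OF this]]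
    show ?thesis unfolding A'_def[abs_def] by simp
  qed
  have \<eta>_lim: "(\<eta> \<longlongrightarrow> 0) at_top"
  proof -
    have "((\<lambda>t. F \<bullet> (v j t - v (Some i) t)) \<longlongrightarrow> 0) at_top" for j
    proof -
      have "((\<lambda>t. v j t - v (Some i) t) \<longlongrightarrow> 0) at_top"
        using tendsto_diff[OF v_all[of j] v_all[of "Some i"]] by simp
      from tendsto_inner[OF tendsto_const[of F] this] show ?thesis by simp
    qed
    from tendsto_scaleR[OF neighbor_sum_tendsto[where h = "\<lambda>j t. F \<bullet> (v j t - v (Some i) t)" and G = G, OF this] L_lim]
    show ?thesis unfolding \<eta>_def[abs_def] by simp
  qed
  have D_lim: "(D k \<longlongrightarrow> 0) at_top" for k
    unfolding D_def[abs_def]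
    by (rule power_defect_tendsto[OF Sh_lim A'_lim \<eta>_lim]) (use P_B in \<open>simp add: P_def[abs_def]\<close>)
  have P_cont: "continuous_on {0..} (P k)" for k
    unfolding P_def[abs_def] by (rule mat_power_continuous) (use Shi[of i] vi[of i] in \<open>auto simp: pw_derivative_def\<close>)
  have P_der: "(P k has_vector_derivative P (Suc k) t + D k t) (at t)" if t: "0 < t" "t \<notin> range ts" for k t
  proof -
    have "(Sh (Some i) has_vector_derivative A' t) (at t)"
      using Shi[of i] t unfolding pw_derivative_def A'_def by blast
    moreover have "(v (Some i) has_vector_derivative Sh (Some i) t *v v (Some i) t + \<eta> t) (at t)"
      using vi[of i] t unfolding pw_derivative_def \<eta>_def by blast
    ultimately show ?thesis unfolding P_def[abs_def] D_def by (rule mat_power_derivative)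
  qed
  have track: "((\<lambda>t. x i t $\<^sub>v k - F \<bullet> P k t) \<longlongrightarrow> 0) at_top"
  proof (rule follower_tracking[OF finite_switching r_pos f_carrier f_lipschitz f_bound \<theta> \<kappa> spd roots d plant adapt,
        where \<psi> = "\<lambda>k t. F \<bullet> P k t" and \<delta> = "\<lambda>k t. F \<bullet> D k t"])
    fix k
    show "F \<bullet> P k t = F \<bullet> mat_power_vec (Sh (Some i) t) k (v (Some i) t)" for t by (simp add: P_def)
    show "continuous_on {0..} (\<lambda>t. F \<bullet> P k t)" by (intro continuous_intros P_cont)
    show "((\<lambda>t. F \<bullet> P k t) has_vector_derivative F \<bullet> P (Suc k) t + F \<bullet> D k t) (at t)"
      if "0 < t" "t \<notin> range ts" for t
      using bounded_linear.has_vector_derivative[OF bounded_linear_inner_right P_der[OF that]]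
      by (simp add: inner_add_right)
    show "((\<lambda>t. F \<bullet> D k t) \<longlongrightarrow> 0) at_top" using tendsto_inner[OF tendsto_const[of F] D_lim] by simp
    have "Bfun (\<lambda>t. F \<bullet> P k t) at_top" by (rule Bfun_linear[OF bounded_linear_inner_right P_B])
    then show "\<exists>K. \<forall>\<^sub>F t in at_top. \<bar>F \<bullet> P k t\<bar> \<le> K" unfolding Bfun_def by auto
  qed (assumption | rule k)+
  have "((\<lambda>t. F \<bullet> (P k t - mat_power_vec S k (v None t))) \<longlongrightarrow> 0) at_top"
    using tendsto_inner[OF tendsto_const[of F] P_lim] by simp
  from tendsto_add[OF track this] show ?thesis by (simp add: inner_diff_right)
qed

lemma output_synchronization:
  fixes S :: "real ^ 'n ^ 'n"
  assumes S: "marginally_stable S"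
    and par: "admissible_parameters (range ts) G r m S F \<mu>1 \<mu>2 \<kappa> \<Lambda> \<beta> L0"
    and r_pos: "\<And>i. 1 \<le> r i"
    and f_carrier: "\<And>i. \<forall>x\<in>carrier_vec (r i). \<forall>t\<ge>0. f i x t \<in> carrier_vec (m i)"
    and f_lipschitz: "\<And>i. locally_lipschitz_uniform (r i) (f i)"
    and f_bound: "\<And>i. \<exists>\<phi>. \<forall>x\<in>carrier_vec (r i). \<forall>t\<ge>0. vec_norm (f i x t) \<le> \<phi> x"
    and \<theta>: "\<And>i. \<theta> i \<in> carrier_vec (m i)" and d: "\<And>i t. 0 \<le> t \<Longrightarrow> d i t = 0"
    and sol: "closed_loop_solution (range ts) G r m f \<theta> d S F \<mu>1 \<mu>2 \<kappa> \<Lambda> \<beta> L0 x \<theta>h v Sh L"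
    and k: "k < r i"
  shows "((\<lambda>t. (deriv ^^ k) (\<lambda>s. x i s $\<^sub>v 0) t - (deriv ^^ k) (\<lambda>s. F \<bullet> v None s) t) \<longlongrightarrow> 0) at_top"
proof -
  have interior: "at t within {0..} = at t" if "0 < t" for t :: real
    by (rule at_within_nhd[of t "{0<..}", THEN trans]) (use that in auto)
  have plant: "follower_plant (range ts) (r i) (f i) (\<theta> i) (d i)
          (control_input (r i) (f i) F (\<kappa> i) (\<beta> i) (x i) (\<theta>h i) (Sh (Some i)) (v (Some i))) (x i)"
    and v0: "\<And>t. 0 \<le> t \<Longrightarrow> (v None has_vector_derivative S *v v None t) (at t within {0..})"
    using sol unfolding closed_loop_solution_def by blast+
  have x_der: "((\<lambda>s. x i s $\<^sub>v k) has_real_derivative x i t $\<^sub>v Suc k) (at t)" if "Suc k < r i" "0 < t" for k t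
    using plant that interior[OF that(2)] unfolding follower_plant_def by (metis less_imp_le)
  have v_der: "((\<lambda>s. F \<bullet> mat_power_vec S k (v None s)) has_real_derivative F \<bullet> mat_power_vec S (Suc k) (v None t)) (at t)"
    if t: "0 < t" for k t
  proof -
    have "(v None has_vector_derivative S *v v None t) (at t)" using v0[of t] interior[OF t] t by simp
    from bounded_linear.has_vector_derivative[OF linear_conv_bounded_linear[THEN iffD1, OF mat_power_vec_linear[of S k]] this]
    have "((\<lambda>s. mat_power_vec S k (v None s)) has_vector_derivative mat_power_vec S (Suc k) (v None t)) (at t)"
      unfolding mat_power_vec_swap .
    from bounded_linear.has_vector_derivative[OF bounded_linear_inner_right this]
    show ?thesis by (simp add: has_real_derivative_iff_has_vector_derivative)
  qed
  have 1: "(deriv ^^ k) (\<lambda>s. x i s $\<^sub>v 0) t = x i t $\<^sub>v k" if "0 < t" for t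
    using iterated_deriv[of "r i" "\<lambda>k t. x i t $\<^sub>v k", OF x_der k that] by simp
  have 2: "(deriv ^^ k) (\<lambda>s. F \<bullet> v None s) t = F \<bullet> mat_power_vec S k (v None t)" if "0 < t" for t
    using iterated_deriv[of "r i" "\<lambda>k t. F \<bullet> mat_power_vec S k (v None t)", OF v_der k that] by (simp add: mat_power_vec_0)
  have lim: "((\<lambda>t. x i t $\<^sub>v k - F \<bullet> mat_power_vec S k (v None t)) \<longlongrightarrow> 0) at_top"
    by (rule closed_loop_tracking[OF S par r_pos f_carrier f_lipschitz f_bound \<theta> d sol k])
  show ?thesis
  proof (rule Lim_transform_eventually[OF lim])
    show "\<forall>\<^sub>F t in at_top. x i t $\<^sub>v k - F \<bullet> mat_power_vec S k (v None t)
        = (deriv ^^ k) (\<lambda>s. x i s $\<^sub>v 0) t - (deriv ^^ k) (\<lambda>s. F \<bullet> v None s) t"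
      using eventually_gt_at_top[of 0] by (rule eventually_mono) (simp add: 1 2)
  qed
qed

end


subsection \<open>Existence of closed-loop solutions\<close>


lemma norm_vec_le_sum: "norm (x :: 'a::real_normed_vector ^ 'N) \<le> (\<Sum>i\<in>UNIV. norm (x $ i))"
  unfolding norm_vec_def by (rule L2_set_le_sum) auto

lemma continuous_bounded_on_interval:
  fixes h :: "real \<Rightarrow> 'a::real_normed_vector"
  assumes "continuous_on {0..} h" "0 \<le> a"
  shows "\<exists>M\<ge>0. \<forall>t\<in>{a..b}. norm (h t) \<le> M"
proof -
  have "continuous_on {a..b} h" by (rule continuous_on_subset[OF assms(1)]) (use assms(2) in auto)
  then have "bounded (h ` {a..b})" by (intro compact_imp_bounded compact_continuous_image) auto
  then obtain M where M: "\<And>t. t \<in> {a..b} \<Longrightarrow> norm (h t) \<le> M" unfolding bounded_iff by blast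
  have "norm (h t) \<le> \<bar>M\<bar>" if "t \<in> {a..b}" for t using M[OF that] by linarith
  then show ?thesis by (intro exI[of _ "\<bar>M\<bar>"]) simp
qed

context switching_network
begin

text \<open>The graph is a separate argument of the field: once it is frozen on an interval between
  switching instants, the field is continuous in time.\<close>

lemma coupled_solution_exists:
  fixes g :: "('N option \<times> 'N option) set \<Rightarrow> 'N \<Rightarrow> real \<Rightarrow> 'a::banach ^ 'N \<Rightarrow> 'a"
  assumes cont: "\<And>E i z. continuous_on {0..} (\<lambda>t. g E i t z)"
    and lip: "\<And>E i a b. 0 \<le> a \<Longrightarrow> \<exists>K. \<forall>t\<in>{a..b}. \<forall>x y. norm (g E i t x - g E i t y) \<le> K * norm (x - y)"
  shows "\<exists>X. \<forall>i. X i 0 = x0 i \<and> pw_derivative (range ts) 0 (X i) (\<lambda>t. g (G t) i t (\<chi> i. X i t))"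
proof -
  have "\<exists>w. w (ts 0) = (\<chi> i. x0 i) \<and> pw_derivative (range ts) (ts 0) w (\<lambda>t. (\<chi> i. g (G t) i t (w t)))"
  proof (rule ode_switched_lipschitz[where g = "\<lambda>k t z. (\<chi> i. g (G (ts k)) i t z)", OF ts_strict ts_unbounded])
    fix k t z assume "t \<in> {ts k<..<ts (Suc k)}"
    then show "(\<chi> i. g (G t) i t z) = (\<chi> i. g (G (ts k)) i t z)" using G_const[of t k] by simp
  next
    fix k z
    have "continuous_on {ts k..ts (Suc k)} (\<lambda>t. g (G (ts k)) i t z)" for i
      by (rule continuous_on_subset[OF cont]) (use ts_nonneg[of k] in auto)
    then show "continuous_on {ts k..ts (Suc k)} (\<lambda>t. (\<chi> i. g (G (ts k)) i t z))"
      by (rule continuous_on_vec_lambda)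
  next
    fix k
    have "\<forall>i. \<exists>K. \<forall>t\<in>{ts k..ts (Suc k)}. \<forall>x y. norm (g (G (ts k)) i t x - g (G (ts k)) i t y) \<le> K * norm (x - y)"
      using lip[OF ts_nonneg] by blast
    then obtain K where K: "\<And>i t x y. t \<in> {ts k..ts (Suc k)} \<Longrightarrow>
        norm (g (G (ts k)) i t x - g (G (ts k)) i t y) \<le> K i * norm (x - y)" by metis
    show "\<exists>K. \<forall>t\<in>{ts k..ts (Suc k)}. \<forall>x y.
        norm ((\<chi> i. g (G (ts k)) i t x) - (\<chi> i. g (G (ts k)) i t y)) \<le> K * norm (x - y)"
    proof (intro exI[of _ "\<Sum>i\<in>UNIV. K i"] ballI allI)
      fix t x y assume t: "t \<in> {ts k..ts (Suc k)}"
      have "norm ((\<chi> i. g (G (ts k)) i t x) - (\<chi> i. g (G (ts k)) i t y))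
          \<le> (\<Sum>i\<in>UNIV. norm (g (G (ts k)) i t x - g (G (ts k)) i t y))"
        by (rule order_trans[OF norm_vec_le_sum]) simp
      also have "\<dots> \<le> (\<Sum>i\<in>UNIV. K i) * norm (x - y)"
        unfolding sum_distrib_right by (rule sum_mono) (rule K[OF t])
      finally show "norm ((\<chi> i. g (G (ts k)) i t x) - (\<chi> i. g (G (ts k)) i t y)) \<le> (\<Sum>i\<in>UNIV. K i) * norm (x - y)" .
    qed
  qed
  then obtain w where w: "w 0 = (\<chi> i. x0 i)" "pw_derivative (range ts) 0 w (\<lambda>t. (\<chi> i. g (G t) i t (w t)))"
    unfolding ts_0 by blast
  have "pw_derivative (range ts) 0 (\<lambda>t. w t $ i) (\<lambda>t. g (G t) i t (\<chi> i. w t $ i))" for i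
    using pw_derivative_linear[OF w(2) bounded_linear_vec_nth[of i]] by simp
  then show ?thesis using w(1) by (intro exI[of _ "\<lambda>i t. w t $ i"]) simp
qed

lemma vector_consensus_exists:
  fixes X0 :: "'a::banach"
  shows "\<exists>X. (\<forall>t. X None t = X0) \<and> (\<forall>i. X (Some i) 0 = x0 i \<and>
    pw_derivative (range ts) 0 (X (Some i)) (\<lambda>t. \<mu> *\<^sub>R (\<Sum>j\<in>neighbors (G t) (Some i). X j t - X (Some i) t)))"
proof -
  define Z where "Z j z = (case j of None \<Rightarrow> X0 | Some i \<Rightarrow> z $ i)" for j and z :: "'a ^ 'N"
  define g where "g E i t z = \<mu> *\<^sub>R (\<Sum>j\<in>neighbors E (Some i). Z j z - z $ i)"
    for E :: "('N option \<times> 'N option) set" and i and t :: real and z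
  have Zd: "norm (Z j x - Z j y) \<le> norm (x - y)" for j x y
    using Finite_Cartesian_Product.norm_nth_le[of "x - y"] by (cases j) (auto simp: Z_def)
  have lip: "norm (g E i t x - g E i t y) \<le> (\<bar>\<mu>\<bar> * (\<Sum>j\<in>neighbors E (Some i). 2)) * norm (x - y)" for E i t x y
  proof -
    have "norm (g E i t x - g E i t y) = \<bar>\<mu>\<bar> * norm (\<Sum>j\<in>neighbors E (Some i). (Z j x - Z j y) - (x - y) $ i)"
      unfolding g_def by (simp add: scaleR_diff_right[symmetric] sum_subtractf[symmetric] algebra_simps)
    also have "\<dots> \<le> \<bar>\<mu>\<bar> * (\<Sum>j\<in>neighbors E (Some i). 2 * norm (x - y))"
    proof (intro mult_left_mono sum_norm_le)
      fix j
      have "norm ((Z j x - Z j y) - (x - y) $ i) \<le> norm (Z j x - Z j y) + norm ((x - y) $ i)" by (rule norm_triangle_ineq4)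
      then show "norm ((Z j x - Z j y) - (x - y) $ i) \<le> 2 * norm (x - y)"
        using Zd[of j x y] Finite_Cartesian_Product.norm_nth_le[of "x - y" i] by linarith
    qed simp
    finally show ?thesis by (simp add: sum_distrib_right mult.assoc)
  qed
  have "\<exists>X. \<forall>i. X i 0 = x0 i \<and> pw_derivative (range ts) 0 (X i) (\<lambda>t. g (G t) i t (\<chi> i. X i t))"
  proof (rule coupled_solution_exists)
    show "continuous_on {0..} (\<lambda>t. g E i t z)" for E i z unfolding g_def by (rule continuous_on_const)
    show "\<exists>K. \<forall>t\<in>{a..b}. \<forall>x y. norm (g E i t x - g E i t y) \<le> K * norm (x - y)" for E i a b
      using lip by blast
  qed
  then obtain X where X: "\<And>i. X i 0 = x0 i" "\<And>i. pw_derivative (range ts) 0 (X i) (\<lambda>t. g (G t) i t (\<chi> i. X i t))" by blast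
  define Y where "Y j t = (case j of None \<Rightarrow> X0 | Some i \<Rightarrow> X i t)" for j t
  have ZY: "Z j (\<chi> i. X i t) = Y j t" for j t by (cases j) (simp_all add: Z_def Y_def)
  have "pw_derivative (range ts) 0 (Y (Some i)) (\<lambda>t. \<mu> *\<^sub>R (\<Sum>j\<in>neighbors (G t) (Some i). Y j t - Y (Some i) t))" for i
    using X(2)[of i] unfolding g_def ZY by (simp add: Y_def[of "Some i", abs_def] Y_def[of "Some i"])
  then show ?thesis using X(1) by (intro exI[of _ Y]) (simp add: Y_def)
qed

lemma leader_exists:
  fixes S :: "real ^ 'n ^ 'n"
  shows "\<exists>v. v 0 = v0 \<and> (\<forall>t\<ge>0. (v has_vector_derivative S *v v t) (at t within {0..}))"
proof -
  obtain v where v: "v 0 = v0" "pw_derivative (range ts) 0 v (\<lambda>t. S *v v t)"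
    using linear_solution_exists[of 0 v0 "\<lambda>_. S"] by auto
  have "continuous_on {0..} (\<lambda>t. S *v v t)"
    using v(2) by (intro bounded_linear.continuous_on[OF matrix_vector_mul_bounded_linear]) (simp add: pw_derivative_def)
  then show ?thesis using v pw_derivative_continuous[OF finite_switching v(2)] by blast
qed

lemma observer_exists:
  fixes v0 :: "real \<Rightarrow> real ^ 'n" and Sh :: "'N option \<Rightarrow> real \<Rightarrow> real ^ 'n ^ 'n"
  assumes v0: "continuous_on {0..} v0" and Sh: "\<And>i. continuous_on {0..} (Sh (Some i))"
    and L: "\<And>i. continuous_on {0..} (L (Some i))"
  shows "\<exists>v. v None = v0 \<and> (\<forall>i. v (Some i) 0 = x0 i \<and>
    pw_derivative (range ts) 0 (v (Some i)) (\<lambda>t. Sh (Some i) t *v v (Some i) t +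
               (\<Sum>j\<in>neighbors (G t) (Some i). F \<bullet> (v j t - v (Some i) t)) *\<^sub>R L (Some i) t))"
proof -
  define Z where "Z j t z = (case j of None \<Rightarrow> v0 t | Some i \<Rightarrow> z $ i)" for j t and z :: "(real ^ 'n) ^ 'N"
  define g where "g E i t z = Sh (Some i) t *v (z $ i) + (\<Sum>j\<in>neighbors E (Some i). F \<bullet> (Z j t z - z $ i)) *\<^sub>R L (Some i) t"
    for E :: "('N option \<times> 'N option) set" and i and t :: real and z
  obtain Km where Km: "Km \<ge> 0" "\<And>(M :: real ^ 'n ^ 'n) x. norm (M *v x) \<le> norm M * norm x * Km"
    using bounded_bilinear.nonneg_bounded[OF bounded_bilinear_matvec] by blast
  have Zd: "norm (Z j t x - Z j t y) \<le> norm (x - y)" for j t x y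
    using Finite_Cartesian_Product.norm_nth_le[of "x - y"] by (cases j) (auto simp: Z_def)
  have "\<exists>v. \<forall>i. v i 0 = x0 i \<and> pw_derivative (range ts) 0 (v i) (\<lambda>t. g (G t) i t (\<chi> i. v i t))"
  proof (rule coupled_solution_exists)
    fix E i z
    have "continuous_on {0..} (\<lambda>t. Z j t z)" for j using v0 by (cases j) (simp_all add: Z_def)
    then show "continuous_on {0..} (\<lambda>t. g E i t z)" unfolding g_def
      by (intro continuous_intros bounded_bilinear.continuous_on[OF bounded_bilinear_matvec] Sh L)
  next
    fix E i and a b :: real assume a: "0 \<le> a"
    obtain MS where MS: "MS \<ge> 0" "\<And>t. t \<in> {a..b} \<Longrightarrow> norm (Sh (Some i) t) \<le> MS"
      using continuous_bounded_on_interval[OF Sh a] by blast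
    obtain Ml where Ml: "Ml \<ge> 0" "\<And>t. t \<in> {a..b} \<Longrightarrow> norm (L (Some i) t) \<le> Ml"
      using continuous_bounded_on_interval[OF L a] by blast
    define c where "c = (\<Sum>j\<in>neighbors E (Some i). 2 * norm F)"
    show "\<exists>K. \<forall>t\<in>{a..b}. \<forall>x y. norm (g E i t x - g E i t y) \<le> K * norm (x - y)"
    proof (intro exI[of _ "MS * Km + c * Ml"] ballI allI)
      fix t x y assume t: "t \<in> {a..b}"
      define \<Delta> where "\<Delta> = (\<Sum>j\<in>neighbors E (Some i). F \<bullet> ((Z j t x - Z j t y) - (x - y) $ i))"
      have eq: "g E i t x - g E i t y = Sh (Some i) t *v ((x - y) $ i) + \<Delta> *\<^sub>R L (Some i) t"
      proof -
        have 1: "Sh (Some i) t *v ((x - y) $ i) = Sh (Some i) t *v (x $ i) - Sh (Some i) t *v (y $ i)"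
          by (simp add: matrix_vector_mult_diff_distrib)
        have 2: "\<Delta> = (\<Sum>j\<in>neighbors E (Some i). F \<bullet> (Z j t x - x $ i)) - (\<Sum>j\<in>neighbors E (Some i). F \<bullet> (Z j t y - y $ i))"
          unfolding \<Delta>_def sum_subtractf[symmetric] by (intro sum.cong refl) (simp add: inner_diff_right)
        show ?thesis unfolding g_def 1 2 scaleR_diff_left by (rule add_diff_add)
      qed
      have "\<bar>\<Delta>\<bar> \<le> (\<Sum>j\<in>neighbors E (Some i). 2 * norm F * norm (x - y))"
        unfolding \<Delta>_def
      proof (rule order_trans[OF sum_abs], rule sum_mono)
        fix j
        have "norm ((Z j t x - Z j t y) - (x - y) $ i) \<le> norm (Z j t x - Z j t y) + norm ((x - y) $ i)" by (rule norm_triangle_ineq4)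
        then have n: "norm ((Z j t x - Z j t y) - (x - y) $ i) \<le> 2 * norm (x - y)"
          using Zd[of j t x y] Finite_Cartesian_Product.norm_nth_le[of "x - y" i] by linarith
        have "\<bar>F \<bullet> ((Z j t x - Z j t y) - (x - y) $ i)\<bar> \<le> norm F * norm ((Z j t x - Z j t y) - (x - y) $ i)"
          by (rule Cauchy_Schwarz_ineq2)
        also have "\<dots> \<le> norm F * (2 * norm (x - y))" by (intro mult_left_mono n) simp
        finally show "\<bar>F \<bullet> ((Z j t x - Z j t y) - (x - y) $ i)\<bar> \<le> 2 * norm F * norm (x - y)" by simp
      qed
      then have \<Delta>b: "\<bar>\<Delta>\<bar> \<le> c * norm (x - y)" unfolding c_def by (simp add: sum_distrib_right)
      have "norm (g E i t x - g E i t y) \<le> norm (Sh (Some i) t *v ((x - y) $ i)) + \<bar>\<Delta>\<bar> * norm (L (Some i) t)"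
        unfolding eq by (rule order_trans[OF norm_triangle_ineq]) simp
      also have "norm (Sh (Some i) t *v ((x - y) $ i)) \<le> MS * norm (x - y) * Km"
        by (rule order_trans[OF Km(2)]) (intro mult_right_mono mult_mono MS t Finite_Cartesian_Product.norm_nth_le Km, auto)
      also have "\<bar>\<Delta>\<bar> * norm (L (Some i) t) \<le> (c * norm (x - y)) * Ml"
        by (intro mult_mono \<Delta>b Ml t) (auto simp: c_def sum_nonneg)
      finally show "norm (g E i t x - g E i t y) \<le> (MS * Km + c * Ml) * norm (x - y)" by (simp add: algebra_simps)
    qed
  qed
  then obtain X where X: "\<And>i. X i 0 = x0 i" "\<And>i. pw_derivative (range ts) 0 (X i) (\<lambda>t. g (G t) i t (\<chi> i. X i t))" by blast
  define Y where "Y j t = (case j of None \<Rightarrow> v0 t | Some i \<Rightarrow> X i t)" for j t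
  have ZY: "Z j t (\<chi> i. X i t) = Y j t" for j t by (cases j) (simp_all add: Z_def Y_def)
  have "pw_derivative (range ts) 0 (Y (Some i)) (\<lambda>t. Sh (Some i) t *v Y (Some i) t +
               (\<Sum>j\<in>neighbors (G t) (Some i). F \<bullet> (Y j t - Y (Some i) t)) *\<^sub>R L (Some i) t)" for i
    using X(2)[of i] unfolding g_def ZY by (simp add: Y_def[of "Some i", abs_def] Y_def[of "Some i"])
  then show ?thesis using X(1) by (intro exI[of _ Y]) (simp add: Y_def fun_eq_iff)
qed

end

section \<open>Lipschitz continuity on balls, uniformly in time\<close>

text \<open>The bound \<open>M\<close> is carried along with the Lipschitz constant because products
  need it.\<close>

definition ball_lipschitz :: "real \<Rightarrow> real \<Rightarrow> real \<Rightarrow> (real \<Rightarrow> 'a::real_normed_vector \<Rightarrow> real) \<Rightarrow> bool" where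
  "ball_lipschitz a b R h \<longleftrightarrow> (\<exists>K\<ge>0. \<exists>M\<ge>0. \<forall>t\<in>{a..b}. \<forall>x y. norm x \<le> R \<longrightarrow> norm y \<le> R \<longrightarrow>
     \<bar>h t x\<bar> \<le> M \<and> \<bar>h t x - h t y\<bar> \<le> K * norm (x - y))"

lemma ball_lipschitzI:
  assumes "K \<ge> 0" "M \<ge> 0" "\<And>t x. t \<in> {a..b} \<Longrightarrow> norm x \<le> R \<Longrightarrow> \<bar>h t x\<bar> \<le> M"
    "\<And>t x y. t \<in> {a..b} \<Longrightarrow> norm x \<le> R \<Longrightarrow> norm y \<le> R \<Longrightarrow> \<bar>h t x - h t y\<bar> \<le> K * norm (x - y)"
  shows "ball_lipschitz a b R h"
  unfolding ball_lipschitz_def using assms by blast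

lemma ball_lipschitz_time:
  assumes "continuous_on {0..} h" "0 \<le> a"
  shows "ball_lipschitz a b R (\<lambda>t x. h t)"
proof -
  obtain M where "M \<ge> 0" "\<forall>t\<in>{a..b}. norm (h t) \<le> M" using continuous_bounded_on_interval[OF assms] by blast
  then show ?thesis by (intro ball_lipschitzI[of 0 M]) auto
qed

lemma ball_lipschitz_const: "ball_lipschitz a b R (\<lambda>t x. c)"
  by (rule ball_lipschitzI[of 0 "\<bar>c\<bar>"]) auto

lemma ball_lipschitz_add:
  fixes g h :: "real \<Rightarrow> 'a::real_normed_vector \<Rightarrow> real"
  assumes "ball_lipschitz a b R g" "ball_lipschitz a b R h"
  shows "ball_lipschitz a b R (\<lambda>t x. g t x + h t x)"
proof -
  obtain K M where g0: "K \<ge> 0" "M \<ge> 0" "\<forall>t\<in>{a..b}. \<forall>x y. norm x \<le> R \<longrightarrow> norm y \<le> R \<longrightarrow>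
      \<bar>g t x\<bar> \<le> M \<and> \<bar>g t x - g t y\<bar> \<le> K * norm (x - y)"
    using assms(1) unfolding ball_lipschitz_def by (elim exE conjE) (rule that)
  then have g: "K \<ge> 0" "M \<ge> 0" "\<And>t x. t \<in> {a..b} \<Longrightarrow> norm x \<le> R \<Longrightarrow> \<bar>g t x\<bar> \<le> M"
    "\<And>t x y. t \<in> {a..b} \<Longrightarrow> norm x \<le> R \<Longrightarrow> norm y \<le> R \<Longrightarrow> \<bar>g t x - g t y\<bar> \<le> K * norm (x - y)"
    by blast+
  obtain K' M' where h0: "K' \<ge> 0" "M' \<ge> 0" "\<forall>t\<in>{a..b}. \<forall>x y. norm x \<le> R \<longrightarrow> norm y \<le> R \<longrightarrow>
      \<bar>h t x\<bar> \<le> M' \<and> \<bar>h t x - h t y\<bar> \<le> K' * norm (x - y)"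
    using assms(2) unfolding ball_lipschitz_def by (elim exE conjE) (rule that)
  then have h: "K' \<ge> 0" "M' \<ge> 0" "\<And>t x. t \<in> {a..b} \<Longrightarrow> norm x \<le> R \<Longrightarrow> \<bar>h t x\<bar> \<le> M'"
    "\<And>t x y. t \<in> {a..b} \<Longrightarrow> norm x \<le> R \<Longrightarrow> norm y \<le> R \<Longrightarrow> \<bar>h t x - h t y\<bar> \<le> K' * norm (x - y)"
    by blast+
  show ?thesis
  proof (rule ball_lipschitzI[of "K + K'" "M + M'"])
    fix t and x :: 'a assume tx: "t \<in> {a..b}" "norm x \<le> R"
    show "\<bar>g t x + h t x\<bar> \<le> M + M'" using g(3)[OF tx] h(3)[OF tx] by linarith
    fix y :: 'a assume y: "norm y \<le> R"
    show "\<bar>(g t x + h t x) - (g t y + h t y)\<bar> \<le> (K + K') * norm (x - y)"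
      using g(4)[OF tx y] h(4)[OF tx y] unfolding distrib_right by linarith
  qed (use g h in auto)
qed

lemma ball_lipschitz_mult:
  fixes g h :: "real \<Rightarrow> 'a::real_normed_vector \<Rightarrow> real"
  assumes "ball_lipschitz a b R g" "ball_lipschitz a b R h"
  shows "ball_lipschitz a b R (\<lambda>t x. g t x * h t x)"
proof -
  obtain K M where g0: "K \<ge> 0" "M \<ge> 0" "\<forall>t\<in>{a..b}. \<forall>x y. norm x \<le> R \<longrightarrow> norm y \<le> R \<longrightarrow>
      \<bar>g t x\<bar> \<le> M \<and> \<bar>g t x - g t y\<bar> \<le> K * norm (x - y)"
    using assms(1) unfolding ball_lipschitz_def by (elim exE conjE) (rule that)
  then have g: "K \<ge> 0" "M \<ge> 0" "\<And>t x. t \<in> {a..b} \<Longrightarrow> norm x \<le> R \<Longrightarrow> \<bar>g t x\<bar> \<le> M"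
    "\<And>t x y. t \<in> {a..b} \<Longrightarrow> norm x \<le> R \<Longrightarrow> norm y \<le> R \<Longrightarrow> \<bar>g t x - g t y\<bar> \<le> K * norm (x - y)"
    by blast+
  obtain K' M' where h0: "K' \<ge> 0" "M' \<ge> 0" "\<forall>t\<in>{a..b}. \<forall>x y. norm x \<le> R \<longrightarrow> norm y \<le> R \<longrightarrow>
      \<bar>h t x\<bar> \<le> M' \<and> \<bar>h t x - h t y\<bar> \<le> K' * norm (x - y)"
    using assms(2) unfolding ball_lipschitz_def by (elim exE conjE) (rule that)
  then have h: "K' \<ge> 0" "M' \<ge> 0" "\<And>t x. t \<in> {a..b} \<Longrightarrow> norm x \<le> R \<Longrightarrow> \<bar>h t x\<bar> \<le> M'"
    "\<And>t x y. t \<in> {a..b} \<Longrightarrow> norm x \<le> R \<Longrightarrow> norm y \<le> R \<Longrightarrow> \<bar>h t x - h t y\<bar> \<le> K' * norm (x - y)"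
    by blast+
  show ?thesis
  proof (rule ball_lipschitzI[of "K * M' + M * K'" "M * M'"])
    fix t and x :: 'a assume tx: "t \<in> {a..b}" "norm x \<le> R"
    show "\<bar>g t x * h t x\<bar> \<le> M * M'" unfolding abs_mult using g h tx by (intro mult_mono) auto
    fix y :: 'a assume y: "norm y \<le> R"
    have "g t x * h t x - g t y * h t y = (g t x - g t y) * h t x + g t y * (h t x - h t y)" by (simp add: algebra_simps)
    then have "\<bar>g t x * h t x - g t y * h t y\<bar> \<le> \<bar>g t x - g t y\<bar> * \<bar>h t x\<bar> + \<bar>g t y\<bar> * \<bar>h t x - h t y\<bar>"
      by (metis abs_mult abs_triangle_ineq)
    also have "\<dots> \<le> (K * norm (x - y)) * M' + M * (K' * norm (x - y))"
      using g h tx y by (intro add_mono mult_mono) auto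
    finally show "\<bar>g t x * h t x - g t y * h t y\<bar> \<le> (K * M' + M * K') * norm (x - y)" by (simp add: algebra_simps)
  qed (use g h in auto)
qed

lemma ball_lipschitz_minus: "ball_lipschitz a b R g \<Longrightarrow> ball_lipschitz a b R (\<lambda>t x. - g t x)"
  using ball_lipschitz_mult[OF ball_lipschitz_const[of a b R "-1"]] by force

lemma ball_lipschitz_diff:
  "ball_lipschitz a b R g \<Longrightarrow> ball_lipschitz a b R h \<Longrightarrow> ball_lipschitz a b R (\<lambda>t x. g t x - h t x)"
  using ball_lipschitz_add[OF _ ball_lipschitz_minus] by force

lemma ball_lipschitz_sum:
  assumes "finite I" "\<And>i. i \<in> I \<Longrightarrow> ball_lipschitz a b R (g i)"
  shows "ball_lipschitz a b R (\<lambda>t x. \<Sum>i\<in>I. g i t x)"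
  using assms
proof (induction I rule: finite_induct)
  case empty then show ?case using ball_lipschitz_const[of a b R 0] by simp
next
  case (insert i I)
  have "ball_lipschitz a b R (\<lambda>t x. g i t x + (\<Sum>i\<in>I. g i t x))"
    by (rule ball_lipschitz_add) (use insert in auto)
  then show ?case using insert by simp
qed

text \<open>On a ball the state stays in a fixed box, on which \<open>f\<close> has a uniform bound
  and a uniform Lipschitz constant.\<close>

lemma ball_lipschitz_comp:
  fixes X :: "real \<Rightarrow> 'a::real_normed_vector \<Rightarrow> nat \<Rightarrow> real"
  assumes car: "\<forall>x\<in>carrier_vec r. \<forall>t\<ge>0. f x t \<in> carrier_vec m"
    and lip: "locally_lipschitz_uniform r f"
    and bnd: "\<exists>\<phi>. \<forall>x\<in>carrier_vec r. \<forall>t\<ge>0. vec_norm (f x t) \<le> \<phi> x"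
    and X: "\<And>k. k < r \<Longrightarrow> ball_lipschitz a b R (\<lambda>t z. X t z k)" and a: "0 \<le> a" and l: "l < m"
  shows "ball_lipschitz a b R (\<lambda>t z. f (Matrix.vec r (X t z)) t $\<^sub>v l)"
proof -
  define good where "good k K M \<longleftrightarrow> K \<ge> 0 \<and> M \<ge> 0 \<and> (\<forall>t\<in>{a..b}. \<forall>x y. norm x \<le> R \<longrightarrow> norm y \<le> R \<longrightarrow>
     \<bar>X t x k\<bar> \<le> M \<and> \<bar>X t x k - X t y k\<bar> \<le> K * norm (x - y))" for k and K M :: real
  have "\<forall>k. \<exists>K M. k < r \<longrightarrow> good k K M" 
  proof
    fix k
    show "\<exists>K M. k < r \<longrightarrow> good k K M"
    proof (cases "k < r")
      case True
      from X[OF True] obtain K M where "K \<ge> 0" "M \<ge> 0" "\<forall>t\<in>{a..b}. \<forall>x y. norm x \<le> R \<longrightarrow> norm y \<le> R \<longrightarrow>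
          \<bar>X t x k\<bar> \<le> M \<and> \<bar>X t x k - X t y k\<bar> \<le> K * norm (x - y)"
        unfolding ball_lipschitz_def by (elim exE conjE) (rule that)
      then have "good k K M" unfolding good_def by (intro conjI)
      then show ?thesis by blast
    qed simp
  qed
  then obtain K M where "\<And>k. k < r \<Longrightarrow> good k (K k) (M k)" by metis
  then have KM: "\<And>k. k < r \<Longrightarrow> K k \<ge> 0" "\<And>k. k < r \<Longrightarrow> M k \<ge> 0"
    "\<And>k t x. k < r \<Longrightarrow> t \<in> {a..b} \<Longrightarrow> norm x \<le> R \<Longrightarrow> \<bar>X t x k\<bar> \<le> M k"
    "\<And>k t x y. k < r \<Longrightarrow> t \<in> {a..b} \<Longrightarrow> norm x \<le> R \<Longrightarrow> norm y \<le> R \<Longrightarrow> \<bar>X t x k - X t y k\<bar> \<le> K k * norm (x - y)"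
    unfolding good_def by blast+
  define R' where "R' = (\<Sum>k<r. M k)"
  have box: "in_box r R' (Matrix.vec r (X t x))" if "t \<in> {a..b}" "norm x \<le> R" for t x
    unfolding in_box_def
  proof (intro conjI allI impI)
    fix k assume k: "k < r"
    have "M k \<le> R'" unfolding R'_def by (rule member_le_sum) (use KM(2) k in auto)
    then show "\<bar>Matrix.vec r (X t x) $\<^sub>v k\<bar> \<le> R'" using KM(3)[OF k that] k by simp
  qed simp
  obtain Mf where Mf: "\<And>x t. in_box r R' x \<Longrightarrow> t \<ge> 0 \<Longrightarrow> vec_norm (f x t) \<le> Mf"
    using uniform_bound_on_box[OF car lip bnd] by blast
  obtain Kf where Kf: "Kf \<ge> 0" "\<And>x y t. in_box r R' x \<Longrightarrow> in_box r R' y \<Longrightarrow> t \<ge> 0 \<Longrightarrow>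
      vec_norm (f x t - f y t) \<le> Kf * vec_norm (x - y)"
    using uniform_lipschitz_on_box[OF car lip bnd, of R'] by blast
  show ?thesis
  proof (rule ball_lipschitzI[of "Kf * (\<Sum>k<r. K k)" "\<bar>Mf\<bar>"])
    show "Kf * (\<Sum>k<r. K k) \<ge> 0" using Kf KM(1) by (intro mult_nonneg_nonneg sum_nonneg) auto
    fix t and x :: 'a assume t: "t \<in> {a..b}" and x: "norm x \<le> R"
    have t0: "t \<ge> 0" using t a by simp
    have fc: "f (Matrix.vec r (X t x)) t \<in> carrier_vec m" if "norm x \<le> R" for x using car t0 by simp
    show "\<bar>f (Matrix.vec r (X t x)) t $\<^sub>v l\<bar> \<le> \<bar>Mf\<bar>"
      using component_le_vec_norm[OF fc[OF x] l] Mf[OF box[OF t x] t0] by linarith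
    fix y :: 'a assume y: "norm y \<le> R"
    let ?x = "Matrix.vec r (X t x)" and ?y = "Matrix.vec r (X t y)"
    have "\<bar>f ?x t $\<^sub>v l - f ?y t $\<^sub>v l\<bar> = \<bar>(f ?x t - f ?y t) $\<^sub>v l\<bar>" using fc[OF x] fc[OF y] l by simp
    also have "\<dots> \<le> vec_norm (f ?x t - f ?y t)"
      by (rule component_le_vec_norm[OF _ l]) (use fc[OF x] fc[OF y] in auto)
    also have "\<dots> \<le> Kf * vec_norm (?x - ?y)" by (rule Kf(2)[OF box[OF t x] box[OF t y] t0])
    also have "\<dots> \<le> Kf * ((\<Sum>k<r. K k) * norm (x - y))"
    proof (rule mult_left_mono[OF _ Kf(1)])
      have "vec_norm (?x - ?y) \<le> (\<Sum>k<r. \<bar>(?x - ?y) $\<^sub>v k\<bar>)" by (rule vec_norm_le_sum) simp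
      also have "\<dots> \<le> (\<Sum>k<r. K k * norm (x - y))" by (rule sum_mono) (use KM(4) t x y in simp)
      finally show "vec_norm (?x - ?y) \<le> (\<Sum>k<r. K k) * norm (x - y)" by (simp add: sum_distrib_right)
    qed
    finally show "\<bar>f ?x t $\<^sub>v l - f ?y t $\<^sub>v l\<bar> \<le> Kf * (\<Sum>k<r. K k) * norm (x - y)" by (simp add: mult.assoc)
  qed simp
qed

lemma continuous_on_comp_vec:
  assumes car: "\<forall>x\<in>carrier_vec r. \<forall>t\<ge>0. f x t \<in> carrier_vec m"
    and lip: "locally_lipschitz_uniform r f"
    and cont: "\<forall>x\<in>carrier_vec r. \<forall>l<m. continuous_on {0..} (\<lambda>t. f x t $\<^sub>v l)"
    and X: "\<And>k. k < r \<Longrightarrow> continuous_on {0..} (\<lambda>t. X t k)" and l: "l < m"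
  shows "continuous_on {0..} (\<lambda>t. f (Matrix.vec r (X t)) t $\<^sub>v l)"
  unfolding continuous_on_def
proof
  fix t :: real assume t: "t \<in> {0..}"
  define x where "x s = Matrix.vec r (X s)" for s
  have xc: "x s \<in> carrier_vec r" for s unfolding x_def by simp
  obtain \<delta> K where \<delta>: "\<delta> > 0" "K \<ge> 0" and K: "\<And>a b s. a \<in> carrier_vec r \<Longrightarrow> b \<in> carrier_vec r \<Longrightarrow>
      vec_norm (a - x t) < \<delta> \<Longrightarrow> vec_norm (b - x t) < \<delta> \<Longrightarrow> s \<ge> 0 \<Longrightarrow> vec_norm (f a s - f b s) \<le> K * vec_norm (a - b)"
    using lip xc[of t] unfolding locally_lipschitz_uniform_def by meson
  have xlim: "((\<lambda>s. vec_norm (x s - x t)) \<longlongrightarrow> 0) (at t within {0..})"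
  proof (rule Lim_null_comparison)
    show "\<forall>\<^sub>F s in at t within {0..}. norm (vec_norm (x s - x t)) \<le> (\<Sum>k<r. \<bar>X s k - X t k\<bar>)"
    proof (rule always_eventually, rule allI)
      fix s
      have c: "x s - x t \<in> carrier_vec r" using xc by simp
      have "vec_norm (x s - x t) \<le> (\<Sum>k<r. \<bar>(x s - x t) $\<^sub>v k\<bar>)" by (rule vec_norm_le_sum[OF c])
      also have "\<dots> = (\<Sum>k<r. \<bar>X s k - X t k\<bar>)" by (rule sum.cong[OF refl]) (simp add: x_def)
      finally show "norm (vec_norm (x s - x t)) \<le> (\<Sum>k<r. \<bar>X s k - X t k\<bar>)" using vec_norm_nonneg[OF c] by simp
    qed
    have "((\<lambda>s. \<Sum>k<r. \<bar>X s k - X t k\<bar>) \<longlongrightarrow> (\<Sum>k<r. \<bar>X t k - X t k\<bar>)) (at t within {0..})"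
      by (intro tendsto_intros) (use X t in \<open>auto simp: continuous_on_def\<close>)
    then show "((\<lambda>s. \<Sum>k<r. \<bar>X s k - X t k\<bar>) \<longlongrightarrow> 0) (at t within {0..})" by simp
  qed
  have ll: "vec_norm (x t - x t) < \<delta>" using xc[of t] \<delta> vec_norm_le_sum[of "x t - x t" r] by simp
  have 1: "((\<lambda>s. f (x s) s $\<^sub>v l - f (x t) s $\<^sub>v l) \<longlongrightarrow> 0) (at t within {0..})"
  proof (rule Lim_null_comparison)
    have "\<forall>\<^sub>F s in at t within {0..}. vec_norm (x s - x t) < \<delta>" using order_tendstoD(2)[OF xlim \<delta>(1)] .
    moreover have "\<forall>\<^sub>F s in at t within {0..}. s \<ge> 0" unfolding eventually_at by (auto intro: exI[of _ 1])
    ultimately show "\<forall>\<^sub>F s in at t within {0..}. norm (f (x s) s $\<^sub>v l - f (x t) s $\<^sub>v l) \<le> K * vec_norm (x s - x t)"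
    proof eventually_elim
      case (elim s)
      have fc: "f (x s) s \<in> carrier_vec m" "f (x t) s \<in> carrier_vec m" using car xc elim by auto
      then have "norm (f (x s) s $\<^sub>v l - f (x t) s $\<^sub>v l) = \<bar>(f (x s) s - f (x t) s) $\<^sub>v l\<bar>" using l by simp
      also have "\<dots> \<le> vec_norm (f (x s) s - f (x t) s)" by (rule component_le_vec_norm[OF _ l]) (use fc in auto)
      also have "\<dots> \<le> K * vec_norm (x s - x t)" by (rule K[OF xc xc elim(1) ll elim(2)])
      finally show ?case .
    qed
    show "((\<lambda>s. K * vec_norm (x s - x t)) \<longlongrightarrow> 0) (at t within {0..})" using tendsto_mult_right_zero[OF xlim] .
  qed
  have 2: "((\<lambda>s. f (x t) s $\<^sub>v l) \<longlongrightarrow> f (x t) t $\<^sub>v l) (at t within {0..})"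
    using cont xc[of t] l t unfolding continuous_on_def by blast
  show "((\<lambda>t. f (Matrix.vec r (X t)) t $\<^sub>v l) \<longlongrightarrow> f (Matrix.vec r (X t)) t $\<^sub>v l) (at t within {0..})"
    using tendsto_add[OF 1 2] unfolding x_def by simp
qed



text \<open>The discrete metric makes bounded sequences a Banach space of type \<open>nat \<Rightarrow>\<^sub>C real\<close>, so that the state space
  of a follower, whose dimension depends on the follower, embeds into a single Banach space.\<close>

instantiation nat :: metric_space
begin

definition dist_nat :: "nat \<Rightarrow> nat \<Rightarrow> real" where "dist_nat k l = (if k = l then 0 else 1)"

definition uniformity_nat :: "(nat \<times> nat) filter" where
  "uniformity_nat = (INF e\<in>{0 <..}. principal {(x, y). dist x y < e})"

instance
proof
  show "open U \<longleftrightarrow> (\<forall>x\<in>U. \<forall>\<^sub>F (x', y) in uniformity. x' = x \<longrightarrow> y \<in> U)" for U :: "nat set"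
  proof -
    have "\<forall>\<^sub>F z in uniformity. fst z = (snd z :: nat)"
      unfolding uniformity_nat_def
      by (rule eventually_INF1[of 1]) (auto simp: eventually_principal dist_nat_def split: if_splits)
    then have "\<forall>\<^sub>F z in uniformity. case z of (x', y) \<Rightarrow> x' = x \<longrightarrow> y \<in> U" if "x \<in> U" for x
      by (rule eventually_mono) (use that in auto)
    then show ?thesis by (simp add: open_discrete)
  qed
qed (auto simp: uniformity_nat_def dist_nat_def)

end

instance bcontfun :: (metric_space, banach) banach ..

definition fin_bcontfun :: "nat \<Rightarrow> (nat \<Rightarrow> real) \<Rightarrow> (nat \<Rightarrow>\<^sub>C real)" where
  "fin_bcontfun N g = Bcontfun (\<lambda>k. if k < N then g k else 0)"

lemma apply_fin_bcontfun: "apply_bcontfun (fin_bcontfun N g) k = (if k < N then g k else 0)"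
proof -
  have "(\<lambda>k. if k < N then g k else 0) \<in> bcontfun"
  proof (rule bcontfun_normI)
    fix k
    show "norm (if k < N then g k else 0) \<le> (\<Sum>k<N. \<bar>g k\<bar>)"
      using member_le_sum[of k "{..<N}" "\<lambda>k. \<bar>g k\<bar>"] by (auto intro: sum_nonneg)
  qed simp
  then show ?thesis unfolding fin_bcontfun_def by (simp add: Bcontfun_inverse)
qed

lemma norm_fin_bcontfun_diff: "norm (fin_bcontfun N g - fin_bcontfun N h) \<le> (\<Sum>k<N. \<bar>g k - h k\<bar>)"
proof (rule norm_bound)
  fix k
  show "norm (apply_bcontfun (fin_bcontfun N g - fin_bcontfun N h) k) \<le> (\<Sum>k<N. \<bar>g k - h k\<bar>)"
    using member_le_sum[of k "{..<N}" "\<lambda>k. \<bar>g k - h k\<bar>"]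
    by (auto simp: apply_fin_bcontfun intro: sum_nonneg)
qed

lemma continuous_fin_bcontfun:
  assumes "\<And>k. k < N \<Longrightarrow> continuous_on T (\<lambda>t. g t k)"
  shows "continuous_on T (\<lambda>t. fin_bcontfun N (g t))"
  unfolding continuous_on_def
proof
  fix t assume t: "t \<in> T"
  have "((\<lambda>s. fin_bcontfun N (g s) - fin_bcontfun N (g t)) \<longlongrightarrow> 0) (at t within T)"
  proof (rule Lim_null_comparison)
    show "\<forall>\<^sub>F s in at t within T. norm (fin_bcontfun N (g s) - fin_bcontfun N (g t)) \<le> (\<Sum>k<N. \<bar>g s k - g t k\<bar>)"
      by (rule always_eventually) (intro allI norm_fin_bcontfun_diff)
    have "((\<lambda>s. \<Sum>k<N. \<bar>g s k - g t k\<bar>) \<longlongrightarrow> (\<Sum>k<N. \<bar>g t k - g t k\<bar>)) (at t within T)"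
      by (intro tendsto_intros) (use assms t in \<open>auto simp: continuous_on_def\<close>)
    then show "((\<lambda>s. \<Sum>k<N. \<bar>g s k - g t k\<bar>) \<longlongrightarrow> 0) (at t within T)" by simp
  qed
  then show "((\<lambda>t. fin_bcontfun N (g t)) \<longlongrightarrow> fin_bcontfun N (g t)) (at t within T)" by (rule LIM_zero_cancel)
qed

lemma bounded_linear_apply_bcontfun: "bounded_linear (\<lambda>z :: nat \<Rightarrow>\<^sub>C real. apply_bcontfun z k)"
proof (rule bounded_linear_intro)
  show "norm (apply_bcontfun x k) \<le> norm x * 1" for x :: "nat \<Rightarrow>\<^sub>C real" using norm_bounded[of x k] by simp
qed simp_all

lemma fin_bcontfun_lipschitz:
  fixes g :: "real \<Rightarrow> 'a::real_normed_vector \<Rightarrow> nat \<Rightarrow> real"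
  assumes "\<And>k. k < N \<Longrightarrow> ball_lipschitz a b R (\<lambda>t z. g t z k)"
  shows "\<exists>K. \<forall>t\<in>{a..b}. \<forall>x y. norm x \<le> R \<longrightarrow> norm y \<le> R \<longrightarrow>
    norm (fin_bcontfun N (g t x) - fin_bcontfun N (g t y)) \<le> K * norm (x - y)"
proof -
  define lipk where "lipk k K \<longleftrightarrow> (\<forall>t\<in>{a..b}. \<forall>x y. norm x \<le> R \<longrightarrow> norm y \<le> R \<longrightarrow>
    \<bar>g t x k - g t y k\<bar> \<le> K * norm (x - y))" for k K
  have "\<exists>K. lipk k K" if "k < N" for k
    using assms[OF that] unfolding ball_lipschitz_def lipk_def by blast
  then obtain K where K: "\<And>k. k < N \<Longrightarrow> lipk k (K k)" by metis
  show ?thesis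
  proof (intro exI[of _ "\<Sum>k<N. K k"] ballI allI impI)
    fix t and x y :: 'a assume t: "t \<in> {a..b}" and xy: "norm x \<le> R" "norm y \<le> R"
    have "norm (fin_bcontfun N (g t x) - fin_bcontfun N (g t y)) \<le> (\<Sum>k<N. \<bar>g t x k - g t y k\<bar>)"
      by (rule norm_fin_bcontfun_diff)
    also have "\<dots> \<le> (\<Sum>k<N. K k * norm (x - y))"
    proof (rule sum_mono)
      fix k assume "k \<in> {..<N}"
      then have "lipk k (K k)" using K by simp
      then show "\<bar>g t x k - g t y k\<bar> \<le> K k * norm (x - y)" using t xy unfolding lipk_def by blast
    qed
    finally show "norm (fin_bcontfun N (g t x) - fin_bcontfun N (g t y)) \<le> (\<Sum>k<N. K k) * norm (x - y)"
      by (simp add: sum_distrib_right)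
  qed
qed

text \<open>The closed loop of one follower in the coordinates \<open>x\<^sub>0, \<dots>, x\<^sub>n\<^sub>-\<^sub>1\<close> (with \<open>n = r - 1\<close>), \<open>s\<close>,
  and the parameter errors: index \<open>n\<close> is \<open>s\<close> and index \<open>n + 1 + l\<close> is the \<open>l\<close>-th parameter error.
  These coordinates avoid the derivative of the reference signal.\<close>

locale follower_system =
  fixes r m :: nat and f :: "real Matrix.vec \<Rightarrow> real \<Rightarrow> real Matrix.vec"
    and \<beta> :: "nat \<Rightarrow> real" and \<kappa> :: real and \<Lambda> :: "real Matrix.mat" and \<psi> :: "nat \<Rightarrow> real \<Rightarrow> real"
  assumes r: "1 \<le> r"
    and car: "\<forall>x\<in>carrier_vec r. \<forall>t\<ge>0. f x t \<in> carrier_vec m"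
    and lip: "locally_lipschitz_uniform r f"
    and cont: "\<forall>x\<in>carrier_vec r. \<forall>l<m. continuous_on {0..} (\<lambda>t. f x t $\<^sub>v l)"
    and bnd: "\<exists>\<phi>. \<forall>x\<in>carrier_vec r. \<forall>t\<ge>0. vec_norm (f x t) \<le> \<phi> x"
    and \<kappa>: "0 < \<kappa>" and spd: "sym_pos_def m \<Lambda>"
    and \<psi>c: "\<And>k. continuous_on {0..} (\<psi> k)"
begin

definition n :: nat where "n = r - 1"

definition \<Gamma> :: "real Matrix.mat" where "\<Gamma> = the (mat_inverse \<Lambda>)"

definition ref :: "real \<Rightarrow> (nat \<Rightarrow> real) \<Rightarrow> real" where
  "ref t z = \<psi> n t - (\<Sum>k=1..n. \<beta> k * (z (n - k) - \<psi> (n - k) t))"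

text \<open>Inverts the change of coordinates. This is explicit because \<open>ref\<close> involves
  only the coordinates below \<open>n\<close>.\<close>

definition state :: "real \<Rightarrow> (nat \<Rightarrow> real) \<Rightarrow> nat \<Rightarrow> real" where
  "state t z k = (if k < n then z k else z n + ref t z)"

definition regressor :: "real \<Rightarrow> (nat \<Rightarrow> real) \<Rightarrow> real Matrix.vec" where
  "regressor t z = f (Matrix.vec r (state t z)) t"

text \<open>In the equation for \<open>s\<close> the derivative term of the input has cancelled, and
  the unknown parameter enters only through the parameter errors.\<close>

definition rhs :: "real \<Rightarrow> (nat \<Rightarrow> real) \<Rightarrow> nat \<Rightarrow> real" where
  "rhs t z k = (if k < n then state t z (Suc k)
     else if k = n then (\<Sum>l<m. z (n + 1 + l) * regressor t z $\<^sub>v l) - \<kappa> * z n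
     else - z n * (\<Sum>j<m. \<Gamma> $$ (k - n - 1, j) * regressor t z $\<^sub>v j))"

definition field :: "real \<Rightarrow> (nat \<Rightarrow>\<^sub>C real) \<Rightarrow> (nat \<Rightarrow>\<^sub>C real)" where
  "field t z = fin_bcontfun (n + 1 + m) (rhs t (apply_bcontfun z))"

lemma rn: "r = Suc n" unfolding n_def using r by simp

lemma regressor_carrier: "0 \<le> t \<Longrightarrow> regressor t z \<in> carrier_vec m"
  unfolding regressor_def using car by simp

lemma gamma_regressor:
  assumes "0 \<le> t" "l < m"
  shows "(\<Gamma> *\<^sub>v regressor t z) $\<^sub>v l = (\<Sum>j<m. \<Gamma> $$ (l, j) * regressor t z $\<^sub>v j)"
  using sym_pos_def_inverse(1)[OF spd] regressor_carrier[OF assms(1), of z] assms(2)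
  unfolding \<Gamma>_def[symmetric] by (auto simp: scalar_prod_def atLeast0LessThan)

lemma rhs_continuous:
  assumes z: "\<And>k. continuous_on {0..} (\<lambda>t. z t k)" and k: "k < n + 1 + m"
  shows "continuous_on {0..} (\<lambda>t. rhs t (z t) k)"
proof -
  have ref: "continuous_on {0..} (\<lambda>t. ref t (z t))" unfolding ref_def by (intro continuous_intros \<psi>c z)
  have st: "continuous_on {0..} (\<lambda>t. state t (z t) k)" for k
    unfolding state_def by (cases "k < n") (auto intro!: continuous_intros z ref)
  have reg: "continuous_on {0..} (\<lambda>t. regressor t (z t) $\<^sub>v l)" if "l < m" for l
    unfolding regressor_def by (rule continuous_on_comp_vec[OF car lip cont st that])
  consider "k < n" | "k = n" | "k > n" by linarith
  then show ?thesis
  proof cases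
    case 1 then show ?thesis unfolding rhs_def using st by simp
  next
    case 2 then show ?thesis unfolding rhs_def by (auto intro!: continuous_intros z reg)
  next
    case 3 then show ?thesis unfolding rhs_def by (auto intro!: continuous_intros z reg)
  qed
qed

lemma rhs_ball_lipschitz:
  assumes a: "0 \<le> a" and k: "k < n + 1 + m"
  shows "ball_lipschitz a b R (\<lambda>t z. rhs t (apply_bcontfun z) k)"
proof -
  have crd: "ball_lipschitz a b R (\<lambda>t z :: nat \<Rightarrow>\<^sub>C real. apply_bcontfun z k)" for k
  proof (rule ball_lipschitzI[of 1 "\<bar>R\<bar>"])
    fix x y :: "nat \<Rightarrow>\<^sub>C real"
    show "\<bar>apply_bcontfun x k\<bar> \<le> \<bar>R\<bar>" if "norm x \<le> R" using norm_bounded[of x k] that by simp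
    show "\<bar>apply_bcontfun x k - apply_bcontfun y k\<bar> \<le> 1 * norm (x - y)" using norm_bounded[of "x - y" k] by simp
  qed auto
  note rules = ball_lipschitz_add ball_lipschitz_diff ball_lipschitz_mult ball_lipschitz_minus
    ball_lipschitz_const crd ball_lipschitz_time[OF \<psi>c a]
  have ref: "ball_lipschitz a b R (\<lambda>t z. ref t (apply_bcontfun z))"
    unfolding ref_def by (intro rules ball_lipschitz_sum) auto
  have st: "ball_lipschitz a b R (\<lambda>t z. state t (apply_bcontfun z) k)" for k
    unfolding state_def by (cases "k < n") (auto intro!: crd ball_lipschitz_add ref)
  have reg: "ball_lipschitz a b R (\<lambda>t z. regressor t (apply_bcontfun z) $\<^sub>v l)" if "l < m" for l
    unfolding regressor_def by (rule ball_lipschitz_comp[OF car lip bnd st a that])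
  consider "k < n" | "k = n" | "k > n" by linarith
  then show ?thesis
  proof cases
    case 1 then show ?thesis unfolding rhs_def using st by simp
  next
    case 2
    have "ball_lipschitz a b R (\<lambda>t z. (\<Sum>l<m. apply_bcontfun z (n + 1 + l) * regressor t (apply_bcontfun z) $\<^sub>v l)
        - \<kappa> * apply_bcontfun z n)"
      by (intro rules ball_lipschitz_sum reg) auto
    then show ?thesis unfolding rhs_def using 2 by simp
  next
    case 3
    have "ball_lipschitz a b R (\<lambda>t z. - apply_bcontfun z n *
        (\<Sum>j<m. \<Gamma> $$ (k - n - 1, j) * regressor t (apply_bcontfun z) $\<^sub>v j))"
      by (intro rules ball_lipschitz_sum reg) auto
    then show ?thesis unfolding rhs_def using 3 by simp
  qed
qed

text \<open>Slowing down time by a factor \<open>\<omega> t \<in> [0, 1]\<close> does not affect the bounds: the Lyapunov function is still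
  nonincreasing, and the remaining coordinates satisfy a linear differential inequality.\<close>

lemma apriori_bound:
  assumes a: "0 \<le> a"
  shows "\<exists>R. \<forall>z \<omega>. z a = z0 \<longrightarrow> (\<forall>t. 0 \<le> \<omega> t \<and> \<omega> t \<le> (1::real)) \<longrightarrow>
    (\<forall>t\<in>{a..b}. (z has_vector_derivative \<omega> t *\<^sub>R field t (z t)) (at t within {a..b})) \<longrightarrow>
    (\<forall>t\<in>{a..b}. norm (z t) \<le> R)"
proof -
  define i0 where "i0 = apply_bcontfun z0"
  define Va where "Va = (i0 n)\<^sup>2 + quad m \<Lambda> (\<lambda>l. i0 (n + 1 + l)) (\<lambda>l. i0 (n + 1 + l))"
  obtain Ky where Ky: "Ky \<ge> 0" "\<And>y l. l < m \<Longrightarrow> (y l)\<^sup>2 \<le> Ky * quad m \<Lambda> y y"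
    using quad_component_bound[OF spd] by blast
  define bs where "bs = (\<Sum>k=1..n. \<bar>\<beta> k\<bar>)"
  have "\<exists>M\<ge>0. \<forall>t\<in>{a..b}. \<bar>\<psi> k t\<bar> \<le> M" for k
    using continuous_bounded_on_interval[OF \<psi>c[of k] a, of b] by simp
  then obtain Mk where Mk: "\<And>k. Mk k \<ge> 0" "\<And>k t. t \<in> {a..b} \<Longrightarrow> \<bar>\<psi> k t\<bar> \<le> Mk k" by metis
  define M where "M = (\<Sum>k\<le>n. Mk k)"
  have M: "\<bar>\<psi> k t\<bar> \<le> M" if "k \<le> n" "t \<in> {a..b}" for k t
  proof -
    have "Mk k \<le> M" unfolding M_def by (rule member_le_sum) (use that Mk in auto)
    then show ?thesis using Mk(2)[OF that(2), of k] by linarith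
  qed
  \<comment> \<open>Every derivative of a lower state is at most \<open>c1\<close> times the sum of
    the lower states plus \<open>c2\<close>, where \<open>c2\<close> contains the Lyapunov bound on
    \<open>s\<close> and the bound on \<psi>. Squaring and summing gives the rates \<open>k1\<close>
    and \<open>k2\<close> for the sum of squares.\<close>
  define c1 where "c1 = 1 + bs"
  define c2 where "c2 = sqrt Va + M + bs * M"
  define k1 where "k1 = 1 + 2 * (real n)\<^sup>2 * c1\<^sup>2"
  define k2 where "k2 = 2 * real n * c2\<^sup>2"
  define \<Phi>0 where "\<Phi>0 = (\<Sum>k<n. (i0 k)\<^sup>2)"
  define Q where "Q = exp (k1 * (b - a)) * (\<Phi>0 + k2 / k1)"
  \<comment> \<open>The first three terms bound \<open>s\<close>, the parameter errors and the lower
    states. The term \<open>norm z0\<close> covers the coordinates from \<open>n + 1 + m\<close> on,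
    where the field is 0.\<close>
  define R where "R = sqrt Va + sqrt (Ky * Va) + sqrt Q + norm z0"
  have bs0: "bs \<ge> 0" unfolding bs_def by (simp add: sum_nonneg)
  have M0: "M \<ge> 0" unfolding M_def using Mk(1) by (simp add: sum_nonneg)
  have Va0: "Va \<ge> 0" unfolding Va_def using quad_nonneg[OF spd] by simp
  have c10: "c1 \<ge> 0" "c2 \<ge> 0" unfolding c1_def c2_def using bs0 M0 Va0 by simp_all
  have k10: "k1 \<ge> 1" "k2 \<ge> 0" unfolding k1_def k2_def by simp_all
  have \<Phi>00: "\<Phi>0 \<ge> 0" unfolding \<Phi>0_def by (simp add: sum_nonneg)
  have Q0: "Q \<ge> 0" unfolding Q_def using k10 \<Phi>00 by simp
  have main: "norm (z t) \<le> R"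
    if z0: "z a = z0" and l: "\<And>t. 0 \<le> \<omega> t \<and> \<omega> t \<le> (1::real)"
      and der: "\<And>t. t \<in> {a..b} \<Longrightarrow> (z has_vector_derivative \<omega> t *\<^sub>R field t (z t)) (at t within {a..b})"
      and t: "t \<in> {a..b}" for z \<omega> t
  proof -
    define c where "c t k = apply_bcontfun (z t) k" for t k
    have ca: "c a = i0" unfolding c_def i0_def using z0 by auto
    have c_der: "((\<lambda>t. c t k) has_vector_derivative \<omega> t * (if k < n + 1 + m then rhs t (c t) k else 0)) (at t within {a..b})"
      if "t \<in> {a..b}" for k t
    proof -
      have eq: "apply_bcontfun (\<omega> t *\<^sub>R field t (z t)) k = \<omega> t * (if k < n + 1 + m then rhs t (c t) k else 0)"
        unfolding c_def field_def by (simp add: apply_fin_bcontfun)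
      show ?thesis
        using bounded_linear.has_vector_derivative[OF bounded_linear_apply_bcontfun der[OF that], of k]
        unfolding eq by (simp only: c_def)
    qed
    have c_at: "((\<lambda>t. c t k) has_vector_derivative \<omega> t * (if k < n + 1 + m then rhs t (c t) k else 0)) (at t)"
      if "a < t" "t < b" for k t
      by (rule has_vector_derivative_interior_interval[OF c_der]) (use that in auto)
    have c_cont: "continuous_on {a..t} (\<lambda>t. c t k)" if "t \<in> {a..b}" for k t
    proof -
      have "continuous_on {a..b} (\<lambda>t. c t k)" by (rule continuous_on_vector_derivative) (use c_der in auto)
      then show ?thesis by (rule continuous_on_subset) (use that in auto)
    qed
    define y where "y t l = c t (n + 1 + l)" for t l
    define V where "V t = (c t n)\<^sup>2 + quad m \<Lambda> (y t) (y t)" for t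
    have V_le: "V t \<le> Va" if t: "t \<in> {a..b}" for t
    proof -
      \<comment> \<open>The cross terms cancel as in the tracking proof; the factor \<omega> scales
        all of them alike and is nonnegative.\<close>
      have "V t \<le> V a"
      proof (rule pw_antimono[where D = "{}" and w = V and w' = "\<lambda>t. - 2 * \<kappa> * \<omega> t * (c t n)\<^sup>2"])
        show "continuous_on {a..t} V"
          unfolding V_def quad_def y_def by (intro continuous_intros c_cont t)
        fix s assume s: "a < s" "s < t"
        have s0: "0 \<le> s" and sb: "s < b" using s t a by auto
        let ?G = "\<lambda>l. (\<Gamma> *\<^sub>v regressor s (c s)) $\<^sub>v l"
        have yd: "((\<lambda>t. y t l) has_vector_derivative (- \<omega> s * c s n) * ?G l) (at s within UNIV)" if "l < m" for l
        proof -
          have "rhs s (c s) (n + 1 + l) = - c s n * ?G l"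
            unfolding rhs_def using gamma_regressor[OF s0 that, of "c s"] by simp
          then show ?thesis using c_at[OF s(1) sb, of "n + 1 + l"] that unfolding y_def by (simp add: mult.assoc)
        qed
        have q: "((\<lambda>t. quad m \<Lambda> (y t) (y t)) has_real_derivative
            2 * ((- \<omega> s * c s n) * (\<Sum>l<m. y s l * regressor s (c s) $\<^sub>v l))) (at s)"
          using quad_derivative[OF spd, of y "\<lambda>l. (- \<omega> s * c s n) * ?G l" s UNIV, OF yd]
          unfolding quad_scale_right \<Gamma>_def quad_inverse[OF spd regressor_carrier[OF s0]]
          by (simp only: has_real_derivative_iff_has_vector_derivative)
        have cn: "((\<lambda>t. c t n) has_real_derivative
            \<omega> s * ((\<Sum>l<m. y s l * regressor s (c s) $\<^sub>v l) - \<kappa> * c s n)) (at s)"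
          using c_at[OF s(1) sb, of n] unfolding rhs_def y_def by (simp add: has_real_derivative_iff_has_vector_derivative)
        have "(V has_real_derivative (2 * c s n * (\<omega> s * ((\<Sum>l<m. y s l * regressor s (c s) $\<^sub>v l) - \<kappa> * c s n))
            + 2 * ((- \<omega> s * c s n) * (\<Sum>l<m. y s l * regressor s (c s) $\<^sub>v l)))) (at s)"
          unfolding V_def[abs_def] using cn q by (auto intro!: derivative_eq_intros)
        moreover have "2 * c s n * (\<omega> s * ((\<Sum>l<m. y s l * regressor s (c s) $\<^sub>v l) - \<kappa> * c s n))
            + 2 * ((- \<omega> s * c s n) * (\<Sum>l<m. y s l * regressor s (c s) $\<^sub>v l)) = - 2 * \<kappa> * \<omega> s * (c s n)\<^sup>2"
          by (simp add: algebra_simps power2_eq_square)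
        ultimately show "(V has_vector_derivative - 2 * \<kappa> * \<omega> s * (c s n)\<^sup>2) (at s)"
          by (simp only: has_real_derivative_iff_has_vector_derivative)
        show "- 2 * \<kappa> * \<omega> s * (c s n)\<^sup>2 \<le> 0" using \<kappa> l[of s] by simp
      qed (use t in auto)
      also have "V a = Va" unfolding V_def Va_def y_def ca ..
      finally show ?thesis .
    qed
    have cn_bound: "\<bar>c t n\<bar> \<le> sqrt Va" if "t \<in> {a..b}" for t
    proof -
      have "(c t n)\<^sup>2 \<le> Va" using V_le[OF that] quad_nonneg[OF spd, of "y t"] unfolding V_def by linarith
      then show ?thesis by (simp add: real_le_rsqrt)
    qed
    have y_bound: "\<bar>c t (n + 1 + i)\<bar> \<le> sqrt (Ky * Va)" if "t \<in> {a..b}" "i < m" for t i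
    proof -
      have "quad m \<Lambda> (y t) (y t) \<le> Va" using V_le[OF that(1)] zero_le_power2[of "c t n"] unfolding V_def by linarith
      then have "Ky * quad m \<Lambda> (y t) (y t) \<le> Ky * Va" using Ky(1) by (rule mult_left_mono)
      then have "(y t i)\<^sup>2 \<le> Ky * Va" using Ky(2)[OF that(2), of "y t"] by linarith
      then show ?thesis unfolding y_def by (simp add: real_le_rsqrt)
    qed
    define \<Phi> where "\<Phi> t = (\<Sum>k<n. (c t k)\<^sup>2)" for t
    have x_bound: "\<Phi> t \<le> Q" if t: "t \<in> {a..b}" for t
    proof -
      have "\<Phi> t + k2 / k1 \<le> exp (k1 * (t - a)) * (\<Phi> a + k2 / k1)"
      proof (rule pw_gronwall[where D = "{}" and \<phi> = \<Phi> and \<phi>' = "\<lambda>t. \<Sum>k<n. 2 * c t k * (\<omega> t * state t (c t) (Suc k))"])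
        show "continuous_on {a..t} \<Phi>" unfolding \<Phi>_def by (intro continuous_intros c_cont t)
        show "k1 \<noteq> 0" using k10 by simp
        fix s assume s: "a < s" "s < t"
        have sb: "s < b" "s \<in> {a..b}" using s t by auto
        have "((\<lambda>t. c t k) has_real_derivative \<omega> s * state s (c s) (Suc k)) (at s)" if "k < n" for k
          using c_at[OF s(1) sb(1), of k] that unfolding rhs_def by (simp add: has_real_derivative_iff_has_vector_derivative)
        then have "((\<lambda>t. (c t k)\<^sup>2) has_real_derivative 2 * c s k * (\<omega> s * state s (c s) (Suc k))) (at s)" if "k < n" for k
          using that by (auto intro!: derivative_eq_intros)
        then have "(\<Phi> has_real_derivative (\<Sum>k<n. 2 * c s k * (\<omega> s * state s (c s) (Suc k)))) (at s)"
          unfolding \<Phi>_def[abs_def] by (intro DERIV_sum) auto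
        then show "(\<Phi> has_vector_derivative (\<Sum>k<n. 2 * c s k * (\<omega> s * state s (c s) (Suc k)))) (at s)"
          by (simp only: has_real_derivative_iff_has_vector_derivative)
        define Sm where "Sm = (\<Sum>j<n. \<bar>c s j\<bar>)"
        have Sm0: "Sm \<ge> 0" unfolding Sm_def by (simp add: sum_nonneg)
        have cS: "\<bar>c s j\<bar> \<le> Sm" if "j < n" for j
          unfolding Sm_def by (rule member_le_sum) (use that in auto)
        have ref_b: "\<bar>ref s (c s)\<bar> \<le> M + bs * (Sm + M)"
        proof -
          have "\<bar>\<Sum>k=1..n. \<beta> k * (c s (n - k) - \<psi> (n - k) s)\<bar> \<le> (\<Sum>k=1..n. \<bar>\<beta> k\<bar> * (Sm + M))"
          proof (rule order_trans[OF sum_abs], rule sum_mono)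
            fix k assume k: "k \<in> {1..n}"
            have "\<bar>c s (n - k) - \<psi> (n - k) s\<bar> \<le> Sm + M"
              using cS[of "n - k"] M[of "n - k" s] sb k by (auto intro: order_trans[OF abs_triangle_ineq4] add_mono)
            then show "\<bar>\<beta> k * (c s (n - k) - \<psi> (n - k) s)\<bar> \<le> \<bar>\<beta> k\<bar> * (Sm + M)"
              unfolding abs_mult by (rule mult_left_mono) simp
          qed
          also have "\<dots> = bs * (Sm + M)" unfolding bs_def by (rule sum_distrib_right[symmetric])
          finally show ?thesis using M[of n s] sb unfolding ref_def by linarith
        qed
        have st_b: "\<bar>state s (c s) (Suc k)\<bar> \<le> c1 * Sm + c2" if "k < n" for k
        proof (cases "Suc k < n")
          case True
          have "\<bar>c s (Suc k)\<bar> \<le> Sm" by (rule cS[OF True])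
          moreover have "0 \<le> bs * Sm" using bs0 Sm0 by simp
          ultimately show ?thesis using c10 True unfolding state_def c1_def by (simp add: algebra_simps)
        next
          case False
          have "\<bar>state s (c s) (Suc k)\<bar> \<le> \<bar>c s n\<bar> + \<bar>ref s (c s)\<bar>" using False unfolding state_def by simp
          then show ?thesis using ref_b cn_bound[OF sb(2)] Sm0 unfolding c1_def c2_def by (simp add: algebra_simps)
        qed
        have Sm2: "Sm\<^sup>2 \<le> real n * \<Phi> s"
          using sum_power2_le_card[of "\<lambda>j. \<bar>c s j\<bar>" "{..<n}"] unfolding Sm_def \<Phi>_def by simp
        have term_b: "2 * c s k * (\<omega> s * state s (c s) (Suc k)) \<le> (c s k)\<^sup>2 + (2 * c1\<^sup>2 * (real n * \<Phi> s) + 2 * c2\<^sup>2)" if k: "k < n" for k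
        proof -
          let ?X = "state s (c s) (Suc k)"
          have "\<bar>c s k * (\<omega> s * ?X)\<bar> = \<omega> s * (\<bar>c s k\<bar> * \<bar>?X\<bar>)" using l[of s] by (simp add: abs_mult)
          also have "\<dots> \<le> 1 * (\<bar>c s k\<bar> * \<bar>?X\<bar>)" using l[of s] by (intro mult_right_mono) auto
          finally have "2 * c s k * (\<omega> s * ?X) \<le> 2 * \<bar>c s k\<bar> * \<bar>?X\<bar>" by (simp add: abs_le_iff)
          also have "\<dots> \<le> \<bar>c s k\<bar>\<^sup>2 + \<bar>?X\<bar>\<^sup>2" by (rule sum_squares_bound)
          also have "\<bar>?X\<bar>\<^sup>2 \<le> (c1 * Sm + c2)\<^sup>2" using st_b[OF k] by (intro power_mono) auto
          also have "(c1 * Sm + c2)\<^sup>2 \<le> 2 * (c1 * Sm)\<^sup>2 + 2 * c2\<^sup>2"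
            using sum_squares_bound[of "c1 * Sm" c2] by (simp add: power2_sum)
          also have "(c1 * Sm)\<^sup>2 \<le> c1\<^sup>2 * (real n * \<Phi> s)" unfolding power_mult_distrib by (intro mult_left_mono Sm2) simp
          finally show ?thesis by (simp add: mult.assoc)
        qed
        have "(\<Sum>k<n. 2 * c s k * (\<omega> s * state s (c s) (Suc k)))
            \<le> (\<Sum>k<n. (c s k)\<^sup>2 + (2 * c1\<^sup>2 * (real n * \<Phi> s) + 2 * c2\<^sup>2))"
          by (rule sum_mono) (use term_b in auto)
        also have "\<dots> = k1 * \<Phi> s + k2"
          unfolding sum.distrib \<Phi>_def[symmetric] k1_def k2_def by (simp add: algebra_simps power2_eq_square)
        finally show "(\<Sum>k<n. 2 * c s k * (\<omega> s * state s (c s) (Suc k))) \<le> k1 * \<Phi> s + k2" .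
      qed (use t in auto)
      also have "\<Phi> a = \<Phi>0" unfolding \<Phi>_def \<Phi>0_def ca ..
      also have "exp (k1 * (t - a)) * (\<Phi>0 + k2 / k1) \<le> Q"
        unfolding Q_def using t k10 \<Phi>00 by (intro mult_right_mono) (auto intro!: mult_left_mono)
      moreover have "0 \<le> k2 / k1" using k10 by simp
      ultimately show ?thesis by linarith
    qed
    have R_ge: "sqrt Va \<le> R" "sqrt (Ky * Va) \<le> R" "sqrt Q \<le> R" "norm z0 \<le> R"
      using real_sqrt_ge_zero[OF Va0] real_sqrt_ge_zero[OF mult_nonneg_nonneg[OF Ky(1) Va0]] real_sqrt_ge_zero[OF Q0]
        norm_ge_zero[of z0] unfolding R_def by linarith+
    have "norm (apply_bcontfun (z t) k) \<le> R" for k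
    proof -
      consider "k < n" | "k = n" | i where "k = n + 1 + i" "i < m" | "n + 1 + m \<le> k"
        by (metis Suc_eq_plus1 add_less_cancel_left le_add_diff_inverse less_SucE linorder_not_le not_less_eq)
      then have "\<bar>c t k\<bar> \<le> R"
      proof cases
        case 1
        have "(c t k)\<^sup>2 \<le> \<Phi> t" unfolding \<Phi>_def by (rule member_le_sum) (use 1 in auto)
        then have "\<bar>c t k\<bar> \<le> sqrt Q" using x_bound[OF t] by (intro real_le_rsqrt) simp
        then show ?thesis using R_ge(3) by linarith
      next
        case 2 then show ?thesis using cn_bound[OF t] R_ge(1) by simp
      next
        case 3 then show ?thesis using y_bound[OF t, of i] R_ge(2) by (simp add: y_def)
      next
        case 4
        have "((\<lambda>t. c t k) has_vector_derivative 0) (at s within {a..b})" if "s \<in> {a..b}" for s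
          using c_der[OF that, of k] 4 by simp
        then obtain d where d: "\<And>s. s \<in> {a..b} \<Longrightarrow> c s k = d"
          using has_vector_derivative_zero_constant[of "{a..b}" "\<lambda>t. c t k"] by auto
        have "c t k = i0 k" using d[OF t] d[of a] t ca by simp
        then have "\<bar>c t k\<bar> \<le> norm z0" using norm_bounded[of z0 k] unfolding i0_def by simp
        then show ?thesis using R_ge(4) by linarith
      qed
      then show ?thesis unfolding c_def by simp
    qed
    then show ?thesis by (rule norm_bound)
  qed
  show ?thesis
  proof (intro exI[of _ R] allI impI ballI)
    fix z \<omega> t
    assume "z a = z0" "\<forall>t. 0 \<le> \<omega> t \<and> \<omega> t \<le> (1::real)"
      "\<forall>t\<in>{a..b}. (z has_vector_derivative \<omega> t *\<^sub>R field t (z t)) (at t within {a..b})" "t \<in> {a..b}"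
    then show "norm (z t) \<le> R" by - (rule main, assumption, erule spec, erule bspec)
  qed
qed

text \<open>The equations hold at switching instants too: the right-hand side uses only values of
  \<psi>, which are continuous there.\<close>

lemma solution_exists:
  fixes ts :: "nat \<Rightarrow> real"
  assumes ts0: "ts 0 = 0" and strict: "\<And>k. ts k < ts (Suc k)" and unb: "\<And>t. \<exists>k. t < ts k"
    and fin: "\<And>a b. finite (range ts \<inter> {a..b})"
  shows "\<exists>c. (\<forall>k<n + 1 + m. c 0 k = z0 k) \<and>
    (\<forall>k<n + 1 + m. \<forall>t\<ge>0. ((\<lambda>t. c t k) has_vector_derivative rhs t (c t) k) (at t within {0..})) \<and>
    (\<forall>k. continuous_on {0..} (\<lambda>t. c t k))"
proof -
  have nonneg: "0 \<le> ts k" for k 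
  proof (induction k)
    case (Suc k) then show ?case using strict[of k] by linarith
  qed (simp add: ts0)
  have "\<exists>w. w (ts 0) = fin_bcontfun (n + 1 + m) z0 \<and> pw_derivative (range ts) (ts 0) w (\<lambda>t. field t (w t))"
  proof (rule ode_glue[OF strict unb])
    fix k z
    have ex: "\<exists>w. w (ts k) = z \<and> (\<forall>t\<in>{ts k..ts (Suc k)}. (w has_vector_derivative field t (w t)) (at t within {ts k..ts (Suc k)}))"
    proof -
      obtain R where R: "\<forall>u \<omega>. u (ts k) = z \<longrightarrow> (\<forall>t. 0 \<le> \<omega> t \<and> \<omega> t \<le> (1::real)) \<longrightarrow>
        (\<forall>t\<in>{ts k..ts (Suc k)}. (u has_vector_derivative \<omega> t *\<^sub>R field t (u t)) (at t within {ts k..ts (Suc k)})) \<longrightarrow>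
        (\<forall>t\<in>{ts k..ts (Suc k)}. norm (u t) \<le> R)"
        using apriori_bound[OF nonneg[of k], of z "ts (Suc k)"] by (elim exE) (rule that)
      show ?thesis
      proof (rule picard_lindelof_apriori[where f = field and a = "ts k" and b = "ts (Suc k)" and R = R])
        show "ts k \<le> ts (Suc k)" using strict by (rule less_imp_le)
        show "continuous_on {ts k..ts (Suc k)} (\<lambda>t. field t x)" for x
          unfolding field_def
        proof (rule continuous_fin_bcontfun)
          fix j assume "j < n + 1 + m"
          then have "continuous_on {0..} (\<lambda>t. rhs t (apply_bcontfun x) j)" by (intro rhs_continuous continuous_on_const)
          then show "continuous_on {ts k..ts (Suc k)} (\<lambda>t. rhs t (apply_bcontfun x) j)"
            by (rule continuous_on_subset) (use nonneg[of k] in auto)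
        qed
        show "\<exists>K. \<forall>t\<in>{ts k..ts (Suc k)}. \<forall>x y. norm x \<le> R \<longrightarrow> norm y \<le> R \<longrightarrow>
            norm (field t x - field t y) \<le> K * norm (x - y)" for R
          unfolding field_def by (rule fin_bcontfun_lipschitz[OF rhs_ball_lipschitz[OF nonneg]])
        show "\<forall>t\<in>{ts k..ts (Suc k)}. norm (u t) \<le> R"
          if "u (ts k) = z" "\<And>t. 0 \<le> \<omega> t \<and> \<omega> t \<le> 1"
            "\<And>t. t \<in> {ts k..ts (Suc k)} \<Longrightarrow>
               (u has_vector_derivative \<omega> t *\<^sub>R field t (u t)) (at t within {ts k..ts (Suc k)})" for u \<omega>
          using R[THEN spec[of _ u], THEN spec[of _ \<omega>], THEN mp, OF that(1), THEN mp, OF allI, OF that(2),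
              THEN mp, OF ballI, OF that(3)] .
      qed
    qed
    then obtain w where w: "w (ts k) = z"
      "\<And>t. t \<in> {ts k..ts (Suc k)} \<Longrightarrow> (w has_vector_derivative field t (w t)) (at t within {ts k..ts (Suc k)})"
      by blast
    have "continuous_on {ts k..ts (Suc k)} w" by (rule continuous_on_vector_derivative[OF w(2)])
    moreover have "(w has_vector_derivative field t (w t)) (at t)" if "t \<in> {ts k<..<ts (Suc k)}" for t
      by (rule has_vector_derivative_interior_interval[OF w(2)]) (use that in auto)
    ultimately show "\<exists>w. w (ts k) = z \<and> continuous_on {ts k..ts (Suc k)} w \<and>
       (\<forall>t\<in>{ts k<..<ts (Suc k)}. (w has_vector_derivative field t (w t)) (at t))" using w(1) by blast
  qed
  then obtain w where w0: "w 0 = fin_bcontfun (n + 1 + m) z0"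
    and wd: "pw_derivative (range ts) 0 w (\<lambda>t. field t (w t))" unfolding ts0 by blast
  define c where "c t = apply_bcontfun (w t)" for t
  have wc: "continuous_on {0..} w" using wd unfolding pw_derivative_def by simp
  have cc: "continuous_on {0..} (\<lambda>t. c t k)" for k
    unfolding c_def by (rule bounded_linear.continuous_on[OF bounded_linear_apply_bcontfun wc])
  have fc: "continuous_on {0..} (\<lambda>t. field t (w t))"
    unfolding field_def by (rule continuous_fin_bcontfun) (rule rhs_continuous[OF cc[unfolded c_def]])
  have cd: "((\<lambda>t. c t k) has_vector_derivative rhs t (c t) k) (at t within {0..})" if "k < n + 1 + m" "0 \<le> t" for k t
  proof -
    have eq: "apply_bcontfun (field t (w t)) k = rhs t (c t) k"
      unfolding field_def c_def using that by (simp add: apply_fin_bcontfun)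
    show ?thesis
      using bounded_linear.has_vector_derivative[OF bounded_linear_apply_bcontfun
          pw_derivative_continuous[OF fin wd fc that(2)], of k]
      unfolding eq by (simp only: c_def)
  qed
  show ?thesis
  proof (intro exI[of _ c] conjI allI impI)
    show "c 0 k = z0 k" if "k < n + 1 + m" for k using that unfolding c_def w0 by (simp add: apply_fin_bcontfun)
  qed (use cd cc in auto)
qed

end



section \<open>Assembling the closed loop\<close>

context switching_network
begin

text \<open>Transforms back from the coordinates of \<open>follower_system\<close>. The derivative
  of the reference, absent from those equations, reappears in the equation of the last state and
  matches the \<open>deriv\<close> term of the input.\<close>

lemma follower_exists:
  fixes F :: "real ^ 'n"
  assumes fol: "1 \<le> r" "\<forall>x\<in>carrier_vec r. \<forall>t\<ge>0. f x t \<in> carrier_vec m" "locally_lipschitz_uniform r f"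
    "\<forall>x\<in>carrier_vec r. \<forall>l<m. continuous_on {0..} (\<lambda>t. f x t $\<^sub>v l)"
    "\<exists>\<phi>. \<forall>x\<in>carrier_vec r. \<forall>t\<ge>0. vec_norm (f x t) \<le> \<phi> x" "0 < \<kappa>" "sym_pos_def m \<Lambda>"
    and \<theta>: "\<theta> \<in> carrier_vec m" and d: "\<And>t. 0 \<le> t \<Longrightarrow> d t = 0"
    and Sh: "pw_derivative (range ts) 0 Sh Sh'" and v: "pw_derivative (range ts) 0 v v'"
    and x0: "x0 \<in> carrier_vec r" and \<theta>0: "\<theta>0 \<in> carrier_vec m"
  shows "\<exists>x \<theta>h. follower_plant (range ts) r f \<theta> d (control_input r f F \<kappa> \<beta> x \<theta>h Sh v) x \<and>
    adaptation_law (range ts) r m f F \<Lambda> \<beta> x \<theta>h Sh v \<and> x 0 = x0 \<and> \<theta>h 0 = \<theta>0"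
proof -
  let ?\<psi> = "\<lambda>k t. F \<bullet> mat_power_vec (Sh t) k (v t)"
  have Shc: "continuous_on {0..} Sh" and vc: "continuous_on {0..} v" using Sh v unfolding pw_derivative_def by auto
  have \<psi>c: "continuous_on {0..} (?\<psi> k)" for k by (intro continuous_intros mat_power_continuous Shc vc)
  interpret FS: follower_system r m f \<beta> \<kappa> \<Lambda> ?\<psi> by unfold_locales (fact fol \<psi>c)+
  define n where "n = FS.n"
  have rn: "r = Suc n" unfolding n_def by (rule FS.rn)
  \<comment> \<open>The initial data in the new coordinates: \<open>s\<close> is the last state
    minus the reference, and index \<open>n + 1 + l\<close> holds the \<open>l\<close>-th parameter
    error.\<close>
  define z0 where "z0 k = (if k < n then x0 $\<^sub>v k else if k = n then x0 $\<^sub>v n - FS.ref 0 (\<lambda>k. x0 $\<^sub>v k)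
    else \<theta>0 $\<^sub>v (k - n - 1) - \<theta> $\<^sub>v (k - n - 1))" for k
  obtain c where c0: "\<forall>k<n + 1 + m. c 0 k = z0 k"
    and c_der0: "\<forall>k<n + 1 + m. \<forall>t\<ge>0. ((\<lambda>t. c t k) has_vector_derivative FS.rhs t (c t) k) (at t within {0..})"
    and cc0: "\<forall>k. continuous_on {0..} (\<lambda>t. c t k)"
    using FS.solution_exists[OF ts_0 ts_strict ts_unbounded finite_switching, of z0] unfolding n_def[symmetric]
    by (elim exE conjE) (rule that)
  have c_der: "((\<lambda>t. c t k) has_vector_derivative FS.rhs t (c t) k) (at t within {0..})" if "k < n + 1 + m" "0 \<le> t" for k t
    using c_der0 that by blast
  have c_at: "((\<lambda>t. c t k) has_vector_derivative FS.rhs t (c t) k) (at t)" if "k < n + 1 + m" "0 < t" for k t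
  proof -
    have "at t within {0..} = at t" by (rule at_within_interior) (use that in auto)
    then show ?thesis using c_der[of k t] that by simp
  qed
  have cc: "continuous_on {0..} (\<lambda>t. c t k)" for k using cc0 by blast
  define x where "x t = Matrix.vec r (FS.state t (c t))" for t
  define \<theta>h where "\<theta>h t = Matrix.vec m (\<lambda>l. c t (n + 1 + l) + \<theta> $\<^sub>v l)" for t
  have x_lt: "x t $\<^sub>v k = c t k" if "k < n" for k t
    unfolding x_def FS.state_def n_def[symmetric] using that rn by simp
  \<comment> \<open>Below \<open>n\<close> the states and the new coordinates coincide, so the
    reference has the same value in both.\<close>
  have ref_cong: "FS.ref t z = FS.ref t z'" if "\<And>k. k < n \<Longrightarrow> z k = z' k" for t z z'
    unfolding FS.ref_def n_def[symmetric] using that by (intro arg_cong2[where f = "(-)"] refl sum.cong) auto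
  have x_n: "x t $\<^sub>v n = c t n + FS.ref t (c t)" for t
    unfolding x_def FS.state_def n_def[symmetric] using rn by simp
  have pref: "p_ref r \<beta> F (x t) (Sh t) (v t) = FS.ref t (c t)" for t
  proof -
    have "p_ref r \<beta> F (x t) (Sh t) (v t) = FS.ref t (\<lambda>k. x t $\<^sub>v k)"
      unfolding p_ref_def FS.ref_def n_def[symmetric] by (simp add: rn)
    also have "\<dots> = FS.ref t (c t)" by (rule ref_cong) (rule x_lt)
    finally show ?thesis .
  qed
  have serr: "s_err r \<beta> F (x t) (Sh t) (v t) = c t n" for t
    unfolding s_err_def pref using x_n[of t] rn by simp
  have reg: "f (x t) t = FS.regressor t (c t)" for t unfolding x_def FS.regressor_def ..
  have \<psi>_diff: "\<exists>D. (?\<psi> k has_real_derivative D) (at t)" if "0 < t" "t \<notin> range ts" for k t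
  proof -
    \<comment> \<open>\<open>mat_power_derivative\<close> expects the derivative in the form
      \<open>A v + \<eta>\<close>; the excess of \<open>v'\<close> over \<open>Sh v\<close> serves
      as \<eta>.\<close>
    have "(v has_vector_derivative Sh t *v v t + (v' t - Sh t *v v t)) (at t)"
      using v that unfolding pw_derivative_def by auto
    moreover have "(Sh has_vector_derivative Sh' t) (at t)" using Sh that unfolding pw_derivative_def by auto
    ultimately have "((\<lambda>t. mat_power_vec (Sh t) k (v t)) has_vector_derivative
        mat_power_vec (Sh t) (Suc k) (v t) + power_defect (Sh' t) (Sh t) (v t) (v' t - Sh t *v v t) k) (at t)"
      by (intro mat_power_derivative)
    from bounded_linear.has_vector_derivative[OF bounded_linear_inner_right this, of F]
    show ?thesis unfolding has_real_derivative_iff_has_vector_derivative by (rule exI)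
  qed
  have ref_diff: "((\<lambda>t. FS.ref t (c t)) has_real_derivative deriv (\<lambda>t. FS.ref t (c t)) t) (at t)"
    if t: "0 < t" "t \<notin> range ts" for t
  proof -
    have cd: "(\<lambda>t. c t k) field_differentiable at t" if "k \<le> n" for k
      using c_at[OF _ t(1), of k] that unfolding field_differentiable_def has_real_derivative_iff_has_vector_derivative by auto
    have pd: "?\<psi> k field_differentiable at t" for k
      using \<psi>_diff[OF t] unfolding field_differentiable_def by blast
    have "(\<lambda>t. ?\<psi> n t - (\<Sum>k=1..n. \<beta> k * (c t (n - k) - ?\<psi> (n - k) t))) field_differentiable at t"
    proof (rule field_differentiable_diff[OF pd field_differentiable_sum])
      fix k assume "k \<in> {1..n}"
      show "(\<lambda>t. \<beta> k * (c t (n - k) - ?\<psi> (n - k) t)) field_differentiable at t"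
        by (rule field_differentiable_mult[OF field_differentiable_const field_differentiable_diff[OF cd pd]]) simp
    qed
    then show ?thesis unfolding FS.ref_def n_def[symmetric] by (simp add: field_differentiable_derivI)
  qed
  have ref_cont: "continuous_on {0..} (\<lambda>t. FS.ref t (c t))"
    unfolding FS.ref_def by (intro continuous_intros \<psi>c cc)
  have plant: "follower_plant (range ts) r f \<theta> d (control_input r f F \<kappa> \<beta> x \<theta>h Sh v) x"
    unfolding follower_plant_def
  proof (intro conjI allI impI)
    show "x t \<in> carrier_vec r" for t unfolding x_def by simp
    show "((\<lambda>s. x s $\<^sub>v k) has_real_derivative x t $\<^sub>v Suc k) (at t within {0..})" if "Suc k < r" "0 \<le> t" for k t
    proof -
      have k: "k < n" using that rn by simp
      have "FS.rhs t (c t) k = x t $\<^sub>v Suc k"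
        unfolding FS.rhs_def n_def[symmetric] x_def using k that by simp
      then show ?thesis using c_der[of k t] k that(2)
        unfolding has_real_derivative_iff_has_vector_derivative by (simp add: x_lt)
    qed
    show "pw_derivative (range ts) 0 (\<lambda>t. x t $\<^sub>v (r - 1))
      (\<lambda>t. control_input r f F \<kappa> \<beta> x \<theta>h Sh v t + d t - f (x t) t \<bullet>\<^sub>v \<theta>)"
      unfolding pw_derivative_def
    proof (intro conjI allI impI)
      show "continuous_on {0..} (\<lambda>t. x t $\<^sub>v (r - 1))"
        using continuous_on_add[OF cc[of n] ref_cont] by (simp add: x_n rn)
      fix t :: real assume t: "0 < t" "t \<notin> range ts"
      have fr: "f (x t) t \<in> carrier_vec m" unfolding reg by (rule FS.regressor_carrier) (use t in simp)
      have th: "f (x t) t \<bullet>\<^sub>v \<theta>h t - f (x t) t \<bullet>\<^sub>v \<theta> = (\<Sum>l<m. c t (n + 1 + l) * FS.regressor t (c t) $\<^sub>v l)"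
        using fr \<theta> unfolding \<theta>h_def scalar_prod_def reg[symmetric]
        by (simp add: atLeast0LessThan sum_subtractf[symmetric] algebra_simps)
      have rhs: "FS.rhs t (c t) n = f (x t) t \<bullet>\<^sub>v \<theta>h t - f (x t) t \<bullet>\<^sub>v \<theta> - \<kappa> * c t n"
        unfolding th FS.rhs_def n_def[symmetric] by simp
      have "((\<lambda>t. c t n + FS.ref t (c t)) has_vector_derivative FS.rhs t (c t) n + deriv (\<lambda>t. FS.ref t (c t)) t) (at t)"
        using ref_diff[OF t] unfolding has_real_derivative_iff_has_vector_derivative
        by (intro has_vector_derivative_add c_at t) simp_all
      moreover have "control_input r f F \<kappa> \<beta> x \<theta>h Sh v t + d t - f (x t) t \<bullet>\<^sub>v \<theta> = FS.rhs t (c t) n + deriv (\<lambda>t. FS.ref t (c t)) t"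
        unfolding control_input_def serr pref rhs using d[of t] t by simp
      ultimately show "((\<lambda>t. x t $\<^sub>v (r - 1)) has_vector_derivative
          control_input r f F \<kappa> \<beta> x \<theta>h Sh v t + d t - f (x t) t \<bullet>\<^sub>v \<theta>) (at t)"
        by (simp add: x_n rn)
    qed
  qed
  have adapt: "adaptation_law (range ts) r m f F \<Lambda> \<beta> x \<theta>h Sh v"
    unfolding adaptation_law_def pw_derivative_def
  proof (intro conjI allI impI)
    show "\<theta>h t \<in> carrier_vec m" for t unfolding \<theta>h_def by simp
    fix l assume l: "l < m"
    have eq: "\<theta>h t $\<^sub>v l = c t (n + 1 + l) + \<theta> $\<^sub>v l" for t unfolding \<theta>h_def using l by simp
    show "continuous_on {0..} (\<lambda>t. \<theta>h t $\<^sub>v l)" unfolding eq by (intro continuous_intros cc)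
    fix t :: real assume t: "0 < t" "t \<notin> range ts"
    have "FS.rhs t (c t) (n + 1 + l) = - ((the (mat_inverse \<Lambda>) *\<^sub>v f (x t) t) $\<^sub>v l * s_err r \<beta> F (x t) (Sh t) (v t))"
      using FS.gamma_regressor[of t l "c t"] t l unfolding FS.rhs_def n_def[symmetric] serr reg FS.\<Gamma>_def by simp
    moreover have "((\<lambda>t. c t (n + 1 + l) + \<theta> $\<^sub>v l) has_vector_derivative FS.rhs t (c t) (n + 1 + l)) (at t)"
      using has_vector_derivative_add[OF c_at[of "n + 1 + l" t] has_vector_derivative_const[of "\<theta> $\<^sub>v l"]] l t by simp
    ultimately show "((\<lambda>t. \<theta>h t $\<^sub>v l) has_vector_derivative
        - ((the (mat_inverse \<Lambda>) *\<^sub>v f (x t) t) $\<^sub>v l * s_err r \<beta> F (x t) (Sh t) (v t))) (at t)"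
      unfolding eq by (simp only:)
  qed
  have "x 0 = x0"
  proof (rule eq_vecI)
    fix k assume "k < dim_vec x0"
    then consider "k < n" | "k = n" using x0 rn by fastforce
    then show "x 0 $\<^sub>v k = x0 $\<^sub>v k"
    proof cases
      case 1 then show ?thesis using c0 by (simp add: x_lt z0_def)
    next
      case 2
      have "FS.ref 0 (c 0) = FS.ref 0 (\<lambda>k. x0 $\<^sub>v k)" by (rule ref_cong) (use c0 in \<open>simp add: z0_def\<close>)
      then show ?thesis using 2 c0 by (simp add: x_n z0_def)
    qed
  qed (use x0 in \<open>simp add: x_def\<close>)
  moreover have "\<theta>h 0 = \<theta>0"
    by (rule eq_vecI) (use \<theta>0 c0 in \<open>auto simp: \<theta>h_def z0_def\<close>)
  ultimately show ?thesis using plant adapt by blast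
qed

text \<open>Follows the cascade: the leader, \<open>Sh\<close> and \<open>L\<close> first, then
  \<open>v\<close> with these as coefficients, and then every follower by itself with
  \<open>Sh\<close> and \<open>v\<close> given.\<close>

lemma closed_loop_exists:
  fixes S :: "real ^ 'n ^ 'n" and F :: "real ^ 'n"
  assumes par: "admissible_parameters (range ts) G r m S F \<mu>1 \<mu>2 \<kappa> \<Lambda> \<beta> L0"
    and r_pos: "\<And>i. 1 \<le> r i"
    and f_carrier: "\<And>i. \<forall>x\<in>carrier_vec (r i). \<forall>t\<ge>0. f i x t \<in> carrier_vec (m i)"
    and f_lipschitz: "\<And>i. locally_lipschitz_uniform (r i) (f i)"
    and f_continuous: "\<And>i. \<forall>x\<in>carrier_vec (r i). \<forall>l<m i. continuous_on {0..} (\<lambda>t. f i x t $\<^sub>v l)"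
    and f_bound: "\<And>i. \<exists>\<phi>. \<forall>x\<in>carrier_vec (r i). \<forall>t\<ge>0. vec_norm (f i x t) \<le> \<phi> x"
    and \<theta>: "\<And>i. \<theta> i \<in> carrier_vec (m i)" and d: "\<And>i t. 0 \<le> t \<Longrightarrow> d i t = 0"
    and x0: "\<And>i. x0 i \<in> carrier_vec (r i)" and \<theta>0: "\<And>i. \<theta>0 i \<in> carrier_vec (m i)"
  shows "\<exists>x \<theta>h v Sh L. closed_loop_solution (range ts) G r m f \<theta> d S F \<mu>1 \<mu>2 \<kappa> \<Lambda> \<beta> L0 x \<theta>h v Sh L \<and>
    (\<forall>i. x i 0 = x0 i \<and> \<theta>h i 0 = \<theta>0 i) \<and> (\<forall>j. v j 0 = v0 j) \<and>
    (\<forall>i. Sh (Some i) 0 = S0 i \<and> L (Some i) 0 = Li i)"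
proof -
  obtain w where w: "w 0 = v0 None" "\<forall>t\<ge>0. (w has_vector_derivative S *v w t) (at t within {0..})"
    using leader_exists by blast
  obtain Sh where Sh: "\<And>t. Sh None t = S" "\<And>i. Sh (Some i) 0 = S0 i" and Shd: "\<And>i. pw_derivative (range ts) 0 (Sh (Some i))
      (\<lambda>t. \<mu>1 *\<^sub>R (\<Sum>j\<in>neighbors (G t) (Some i). Sh j t - Sh (Some i) t))"
    using vector_consensus_exists[of S S0 \<mu>1] by blast
  obtain L where L: "\<And>t. L None t = L0" "\<And>i. L (Some i) 0 = Li i" and Ld: "\<And>i. pw_derivative (range ts) 0 (L (Some i))
      (\<lambda>t. \<mu>2 *\<^sub>R (\<Sum>j\<in>neighbors (G t) (Some i). L j t - L (Some i) t))"
    using vector_consensus_exists[of L0 Li \<mu>2] by blast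
  have cont: "continuous_on {0..} w" "continuous_on {0..} (Sh (Some i))" "continuous_on {0..} (L (Some i))" for i
    using w(2) Shd[of i] Ld[of i] unfolding pw_derivative_def
    by (auto intro!: continuous_on_vector_derivative)
  have "\<exists>v. v None = w \<and> (\<forall>i. v (Some i) 0 = v0 (Some i) \<and>
    pw_derivative (range ts) 0 (v (Some i)) (\<lambda>t. Sh (Some i) t *v v (Some i) t +
               (\<Sum>j\<in>neighbors (G t) (Some i). F \<bullet> (v j t - v (Some i) t)) *\<^sub>R L (Some i) t))"
    by (rule observer_exists) (rule cont)+
  then obtain v where v: "v None = w" "\<And>i. v (Some i) 0 = v0 (Some i)"
    and vd: "\<And>i. pw_derivative (range ts) 0 (v (Some i)) (\<lambda>t. Sh (Some i) t *v v (Some i) t +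
               (\<Sum>j\<in>neighbors (G t) (Some i). F \<bullet> (v j t - v (Some i) t)) *\<^sub>R L (Some i) t)"
    by blast
  define good where "good i xi hi \<longleftrightarrow> follower_plant (range ts) (r i) (f i) (\<theta> i) (d i)
        (control_input (r i) (f i) F (\<kappa> i) (\<beta> i) xi hi (Sh (Some i)) (v (Some i))) xi \<and>
      adaptation_law (range ts) (r i) (m i) (f i) F (\<Lambda> i) (\<beta> i) xi hi (Sh (Some i)) (v (Some i)) \<and>
      xi 0 = x0 i \<and> hi 0 = \<theta>0 i" for i xi hi
  have "\<exists>xi hi. good i xi hi" for i
    unfolding good_def
    by (rule follower_exists[OF r_pos f_carrier f_lipschitz f_continuous f_bound _ _ \<theta> d Shd vd x0 \<theta>0])
      (use par in \<open>simp_all add: admissible_parameters_def\<close>)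
  then obtain x \<theta>h where good: "\<And>i. good i (x i) (\<theta>h i)" by metis
  note x = good[unfolded good_def]
  have sol: "closed_loop_solution (range ts) G r m f \<theta> d S F \<mu>1 \<mu>2 \<kappa> \<Lambda> \<beta> L0 x \<theta>h v Sh L"
    unfolding closed_loop_solution_def
  proof (intro conjI allI impI)
    show "(v None has_vector_derivative S *v v None t) (at t within {0..})" if "0 \<le> t" for t
      using w(2) that unfolding v(1) by blast
  qed (rule Sh(1) L(1) x[THEN conjunct1] x[THEN conjunct2, THEN conjunct1] vd Shd Ld)+
  have "v j 0 = v0 j" for j using v w(1) by (cases j) auto
  then show ?thesis
    using sol x[THEN conjunct2, THEN conjunct2] Sh(2) L(2)
    by (intro exI[of _ x] exI[of _ \<theta>h] exI[of _ v] exI[of _ Sh] exI[of _ L] conjI allI) simp_all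
qed

end



theorem theorem1:
  fixes r m :: "'N::finite \<Rightarrow> nat"
    and f :: "'N \<Rightarrow> real Matrix.vec \<Rightarrow> real \<Rightarrow> real Matrix.vec"
    and \<theta> :: "'N \<Rightarrow> real Matrix.vec"
    and d :: "'N \<Rightarrow> real \<Rightarrow> real"
    and S :: "real ^ 'n ^ 'n"
    and F :: "real ^ 'n"
    and n0 :: nat
    and \<sigma> :: "real \<Rightarrow> nat"
    and ts :: "nat \<Rightarrow> real"
    and \<tau>0 :: real
    and E :: "nat \<Rightarrow> ('N option \<times> 'N option) set"
  assumes r_pos: "\<forall>i. 1 \<le> r i"
    and f_carrier: "\<forall>i. \<forall>x\<in>carrier_vec (r i). \<forall>t\<ge>0. f i x t \<in> carrier_vec (m i)"
    and f_lipschitz: "\<forall>i. locally_lipschitz_uniform (r i) (f i)"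
    and f_continuous: "\<forall>i. \<forall>x\<in>carrier_vec (r i). \<forall>l<m i.
                         continuous_on {0..} (\<lambda>t. f i x t $\<^sub>v l)"
    and \<theta>_carrier: "\<forall>i. \<theta> i \<in> carrier_vec (m i)"
    and no_disturbance: "\<forall>i. \<forall>t\<ge>0. d i t = 0"
    and ts_0: "ts 0 = 0"
    and dwell_pos: "0 < \<tau>0"
    and dwell_time: "\<forall>i. \<tau>0 \<le> ts (Suc i) - ts i"
    and \<sigma>_range: "\<forall>t\<ge>0. \<sigma> t \<in> {1..n0}"
    and \<sigma>_pw_constant: "\<forall>i. \<forall>t\<in>{ts i..<ts (Suc i)}. \<sigma> t = \<sigma> (ts i)"
    and edges: "\<forall>p\<in>{1..n0}. \<forall>(j, i)\<in>E p. i \<noteq> None \<and> i \<noteq> j"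
    and S_marginally_stable: "marginally_stable S"
    and F_S_detectable: "detectable F S"
    and jointly_connected:
      "\<exists>(\<iota> :: nat \<Rightarrow> nat) \<nu>. strict_mono \<iota> \<and> 0 < \<nu> \<and>
         (\<forall>k. ts (\<iota> (Suc k)) - ts (\<iota> k) < \<nu> \<and>
              contains_spanning_tree None
                (union_graph (\<lambda>t. E (\<sigma> t)) (ts (\<iota> k)) (ts (\<iota> (Suc k)))))"
    and undirected: "\<forall>t\<ge>0. sym (follower_subgraph (E (\<sigma> t)))"
    and f_bound: "\<forall>i. \<exists>\<phi> :: real Matrix.vec \<Rightarrow> real.
                    \<forall>x\<in>carrier_vec (r i). \<forall>t\<ge>0. vec_norm (f i x t) \<le> \<phi> x"
  shows
    "(\<exists>\<mu>1 \<mu>2 \<kappa> \<Lambda> \<beta> L0.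
        admissible_parameters (range ts) (\<lambda>t. E (\<sigma> t)) r m S F \<mu>1 \<mu>2 \<kappa> \<Lambda> \<beta> L0)
     \<and>
     (\<forall>\<mu>1 \<mu>2 \<kappa> \<Lambda> \<beta> L0.
        admissible_parameters (range ts) (\<lambda>t. E (\<sigma> t)) r m S F \<mu>1 \<mu>2 \<kappa> \<Lambda> \<beta> L0 \<longrightarrow>
        (\<forall>x_init \<theta>h_init v_init S_init L_init.
           (\<forall>i. x_init i \<in> carrier_vec (r i)) \<and> (\<forall>i. \<theta>h_init i \<in> carrier_vec (m i)) \<longrightarrow>
           (\<exists>x \<theta>h v Sh L.
              closed_loop_solution (range ts) (\<lambda>t. E (\<sigma> t)) r m f \<theta> d S F
                \<mu>1 \<mu>2 \<kappa> \<Lambda> \<beta> L0 x \<theta>h v Sh L \<and>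
              (\<forall>i. x i 0 = x_init i \<and> \<theta>h i 0 = \<theta>h_init i) \<and>
              (\<forall>j. v j 0 = v_init j) \<and>
              (\<forall>i. Sh (Some i) 0 = S_init i \<and> L (Some i) 0 = L_init i))) \<and>
        (\<forall>x \<theta>h v Sh L.
           closed_loop_solution (range ts) (\<lambda>t. E (\<sigma> t)) r m f \<theta> d S F
             \<mu>1 \<mu>2 \<kappa> \<Lambda> \<beta> L0 x \<theta>h v Sh L \<longrightarrow>
           (\<forall>i. \<forall>k<r i.
              ((\<lambda>t. (deriv ^^ k) (\<lambda>s. x i s $\<^sub>v 0) t - (deriv ^^ k) (\<lambda>s. F \<bullet> v None s) t)
                 \<longlongrightarrow> 0) at_top)))"
proof -
  let ?G = "\<lambda>t. E (\<sigma> t)"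
  interpret switching_network ?G ts \<tau>0
  proof
    show "ts 0 = 0" "0 < \<tau>0" by (fact ts_0 dwell_pos)+
    show "\<tau>0 \<le> ts (Suc k) - ts k" for k by (rule dwell_time[THEN spec])
    show "?G t = ?G (ts k)" if "t \<in> {ts k..<ts (Suc k)}" for t k 
      by (rule arg_cong[of _ _ E]) (rule \<sigma>_pw_constant[THEN spec, THEN bspec, OF that])
    show "i \<noteq> None \<and> i \<noteq> j" if "0 \<le> t" "(j, i) \<in> ?G t" for t j i
      using edges[THEN bspec, OF \<sigma>_range[rule_format, OF that(1)], THEN bspec, OF that(2)] by simp
    show "\<exists>(\<iota> :: nat \<Rightarrow> nat) \<nu>. strict_mono \<iota> \<and> 0 < \<nu> \<and>
         (\<forall>k. ts (\<iota> (Suc k)) - ts (\<iota> k) < \<nu> \<and>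
              contains_spanning_tree None (union_graph ?G (ts (\<iota> k)) (ts (\<iota> (Suc k)))))"
      by (fact jointly_connected)
    show "sym (follower_subgraph (?G t))" if "0 \<le> t" for t using that by (rule undirected[rule_format])
  qed
  note hyp = r_pos[rule_format] f_carrier[THEN spec] f_lipschitz[THEN spec]
  show ?thesis
  proof (intro conjI allI impI)
    show "\<exists>\<mu>1 \<mu>2 \<kappa> \<Lambda> \<beta> L0. admissible_parameters (range ts) ?G r m S F \<mu>1 \<mu>2 \<kappa> \<Lambda> \<beta> L0"
      by (rule admissible_parameters_exist[OF S_marginally_stable F_S_detectable])
  next
    fix \<mu>1 \<mu>2 \<kappa> \<Lambda> \<beta> L0 and x_init \<theta>h_init :: "'N \<Rightarrow> real Matrix.vec" and v_init S_init L_init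
    assume par: "admissible_parameters (range ts) ?G r m S F \<mu>1 \<mu>2 \<kappa> \<Lambda> \<beta> L0"
      and "(\<forall>i. x_init i \<in> carrier_vec (r i)) \<and> (\<forall>i. \<theta>h_init i \<in> carrier_vec (m i))"
    then have init: "x_init i \<in> carrier_vec (r i)" "\<theta>h_init i \<in> carrier_vec (m i)" for i by blast+
    show "\<exists>x \<theta>h v Sh L. closed_loop_solution (range ts) ?G r m f \<theta> d S F \<mu>1 \<mu>2 \<kappa> \<Lambda> \<beta> L0 x \<theta>h v Sh L \<and>
              (\<forall>i. x i 0 = x_init i \<and> \<theta>h i 0 = \<theta>h_init i) \<and> (\<forall>j. v j 0 = v_init j) \<and>
              (\<forall>i. Sh (Some i) 0 = S_init i \<and> L (Some i) 0 = L_init i)"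
      by (rule closed_loop_exists[OF par hyp f_continuous[THEN spec] f_bound[THEN spec] \<theta>_carrier[THEN spec]
            no_disturbance[rule_format] init])
  next
    fix \<mu>1 \<mu>2 \<kappa> \<Lambda> \<beta> L0 x \<theta>h v Sh L i k
    assume par: "admissible_parameters (range ts) ?G r m S F \<mu>1 \<mu>2 \<kappa> \<Lambda> \<beta> L0"
      and sol: "closed_loop_solution (range ts) ?G r m f \<theta> d S F \<mu>1 \<mu>2 \<kappa> \<Lambda> \<beta> L0 x \<theta>h v Sh L"
      and k: "k < r i"
    show "((\<lambda>t. (deriv ^^ k) (\<lambda>s. x i s $\<^sub>v 0) t - (deriv ^^ k) (\<lambda>s. F \<bullet> v None s) t) \<longlongrightarrow> 0) at_top"
      by (rule output_synchronization[OF S_marginally_stable par hyp f_bound[THEN spec] \<theta>_carrier[THEN spec] _ sol k])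
        (rule no_disturbance[rule_format])
  qed
qed


end
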